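(* Let $k$ be a field, let $\mathcal{C},\mathcal{D}$ be finite strict tensor categories over $k$, let $F:\mathcal{C}\to\mathcal{D}$ be an exact $k$-linear strict monoidal functor, let $\mathsf{U},\mathsf{W}\in\mathcal{Z}(F)$ and $n\ge1$. Let $f\in C^n_{\mathrm{DY}}(F;\mathsf{U},\mathsf{W})$ be a cocycle. Then there exist objects $\mathsf{V}_1,\dots,\mathsf{V}_{n-1}\in\mathcal{Z}(F)$ and cocycles $$g_1\in C^1_{\mathrm{DY}}(F;\mathsf{V}_1,\mathsf{W}),\quad g_2\in C^1_{\mathrm{DY}}(F;\mathsf{V}_2,\mathsf{V}_1),\ \dots,\quad g_n\in C^1_{\mathrm{DY}}(F;\mathsf{U},\mathsf{V}_{n-1})$$ such that $f=g_1\circ\cdots\circ g_n$, where $\circ$ is the Yoneda product of Davydov--Yetter cocycles.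
   Context: A tensor category over $k$ is a $k$-linear abelian rigid monoidal category with $k$-bilinear tensor product whose unit $\mathbf{1}$ is simple with $\mathrm{End}(\mathbf{1})\cong k$. It is finite if it is equivalent, as a $k$-linear category, to finite-dimensional modules over a finite-dimensional $k$-algebra. Duals: $\mathrm{ev}_X:X^\vee\otimes X\to\mathbf{1}$, $\mathrm{coev}_X:\mathbf{1}\to X\otimes X^\vee$; $F(X)^\vee$ is identified with $F(X^\vee)$. Centralizer. A half-braiding relative to $F$ on $V\in\mathcal{D}$ is a natural isomorphism $\rho^V_X:V\otimes F(X)\to F(X)\otimes V$ ($X\in\mathcal{C}$) with $\rho^V_{X\otimes Y}=(\mathrm{id}_{F(X)}\otimes\rho^V_Y)(\rho^V_X\otimes\mathrm{id}_{F(Y)})$. $\mathcal{Z}(F)$ has as objects the pairs $\mathsf{V}=(V,\rho^V)$, and as morphisms those of $\mathcal{D}$ commuting with the half-braidings. DY complex. $C^n_{\mathrm{DY}}(F;\mathsf{U},\mathsf{V})$ is the space of natural transformations $f_{X_1,\dots,X_n}:U\otimes F(X_1)\otimes\cdots\otimes F(X_n)\to F(X_1)\otimes\cdots\otimes F(X_n)\otimes V$ (for $n=0$: $\mathrm{Hom}_{\mathcal{D}}(U,V)$), with $$\delta^n(f)_{X_0,\dots,X_n}=(\mathrm{id}_{F(X_0)}\otimes f_{X_1,\dots,X_n})(\rho^U_{X_0}\otimes\mathrm{id})+\sum_{i=1}^n(-1)^if_{X_0,\dots,X_{i-1}\otimes X_i,\dots,X_n}+(-1)^{n+1}(\mathrm{id}\otimes\rho^V_{X_n})(f_{X_0,\dots,X_{n-1}}\otimes\mathrm{id}_{F(X_n)}).$$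 Comonad and bar complex. For $V\in\mathcal{D}$ let $Z_F(V)=\int^{X\in\mathcal{C}}F(X)^\vee\otimes V\otimes F(X)$ with universal dinatural maps $i_X(V):F(X)^\vee\otimes V\otimes F(X)\to Z_F(V)$, and with the half-braiding determined by $\rho^{Z_F(V)}_Y(i_X(V)\otimes\mathrm{id}_{F(Y)})=(\mathrm{id}_{F(Y)}\otimes i_{X\otimes Y}(V))(\mathrm{coev}_{F(Y)}\otimes\mathrm{id})$. Then $V\mapsto(Z_F(V),\rho^{Z_F(V)})$ is left adjoint to the forgetful functor $\mathcal{Z}(F)\to\mathcal{D}$. Let $G$ be the resulting comonad on $\mathcal{Z}(F)$, $G(\mathsf{V})=(Z_F(V),\rho^{Z_F(V)})$, with counit determined by $\varepsilon_{\mathsf{V}}i_X(V)=(\mathrm{ev}_{F(X)}\otimes\mathrm{id}_V)(\mathrm{id}\otimes\rho^V_X)$. Write $i^{(n)}_{X_1,\dots,X_n}(V)=i_{X_n}(Z_F^{n-1}(V))(\mathrm{id}\otimes i^{(n-1)}_{X_1,\dots,X_{n-1}}(V)\otimes\mathrm{id})$ for the iterated universal dinatural map into $Z_F^n(V)$. The bar resolution of $\mathsf{V}$ is $\cdots\to G^2(\mathsf{V})\xrightarrow{d_1}G(\mathsf{V})\xrightarrow{d_0=\varepsilon_{\mathsf{V}}}\mathsf{V}\to0$ with $d_n=\sum_{i=0}^n(-1)^iG^{n-i}(\varepsilon_{G^i(\mathsf{V})})$, and the bar complex is $\mathrm{Bar}^n(\mathsf{V},\mathsf{W})=\mathrm{Hom}_{\mathcal{Z}(F)}(G^{n+1}(\mathsf{V}),\mathsf{W})$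 with differential given by precomposition with $d_{n+1}$. Isomorphism $\Gamma$. There is an isomorphism of complexes $\Gamma:C^n_{\mathrm{DY}}(F;\mathsf{U},\mathsf{V})\to\mathrm{Bar}^n(\mathsf{U},\mathsf{V})$ for which $\Gamma(f)\,i^{(n+1)}_{X_1,\dots,X_{n+1}}(U)$ is the composite of $\mathrm{id}\otimes f_{X_1,\dots,X_n}\otimes\mathrm{id}_{F(X_{n+1})}$, then $\mathrm{id}\otimes\rho^V_{X_{n+1}}$, then the evaluations of $F(X_{n+1})^\vee\otimes\cdots\otimes F(X_1)^\vee$ against $F(X_1)\otimes\cdots\otimes F(X_{n+1})$. Yoneda product. For cocycles $\alpha\in\mathrm{Bar}^n(\mathsf{V},\mathsf{W})$, $\beta\in\mathrm{Bar}^m(\mathsf{U},\mathsf{V})$, take morphisms $\widetilde\beta_l:G^{m+l+1}(\mathsf{U})\to G^{l+1}(\mathsf{V})$ ($0\le l\le n$) in $\mathcal{Z}(F)$ with $\varepsilon_{\mathsf{V}}\widetilde\beta_0=\beta$ and $d^{\mathsf{V}}_{l+1}\widetilde\beta_{l+1}=\widetilde\beta_l\,d^{\mathsf{U}}_{m+l+1}$ (these always exist); then $\alpha\circ\beta$ is defined to be $\alpha\widetilde\beta_n\in\mathrm{Bar}^{m+n}(\mathsf{U},\mathsf{W})$. For Davydov--Yetter cocycles $f\in C^n_{\mathrm{DY}}(F;\mathsf{V},\mathsf{W})$, $g\in C^m_{\mathrm{DY}}(F;\mathsf{U},\mathsf{V})$, one sets $f\circ g=\Gamma^{-1}(\Gamma(f)\circ\Gamma(g))\in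 C^{m+n}_{\mathrm{DY}}(F;\mathsf{U},\mathsf{W})$; this is an associative product on Davydov--Yetter cocycles which descends to the cohomology groups.
   Formalization: The equality f = g_1∘⋯∘g_n is proved up to a coboundary, for every choice of lifts in the Yoneda products; as an equality of cochains it fails for C = D = Vect, F = id, U = W = 1, n = 2, f = 1, where every 1-cocycle is 0. *)

theory Defs
  imports "HOL-Library.FuncSet" "Jordan_Normal_Form.Matrix"
begin

no_notation mult (infixl \<open>\<otimes>\<index>\<close> 70)

section \<open>Linear and abelian categories\<close>

text \<open>Arrows determine their domain and codomain; \<open>g \<cdot> f\<close> is "first f, then g".
  The type \<open>'k::field\<close> is the ground field.\<close>

record ('o, 'm, 'k) lincat =
  Obj :: "'o set"
  Arr :: "'m set"
  Dom :: "'m \<Rightarrow> 'o"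
  Cod :: "'m \<Rightarrow> 'o"
  Id :: "'o \<Rightarrow> 'm"
  Comp :: "'m \<Rightarrow> 'm \<Rightarrow> 'm" (infixr \<open>\<cdot>\<index>\<close> 60)
  Add :: "'m \<Rightarrow> 'm \<Rightarrow> 'm"
  Zero :: "'o \<Rightarrow> 'o \<Rightarrow> 'm"
  Scale :: "'k \<Rightarrow> 'm \<Rightarrow> 'm"

definition Hom :: "('o, 'm, 'k, 'x) lincat_scheme \<Rightarrow> 'o \<Rightarrow> 'o \<Rightarrow> 'm set" where
  "Hom C X Y = {f \<in> Arr C. Dom C f = X \<and> Cod C f = Y}"

locale linear_category =
  fixes C :: "('o, 'm, 'k::field, 'x) lincat_scheme" (structure)
  assumes dom_obj: "f \<in> Arr C \<Longrightarrow> Dom C f \<in> Obj C"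
    and cod_obj: "f \<in> Arr C \<Longrightarrow> Cod C f \<in> Obj C"
    and id_hom: "X \<in> Obj C \<Longrightarrow> Id C X \<in> Hom C X X"
    and comp_hom: "\<lbrakk>f \<in> Hom C X Y; g \<in> Hom C Y Z\<rbrakk> \<Longrightarrow> g \<cdot> f \<in> Hom C X Z"
    and id_left: "f \<in> Hom C X Y \<Longrightarrow> Id C Y \<cdot> f = f"
    and id_right: "f \<in> Hom C X Y \<Longrightarrow> f \<cdot> Id C X = f"
    and comp_assoc: "\<lbrakk>f \<in> Hom C X Y; g \<in> Hom C Y Z; h \<in> Hom C Z T\<rbrakk>
        \<Longrightarrow> (h \<cdot> g) \<cdot> f = h \<cdot> (g \<cdot> f)"
    and zero_hom: "\<lbrakk>X \<in> Obj C; Y \<in> Obj C\<rbrakk> \<Longrightarrow> Zero C X Y \<in> Hom C X Y"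
    and add_hom: "\<lbrakk>f \<in> Hom C X Y; g \<in> Hom C X Y\<rbrakk> \<Longrightarrow> Add C f g \<in> Hom C X Y"
    and scale_hom: "f \<in> Hom C X Y \<Longrightarrow> Scale C c f \<in> Hom C X Y"
    and add_assoc: "\<lbrakk>f \<in> Hom C X Y; g \<in> Hom C X Y; h \<in> Hom C X Y\<rbrakk>
        \<Longrightarrow> Add C (Add C f g) h = Add C f (Add C g h)"
    and add_commute: "\<lbrakk>f \<in> Hom C X Y; g \<in> Hom C X Y\<rbrakk> \<Longrightarrow> Add C f g = Add C g f"
    and add_zero: "f \<in> Hom C X Y \<Longrightarrow> Add C f (Zero C X Y) = f"
    and add_neg: "f \<in> Hom C X Y \<Longrightarrow> Add C f (Scale C (- 1) f) = Zero C X Y"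
    and scale_one: "f \<in> Hom C X Y \<Longrightarrow> Scale C 1 f = f"
    and scale_scale: "f \<in> Hom C X Y \<Longrightarrow> Scale C a (Scale C b f) = Scale C (a * b) f"
    and scale_add: "\<lbrakk>f \<in> Hom C X Y; g \<in> Hom C X Y\<rbrakk>
        \<Longrightarrow> Scale C c (Add C f g) = Add C (Scale C c f) (Scale C c g)"
    and add_scale: "f \<in> Hom C X Y \<Longrightarrow> Scale C (a + b) f = Add C (Scale C a f) (Scale C b f)"
    and comp_add_left: "\<lbrakk>f \<in> Hom C X Y; g \<in> Hom C Y Z; h \<in> Hom C Y Z\<rbrakk>
        \<Longrightarrow> Add C g h \<cdot> f = Add C (g \<cdot> f) (h \<cdot> f)"
    and comp_add_right: "\<lbrakk>f \<in> Hom C X Y; g \<in> Hom C X Y; h \<in> Hom C Y Z\<rbrakk>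
        \<Longrightarrow> h \<cdot> Add C f g = Add C (h \<cdot> f) (h \<cdot> g)"
    and comp_scale_left: "\<lbrakk>f \<in> Hom C X Y; g \<in> Hom C Y Z\<rbrakk>
        \<Longrightarrow> Scale C c g \<cdot> f = Scale C c (g \<cdot> f)"
    and comp_scale_right: "\<lbrakk>f \<in> Hom C X Y; g \<in> Hom C Y Z\<rbrakk>
        \<Longrightarrow> g \<cdot> Scale C c f = Scale C c (g \<cdot> f)"

primrec hom_sum :: "('o, 'm, 'k, 'x) lincat_scheme \<Rightarrow> 'o \<Rightarrow> 'o \<Rightarrow> (nat \<Rightarrow> 'm) \<Rightarrow> nat \<Rightarrow> 'm" where
  "hom_sum C X Y h 0 = Zero C X Y"
| "hom_sum C X Y h (Suc n) = Add C (hom_sum C X Y h n) (h n)"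

definition is_iso :: "('o, 'm, 'k, 'x) lincat_scheme \<Rightarrow> 'm \<Rightarrow> bool" where
  "is_iso C f \<longleftrightarrow> f \<in> Arr C \<and>
     (\<exists>g\<in>Hom C (Cod C f) (Dom C f).
        Comp C g f = Id C (Dom C f) \<and> Comp C f g = Id C (Cod C f))"

definition is_mono :: "('o, 'm, 'k, 'x) lincat_scheme \<Rightarrow> 'm \<Rightarrow> bool" where
  "is_mono C f \<longleftrightarrow> f \<in> Arr C \<and>
     (\<forall>T\<in>Obj C. \<forall>u\<in>Hom C T (Dom C f). \<forall>v\<in>Hom C T (Dom C f).
        Comp C f u = Comp C f v \<longrightarrow> u = v)"

definition is_epi :: "('o, 'm, 'k, 'x) lincat_scheme \<Rightarrow> 'm \<Rightarrow> bool" where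
  "is_epi C f \<longleftrightarrow> f \<in> Arr C \<and>
     (\<forall>T\<in>Obj C. \<forall>u\<in>Hom C (Cod C f) T. \<forall>v\<in>Hom C (Cod C f) T.
        Comp C u f = Comp C v f \<longrightarrow> u = v)"

definition is_zero_object :: "('o, 'm, 'k, 'x) lincat_scheme \<Rightarrow> 'o \<Rightarrow> bool" where
  "is_zero_object C N \<longleftrightarrow> N \<in> Obj C \<and>
     (\<forall>X\<in>Obj C. (\<exists>!f. f \<in> Hom C N X) \<and> (\<exists>!f. f \<in> Hom C X N))"

definition is_biproduct ::
    "('o, 'm, 'k, 'x) lincat_scheme \<Rightarrow> 'o \<Rightarrow> 'o \<Rightarrow> 'o \<Rightarrow> 'm \<Rightarrow> 'm \<Rightarrow> 'm \<Rightarrow> 'm \<Rightarrow> bool" where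
  "is_biproduct C X Y B i j p q \<longleftrightarrow> B \<in> Obj C \<and>
     i \<in> Hom C X B \<and> j \<in> Hom C Y B \<and> p \<in> Hom C B X \<and> q \<in> Hom C B Y \<and>
     Comp C p i = Id C X \<and> Comp C q j = Id C Y \<and>
     Comp C p j = Zero C Y X \<and> Comp C q i = Zero C X Y \<and>
     Add C (Comp C i p) (Comp C j q) = Id C B"

definition is_kernel :: "('o, 'm, 'k, 'x) lincat_scheme \<Rightarrow> 'm \<Rightarrow> 'm \<Rightarrow> bool" where
  "is_kernel C i f \<longleftrightarrow> f \<in> Arr C \<and> i \<in> Arr C \<and> Cod C i = Dom C f \<and>
     Comp C f i = Zero C (Dom C i) (Cod C f) \<and>
     (\<forall>T\<in>Obj C. \<forall>t\<in>Hom C T (Dom C f). Comp C f t = Zero C T (Cod C f) \<longrightarrow>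
        (\<exists>!u. u \<in> Hom C T (Dom C i) \<and> Comp C i u = t))"

definition is_cokernel :: "('o, 'm, 'k, 'x) lincat_scheme \<Rightarrow> 'm \<Rightarrow> 'm \<Rightarrow> bool" where
  "is_cokernel C p f \<longleftrightarrow> f \<in> Arr C \<and> p \<in> Arr C \<and> Dom C p = Cod C f \<and>
     Comp C p f = Zero C (Dom C f) (Cod C p) \<and>
     (\<forall>T\<in>Obj C. \<forall>t\<in>Hom C (Cod C f) T. Comp C t f = Zero C (Dom C f) T \<longrightarrow>
        (\<exists>!u. u \<in> Hom C (Cod C p) T \<and> Comp C u p = t))"

definition short_exact :: "('o, 'm, 'k, 'x) lincat_scheme \<Rightarrow> 'm \<Rightarrow> 'm \<Rightarrow> bool" where
  "short_exact C i p \<longleftrightarrow> is_kernel C i p \<and> is_cokernel C p i"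

locale abelian_category = linear_category +
  assumes has_zero: "\<exists>N. is_zero_object C N"
    and has_biproducts: "\<lbrakk>X \<in> Obj C; Y \<in> Obj C\<rbrakk> \<Longrightarrow> \<exists>B i j p q. is_biproduct C X Y B i j p q"
    and has_kernels: "f \<in> Arr C \<Longrightarrow> \<exists>i. is_kernel C i f"
    and has_cokernels: "f \<in> Arr C \<Longrightarrow> \<exists>p. is_cokernel C p f"
    and mono_normal: "is_mono C i \<Longrightarrow> \<exists>f. is_kernel C i f"
    and epi_normal: "is_epi C p \<Longrightarrow> \<exists>f. is_cokernel C p f"


section \<open>Linear functors and equivalences\<close>

record ('o, 'm, 'p, 'q) functr =
  FO :: "'o \<Rightarrow> 'p"
  FA :: "'m \<Rightarrow> 'q"

locale linear_functor = source: linear_category C + target: linear_category D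
  for C :: "('o, 'm, 'k::field, 'x) lincat_scheme"
    and D :: "('p, 'q, 'k, 'y) lincat_scheme"
    and F :: "('o, 'm, 'p, 'q) functr" +
  assumes obj_map: "X \<in> Obj C \<Longrightarrow> FO F X \<in> Obj D"
    and hom_map: "f \<in> Hom C X Y \<Longrightarrow> FA F f \<in> Hom D (FO F X) (FO F Y)"
    and id_map: "X \<in> Obj C \<Longrightarrow> FA F (Id C X) = Id D (FO F X)"
    and comp_map: "\<lbrakk>f \<in> Hom C X Y; g \<in> Hom C Y Z\<rbrakk>
        \<Longrightarrow> FA F (Comp C g f) = Comp D (FA F g) (FA F f)"
    and add_map: "\<lbrakk>f \<in> Hom C X Y; g \<in> Hom C X Y\<rbrakk>
        \<Longrightarrow> FA F (Add C f g) = Add D (FA F f) (FA F g)"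
    and scale_map: "f \<in> Hom C X Y \<Longrightarrow> FA F (Scale C c f) = Scale D c (FA F f)"

definition id_functor :: "('o, 'm, 'o, 'm) functr" where
  "id_functor = \<lparr>FO = id, FA = id\<rparr>"

definition comp_functor ::
    "('p, 'q, 'r, 's) functr \<Rightarrow> ('o, 'm, 'p, 'q) functr \<Rightarrow> ('o, 'm, 'r, 's) functr" where
  "comp_functor G F = \<lparr>FO = FO G \<circ> FO F, FA = FA G \<circ> FA F\<rparr>"

definition naturally_isomorphic ::
    "('o, 'm, 'k, 'x) lincat_scheme \<Rightarrow> ('p, 'q, 'k, 'y) lincat_scheme \<Rightarrow>
     ('o, 'm, 'p, 'q) functr \<Rightarrow> ('o, 'm, 'p, 'q) functr \<Rightarrow> bool" where
  "naturally_isomorphic C D F G \<longleftrightarrow>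
     (\<exists>t. (\<forall>X\<in>Obj C. t X \<in> Hom D (FO F X) (FO G X) \<and> is_iso D (t X)) \<and>
          (\<forall>f\<in>Arr C. Comp D (t (Cod C f)) (FA F f) = Comp D (FA G f) (t (Dom C f))))"

definition linearly_equivalent ::
    "('o, 'm, 'k::field, 'x) lincat_scheme \<Rightarrow> ('p, 'q, 'k, 'y) lincat_scheme \<Rightarrow> bool" where
  "linearly_equivalent C D \<longleftrightarrow>
     (\<exists>F G. linear_functor C D F \<and> linear_functor D C G \<and>
        naturally_isomorphic C C (comp_functor G F) id_functor \<and>
        naturally_isomorphic D D (comp_functor F G) id_functor)"

definition exact_functor ::
    "('o, 'm, 'k, 'x) lincat_scheme \<Rightarrow> ('p, 'q, 'k, 'y) lincat_scheme \<Rightarrow>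
     ('o, 'm, 'p, 'q) functr \<Rightarrow> bool" where
  "exact_functor C D F \<longleftrightarrow>
     (\<forall>i p. short_exact C i p \<longrightarrow> short_exact D (FA F i) (FA F p))"


section \<open>Finite-dimensional modules and finite categories\<close>

text \<open>A finite-dimensional unital associative algebra, carried by \<open>k\<^sup>n\<close>. Up to isomorphism this is
  every finite-dimensional algebra.\<close>

definition fd_algebra ::
    "nat \<Rightarrow> ('k::field vec \<Rightarrow> 'k vec \<Rightarrow> 'k vec) \<Rightarrow> 'k vec \<Rightarrow> bool" where
  "fd_algebra n mul e \<longleftrightarrow>
     e \<in> carrier_vec n \<and>
     (\<forall>a\<in>carrier_vec n. mul e a = a \<and> mul a e = a) \<and>
     (\<forall>a\<in>carrier_vec n. \<forall>b\<in>carrier_vec n. mul a b \<in> carrier_vec n) \<and>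
     (\<forall>a\<in>carrier_vec n. \<forall>b\<in>carrier_vec n. \<forall>c\<in>carrier_vec n.
        mul (mul a b) c = mul a (mul b c) \<and>
        mul (a + b) c = mul a c + mul b c \<and>
        mul a (b + c) = mul a b + mul a c) \<and>
     (\<forall>a\<in>carrier_vec n. \<forall>b\<in>carrier_vec n. \<forall>s.
        mul (s \<cdot>\<^sub>v a) b = s \<cdot>\<^sub>v mul a b \<and> mul a (s \<cdot>\<^sub>v b) = s \<cdot>\<^sub>v mul a b)"

text \<open>A module structure on \<open>k\<^sup>d\<close>, given by a representation of the algebra by \<open>d \<times> d\<close> matrices.\<close>

definition fd_module ::
    "nat \<Rightarrow> ('k::field vec \<Rightarrow> 'k vec \<Rightarrow> 'k vec) \<Rightarrow> 'k vec \<Rightarrow> nat \<times> ('k vec \<Rightarrow> 'k mat) \<Rightarrow> bool" where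
  "fd_module n mul e M \<longleftrightarrow> (case M of (d, act) \<Rightarrow>
     act \<in> carrier_vec n \<rightarrow>\<^sub>E carrier_mat d d \<and>
     act e = 1\<^sub>m d \<and>
     (\<forall>a\<in>carrier_vec n. \<forall>b\<in>carrier_vec n.
        act (mul a b) = act a * act b \<and> act (a + b) = act a + act b) \<and>
     (\<forall>a\<in>carrier_vec n. \<forall>s. act (s \<cdot>\<^sub>v a) = s \<cdot>\<^sub>m act a))"

definition fd_modules ::
    "nat \<Rightarrow> ('k::field vec \<Rightarrow> 'k vec \<Rightarrow> 'k vec) \<Rightarrow> 'k vec \<Rightarrow>
     (nat \<times> ('k vec \<Rightarrow> 'k mat),
      (nat \<times> ('k vec \<Rightarrow> 'k mat)) \<times> (nat \<times> ('k vec \<Rightarrow> 'k mat)) \<times> 'k mat, 'k) lincat" where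
  "fd_modules n mul e =
     \<lparr>Obj = {M. fd_module n mul e M},
      Arr = {(M, N, A). fd_module n mul e M \<and> fd_module n mul e N \<and>
               A \<in> carrier_mat (fst N) (fst M) \<and>
               (\<forall>a\<in>carrier_vec n. A * snd M a = snd N a * A)},
      Dom = (\<lambda>(M, N, A). M),
      Cod = (\<lambda>(M, N, A). N),
      Id = (\<lambda>M. (M, M, 1\<^sub>m (fst M))),
      Comp = (\<lambda>(N, P, B) (M, N', A). (M, P, B * A)),
      Add = (\<lambda>(M, N, A) (M', N', B). (M, N, A + B)),
      Zero = (\<lambda>M N. (M, N, 0\<^sub>m (fst N) (fst M))),
      Scale = (\<lambda>c (M, N, A). (M, N, c \<cdot>\<^sub>m A))\<rparr>"

definition finite_category :: "('o, 'm, 'k::field, 'x) lincat_scheme \<Rightarrow> bool" where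
  "finite_category C \<longleftrightarrow>
     (\<exists>n mul e. fd_algebra n mul e \<and> linearly_equivalent C (fd_modules n mul e))"


section \<open>Strict tensor categories\<close>

text \<open>\<open>X \<otimes> Y\<close> is the tensor product of objects, \<open>f \<boxtimes> g\<close> that of arrows. Left duals come with
  chosen (co)evaluations; right duals are only required to exist.\<close>

record ('o, 'm, 'k) tcat = "('o, 'm, 'k) lincat" +
  TensO :: "'o \<Rightarrow> 'o \<Rightarrow> 'o" (infixr \<open>\<otimes>\<index>\<close> 75)
  TensA :: "'m \<Rightarrow> 'm \<Rightarrow> 'm" (infixr \<open>\<boxtimes>\<index>\<close> 75)
  Unit :: 'o
  Dual :: "'o \<Rightarrow> 'o"
  Ev :: "'o \<Rightarrow> 'm"
  Coev :: "'o \<Rightarrow> 'm"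

locale strict_tensor_category = abelian_category C
  for C :: "('o, 'm, 'k::field, 'x) tcat_scheme" (structure) +
  assumes unit_obj: "Unit C \<in> Obj C"
    and tens_obj: "\<lbrakk>X \<in> Obj C; Y \<in> Obj C\<rbrakk> \<Longrightarrow> X \<otimes> Y \<in> Obj C"
    and tens_assoc: "\<lbrakk>X \<in> Obj C; Y \<in> Obj C; Z \<in> Obj C\<rbrakk> \<Longrightarrow> (X \<otimes> Y) \<otimes> Z = X \<otimes> (Y \<otimes> Z)"
    and tens_unit_left: "X \<in> Obj C \<Longrightarrow> Unit C \<otimes> X = X"
    and tens_unit_right: "X \<in> Obj C \<Longrightarrow> X \<otimes> Unit C = X"
    and tens_hom: "\<lbrakk>f \<in> Hom C X Y; g \<in> Hom C X' Y'\<rbrakk> \<Longrightarrow> f \<boxtimes> g \<in> Hom C (X \<otimes> X') (Y \<otimes> Y')"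
    and tens_id: "\<lbrakk>X \<in> Obj C; Y \<in> Obj C\<rbrakk> \<Longrightarrow> Id C X \<boxtimes> Id C Y = Id C (X \<otimes> Y)"
    and tens_comp: "\<lbrakk>f \<in> Hom C X Y; g \<in> Hom C Y Z; f' \<in> Hom C X' Y'; g' \<in> Hom C Y' Z'\<rbrakk>
        \<Longrightarrow> (g \<cdot> f) \<boxtimes> (g' \<cdot> f') = (g \<boxtimes> g') \<cdot> (f \<boxtimes> f')"
    and tens_arr_assoc: "\<lbrakk>f \<in> Arr C; g \<in> Arr C; h \<in> Arr C\<rbrakk>
        \<Longrightarrow> (f \<boxtimes> g) \<boxtimes> h = f \<boxtimes> (g \<boxtimes> h)"
    and tens_arr_unit_left: "f \<in> Arr C \<Longrightarrow> Id C (Unit C) \<boxtimes> f = f"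
    and tens_arr_unit_right: "f \<in> Arr C \<Longrightarrow> f \<boxtimes> Id C (Unit C) = f"
    and tens_add_left: "\<lbrakk>f \<in> Hom C X Y; g \<in> Hom C X Y; h \<in> Arr C\<rbrakk>
        \<Longrightarrow> Add C f g \<boxtimes> h = Add C (f \<boxtimes> h) (g \<boxtimes> h)"
    and tens_add_right: "\<lbrakk>f \<in> Hom C X Y; g \<in> Hom C X Y; h \<in> Arr C\<rbrakk>
        \<Longrightarrow> h \<boxtimes> Add C f g = Add C (h \<boxtimes> f) (h \<boxtimes> g)"
    and tens_scale_left: "\<lbrakk>f \<in> Arr C; h \<in> Arr C\<rbrakk> \<Longrightarrow> Scale C c f \<boxtimes> h = Scale C c (f \<boxtimes> h)"
    and tens_scale_right: "\<lbrakk>f \<in> Arr C; h \<in> Arr C\<rbrakk> \<Longrightarrow> h \<boxtimes> Scale C c f = Scale C c (h \<boxtimes> f)"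
    and dual_obj: "X \<in> Obj C \<Longrightarrow> Dual C X \<in> Obj C"
    and ev_hom: "X \<in> Obj C \<Longrightarrow> Ev C X \<in> Hom C (Dual C X \<otimes> X) (Unit C)"
    and coev_hom: "X \<in> Obj C \<Longrightarrow> Coev C X \<in> Hom C (Unit C) (X \<otimes> Dual C X)"
    and zigzag: "X \<in> Obj C \<Longrightarrow> (Id C X \<boxtimes> Ev C X) \<cdot> (Coev C X \<boxtimes> Id C X) = Id C X"
    and zigzag_dual: "X \<in> Obj C \<Longrightarrow>
        (Ev C X \<boxtimes> Id C (Dual C X)) \<cdot> (Id C (Dual C X) \<boxtimes> Coev C X) = Id C (Dual C X)"
    and right_dual: "X \<in> Obj C \<Longrightarrow>
        \<exists>Y\<in>Obj C. \<exists>e\<in>Hom C (X \<otimes> Y) (Unit C). \<exists>c\<in>Hom C (Unit C) (Y \<otimes> X).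
          (e \<boxtimes> Id C X) \<cdot> (Id C X \<boxtimes> c) = Id C X \<and>
          (Id C Y \<boxtimes> e) \<cdot> (c \<boxtimes> Id C Y) = Id C Y"
    and unit_nonzero: "\<not> is_zero_object C (Unit C)"
    and unit_simple: "\<lbrakk>is_mono C i; Cod C i = Unit C\<rbrakk>
        \<Longrightarrow> is_zero_object C (Dom C i) \<or> is_iso C i"
    and unit_end: "bij_betw (\<lambda>c. Scale C c (Id C (Unit C))) UNIV (Hom C (Unit C) (Unit C))"

definition finite_strict_tensor_category :: "('o, 'm, 'k::field, 'x) tcat_scheme \<Rightarrow> bool" where
  "finite_strict_tensor_category C \<longleftrightarrow> strict_tensor_category C \<and> finite_category C"

definition exact_strict_monoidal_functor ::
    "('o, 'm, 'k::field, 'x) tcat_scheme \<Rightarrow> ('p, 'q, 'k, 'y) tcat_scheme \<Rightarrow>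
     ('o, 'm, 'p, 'q) functr \<Rightarrow> bool" where
  "exact_strict_monoidal_functor C D F \<longleftrightarrow>
     linear_functor C D F \<and> exact_functor C D F \<and>
     FO F (Unit C) = Unit D \<and>
     (\<forall>X\<in>Obj C. \<forall>Y\<in>Obj C. FO F (X \<otimes>\<^bsub>C\<^esub> Y) = FO F X \<otimes>\<^bsub>D\<^esub> FO F Y) \<and>
     (\<forall>f\<in>Arr C. \<forall>g\<in>Arr C. FA F (f \<boxtimes>\<^bsub>C\<^esub> g) = FA F f \<boxtimes>\<^bsub>D\<^esub> FA F g)"

text \<open>The transpose \<open>Y\<^sup>\<or> \<rightarrow> X\<^sup>\<or>\<close> of \<open>\<phi> : X \<rightarrow> Y\<close>.\<close>

definition dual_map :: "('o, 'm, 'k, 'x) tcat_scheme \<Rightarrow> 'm \<Rightarrow> 'm" where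
  "dual_map C \<phi> = (let X = Dom C \<phi>; Y = Cod C \<phi>; X' = Dual C X; Y' = Dual C Y in
     (Ev C Y \<boxtimes>\<^bsub>C\<^esub> Id C X') \<cdot>\<^bsub>C\<^esub> (Id C Y' \<boxtimes>\<^bsub>C\<^esub> \<phi> \<boxtimes>\<^bsub>C\<^esub> Id C X') \<cdot>\<^bsub>C\<^esub>
       (Id C Y' \<boxtimes>\<^bsub>C\<^esub> Coev C X))"

text \<open>The canonical isomorphism \<open>Y\<^sup>\<or> \<otimes> X\<^sup>\<or> \<rightarrow> (X \<otimes> Y)\<^sup>\<or>\<close>, an identification that is not assumed
  to be strict.\<close>

definition dual_tensor :: "('o, 'm, 'k, 'x) tcat_scheme \<Rightarrow> 'o \<Rightarrow> 'o \<Rightarrow> 'm" where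
  "dual_tensor C X Y = (let X' = Dual C X; Y' = Dual C Y; P = X \<otimes>\<^bsub>C\<^esub> Y in
     ((Ev C Y \<cdot>\<^bsub>C\<^esub> (Id C Y' \<boxtimes>\<^bsub>C\<^esub> Ev C X \<boxtimes>\<^bsub>C\<^esub> Id C Y)) \<boxtimes>\<^bsub>C\<^esub> Id C (Dual C P)) \<cdot>\<^bsub>C\<^esub>
       (Id C (Y' \<otimes>\<^bsub>C\<^esub> X') \<boxtimes>\<^bsub>C\<^esub> Coev C P))"


section \<open>Centralizer, Davydov--Yetter complex and bar complex of a functor\<close>

text \<open>In this locale unindexed operations are those of \<open>D\<close>. The locale has no assumptions; the
  definitions are meaningful for an exact strict monoidal functor between finite strict tensor
  categories. The dual of \<open>F(X)\<close> is taken to be \<open>F(X\<^sup>\<or>)\<close>, with the images of the (co)evaluations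
  of \<open>X\<close>. An object of the centralizer is a pair of an object of \<open>D\<close> and a half-braiding, the latter
  extensional on the objects of \<open>C\<close>.\<close>

locale davydov_yetter =
  fixes C :: "('o, 'm, 'k::field) tcat"
    and D :: "('p, 'q, 'k) tcat" (structure)
    and F :: "('o, 'm, 'p, 'q) functr"
begin

definition half_braiding :: "'p \<Rightarrow> ('o \<Rightarrow> 'q) \<Rightarrow> bool" where
  "half_braiding V \<rho> \<longleftrightarrow>
     \<rho> \<in> extensional (Obj C) \<and>
     (\<forall>X\<in>Obj C. \<rho> X \<in> Hom D (V \<otimes> FO F X) (FO F X \<otimes> V) \<and> is_iso D (\<rho> X)) \<and>
     (\<forall>X\<in>Obj C. \<forall>Y\<in>Obj C. \<forall>\<phi>\<in>Hom C X Y.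
        \<rho> Y \<cdot> (Id D V \<boxtimes> FA F \<phi>) = (FA F \<phi> \<boxtimes> Id D V) \<cdot> \<rho> X) \<and>
     (\<forall>X\<in>Obj C. \<forall>Y\<in>Obj C.
        \<rho> (X \<otimes>\<^bsub>C\<^esub> Y) = (Id D (FO F X) \<boxtimes> \<rho> Y) \<cdot> (\<rho> X \<boxtimes> Id D (FO F Y)))"

definition centralizer :: "('p \<times> ('o \<Rightarrow> 'q)) set" where
  "centralizer = {(V, \<rho>). V \<in> Obj D \<and> half_braiding V \<rho>}"

definition centralizer_hom :: "'p \<times> ('o \<Rightarrow> 'q) \<Rightarrow> 'p \<times> ('o \<Rightarrow> 'q) \<Rightarrow> 'q set" where
  "centralizer_hom V W = {f \<in> Hom D (fst V) (fst W).
     \<forall>X\<in>Obj C. (Id D (FO F X) \<boxtimes> f) \<cdot> snd V X = snd W X \<cdot> (f \<boxtimes> Id D (FO F X))}"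


subsection \<open>The Davydov--Yetter complex\<close>

definition tuples :: "nat \<Rightarrow> 'o list set" where
  "tuples n = {Xs. set Xs \<subseteq> Obj C \<and> length Xs = n}"

definition FOs :: "'o list \<Rightarrow> 'p" where
  "FOs Xs = foldr (\<lambda>X P. FO F X \<otimes> P) Xs (Unit D)"

definition FAs :: "'m list \<Rightarrow> 'q" where
  "FAs \<phi>s = foldr (\<lambda>\<phi> g. FA F \<phi> \<boxtimes> g) \<phi>s (Id D (Unit D))"

definition dy_cochains ::
    "nat \<Rightarrow> 'p \<times> ('o \<Rightarrow> 'q) \<Rightarrow> 'p \<times> ('o \<Rightarrow> 'q) \<Rightarrow> ('o list \<Rightarrow> 'q) set" where
  "dy_cochains n U V = {f \<in> extensional (tuples n).
     (\<forall>Xs\<in>tuples n. f Xs \<in> Hom D (fst U \<otimes> FOs Xs) (FOs Xs \<otimes> fst V)) \<and>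
     (\<forall>\<phi>s. set \<phi>s \<subseteq> Arr C \<and> length \<phi>s = n \<longrightarrow>
        f (map (Cod C) \<phi>s) \<cdot> (Id D (fst U) \<boxtimes> FAs \<phi>s) =
        (FAs \<phi>s \<boxtimes> Id D (fst V)) \<cdot> f (map (Dom C) \<phi>s))}"

text \<open>With \<open>Xs = [X\<^sub>0, \<dots>, X\<^sub>n]\<close>, the summand of index \<open>j\<close> below is the one that multiplies
  \<open>X\<^sub>j\<close> and \<open>X\<^sub>j\<^sub>+\<^sub>1\<close> and has sign \<open>(-1)\<^sup>j\<^sup>+\<^sup>1\<close>.\<close>

definition dy_delta ::
    "nat \<Rightarrow> 'p \<times> ('o \<Rightarrow> 'q) \<Rightarrow> 'p \<times> ('o \<Rightarrow> 'q) \<Rightarrow> ('o list \<Rightarrow> 'q) \<Rightarrow> 'o list \<Rightarrow> 'q" where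
  "dy_delta n U V f = (\<lambda>Xs\<in>tuples (Suc n).
     Add D
       (Add D
         ((Id D (FO F (hd Xs)) \<boxtimes> f (tl Xs)) \<cdot> (snd U (hd Xs) \<boxtimes> Id D (FOs (tl Xs))))
         (hom_sum D (fst U \<otimes> FOs Xs) (FOs Xs \<otimes> fst V)
           (\<lambda>j. Scale D ((- 1) ^ Suc j)
                  (f (take j Xs @ [(Xs ! j) \<otimes>\<^bsub>C\<^esub> (Xs ! Suc j)] @ drop (Suc (Suc j)) Xs)))
           n))
       (Scale D ((- 1) ^ Suc n)
         ((Id D (FOs (butlast Xs)) \<boxtimes> snd V (last Xs)) \<cdot>
          (f (butlast Xs) \<boxtimes> Id D (FO F (last Xs))))))"

definition dy_cocycles ::
    "nat \<Rightarrow> 'p \<times> ('o \<Rightarrow> 'q) \<Rightarrow> 'p \<times> ('o \<Rightarrow> 'q) \<Rightarrow> ('o list \<Rightarrow> 'q) set" where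
  "dy_cocycles n U V = {f \<in> dy_cochains n U V.
     \<forall>Xs\<in>tuples (Suc n).
       dy_delta n U V f Xs = Zero D (fst U \<otimes> FOs Xs) (FOs Xs \<otimes> fst V)}"

definition dy_cohomologous ::
    "nat \<Rightarrow> 'p \<times> ('o \<Rightarrow> 'q) \<Rightarrow> 'p \<times> ('o \<Rightarrow> 'q) \<Rightarrow> ('o list \<Rightarrow> 'q) \<Rightarrow> ('o list \<Rightarrow> 'q) \<Rightarrow> bool" where
  "dy_cohomologous n U V f h \<longleftrightarrow>
     (case n of
        0 \<Rightarrow> f = h
      | Suc m \<Rightarrow> \<exists>e\<in>dy_cochains m U V.
          \<forall>Xs\<in>tuples n. f Xs = Add D (h Xs) (dy_delta m U V e Xs))"


subsection \<open>The central coend and its comonad\<close>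

definition coend_body :: "'p \<Rightarrow> 'o \<Rightarrow> 'p" where
  "coend_body V X = FO F (Dual C X) \<otimes> V \<otimes> FO F X"

definition dinatural :: "'p \<Rightarrow> 'p \<Rightarrow> ('o \<Rightarrow> 'q) \<Rightarrow> bool" where
  "dinatural V T j \<longleftrightarrow> T \<in> Obj D \<and>
     (\<forall>X\<in>Obj C. j X \<in> Hom D (coend_body V X) T) \<and>
     (\<forall>X\<in>Obj C. \<forall>Y\<in>Obj C. \<forall>\<phi>\<in>Hom C X Y.
        j X \<cdot> (FA F (dual_map C \<phi>) \<boxtimes> Id D V \<boxtimes> Id D (FO F X)) =
        j Y \<cdot> (Id D (FO F (Dual C Y)) \<boxtimes> Id D V \<boxtimes> FA F \<phi>))"

definition is_coend :: "'p \<Rightarrow> 'p \<Rightarrow> ('o \<Rightarrow> 'q) \<Rightarrow> bool" where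
  "is_coend V T j \<longleftrightarrow> dinatural V T j \<and>
     (\<forall>T' j'. dinatural V T' j' \<longrightarrow>
        (\<exists>!t. t \<in> Hom D T T' \<and> (\<forall>X\<in>Obj C. t \<cdot> j X = j' X)))"

text \<open>A coend is determined only up to unique isomorphism; one is chosen for each \<open>V\<close>. Such coends
  exist because \<open>C\<close> and \<open>D\<close> are finite and \<open>F\<close> is exact.\<close>

definition coend_choice :: "'p \<Rightarrow> 'p \<times> ('o \<Rightarrow> 'q)" where
  "coend_choice V = (SOME (T, j). is_coend V T j)"

definition ZO :: "'p \<Rightarrow> 'p" where
  "ZO V = fst (coend_choice V)"

definition din :: "'o \<Rightarrow> 'p \<Rightarrow> 'q" where
  "din X V = snd (coend_choice V) X"

definition ZA :: "'q \<Rightarrow> 'q" where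
  "ZA f = (THE t. t \<in> Hom D (ZO (Dom D f)) (ZO (Cod D f)) \<and>
     (\<forall>X\<in>Obj C. t \<cdot> din X (Dom D f) =
        din X (Cod D f) \<cdot> (Id D (FO F (Dual C X)) \<boxtimes> f \<boxtimes> Id D (FO F X))))"

definition Z_braiding :: "'p \<Rightarrow> 'o \<Rightarrow> 'q" where
  "Z_braiding V = (\<lambda>Y\<in>Obj C. THE r. r \<in> Hom D (ZO V \<otimes> FO F Y) (FO F Y \<otimes> ZO V) \<and>
     (\<forall>X\<in>Obj C. r \<cdot> (din X V \<boxtimes> Id D (FO F Y)) =
        (Id D (FO F Y) \<boxtimes> din (X \<otimes>\<^bsub>C\<^esub> Y) V) \<cdot>
        (Id D (FO F Y) \<boxtimes> FA F (dual_tensor C X Y) \<boxtimes> Id D (V \<otimes> FO F X \<otimes> FO F Y)) \<cdot>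
        (FA F (Coev C Y) \<boxtimes> Id D (coend_body V X \<otimes> FO F Y))))"

text \<open>The comonad \<open>G\<close> on the centralizer; on morphisms it is \<open>ZA\<close>.\<close>

definition GO :: "'p \<times> ('o \<Rightarrow> 'q) \<Rightarrow> 'p \<times> ('o \<Rightarrow> 'q)" where
  "GO V = (ZO (fst V), Z_braiding (fst V))"

definition counit :: "'p \<times> ('o \<Rightarrow> 'q) \<Rightarrow> 'q" where
  "counit V = (THE t. t \<in> Hom D (ZO (fst V)) (fst V) \<and>
     (\<forall>X\<in>Obj C. t \<cdot> din X (fst V) =
        (FA F (Ev C X) \<boxtimes> Id D (fst V)) \<cdot> (Id D (FO F (Dual C X)) \<boxtimes> snd V X)))"


subsection \<open>The bar complex and the isomorphism \<open>\<Gamma>\<close>\<close>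

text \<open>\<open>bar_d V n\<close> is the arrow \<open>d\<^sub>n : G\<^sup>n\<^sup>+\<^sup>1(V) \<rightarrow> G\<^sup>n(V)\<close>.\<close>

definition bar_d :: "'p \<times> ('o \<Rightarrow> 'q) \<Rightarrow> nat \<Rightarrow> 'q" where
  "bar_d V n = hom_sum D ((ZO ^^ Suc n) (fst V)) ((ZO ^^ n) (fst V))
     (\<lambda>i. Scale D ((- 1) ^ i) ((ZA ^^ (n - i)) (counit ((GO ^^ i) V)))) (Suc n)"

text \<open>The next two functions recurse over the reversed list \<open>[X\<^sub>n, \<dots>, X\<^sub>1]\<close>: the outermost pair of
  factors \<open>F(X\<^sub>n)\<^sup>\<or>\<close>, \<open>F(X\<^sub>n)\<close> comes first.\<close>

primrec din_iter_rev :: "'p \<Rightarrow> 'o list \<Rightarrow> 'q" where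
  "din_iter_rev V [] = Id D V"
| "din_iter_rev V (X # Xs) = din X ((ZO ^^ length Xs) V) \<cdot>
     (Id D (FO F (Dual C X)) \<boxtimes> din_iter_rev V Xs \<boxtimes> Id D (FO F X))"

primrec evs_rev :: "'o list \<Rightarrow> 'q" where
  "evs_rev [] = Id D (Unit D)"
| "evs_rev (X # Xs) = FA F (Ev C X) \<cdot>
     (Id D (FO F (Dual C X)) \<boxtimes> evs_rev Xs \<boxtimes> Id D (FO F X))"

definition din_iter :: "'o list \<Rightarrow> 'p \<Rightarrow> 'q" where
  "din_iter Xs V = din_iter_rev V (rev Xs)"

definition evs :: "'o list \<Rightarrow> 'q" where
  "evs Xs = evs_rev (rev Xs)"

definition FO_duals :: "'o list \<Rightarrow> 'p" where
  "FO_duals Xs = FOs (map (Dual C) (rev Xs))"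

definition Gam ::
    "nat \<Rightarrow> 'p \<times> ('o \<Rightarrow> 'q) \<Rightarrow> 'p \<times> ('o \<Rightarrow> 'q) \<Rightarrow> ('o list \<Rightarrow> 'q) \<Rightarrow> 'q" where
  "Gam n U V f = (THE t. t \<in> Hom D ((ZO ^^ Suc n) (fst U)) (fst V) \<and>
     (\<forall>Xs\<in>tuples (Suc n). t \<cdot> din_iter Xs (fst U) =
        (evs Xs \<boxtimes> Id D (fst V)) \<cdot>
        (Id D (FO_duals Xs) \<boxtimes> Id D (FOs (butlast Xs)) \<boxtimes> snd V (last Xs)) \<cdot>
        (Id D (FO_duals Xs) \<boxtimes> f (butlast Xs) \<boxtimes> Id D (FO F (last Xs)))))"


subsection \<open>The Yoneda product\<close>

text \<open>\<open>yoneda_product n m U V W f g h\<close> says that \<open>h\<close> is a value of \<open>f \<circ> g\<close>, that is, \<open>\<Gamma>(h)\<close> is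
  the composite of \<open>\<Gamma>(f)\<close> with the last of some lifts \<open>b\<^sub>0, \<dots>, b\<^sub>n\<close> of \<open>\<Gamma>(g)\<close>. This is a relation
  because the cochain \<open>f \<circ> g\<close> depends on the lifts; only its cohomology class does not.\<close>

definition yoneda_product ::
    "nat \<Rightarrow> nat \<Rightarrow> 'p \<times> ('o \<Rightarrow> 'q) \<Rightarrow> 'p \<times> ('o \<Rightarrow> 'q) \<Rightarrow> 'p \<times> ('o \<Rightarrow> 'q) \<Rightarrow>
     ('o list \<Rightarrow> 'q) \<Rightarrow> ('o list \<Rightarrow> 'q) \<Rightarrow> ('o list \<Rightarrow> 'q) \<Rightarrow> bool" where
  "yoneda_product n m U V W f g h \<longleftrightarrow>
     h \<in> dy_cochains (m + n) U W \<and>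
     (\<exists>b. (\<forall>l\<le>n. b l \<in> centralizer_hom ((GO ^^ Suc (m + l)) U) ((GO ^^ Suc l) V)) \<and>
          counit V \<cdot> b 0 = Gam m U V g \<and>
          (\<forall>l<n. bar_d V (Suc l) \<cdot> b (Suc l) = b l \<cdot> bar_d U (Suc (m + l))) \<and>
          Gam (m + n) U W h = Gam n V W f \<cdot> b n)"

text \<open>\<open>yoneda_chain V g n h\<close> says that \<open>h\<close> is a value of the product
  \<open>(\<dots>(g\<^sub>1 \<circ> g\<^sub>2) \<circ> \<dots>) \<circ> g\<^sub>n\<close> of 1-cochains, where \<open>g\<^sub>i\<close> goes from \<open>V\<^sub>i\<close> to \<open>V\<^sub>i\<^sub>-\<^sub>1\<close>.\<close>

inductive yoneda_chain ::
    "(nat \<Rightarrow> 'p \<times> ('o \<Rightarrow> 'q)) \<Rightarrow> (nat \<Rightarrow> 'o list \<Rightarrow> 'q) \<Rightarrow> nat \<Rightarrow> ('o list \<Rightarrow> 'q) \<Rightarrow> bool"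
  for V :: "nat \<Rightarrow> 'p \<times> ('o \<Rightarrow> 'q)" and g :: "nat \<Rightarrow> 'o list \<Rightarrow> 'q" where
  single: "yoneda_chain V g 1 (g 1)"
| extend: "\<lbrakk>n \<ge> 1; yoneda_chain V g n h;
           yoneda_product n 1 (V (Suc n)) (V n) (V 0) h (g (Suc n)) h'\<rbrakk>
         \<Longrightarrow> yoneda_chain V g (Suc n) h'"

end

end

theory Submission
  imports Defs
begin

text \<open>The proof is dimension shifting along \<open>0 \<rightarrow> K \<rightarrow> G(U) \<rightarrow> U \<rightarrow> 0\<close>, where \<open>K\<close> is the kernel of the counit
  \<open>\<epsilon>\<close>. In \<open>D\<close> this sequence is split by the unit \<open>\<eta>\<close> of the adjunction; let \<open>i : K \<rightarrow> G(U)\<close> be the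
  inclusion and \<open>r : G(U) \<rightarrow> K\<close> the retraction, so that \<open>i r = 1 - \<eta> \<epsilon>\<close>. The arrows \<open>(-1)\<^sup>l Z\<^sup>l\<^sup>+\<^sup>1(r)\<close> lift
  the cocycle \<open>\<epsilon> Z(r) : G\<^sup>2(U) \<rightarrow> K\<close>, the class of the sequence, to a map of bar resolutions. Given a
  bar cocycle \<open>\<alpha> : G\<^sup>n\<^sup>+\<^sup>2(U) \<rightarrow> W\<close>, the arrow \<open>(-1)\<^sup>n \<alpha> Z\<^sup>n\<^sup>+\<^sup>1(i)\<close> is a cocycle of degree one less, and its
  product with the class of the sequence is \<open>\<alpha> Z\<^sup>n\<^sup>+\<^sup>1(1 - \<eta> \<epsilon>)\<close>, which differs from \<open>\<alpha>\<close> by the coboundary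
  of \<open>\<alpha> Z\<^sup>n\<^sup>+\<^sup>1(\<eta>)\<close>. Iterating splits off one 1-cocycle at a time.

  All calculations with the coend are done with the transposes
  \<open>\<theta>\<^sub>X : A \<otimes> F(X) \<rightarrow> F(X) \<otimes> Z(A)\<close> of the universal dinatural maps. They form the universal natural
  family of this shape, and the duals no longer occur: \<open>\<epsilon>\<close> is characterised by
  \<open>(1 \<otimes> \<epsilon>) \<theta>\<^sub>X = \<rho>\<^sub>X\<close>, the half-braiding of \<open>Z(A)\<close> by \<open>(1 \<otimes> \<rho>\<^sub>Y) (\<theta>\<^sub>X \<otimes> 1) = \<theta>\<^bsub>X \<otimes> Y\<^esub>\<close>, and \<open>\<eta> = \<theta>\<^sub>1\<close>.\<close>

section \<open>Calculus in linear and strict tensor categories\<close>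

text \<open>Two obstacles shape the proof. \<open>ZO\<close>, \<open>din\<close> and the arrows
  built from them are given by \<open>SOME\<close> and \<open>THE\<close>, so nothing can be
  computed before a coend is known to exist. Existence comes from finiteness: the regular module of
  the algebra becomes a generator P of C, and A \<otimes> F(-) is right exact since F is exact and D
  has duals, so a natural family on A \<otimes> F(-) can be reconstructed from its component at P.
  The second obstacle is that a product of cochains depends on chosen lifts. The induction therefore
  speaks about every value of a chain of products, and in its step both the lifts and the
  representative of the shifted class may differ from the constructed ones. The error is a
  coboundary because two lifts are homotopic. This rests on the bar resolution being contractible in
  D, with \<eta> as contraction, while an arrow out of a free object G(X) is determined by its
  restriction along \<eta>. The signs of the lift arise because the arrows Z^l(r) anticommute with
  the bar differentials. Each 1-cocycle is split off at the U end, which matches the left bracketing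
  in \<open>yoneda_chain\<close>.\<close>

lemma hom_iff: "f \<in> Hom C X Y \<longleftrightarrow> f \<in> Arr C \<and> Dom C f = X \<and> Cod C f = Y"
  by (simp add: Hom_def)

context linear_category
begin

lemma arr_obj [simp]:
  "f \<in> Arr C \<Longrightarrow> Dom C f \<in> Obj C" "f \<in> Arr C \<Longrightarrow> Cod C f \<in> Obj C"
  by (fact dom_obj cod_obj)+

lemma hom_obj: "f \<in> Hom C X Y \<Longrightarrow> X \<in> Obj C \<and> Y \<in> Obj C"
  by (auto simp: hom_iff)

lemma id_typing [simp]:
  assumes "X \<in> Obj C"
  shows "Id C X \<in> Arr C" "Dom C (Id C X) = X" "Cod C (Id C X) = X"
  using id_hom[OF assms] by (simp_all add: hom_iff)

lemma comp_typing [simp]: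
  assumes "f \<in> Arr C" "g \<in> Arr C" "Dom C g = Cod C f"
  shows "g \<cdot> f \<in> Arr C" "Dom C (g \<cdot> f) = Dom C f" "Cod C (g \<cdot> f) = Cod C g"
  using comp_hom[of f "Dom C f" "Cod C f" g "Cod C g"] assms by (simp_all add: hom_iff)

lemma zero_typing [simp]:
  assumes "X \<in> Obj C" "Y \<in> Obj C"
  shows "Zero C X Y \<in> Arr C" "Dom C (Zero C X Y) = X" "Cod C (Zero C X Y) = Y"
  using zero_hom[OF assms] by (simp_all add: hom_iff)

lemma add_typing [simp]:
  assumes "f \<in> Arr C" "g \<in> Arr C" "Dom C g = Dom C f" "Cod C g = Cod C f"
  shows "Add C f g \<in> Arr C" "Dom C (Add C f g) = Dom C f" "Cod C (Add C f g) = Cod C f"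
  using add_hom[of f "Dom C f" "Cod C f" g] assms by (simp_all add: hom_iff)

lemma scale_typing [simp]:
  assumes "f \<in> Arr C"
  shows "Scale C c f \<in> Arr C" "Dom C (Scale C c f) = Dom C f" "Cod C (Scale C c f) = Cod C f"
  using scale_hom[of f "Dom C f" "Cod C f" c] assms by (simp_all add: hom_iff)

lemma id_comp [simp]:
  "\<lbrakk>f \<in> Arr C; Cod C f = Y\<rbrakk> \<Longrightarrow> Id C Y \<cdot> f = f"
  "\<lbrakk>f \<in> Arr C; Dom C f = X\<rbrakk> \<Longrightarrow> f \<cdot> Id C X = f"
  by (auto intro: id_left id_right simp: hom_iff)

lemma assoc:
  "\<lbrakk>f \<in> Arr C; g \<in> Arr C; h \<in> Arr C; Dom C g = Cod C f; Dom C h = Cod C g\<rbrakk>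
    \<Longrightarrow> (h \<cdot> g) \<cdot> f = h \<cdot> g \<cdot> f"
  by (rule comp_assoc) (auto simp: hom_iff)

lemma add_comp:
  "\<lbrakk>f \<in> Arr C; g \<in> Arr C; h \<in> Arr C; Dom C g = Cod C f; Dom C h = Cod C f; Cod C h = Cod C g\<rbrakk>
    \<Longrightarrow> Add C g h \<cdot> f = Add C (g \<cdot> f) (h \<cdot> f)"
  "\<lbrakk>f \<in> Arr C; g \<in> Arr C; h \<in> Arr C; Dom C f = Dom C g; Cod C f = Cod C g; Dom C h = Cod C g\<rbrakk>
    \<Longrightarrow> h \<cdot> Add C f g = Add C (h \<cdot> f) (h \<cdot> g)"
  by (rule comp_add_left comp_add_right; auto simp: hom_iff)+

lemma scale_comp:
  "\<lbrakk>f \<in> Arr C; g \<in> Arr C; Dom C g = Cod C f\<rbrakk> \<Longrightarrow> Scale C c g \<cdot> f = Scale C c (g \<cdot> f)"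
  "\<lbrakk>f \<in> Arr C; g \<in> Arr C; Dom C g = Cod C f\<rbrakk> \<Longrightarrow> g \<cdot> Scale C c f = Scale C c (g \<cdot> f)"
  by (rule comp_scale_left comp_scale_right; auto simp: hom_iff)+

lemma add_ac:
  "\<lbrakk>f \<in> Arr C; g \<in> Arr C; h \<in> Arr C; Dom C g = Dom C f; Cod C g = Cod C f;
     Dom C h = Dom C f; Cod C h = Cod C f\<rbrakk> \<Longrightarrow> Add C (Add C f g) h = Add C f (Add C g h)"
  "\<lbrakk>f \<in> Arr C; g \<in> Arr C; Dom C g = Dom C f; Cod C g = Cod C f\<rbrakk> \<Longrightarrow> Add C f g = Add C g f"
  "\<lbrakk>f \<in> Arr C; g \<in> Arr C; h \<in> Arr C; Dom C g = Dom C f; Cod C g = Cod C f;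
     Dom C h = Dom C f; Cod C h = Cod C f\<rbrakk> \<Longrightarrow> Add C f (Add C g h) = Add C g (Add C f h)"
proof -
  show 1: "Add C (Add C f g) h = Add C f (Add C g h)"
    if "f \<in> Arr C" "g \<in> Arr C" "h \<in> Arr C" "Dom C g = Dom C f" "Cod C g = Cod C f"
      "Dom C h = Dom C f" "Cod C h = Cod C f" for f g h
    using that by (intro add_assoc) (auto simp: hom_iff)
  show 2: "Add C f g = Add C g f"
    if "f \<in> Arr C" "g \<in> Arr C" "Dom C g = Dom C f" "Cod C g = Cod C f" for f g
    using that by (intro add_commute) (auto simp: hom_iff)
  show "Add C f (Add C g h) = Add C g (Add C f h)"
    if "f \<in> Arr C" "g \<in> Arr C" "h \<in> Arr C" "Dom C g = Dom C f" "Cod C g = Cod C f"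
     "Dom C h = Dom C f" "Cod C h = Cod C f"
    using that 1[of f g h] 1[of g f h] 2[of f g] by simp
qed

lemma add_zero_right [simp]:
  "\<lbrakk>f \<in> Arr C; Dom C f = X; Cod C f = Y\<rbrakk> \<Longrightarrow> Add C f (Zero C X Y) = f"
  by (rule add_zero) (auto simp: hom_iff)

lemma add_zero_left [simp]:
  assumes "f \<in> Arr C" "Dom C f = X" "Cod C f = Y"
  shows "Add C (Zero C X Y) f = f"
proof -
  have "X \<in> Obj C" "Y \<in> Obj C" using assms by auto
  then have "Add C (Zero C X Y) f = Add C f (Zero C X Y)" using assms by (intro add_ac(2)) simp_all
  then show ?thesis using assms by simp
qed

lemma add_minus [simp]:
  assumes "f \<in> Arr C"
  shows "Add C f (Scale C (- 1) f) = Zero C (Dom C f) (Cod C f)"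
    "Add C (Scale C (- 1) f) f = Zero C (Dom C f) (Cod C f)"
proof -
  show "Add C f (Scale C (- 1) f) = Zero C (Dom C f) (Cod C f)"
    by (rule add_neg) (use assms in \<open>auto simp: hom_iff\<close>)
  moreover have "Add C (Scale C (- 1) f) f = Add C f (Scale C (- 1) f)"
    using assms by (intro add_ac(2)) simp_all
  ultimately show "Add C (Scale C (- 1) f) f = Zero C (Dom C f) (Cod C f)" by simp
qed

lemma scale_simps [simp]:
  assumes "f \<in> Arr C"
  shows "Scale C 1 f = f" "Scale C a (Scale C b f) = Scale C (a * b) f"
  using assms by (auto intro!: scale_one scale_scale simp: hom_iff)

lemma scale_add_right:
  "\<lbrakk>f \<in> Arr C; g \<in> Arr C; Dom C g = Dom C f; Cod C g = Cod C f\<rbrakk>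
    \<Longrightarrow> Scale C c (Add C f g) = Add C (Scale C c f) (Scale C c g)"
  by (rule scale_add) (auto simp: hom_iff)

lemma scale_add_left:
  "f \<in> Arr C \<Longrightarrow> Scale C (a + b) f = Add C (Scale C a f) (Scale C b f)"
  by (rule add_scale) (auto simp: hom_iff)

text \<open>Write 0 = 1 + (-1) and use \<open>add_neg\<close>. Zero arrows thereby become scalar
  multiples, so every operation compatible with scalars is seen to preserve them.\<close>

lemma scale_0 [simp]:
  assumes "f \<in> Arr C"
  shows "Scale C 0 f = Zero C (Dom C f) (Cod C f)"
  using scale_add_left[OF assms, of 1 "- 1"] assms by simp

lemma scale_zero [simp]:
  assumes "X \<in> Obj C" "Y \<in> Obj C"
  shows "Scale C c (Zero C X Y) = Zero C X Y"
  using scale_0[of "Zero C X Y"] scale_simps(2)[of "Zero C X Y" c 0] assms by simp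

lemma zero_comp [simp]:
  assumes "f \<in> Arr C" "Z \<in> Obj C"
  shows "Cod C f = Y \<Longrightarrow> Zero C Y Z \<cdot> f = Zero C (Dom C f) Z"
    and "Dom C f = Y \<Longrightarrow> f \<cdot> Zero C Z Y = Zero C Z (Cod C f)"
proof -
  show "Zero C Y Z \<cdot> f = Zero C (Dom C f) Z" if "Cod C f = Y"
  proof -
    have "Y \<in> Obj C" using that assms by auto
    then show ?thesis
      using scale_comp(1)[of f "Zero C Y Z" 0] scale_0[of "Zero C Y Z \<cdot> f"] that assms
      by simp
  qed
  show "f \<cdot> Zero C Z Y = Zero C Z (Cod C f)" if "Dom C f = Y"
  proof -
    have "Y \<in> Obj C" using that assms by auto
    then show ?thesis
      using scale_comp(2)[of "Zero C Z Y" f 0] scale_0[of "f \<cdot> Zero C Z Y"] that assms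
      by simp
  qed
qed

lemma add_eq_zero_iff:
  assumes "f \<in> Arr C" "g \<in> Arr C" "Dom C g = Dom C f" "Cod C g = Cod C f"
  shows "Add C f (Scale C (- 1) g) = Zero C (Dom C f) (Cod C f) \<longleftrightarrow> f = g"
proof
  assume *: "Add C f (Scale C (- 1) g) = Zero C (Dom C f) (Cod C f)"
  have "f = Add C f (Add C (Scale C (- 1) g) g)" using assms by simp
  also have "\<dots> = Add C (Add C f (Scale C (- 1) g)) g" using assms by (intro add_ac(1)[symmetric]) simp_all
  also have "\<dots> = g" using assms * by simp
  finally show "f = g" .
qed (use assms in simp)

lemma add_cancel_minus [simp]:
  assumes "f \<in> Arr C" "g \<in> Arr C" "Dom C g = Dom C f" "Cod C g = Cod C f"
  shows "Add C f (Add C (Scale C (- 1) f) g) = g" "Add C (Scale C (- 1) f) (Add C f g) = g"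
  using assms by (simp_all add: add_ac(1)[symmetric])

lemma hom_sum_typing:
  assumes "X \<in> Obj C" "Y \<in> Obj C" "\<And>i. i < n \<Longrightarrow> h i \<in> Hom C X Y"
  shows "hom_sum C X Y h n \<in> Hom C X Y"
  using assms(3) by (induction n) (use assms(1,2) in \<open>auto simp: hom_iff\<close>)

lemma hom_sum_cong:
  "(\<And>i. i < n \<Longrightarrow> h i = h' i) \<Longrightarrow> hom_sum C X Y h n = hom_sum C X Y h' n"
  by (induction n) auto

end

context strict_tensor_category
begin

lemma tens_obj_simps [simp]:
  "Unit C \<in> Obj C"
  "\<lbrakk>X \<in> Obj C; Y \<in> Obj C\<rbrakk> \<Longrightarrow> X \<otimes> Y \<in> Obj C"
  "\<lbrakk>X \<in> Obj C; Y \<in> Obj C; Z \<in> Obj C\<rbrakk> \<Longrightarrow> (X \<otimes> Y) \<otimes> Z = X \<otimes> Y \<otimes> Z"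
  "X \<in> Obj C \<Longrightarrow> Unit C \<otimes> X = X"
  "X \<in> Obj C \<Longrightarrow> X \<otimes> Unit C = X"
  "X \<in> Obj C \<Longrightarrow> Dual C X \<in> Obj C"
  by (fact unit_obj tens_obj tens_assoc tens_unit_left tens_unit_right dual_obj)+

lemma tens_typing [simp]:
  assumes "f \<in> Arr C" "g \<in> Arr C"
  shows "f \<boxtimes> g \<in> Arr C" "Dom C (f \<boxtimes> g) = Dom C f \<otimes> Dom C g" "Cod C (f \<boxtimes> g) = Cod C f \<otimes> Cod C g"
  using tens_hom[of f "Dom C f" "Cod C f" g "Dom C g" "Cod C g"] assms by (simp_all add: hom_iff)

lemma ev_typing [simp]:
  assumes "X \<in> Obj C"
  shows "Ev C X \<in> Arr C" "Dom C (Ev C X) = Dual C X \<otimes> X" "Cod C (Ev C X) = Unit C"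
  using ev_hom[OF assms] by (simp_all add: hom_iff)

lemma coev_typing [simp]:
  assumes "X \<in> Obj C"
  shows "Coev C X \<in> Arr C" "Dom C (Coev C X) = Unit C" "Cod C (Coev C X) = X \<otimes> Dual C X"
  using coev_hom[OF assms] by (simp_all add: hom_iff)

lemma tens_arr_simps [simp]:
  "\<lbrakk>f \<in> Arr C; g \<in> Arr C; h \<in> Arr C\<rbrakk> \<Longrightarrow> (f \<boxtimes> g) \<boxtimes> h = f \<boxtimes> g \<boxtimes> h"
  "f \<in> Arr C \<Longrightarrow> Id C (Unit C) \<boxtimes> f = f"
  "f \<in> Arr C \<Longrightarrow> f \<boxtimes> Id C (Unit C) = f"
  by (fact tens_arr_assoc tens_arr_unit_left tens_arr_unit_right)+

lemma tens_id_simps: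
  "\<lbrakk>X \<in> Obj C; Y \<in> Obj C\<rbrakk> \<Longrightarrow> Id C X \<boxtimes> Id C Y = Id C (X \<otimes> Y)"
  "\<lbrakk>X \<in> Obj C; Y \<in> Obj C; f \<in> Arr C\<rbrakk> \<Longrightarrow> Id C X \<boxtimes> Id C Y \<boxtimes> f = Id C (X \<otimes> Y) \<boxtimes> f"
  using tens_arr_assoc[of "Id C X" "Id C Y" f] by (simp_all add: tens_id)

lemma interchange:
  "\<lbrakk>f \<in> Arr C; g \<in> Arr C; f' \<in> Arr C; g' \<in> Arr C; Dom C f = Cod C f'; Dom C g = Cod C g'\<rbrakk>
    \<Longrightarrow> (f \<boxtimes> g) \<cdot> (f' \<boxtimes> g') = (f \<cdot> f') \<boxtimes> (g \<cdot> g')"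
  by (rule tens_comp[symmetric]; auto simp: hom_iff)

lemma whisker:
  "\<lbrakk>f \<in> Arr C; g \<in> Arr C; Dom C g = Cod C f; X \<in> Obj C\<rbrakk>
    \<Longrightarrow> Id C X \<boxtimes> (g \<cdot> f) = (Id C X \<boxtimes> g) \<cdot> (Id C X \<boxtimes> f)"
  "\<lbrakk>f \<in> Arr C; g \<in> Arr C; Dom C g = Cod C f; X \<in> Obj C\<rbrakk>
    \<Longrightarrow> (g \<cdot> f) \<boxtimes> Id C X = (g \<boxtimes> Id C X) \<cdot> (f \<boxtimes> Id C X)"
  by (simp_all add: interchange)

text \<open>Rewriting with these rules turns a string diagram into a right-nested composite of
  slices \<open>Id L \<boxtimes> f \<boxtimes> Id R\<close>; what remains to be done by hand is the exchange of slices.\<close>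

lemmas slices = tens_id_simps whisker assoc

lemma exchange:
  "\<lbrakk>f \<in> Arr C; g \<in> Arr C; Dom C f = A; Cod C f = B; Dom C g = A'; Cod C g = B'\<rbrakk>
    \<Longrightarrow> (f \<boxtimes> Id C B') \<cdot> (Id C A \<boxtimes> g) = (Id C B \<boxtimes> g) \<cdot> (f \<boxtimes> Id C A')"
  by (auto simp: interchange)

lemma tens_add:
  "\<lbrakk>f \<in> Arr C; g \<in> Arr C; h \<in> Arr C; Dom C g = Dom C f; Cod C g = Cod C f\<rbrakk>
    \<Longrightarrow> Add C f g \<boxtimes> h = Add C (f \<boxtimes> h) (g \<boxtimes> h)"
  "\<lbrakk>f \<in> Arr C; g \<in> Arr C; h \<in> Arr C; Dom C g = Dom C f; Cod C g = Cod C f\<rbrakk>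
    \<Longrightarrow> h \<boxtimes> Add C f g = Add C (h \<boxtimes> f) (h \<boxtimes> g)"
  by (rule tens_add_left tens_add_right; auto simp: hom_iff)+

lemmas tens_scale = tens_scale_left tens_scale_right

lemma tens_zero [simp]:
  assumes "X \<in> Obj C" "Y \<in> Obj C" "h \<in> Arr C"
  shows "Zero C X Y \<boxtimes> h = Zero C (X \<otimes> Dom C h) (Y \<otimes> Cod C h)"
    "h \<boxtimes> Zero C X Y = Zero C (Dom C h \<otimes> X) (Cod C h \<otimes> Y)"
  using assms tens_scale_left[of "Zero C X Y" h 0] tens_scale_right[of "Zero C X Y" h 0]
    scale_0[of "Zero C X Y \<boxtimes> h"] scale_0[of "h \<boxtimes> Zero C X Y"] by simp_all

end

section \<open>Duality and transposition\<close>

text \<open>X' is a left dual of X with arbitrary evaluation e and coevaluation c. The data are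
  parameters because there are three kinds of instances: the duals chosen in the record, their
  images under F, and an object together with a right dual, where the roles of the two are
  exchanged.\<close>

locale dual_pair = strict_tensor_category C
  for C :: "('o, 'm, 'k::field, 'x) tcat_scheme" (structure) +
  fixes X X' :: 'o and e c :: 'm
  assumes dual_pair_typing [simp]: "X \<in> Obj C" "X' \<in> Obj C" "e \<in> Arr C" "c \<in> Arr C"
      "Dom C e = X' \<otimes> X" "Cod C e = Unit C" "Dom C c = Unit C" "Cod C c = X \<otimes> X'"
    and zigzag_X: "(Id C X \<boxtimes> e) \<cdot> (c \<boxtimes> Id C X) = Id C X"
    and zigzag_X': "(e \<boxtimes> Id C X') \<cdot> (Id C X' \<boxtimes> c) = Id C X'"
begin

text \<open>This lemma and the next three give the bijections between arrows X' \<otimes> A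
  \<rightarrow> B and A \<rightarrow> X \<otimes> B, and between arrows A \<otimes> X \<rightarrow>
  B and A \<rightarrow> B \<otimes> X'. In each case the given arrow is moved past e or c, after
  which e and c meet in a zigzag.\<close>

lemma transpose_left_inv:
  assumes [simp]: "g \<in> Arr C" "Dom C g = A" "Cod C g = X \<otimes> B" "A \<in> Obj C" "B \<in> Obj C"
  shows "(Id C X \<boxtimes> ((e \<boxtimes> Id C B) \<cdot> (Id C X' \<boxtimes> g))) \<cdot> (c \<boxtimes> Id C A) = g"
proof -
  have "(Id C X \<boxtimes> ((e \<boxtimes> Id C B) \<cdot> (Id C X' \<boxtimes> g))) \<cdot> (c \<boxtimes> Id C A)
      = (Id C X \<boxtimes> e \<boxtimes> Id C B) \<cdot> ((Id C (X \<otimes> X') \<boxtimes> g) \<cdot> (c \<boxtimes> Id C A))"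
    by (simp add: slices)
  also have "(Id C (X \<otimes> X') \<boxtimes> g) \<cdot> (c \<boxtimes> Id C A) = (c \<boxtimes> Id C (X \<otimes> B)) \<cdot> g"
    using exchange[of c g "Unit C" "X \<otimes> X'" A "X \<otimes> B"] by simp
  also have "(Id C X \<boxtimes> e \<boxtimes> Id C B) \<cdot> (c \<boxtimes> Id C (X \<otimes> B)) \<cdot> g
      = (((Id C X \<boxtimes> e) \<cdot> (c \<boxtimes> Id C X)) \<boxtimes> Id C B) \<cdot> g"
    by (simp add: slices)
  finally show ?thesis by (simp add: zigzag_X slices)
qed

lemma transpose_left_inv':
  assumes [simp]: "j \<in> Arr C" "Dom C j = X' \<otimes> A" "Cod C j = B" "A \<in> Obj C" "B \<in> Obj C"
  shows "(e \<boxtimes> Id C B) \<cdot> (Id C X' \<boxtimes> ((Id C X \<boxtimes> j) \<cdot> (c \<boxtimes> Id C A))) = j"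
proof -
  have "(e \<boxtimes> Id C B) \<cdot> (Id C X' \<boxtimes> ((Id C X \<boxtimes> j) \<cdot> (c \<boxtimes> Id C A)))
      = ((e \<boxtimes> Id C B) \<cdot> (Id C (X' \<otimes> X) \<boxtimes> j)) \<cdot> (Id C X' \<boxtimes> c \<boxtimes> Id C A)"
    by (simp add: slices)
  also have "(e \<boxtimes> Id C B) \<cdot> (Id C (X' \<otimes> X) \<boxtimes> j) = j \<cdot> (e \<boxtimes> Id C (X' \<otimes> A))"
    using exchange[of e j "X' \<otimes> X" "Unit C" "X' \<otimes> A" B] by simp
  also have "(j \<cdot> (e \<boxtimes> Id C (X' \<otimes> A))) \<cdot> (Id C X' \<boxtimes> c \<boxtimes> Id C A)
      = j \<cdot> (((e \<boxtimes> Id C X') \<cdot> (Id C X' \<boxtimes> c)) \<boxtimes> Id C A)"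
    by (simp add: slices)
  finally show ?thesis by (simp add: zigzag_X' slices)
qed

lemma transpose_right_inv:
  assumes [simp]: "g \<in> Arr C" "Dom C g = A \<otimes> X" "Cod C g = B" "A \<in> Obj C" "B \<in> Obj C"
  shows "(Id C B \<boxtimes> e) \<cdot> (((g \<boxtimes> Id C X') \<cdot> (Id C A \<boxtimes> c)) \<boxtimes> Id C X) = g"
proof -
  have "(Id C B \<boxtimes> e) \<cdot> (((g \<boxtimes> Id C X') \<cdot> (Id C A \<boxtimes> c)) \<boxtimes> Id C X)
      = ((Id C B \<boxtimes> e) \<cdot> (g \<boxtimes> Id C (X' \<otimes> X))) \<cdot> (Id C A \<boxtimes> c \<boxtimes> Id C X)"
    by (simp add: slices)
  also have "(Id C B \<boxtimes> e) \<cdot> (g \<boxtimes> Id C (X' \<otimes> X)) = g \<cdot> (Id C (A \<otimes> X) \<boxtimes> e)"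
    using exchange[of g e "A \<otimes> X" B "X' \<otimes> X" "Unit C"] by simp
  also have "(g \<cdot> (Id C (A \<otimes> X) \<boxtimes> e)) \<cdot> (Id C A \<boxtimes> c \<boxtimes> Id C X)
      = g \<cdot> (Id C A \<boxtimes> ((Id C X \<boxtimes> e) \<cdot> (c \<boxtimes> Id C X)))"
    by (simp add: slices)
  finally show ?thesis by (simp add: zigzag_X slices)
qed

lemma transpose_right_inv':
  assumes [simp]: "j \<in> Arr C" "Dom C j = A" "Cod C j = B \<otimes> X'" "A \<in> Obj C" "B \<in> Obj C"
  shows "(((Id C B \<boxtimes> e) \<cdot> (j \<boxtimes> Id C X)) \<boxtimes> Id C X') \<cdot> (Id C A \<boxtimes> c) = j"
proof -
  have "(((Id C B \<boxtimes> e) \<cdot> (j \<boxtimes> Id C X)) \<boxtimes> Id C X') \<cdot> (Id C A \<boxtimes> c)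
      = (Id C B \<boxtimes> e \<boxtimes> Id C X') \<cdot> ((j \<boxtimes> Id C (X \<otimes> X')) \<cdot> (Id C A \<boxtimes> c))"
    by (simp add: slices)
  also have "(j \<boxtimes> Id C (X \<otimes> X')) \<cdot> (Id C A \<boxtimes> c) = (Id C (B \<otimes> X') \<boxtimes> c) \<cdot> j"
    using exchange[of j c A "B \<otimes> X'" "Unit C" "X \<otimes> X'"] by simp
  also have "(Id C B \<boxtimes> e \<boxtimes> Id C X') \<cdot> (Id C (B \<otimes> X') \<boxtimes> c) \<cdot> j
      = (Id C B \<boxtimes> ((e \<boxtimes> Id C X') \<cdot> (Id C X' \<boxtimes> c))) \<cdot> j"
    by (simp add: slices)
  finally show ?thesis by (simp add: zigzag_X' slices)
qed

lemma transpose_left_cancel: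
  assumes "(e \<boxtimes> Id C B) \<cdot> (Id C X' \<boxtimes> g) = (e \<boxtimes> Id C B) \<cdot> (Id C X' \<boxtimes> g')"
    and "g \<in> Arr C" "g' \<in> Arr C" "Cod C g = X \<otimes> B" "Cod C g' = X \<otimes> B"
    "Dom C g' = Dom C g" "B \<in> Obj C"
  shows "g = g'"
proof -
  have "g = (Id C X \<boxtimes> ((e \<boxtimes> Id C B) \<cdot> (Id C X' \<boxtimes> g))) \<cdot> (c \<boxtimes> Id C (Dom C g))"
    by (rule transpose_left_inv[symmetric]) (simp_all add: assms(2-))
  also have "\<dots> = g'"
    unfolding assms(1) by (rule transpose_left_inv) (simp_all add: assms(2-))
  finally show ?thesis .
qed

lemma transpose_right_cancel:
  assumes "(g \<boxtimes> Id C X') \<cdot> (Id C A \<boxtimes> c) = (g' \<boxtimes> Id C X') \<cdot> (Id C A \<boxtimes> c)"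
    and "g \<in> Arr C" "g' \<in> Arr C" "Dom C g = A \<otimes> X" "Dom C g' = A \<otimes> X"
    "Cod C g' = Cod C g" "A \<in> Obj C"
  shows "g = g'"
proof -
  have "g = (Id C (Cod C g) \<boxtimes> e) \<cdot> (((g \<boxtimes> Id C X') \<cdot> (Id C A \<boxtimes> c)) \<boxtimes> Id C X)"
    by (rule transpose_right_inv[symmetric]) (simp_all add: assms(2-))
  also have "\<dots> = g'"
    unfolding assms(1) by (rule transpose_right_inv) (simp_all add: assms(2-))
  finally show ?thesis .
qed

text \<open>\<open>X' \<otimes> -\<close> is left adjoint to \<open>X \<otimes> -\<close>, so it preserves cokernels.\<close>

lemma tens_cokernel:
  assumes "is_cokernel C p i"
  shows "is_cokernel C (Id C X' \<boxtimes> p) (Id C X' \<boxtimes> i)"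
proof -
  have [simp]: "i \<in> Arr C" "p \<in> Arr C" "Dom C p = Cod C i"
    and pi: "p \<cdot> i = Zero C (Dom C i) (Cod C p)"
    using assms by (auto simp: is_cokernel_def)
  have factor: "\<exists>!u. u \<in> Hom C (Cod C p) T \<and> u \<cdot> p = t"
    if "t \<in> Hom C (Cod C i) T" "t \<cdot> i = Zero C (Dom C i) T" for t T
    using that assms hom_obj[OF that(1)] unfolding is_cokernel_def by blast
  have ex1: "\<exists>!u. u \<in> Hom C (X' \<otimes> Cod C p) T \<and> u \<cdot> (Id C X' \<boxtimes> p) = t"
    if T: "T \<in> Obj C" and t: "t \<in> Hom C (X' \<otimes> Cod C i) T"
      and ti: "t \<cdot> (Id C X' \<boxtimes> i) = Zero C (X' \<otimes> Dom C i) T" for t T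
  proof -
    have [simp]: "T \<in> Obj C" "t \<in> Arr C" "Dom C t = X' \<otimes> Cod C i" "Cod C t = T"
      using T t by (auto simp: hom_iff)
    \<comment> \<open>The test arrow is transposed to an arrow out of the codomain of i, where the
      universal property of p applies; the factor found there is transposed back.\<close>
    define t' where "t' = (Id C X \<boxtimes> t) \<cdot> (c \<boxtimes> Id C (Cod C i))"
    have [simp]: "t' \<in> Arr C" "Dom C t' = Cod C i" "Cod C t' = X \<otimes> T" by (simp_all add: t'_def)
    have "t' \<cdot> i = (Id C X \<boxtimes> t) \<cdot> ((c \<boxtimes> Id C (Cod C i)) \<cdot> i)" by (simp add: t'_def assoc)
    also have "(c \<boxtimes> Id C (Cod C i)) \<cdot> i = (Id C (X \<otimes> X') \<boxtimes> i) \<cdot> (c \<boxtimes> Id C (Dom C i))"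
      using exchange[of c i "Unit C" "X \<otimes> X'" "Dom C i" "Cod C i"] by simp
    also have "(Id C X \<boxtimes> t) \<cdot> (Id C (X \<otimes> X') \<boxtimes> i) \<cdot> (c \<boxtimes> Id C (Dom C i))
        = (Id C X \<boxtimes> (t \<cdot> (Id C X' \<boxtimes> i))) \<cdot> (c \<boxtimes> Id C (Dom C i))"
      by (simp add: slices)
    also have "\<dots> = Zero C (Dom C i) (X \<otimes> T)" by (simp add: ti)
    finally have z: "t' \<cdot> i = Zero C (Dom C i) (X \<otimes> T)" .
    obtain u where u: "u \<in> Hom C (Cod C p) (X \<otimes> T)" "u \<cdot> p = t'"
      using factor[of t' "X \<otimes> T"] z by (auto simp: hom_iff)
    then have [simp]: "u \<in> Arr C" "Dom C u = Cod C p" "Cod C u = X \<otimes> T" by (auto simp: hom_iff)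
    have up: "((e \<boxtimes> Id C T) \<cdot> (Id C X' \<boxtimes> u)) \<cdot> (Id C X' \<boxtimes> p) = t"
    proof -
      have "((e \<boxtimes> Id C T) \<cdot> (Id C X' \<boxtimes> u)) \<cdot> (Id C X' \<boxtimes> p) = (e \<boxtimes> Id C T) \<cdot> (Id C X' \<boxtimes> (u \<cdot> p))"
        by (simp add: slices)
      then show ?thesis using transpose_left_inv'[of t "Cod C i" T] by (simp add: u t'_def)
    qed
    have uniq: "v = (e \<boxtimes> Id C T) \<cdot> (Id C X' \<boxtimes> u)"
      if "v \<in> Hom C (X' \<otimes> Cod C p) T" "v \<cdot> (Id C X' \<boxtimes> p) = t" for v
    proof -
      have [simp]: "v \<in> Arr C" "Dom C v = X' \<otimes> Cod C p" "Cod C v = T" using that by (auto simp: hom_iff)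
      define v' where "v' = (Id C X \<boxtimes> v) \<cdot> (c \<boxtimes> Id C (Cod C p))"
      have [simp]: "v' \<in> Arr C" "Dom C v' = Cod C p" "Cod C v' = X \<otimes> T" by (simp_all add: v'_def)
      have "v' \<cdot> p = (Id C X \<boxtimes> v) \<cdot> ((c \<boxtimes> Id C (Cod C p)) \<cdot> p)" by (simp add: v'_def assoc)
      also have "(c \<boxtimes> Id C (Cod C p)) \<cdot> p = (Id C (X \<otimes> X') \<boxtimes> p) \<cdot> (c \<boxtimes> Id C (Cod C i))"
        using exchange[of c p "Unit C" "X \<otimes> X'" "Cod C i" "Cod C p"] by simp
      also have "(Id C X \<boxtimes> v) \<cdot> (Id C (X \<otimes> X') \<boxtimes> p) \<cdot> (c \<boxtimes> Id C (Cod C i))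
          = (Id C X \<boxtimes> (v \<cdot> (Id C X' \<boxtimes> p))) \<cdot> (c \<boxtimes> Id C (Cod C i))"
        by (simp add: slices)
      finally have "v' \<cdot> p = t'" by (simp add: that(2) t'_def)
      moreover have "\<exists>!u. u \<in> Hom C (Cod C p) (X \<otimes> T) \<and> u \<cdot> p = t'"
        using z by (intro factor) (auto simp: hom_iff)
      moreover have "v' \<in> Hom C (Cod C p) (X \<otimes> T)" by (simp add: hom_iff)
      ultimately have "v' = u" using u by blast
      then show ?thesis using transpose_left_inv'[of v "Cod C p" T] by (simp add: v'_def)
    qed
    show ?thesis using up uniq by (intro ex1I[of _ "(e \<boxtimes> Id C T) \<cdot> (Id C X' \<boxtimes> u)"]) (auto simp: hom_iff)
  qed
  have "(Id C X' \<boxtimes> p) \<cdot> (Id C X' \<boxtimes> i) = Id C X' \<boxtimes> (p \<cdot> i)" by (simp add: whisker)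
  then have "(Id C X' \<boxtimes> p) \<cdot> (Id C X' \<boxtimes> i) = Zero C (X' \<otimes> Dom C i) (X' \<otimes> Cod C p)"
    by (simp add: pi)
  then show ?thesis
    unfolding is_cokernel_def by (simp, intro ballI impI ex1)
qed

end

context strict_tensor_category
begin

lemma dual_pair_Dual: "X \<in> Obj C \<Longrightarrow> dual_pair C X (Dual C X) (Ev C X) (Coev C X)"
  by unfold_locales (simp_all add: zigzag zigzag_dual)

text \<open>A right dual Y of V has V as its left dual, so V \<otimes> - is left adjoint to Y
  \<otimes> - and preserves cokernels.\<close>

lemma tens_cokernel_left:
  assumes "V \<in> Obj C" "is_cokernel C p i"
  shows "is_cokernel C (Id C V \<boxtimes> p) (Id C V \<boxtimes> i)"
proof -
  obtain Y e c where Y: "Y \<in> Obj C" "e \<in> Hom C (V \<otimes> Y) (Unit C)" "c \<in> Hom C (Unit C) (Y \<otimes> V)"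
    "(e \<boxtimes> Id C V) \<cdot> (Id C V \<boxtimes> c) = Id C V" "(Id C Y \<boxtimes> e) \<cdot> (c \<boxtimes> Id C Y) = Id C Y"
    using right_dual[OF assms(1)] by blast
  then interpret dual_pair C Y V e c
    using assms(1) by unfold_locales (auto simp: hom_iff)
  show ?thesis by (rule tens_cokernel[OF assms(2)])
qed

lemma dual_map_typing [simp]:
  assumes "f \<in> Arr C"
  shows "dual_map C f \<in> Arr C" "Dom C (dual_map C f) = Dual C (Cod C f)"
    "Cod C (dual_map C f) = Dual C (Dom C f)"
  using assms by (simp_all add: dual_map_def Let_def)

lemma dual_tensor_typing [simp]:
  assumes "X \<in> Obj C" "Y \<in> Obj C"
  shows "dual_tensor C X Y \<in> Arr C" "Dom C (dual_tensor C X Y) = Dual C Y \<otimes> Dual C X"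
    "Cod C (dual_tensor C X Y) = Dual C (X \<otimes> Y)"
  using assms by (simp_all add: dual_tensor_def Let_def)

text \<open>\<open>dual_map\<close> is the right transpose of the right-hand side, and evaluating
  against X undoes the transposition.\<close>

lemma ev_dual_map:
  assumes [simp]: "f \<in> Arr C" "Dom C f = X" "Cod C f = Y"
  shows "Ev C X \<cdot> (dual_map C f \<boxtimes> Id C X) = Ev C Y \<cdot> (Id C (Dual C Y) \<boxtimes> f)"
proof -
  have [simp]: "X \<in> Obj C" "Y \<in> Obj C" using arr_obj[of f] by simp_all
  interpret X: dual_pair C X "Dual C X" "Ev C X" "Coev C X" by (rule dual_pair_Dual) simp
  have 1: "dual_map C f = ((Ev C Y \<cdot> (Id C (Dual C Y) \<boxtimes> f)) \<boxtimes> Id C (Dual C X)) \<cdot> (Id C (Dual C Y) \<boxtimes> Coev C X)"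
    by (simp add: dual_map_def Let_def slices)
  show ?thesis
    unfolding 1 using X.transpose_right_inv[of "Ev C Y \<cdot> (Id C (Dual C Y) \<boxtimes> f)" "Dual C Y" "Unit C"]
    by simp
qed

text \<open>\<open>dual_tensor\<close> is the right transpose of the nested evaluation with respect
  to the duality of X \<otimes> Y; evaluation undoes it.\<close>

lemma ev_dual_tensor:
  assumes [simp]: "X \<in> Obj C" "Y \<in> Obj C"
  shows "Ev C (X \<otimes> Y) \<cdot> (dual_tensor C X Y \<boxtimes> Id C (X \<otimes> Y))
    = Ev C Y \<cdot> (Id C (Dual C Y) \<boxtimes> Ev C X \<boxtimes> Id C Y)"
proof -
  interpret XY: dual_pair C "X \<otimes> Y" "Dual C (X \<otimes> Y)" "Ev C (X \<otimes> Y)" "Coev C (X \<otimes> Y)"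
    by (rule dual_pair_Dual) simp
  show ?thesis
    using XY.transpose_right_inv[of "Ev C Y \<cdot> (Id C (Dual C Y) \<boxtimes> Ev C X \<boxtimes> Id C Y)" "Dual C Y \<otimes> Dual C X" "Unit C"]
    by (simp add: dual_tensor_def Let_def)
qed

end

section \<open>A generator of a finite category\<close>

text \<open>Linear combinations are built by adding one scaled element at a time, so that properties
  closed under addition and scaling pass from S to its span by induction, without indexed
  sums.\<close>

inductive_set hom_span :: "('o, 'm, 'k, 'x) lincat_scheme \<Rightarrow> 'o \<Rightarrow> 'o \<Rightarrow> 'm set \<Rightarrow> 'm set"
  for C :: "('o, 'm, 'k, 'x) lincat_scheme" and X Y :: 'o and S :: "'m set" where
  zero: "Zero C X Y \<in> hom_span C X Y S"
| add: "\<lbrakk>s \<in> S; h \<in> hom_span C X Y S\<rbrakk> \<Longrightarrow> Add C (Scale C c s) h \<in> hom_span C X Y S"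

definition jointly_epi :: "('o, 'm, 'k, 'x) lincat_scheme \<Rightarrow> 'o \<Rightarrow> 'm set \<Rightarrow> bool" where
  "jointly_epi C X S \<longleftrightarrow> (\<forall>T\<in>Obj C. \<forall>u\<in>Hom C X T. \<forall>v\<in>Hom C X T.
     (\<forall>p\<in>S. Comp C u p = Comp C v p) \<longrightarrow> u = v)"

text \<open>These are the properties of the regular module that pass through a linear equivalence
  and from which coends are built: finitely many arrows from P span all of them, and the same arrows
  are jointly epimorphic.\<close>

definition finite_generator :: "('o, 'm, 'k, 'x) lincat_scheme \<Rightarrow> 'o \<Rightarrow> bool" where
  "finite_generator C P \<longleftrightarrow> P \<in> Obj C \<and>
     (\<forall>X\<in>Obj C. \<exists>S. finite S \<and> S \<subseteq> Hom C P X \<and> Hom C P X \<subseteq> hom_span C P X S \<and> jointly_epi C X S)"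

section \<open>Matrices of linear maps between coordinate spaces\<close>

definition linear_mat :: "nat \<Rightarrow> nat \<Rightarrow> ('k::field vec \<Rightarrow> 'k vec) \<Rightarrow> 'k mat" where
  "linear_mat d n L = mat d n (\<lambda>(i, j). L (unit_vec n j) $ i)"

definition linear_vec_map :: "nat \<Rightarrow> nat \<Rightarrow> ('k::field vec \<Rightarrow> 'k vec) \<Rightarrow> bool" where
  "linear_vec_map d n L \<longleftrightarrow> (\<forall>a\<in>carrier_vec n. L a \<in> carrier_vec d) \<and>
     (\<forall>a\<in>carrier_vec n. \<forall>b\<in>carrier_vec n. L (a + b) = L a + L b) \<and>
     (\<forall>a\<in>carrier_vec n. \<forall>s. L (s \<cdot>\<^sub>v a) = s \<cdot>\<^sub>v L a)"

text \<open>Truncation allows induction along the coordinates of a vector.\<close>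

definition trunc_vec :: "'k::field vec \<Rightarrow> nat \<Rightarrow> 'k vec" where
  "trunc_vec a k = vec (dim_vec a) (\<lambda>i. if i < k then a $ i else 0)"

lemma trunc_vec_0: "trunc_vec a 0 = 0\<^sub>v (dim_vec a)"
  by (auto simp: trunc_vec_def)

lemma trunc_vec_Suc: "trunc_vec a (Suc k) = a $ k \<cdot>\<^sub>v unit_vec (dim_vec a) k + trunc_vec a k"
  by (intro eq_vecI) (auto simp: trunc_vec_def less_Suc_eq unit_vec_def)

lemma trunc_vec_dim: "trunc_vec a (dim_vec a) = a"
  by (auto simp: trunc_vec_def)

lemma trunc_vec_carrier [simp]: "a \<in> carrier_vec n \<Longrightarrow> trunc_vec a k \<in> carrier_vec n"
  by (auto simp: trunc_vec_def)

lemma linear_mat_carrier [simp]: "linear_mat d n L \<in> carrier_mat d n"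
  by (simp add: linear_mat_def)

text \<open>The vector is assembled from 0 by adding one coordinate multiple of a unit vector at a
  time; each entry of its image then accumulates the sum that defines the matrix product.\<close>

lemma linear_mat_mult_vec:
  assumes L: "linear_vec_map d n L" and a: "a \<in> carrier_vec n"
  shows "linear_mat d n L *\<^sub>v a = L a"
proof -
  have La: "L b \<in> carrier_vec d" if "b \<in> carrier_vec n" for b using L that by (simp add: linear_vec_map_def)
  have dim: "dim_vec a = n" using a by simp
  have "L (0\<^sub>v n) = L (0 \<cdot>\<^sub>v 0\<^sub>v n)" by (rule arg_cong[of _ _ L]) auto
  also have "\<dots> = 0 \<cdot>\<^sub>v L (0\<^sub>v n)" using L unfolding linear_vec_map_def by (metis zero_carrier_vec)
  also have "\<dots> = 0\<^sub>v d" using La[of "0\<^sub>v n"] by (intro eq_vecI) auto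
  finally have L0: "L (0\<^sub>v n) = 0\<^sub>v d" .
  have tr: "L (trunc_vec a k) $ i = (\<Sum>j = 0..<k. L (unit_vec n j) $ i * a $ j)" if "i < d" "k \<le> n" for i k
    using that(2)
  proof (induction k)
    case 0
    then show ?case using that L0 by (simp add: trunc_vec_0 dim)
  next
    case (Suc k)
    have "L (trunc_vec a (Suc k)) = L (a $ k \<cdot>\<^sub>v unit_vec n k) + L (trunc_vec a k)"
      using L a unfolding linear_vec_map_def trunc_vec_Suc dim
      by (metis smult_carrier_vec unit_vec_carrier trunc_vec_carrier)
    also have "L (a $ k \<cdot>\<^sub>v unit_vec n k) = a $ k \<cdot>\<^sub>v L (unit_vec n k)"
      using L unfolding linear_vec_map_def by (metis unit_vec_carrier)
    finally show ?case
      using Suc that La[of "unit_vec n k"] La[of "trunc_vec a k"] a by (simp add: add.commute mult.commute)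
  qed
  show ?thesis
  proof (rule eq_vecI)
    show "dim_vec (linear_mat d n L *\<^sub>v a) = dim_vec (L a)" using La[OF a] by (simp add: linear_mat_def)
    fix i assume "i < dim_vec (L a)"
    then have i: "i < d" using La[OF a] by simp
    then have "(linear_mat d n L *\<^sub>v a) $ i = (\<Sum>j = 0..<n. L (unit_vec n j) $ i * a $ j)"
      using a by (simp add: linear_mat_def scalar_prod_def)
    also have "\<dots> = L a $ i" using tr[OF i, of n] by (metis dim order_refl trunc_vec_dim)
    finally show "(linear_mat d n L *\<^sub>v a) $ i = L a $ i" .
  qed
qed

lemma smult_mat_mult_vec:
  assumes "A \<in> carrier_mat d n" "a \<in> carrier_vec n"
  shows "(s \<cdot>\<^sub>m A) *\<^sub>v a = s \<cdot>\<^sub>v (A *\<^sub>v (a :: 'k::field vec))"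
  using assms by (intro eq_vecI) (auto simp: scalar_prod_def sum_distrib_left mult.assoc)

lemma mat_mult_unit_vec:
  assumes "A \<in> carrier_mat d n" "j < n"
  shows "A *\<^sub>v unit_vec n j = col (A :: 'k::field mat) j"
  using assms by (intro eq_vecI) auto

lemma mat_eq_by_vec:
  assumes A: "A \<in> carrier_mat d n" and B: "B \<in> carrier_mat d n"
    and eq: "\<And>a. a \<in> carrier_vec n \<Longrightarrow> A *\<^sub>v a = B *\<^sub>v (a :: 'k::field vec)"
  shows "A = B"
proof (rule eq_matI)
  fix i j assume ij: "i < dim_row B" "j < dim_col B"
  then have "col A j = col B j"
    using eq[of "unit_vec n j"] A B by (simp add: mat_mult_unit_vec)
  then show "A $$ (i, j) = B $$ (i, j)" using ij A B by (metis carrier_matD index_col)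
qed (use A B in auto)

section \<open>The regular module as a generator of the module category\<close>

context
  fixes n :: nat and mul :: "'k::field vec \<Rightarrow> 'k vec \<Rightarrow> 'k vec" and e :: "'k vec"
  assumes alg: "fd_algebra n mul e"
begin

text \<open>The left regular representation. The action is restricted to
  \<open>carrier_vec n\<close> because \<open>fd_module\<close> requires actions to be
  extensional.\<close>

definition regular :: "nat \<times> ('k vec \<Rightarrow> 'k mat)" where
  "regular = (n, \<lambda>a\<in>carrier_vec n. linear_mat n n (mul a))"

lemma algD:
  "e \<in> carrier_vec n"
  "a \<in> carrier_vec n \<Longrightarrow> mul e a = a" "a \<in> carrier_vec n \<Longrightarrow> mul a e = a"
  "\<lbrakk>a \<in> carrier_vec n; b \<in> carrier_vec n\<rbrakk> \<Longrightarrow> mul a b \<in> carrier_vec n"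
  "\<lbrakk>a \<in> carrier_vec n; b \<in> carrier_vec n; c \<in> carrier_vec n\<rbrakk> \<Longrightarrow> mul (mul a b) c = mul a (mul b c)"
  "\<lbrakk>a \<in> carrier_vec n; b \<in> carrier_vec n; c \<in> carrier_vec n\<rbrakk> \<Longrightarrow> mul (a + b) c = mul a c + mul b c"
  "\<lbrakk>a \<in> carrier_vec n; b \<in> carrier_vec n; c \<in> carrier_vec n\<rbrakk> \<Longrightarrow> mul a (b + c) = mul a b + mul a c"
  "\<lbrakk>a \<in> carrier_vec n; b \<in> carrier_vec n\<rbrakk> \<Longrightarrow> mul (s \<cdot>\<^sub>v a) b = s \<cdot>\<^sub>v mul a b"
  "\<lbrakk>a \<in> carrier_vec n; b \<in> carrier_vec n\<rbrakk> \<Longrightarrow> mul a (s \<cdot>\<^sub>v b) = s \<cdot>\<^sub>v mul a b"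
  using alg unfolding fd_algebra_def by blast+

lemma regular_act:
  assumes "a \<in> carrier_vec n" "b \<in> carrier_vec n"
  shows "linear_mat n n (mul a) *\<^sub>v b = mul a b"
  by (rule linear_mat_mult_vec) (use assms in \<open>auto simp: linear_vec_map_def algD\<close>)

lemma regular_module: "fd_module n mul e regular"
  unfolding fd_module_def regular_def prod.case
proof (intro conjI ballI allI)
  show "(\<lambda>a\<in>carrier_vec n. linear_mat n n (mul a)) \<in> carrier_vec n \<rightarrow>\<^sub>E carrier_mat n n" by auto
  show "(\<lambda>a\<in>carrier_vec n. linear_mat n n (mul a)) e = 1\<^sub>m n"
    by (simp add: algD) (rule mat_eq_by_vec[where d = n and n = n]; simp add: regular_act algD)
  fix a b :: "'k vec" and s assume ab: "a \<in> carrier_vec n"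
  show "(\<lambda>a\<in>carrier_vec n. linear_mat n n (mul a)) (s \<cdot>\<^sub>v a) = s \<cdot>\<^sub>m (\<lambda>a\<in>carrier_vec n. linear_mat n n (mul a)) a"
    using ab by simp (rule mat_eq_by_vec[where d = n and n = n];
      simp add: regular_act algD smult_mat_mult_vec[where d = n and n = n])
  assume b: "b \<in> carrier_vec n"
  show "(\<lambda>a\<in>carrier_vec n. linear_mat n n (mul a)) (mul a b) =
      (\<lambda>a\<in>carrier_vec n. linear_mat n n (mul a)) a * (\<lambda>a\<in>carrier_vec n. linear_mat n n (mul a)) b"
    using ab b assoc_mult_mat_vec[OF linear_mat_carrier[of n n "mul a"] linear_mat_carrier[of n n "mul b"]]
    by (simp add: algD)
      (rule mat_eq_by_vec[OF linear_mat_carrier mult_carrier_mat[OF linear_mat_carrier linear_mat_carrier]];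
        simp add: regular_act algD)
  show "(\<lambda>a\<in>carrier_vec n. linear_mat n n (mul a)) (a + b) =
      (\<lambda>a\<in>carrier_vec n. linear_mat n n (mul a)) a + (\<lambda>a\<in>carrier_vec n. linear_mat n n (mul a)) b"
    using ab b by (simp add: algD) (rule mat_eq_by_vec[where d = n and n = n];
      simp add: regular_act algD add_mult_distrib_mat_vec[where nr = n and nc = n])
qed

context
  fixes N :: "nat \<times> ('k vec \<Rightarrow> 'k mat)" and d act
  assumes N: "fd_module n mul e N" and N_eq: "N = (d, act)"
begin

lemma moduleD:
  "a \<in> carrier_vec n \<Longrightarrow> act a \<in> carrier_mat d d" "act e = 1\<^sub>m d"
  "\<lbrakk>a \<in> carrier_vec n; b \<in> carrier_vec n\<rbrakk> \<Longrightarrow> act (mul a b) = act a * act b"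
  "\<lbrakk>a \<in> carrier_vec n; b \<in> carrier_vec n\<rbrakk> \<Longrightarrow> act (a + b) = act a + act b"
  "a \<in> carrier_vec n \<Longrightarrow> act (s \<cdot>\<^sub>v a) = s \<cdot>\<^sub>m act a"
  using N unfolding N_eq fd_module_def by auto

text \<open>The matrix of the module map a \<mapsto> a v, that is, of the arrow from the regular
  module to N that sends e to v. The lemmas below identify the vectors of N with the arrows from the
  regular module to N in this way.\<close>

definition orbit :: "'k vec \<Rightarrow> 'k mat" where
  "orbit v = linear_mat d n (\<lambda>a. act a *\<^sub>v v)"

lemma orbit_carrier [simp]: "orbit v \<in> carrier_mat d n"
  by (simp add: orbit_def)

lemma orbit_mult_vec:
  assumes v: "v \<in> carrier_vec d" and a: "a \<in> carrier_vec n"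
  shows "orbit v *\<^sub>v a = act a *\<^sub>v v"
  unfolding orbit_def
proof (rule linear_mat_mult_vec[OF _ a])
  show "linear_vec_map d n (\<lambda>a. act a *\<^sub>v v)"
    using v moduleD(1) by (auto simp: linear_vec_map_def moduleD(4,5)
        smult_mat_mult_vec[where n = d and d = d] mult_mat_vec_carrier[where nr = d and n = d] add_mult_distrib_mat_vec[where nr = d and nc = d])
qed

lemma orbit_hom:
  assumes v: "v \<in> carrier_vec d"
  shows "(regular, N, orbit v) \<in> Hom (fd_modules n mul e) regular N"
proof -
  have "orbit v * linear_mat n n (mul a) = act a * orbit v" if a: "a \<in> carrier_vec n" for a
  proof (rule mat_eq_by_vec[where d = d and n = n])
    fix b :: "'k vec" assume b: "b \<in> carrier_vec n"
    have "(orbit v * linear_mat n n (mul a)) *\<^sub>v b = orbit v *\<^sub>v (linear_mat n n (mul a) *\<^sub>v b)"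
      by (rule assoc_mult_mat_vec[OF orbit_carrier linear_mat_carrier b])
    also have "\<dots> = (act a * act b) *\<^sub>v v"
      using a b v by (simp add: regular_act orbit_mult_vec algD moduleD)
    also have "\<dots> = act a *\<^sub>v (act b *\<^sub>v v)"
      by (rule assoc_mult_mat_vec[OF moduleD(1)[OF a] moduleD(1)[OF b] v])
    also have "\<dots> = (act a * orbit v) *\<^sub>v b"
      using orbit_mult_vec[OF v b] assoc_mult_mat_vec[OF moduleD(1)[OF a] orbit_carrier b] by simp
    finally show "(orbit v * linear_mat n n (mul a)) *\<^sub>v b = (act a * orbit v) *\<^sub>v b" .
  qed (use mult_carrier_mat[OF orbit_carrier linear_mat_carrier] mult_carrier_mat[OF moduleD(1)[OF a] orbit_carrier] in auto)
  then show ?thesis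
    using N regular_module by (simp add: hom_iff fd_modules_def regular_def N_eq)
qed

text \<open>A module map B is determined by its value at the unit: B a = B (a e) = a (B e).\<close>

lemma orbit_onto:
  assumes f: "f \<in> Hom (fd_modules n mul e) regular N"
  shows "\<exists>v\<in>carrier_vec d. f = (regular, N, orbit v)"
proof -
  obtain B where B: "f = (regular, N, B)" "B \<in> carrier_mat d n"
    "\<And>a. a \<in> carrier_vec n \<Longrightarrow> B * linear_mat n n (mul a) = act a * B"
    using f by (auto simp: hom_iff fd_modules_def regular_def N_eq)
  have v: "B *\<^sub>v e \<in> carrier_vec d" using B(2) algD(1) by simp
  have "B = orbit (B *\<^sub>v e)"
  proof (rule mat_eq_by_vec[OF B(2) orbit_carrier])
    fix a :: "'k vec" assume a: "a \<in> carrier_vec n"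
    have "B *\<^sub>v a = B *\<^sub>v (linear_mat n n (mul a) *\<^sub>v e)" using a by (simp add: regular_act algD)
    also have "\<dots> = (act a * B) *\<^sub>v e"
      using assoc_mult_mat_vec[OF B(2) linear_mat_carrier algD(1), of "mul a"] B(3)[OF a] by simp
    also have "\<dots> = act a *\<^sub>v (B *\<^sub>v e)" by (rule assoc_mult_mat_vec[OF moduleD(1)[OF a] B(2) algD(1)])
    finally show "B *\<^sub>v a = orbit (B *\<^sub>v e) *\<^sub>v a" using orbit_mult_vec[OF v a] by simp
  qed
  with v B(1) show ?thesis by blast
qed

lemma orbit_lin:
  assumes "u \<in> carrier_vec d" "v \<in> carrier_vec d"
  shows "orbit (s \<cdot>\<^sub>v u + v) = s \<cdot>\<^sub>m orbit u + orbit v"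
proof (rule mat_eq_by_vec[where d = d and n = n])
  fix a :: "'k vec" assume a: "a \<in> carrier_vec n"
  have "orbit (s \<cdot>\<^sub>v u + v) *\<^sub>v a = act a *\<^sub>v (s \<cdot>\<^sub>v u + v)" using assms a by (simp add: orbit_mult_vec)
  also have "\<dots> = s \<cdot>\<^sub>v (act a *\<^sub>v u) + act a *\<^sub>v v"
    using assms moduleD(1)[OF a] by (simp add: mult_add_distrib_mat_vec[where nr = d and nc = d] mult_mat_vec[where nr = d and nc = d])
  also have "\<dots> = (s \<cdot>\<^sub>m orbit u + orbit v) *\<^sub>v a"
    using assms a by (simp add: orbit_mult_vec smult_mat_mult_vec[where d = d and n = n]
      add_mult_distrib_mat_vec[where nr = d and nc = n])
  finally show "orbit (s \<cdot>\<^sub>v u + v) *\<^sub>v a = (s \<cdot>\<^sub>m orbit u + orbit v) *\<^sub>v a" .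
qed auto

text \<open>The coefficients are the coordinates of v. Passing from one truncation of v to the next
  adds a single scaled basis orbit, which is the shape of the rule
  \<open>hom_span.add\<close>.\<close>

lemma orbit_span:
  assumes v: "v \<in> carrier_vec d"
  shows "(regular, N, orbit v) \<in> hom_span (fd_modules n mul e) regular N
    ((\<lambda>i. (regular, N, orbit (unit_vec d i))) ` {..<d})" (is "_ \<in> hom_span ?M _ _ ?S")
proof -
  have "(regular, N, orbit (trunc_vec v k)) \<in> hom_span ?M regular N ?S" if "k \<le> d" for k
    using that
  proof (induction k)
    case 0
    have "orbit (0\<^sub>v d) = 0\<^sub>m d n"
    proof (rule mat_eq_by_vec[where d = d and n = n])
      show "orbit (0\<^sub>v d) *\<^sub>v a = 0\<^sub>m d n *\<^sub>v a" if "a \<in> carrier_vec n" for a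
        using that moduleD(1)[OF that] by (intro eq_vecI) (auto simp: orbit_mult_vec)
    qed auto
    then show ?case
      using hom_span.zero[of ?M regular N ?S] v
      by (simp add: trunc_vec_0 fd_modules_def regular_def N_eq)
  next
    case (Suc k)
    then have "Add ?M (Scale ?M (v $ k) (regular, N, orbit (unit_vec d k))) (regular, N, orbit (trunc_vec v k))
        \<in> hom_span ?M regular N ?S"
      by (intro hom_span.add) auto
    then show ?case
      using v by (simp add: trunc_vec_Suc orbit_lin fd_modules_def)
  qed
  from this[of d] v show ?thesis using trunc_vec_dim[of v] by simp
qed

text \<open>The orbit map of the j-th unit vector sends e to that vector, so arrows that agree after
  all these maps have the same columns.\<close>

lemma orbit_epi:
  "jointly_epi (fd_modules n mul e) N ((\<lambda>i. (regular, N, orbit (unit_vec d i))) ` {..<d})"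
  unfolding jointly_epi_def
proof (intro ballI impI)
  let ?M = "fd_modules n mul e"
  fix T u v
  assume T: "T \<in> Obj ?M" and u: "u \<in> Hom ?M N T" and v: "v \<in> Hom ?M N T"
    and eq: "\<forall>p\<in>(\<lambda>i. (regular, N, orbit (unit_vec d i))) ` {..<d}. Comp ?M u p = Comp ?M v p"
  obtain A where A: "u = (N, T, A)" "A \<in> carrier_mat (fst T) d"
    using u by (auto simp: hom_iff fd_modules_def N_eq)
  obtain B where B: "v = (N, T, B)" "B \<in> carrier_mat (fst T) d"
    using v by (auto simp: hom_iff fd_modules_def N_eq)
  have "A = B"
  proof (rule eq_matI)
    fix i j assume "i < dim_row B" "j < dim_col B"
    then have ij: "i < fst T" "j < d" using B by auto
    have unit: "orbit (unit_vec d j) *\<^sub>v e = unit_vec d j"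
      using orbit_mult_vec[OF unit_vec_carrier algD(1)] by (simp add: moduleD)
    have "A * orbit (unit_vec d j) = B * orbit (unit_vec d j)"
      using eq ij A B by (auto simp: fd_modules_def)
    then have "A *\<^sub>v (orbit (unit_vec d j) *\<^sub>v e) = B *\<^sub>v (orbit (unit_vec d j) *\<^sub>v e)"
      using assoc_mult_mat_vec[OF A(2) orbit_carrier algD(1)] assoc_mult_mat_vec[OF B(2) orbit_carrier algD(1)]
      by metis
    then have "col A j = col B j" using ij by (simp add: unit mat_mult_unit_vec[OF A(2)] mat_mult_unit_vec[OF B(2)])
    then show "A $$ (i, j) = B $$ (i, j)" using ij A B by (metis carrier_matD index_col)
  qed (use A B in auto)
  then show "u = v" using A B by simp
qed

end

lemma regular_generator: "finite_generator (fd_modules n mul e) regular"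
  unfolding finite_generator_def
proof (intro conjI ballI)
  let ?M = "fd_modules n mul e"
  show "regular \<in> Obj ?M" using regular_module by (simp add: fd_modules_def)
  fix N assume "N \<in> Obj ?M"
  then have N: "fd_module n mul e N" by (simp add: fd_modules_def)
  obtain d act where N_eq: "N = (d, act)" by (cases N)
  let ?S = "(\<lambda>i. (regular, N, orbit d act (unit_vec d i))) ` {..<d}"
  have "?S \<subseteq> Hom ?M regular N" using orbit_hom[OF N N_eq] by auto
  moreover have "Hom ?M regular N \<subseteq> hom_span ?M regular N ?S"
    using orbit_onto[OF N N_eq] orbit_span[OF N N_eq] by blast
  ultimately show "\<exists>S. finite S \<and> S \<subseteq> Hom ?M regular N \<and> Hom ?M regular N \<subseteq> hom_span ?M regular N S \<and> jointly_epi ?M N S"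
    using orbit_epi[OF N N_eq] by (intro exI[of _ ?S]) simp
qed

end

section \<open>Transport of a generator along a linear equivalence\<close>

lemma (in linear_category) isoE:
  assumes "is_iso C a"
  obtains b where "a \<in> Arr C" "b \<in> Arr C" "Dom C b = Cod C a" "Cod C b = Dom C a"
    "b \<cdot> a = Id C (Dom C a)" "a \<cdot> b = Id C (Cod C a)"
  using assms unfolding is_iso_def by (auto simp: hom_iff)

lemma (in linear_category) iso_cancel:
  assumes "is_iso C a"
  shows "\<lbrakk>a \<cdot> f = a \<cdot> g; f \<in> Arr C; g \<in> Arr C; Cod C f = Dom C a; Cod C g = Dom C a\<rbrakk> \<Longrightarrow> f = g"
    and "\<lbrakk>f \<cdot> a = g \<cdot> a; f \<in> Arr C; g \<in> Arr C; Dom C f = Cod C a; Dom C g = Cod C a\<rbrakk> \<Longrightarrow> f = g"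
proof -
  obtain b where b: "a \<in> Arr C" "b \<in> Arr C" "Dom C b = Cod C a" "Cod C b = Dom C a"
    "b \<cdot> a = Id C (Dom C a)" "a \<cdot> b = Id C (Cod C a)" using isoE[OF assms] by metis
  show "f = g" if eq: "a \<cdot> f = a \<cdot> g" and t: "f \<in> Arr C" "g \<in> Arr C" "Cod C f = Dom C a" "Cod C g = Dom C a"
  proof -
    have "f = b \<cdot> a \<cdot> f" using b t assoc[of f a b] by simp
    also have "\<dots> = g" unfolding eq using b t assoc[of g a b] by simp
    finally show ?thesis .
  qed
  show "f = g" if eq: "f \<cdot> a = g \<cdot> a" and t: "f \<in> Arr C" "g \<in> Arr C" "Dom C f = Cod C a" "Dom C g = Cod C a"
  proof -
    have "f = (f \<cdot> a) \<cdot> b" using b t assoc[of b a f] by simp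
    also have "\<dots> = g" unfolding eq using b t assoc[of b a g] by simp
    finally show ?thesis .
  qed
qed

lemma (in linear_functor) map_typing [simp]:
  "X \<in> Obj C \<Longrightarrow> FO F X \<in> Obj D"
  "f \<in> Arr C \<Longrightarrow> FA F f \<in> Arr D" "f \<in> Arr C \<Longrightarrow> Dom D (FA F f) = FO F (Dom C f)"
  "f \<in> Arr C \<Longrightarrow> Cod D (FA F f) = FO F (Cod C f)"
  using obj_map hom_map[of f "Dom C f" "Cod C f"] by (simp_all add: hom_iff)

lemma (in linear_functor) map_comp:
  "\<lbrakk>f \<in> Arr C; g \<in> Arr C; Dom C g = Cod C f\<rbrakk> \<Longrightarrow> FA F (Comp C g f) = Comp D (FA F g) (FA F f)"
  using comp_map[of f "Dom C f" "Cod C f" g "Cod C g"] by (simp add: hom_iff)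

lemma (in linear_functor) map_add:
  "\<lbrakk>f \<in> Arr C; g \<in> Arr C; Dom C g = Dom C f; Cod C g = Cod C f\<rbrakk>
    \<Longrightarrow> FA F (Add C f g) = Add D (FA F f) (FA F g)"
  using add_map[of f "Dom C f" "Cod C f" g] by (simp add: hom_iff)

lemma (in linear_functor) map_scale: "f \<in> Arr C \<Longrightarrow> FA F (Scale C c f) = Scale D c (FA F f)"
  using scale_map[of f "Dom C f" "Cod C f"] by (simp add: hom_iff)

lemma (in linear_functor) map_zero:
  assumes "X \<in> Obj C" "Y \<in> Obj C"
  shows "FA F (Zero C X Y) = Zero D (FO F X) (FO F Y)"
  using map_scale[of "Zero C X Y" 0] assms by simp

text \<open>Naturality of the isomorphism t from G F to the identity gives f t = t G(F(f)), and t
  can be cancelled; hence F(f) determines f.\<close>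

lemma faithful_of_retraction:
  assumes F: "linear_functor C D F" and G: "linear_functor D C G"
    and iso: "naturally_isomorphic C C (comp_functor G F) id_functor"
    and eq: "FA F f = FA F g" and fg: "f \<in> Hom C X Y" "g \<in> Hom C X Y"
  shows "f = g"
proof -
  interpret F: linear_functor C D F by fact
  obtain t where t: "\<And>X. X \<in> Obj C \<Longrightarrow> t X \<in> Hom C (FO G (FO F X)) X \<and> is_iso C (t X)"
    "\<And>f. f \<in> Arr C \<Longrightarrow> Comp C (t (Cod C f)) (FA G (FA F f)) = Comp C f (t (Dom C f))"
    using iso unfolding naturally_isomorphic_def comp_functor_def id_functor_def by auto
  have X: "X \<in> Obj C" using F.source.hom_obj[OF fg(1)] by simp
  have "Comp C f (t X) = Comp C g (t X)"
    using t(2)[of f] t(2)[of g] eq fg by (simp add: hom_iff)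
  then show ?thesis
    using F.source.iso_cancel(2)[of "t X" f g] t(1)[OF X] fg by (auto simp: hom_iff)
qed

text \<open>The arrows p : A \<rightarrow> F(X) correspond to the arrows G(A) \<rightarrow> X by p
  \<mapsto> t G(p), with t : G F(X) \<rightarrow> X the given isomorphism. This assignment is
  linear, and it is onto because G is full. Joint epimorphy is carried over by faithfulness of F and
  G.\<close>

lemma finite_generator_equivalent:
  assumes F: "linear_functor C M F" and G: "linear_functor M C G"
    and GF: "naturally_isomorphic C C (comp_functor G F) id_functor"
    and FG: "naturally_isomorphic M M (comp_functor F G) id_functor"
    and A: "finite_generator M A"
  shows "finite_generator C (FO G A)"
proof -
  interpret F: linear_functor C M F by fact
  interpret G: linear_functor M C G by fact
  obtain t where t: "\<And>X. X \<in> Obj C \<Longrightarrow> t X \<in> Hom C (FO G (FO F X)) X \<and> is_iso C (t X)"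
    "\<And>f. f \<in> Arr C \<Longrightarrow> Comp C (t (Cod C f)) (FA G (FA F f)) = Comp C f (t (Dom C f))"
    using GF unfolding naturally_isomorphic_def comp_functor_def id_functor_def by auto
  obtain s where s: "\<And>X. X \<in> Obj M \<Longrightarrow> s X \<in> Hom M (FO F (FO G X)) X \<and> is_iso M (s X)"
    "\<And>f. f \<in> Arr M \<Longrightarrow> Comp M (s (Cod M f)) (FA F (FA G f)) = Comp M f (s (Dom M f))"
    using FG unfolding naturally_isomorphic_def comp_functor_def id_functor_def by auto
  note faithF = faithful_of_retraction[OF F G GF] and faithG = faithful_of_retraction[OF G F FG]
  have AO: "A \<in> Obj M" using A by (simp add: finite_generator_def)
  have full: "\<exists>q\<in>Hom M A N. FA G q = g" if N: "N \<in> Obj M" and g: "g \<in> Hom C (FO G A) (FO G N)" for g N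
  proof -
    obtain r where r: "r \<in> Arr M" "Dom M r = Cod M (s A)" "Cod M r = Dom M (s A)"
      "Comp M r (s A) = Id M (Dom M (s A))"
      using F.target.isoE[of "s A"] s(1)[OF AO] by metis
    \<comment> \<open>The preimage of g under G is F(g) conjugated by the isomorphism s from F G to
      the identity, with r the inverse of s at A. That G maps it to g is checked after applying the
      faithful functor F.\<close>
    let ?q = "Comp M (s N) (Comp M (FA F g) r)"
    have ty [simp]: "s A \<in> Arr M" "Dom M (s A) = FO F (FO G A)" "Cod M (s A) = A"
       "s N \<in> Arr M" "Dom M (s N) = FO F (FO G N)" "Cod M (s N) = N" "g \<in> Arr C"
       "Dom C g = FO G A" "Cod C g = FO G N" "r \<in> Arr M"
      using s(1)[OF AO] s(1)[OF N] g r(1) by (auto simp: hom_iff)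
    have q: "?q \<in> Hom M A N" using r by (simp add: hom_iff)
    then have q' [simp]: "?q \<in> Arr M" "Dom M ?q = A" "Cod M ?q = N" by (auto simp: hom_iff)
    have "Comp M (s N) (FA F (FA G ?q)) = Comp M ?q (s A)" using s(2)[of ?q] q' by metis
    also have "\<dots> = Comp M (s N) (FA F g)"
      using r by (simp add: F.target.assoc)
    finally have "FA F (FA G ?q) = FA F g"
      by (rule F.target.iso_cancel(1)[rotated]) (use s(1)[OF N] q' in simp_all)
    then have "FA G ?q = g"
      by (rule faithF[where X = "FO G A" and Y = "FO G N"]) (use G.hom_map[OF q] g in auto)
    with q show ?thesis by blast
  qed
  show ?thesis
    unfolding finite_generator_def
  proof (intro conjI ballI)
    show "FO G A \<in> Obj C" using AO by simp
    fix X assume X: "X \<in> Obj C"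
    then have FX: "FO F X \<in> Obj M" by simp
    obtain S where S: "finite S" "S \<subseteq> Hom M A (FO F X)" "Hom M A (FO F X) \<subseteq> hom_span M A (FO F X) S"
      "jointly_epi M (FO F X) S"
      using A FX unfolding finite_generator_def by blast
    have tX [simp]: "t X \<in> Arr C" "Dom C (t X) = FO G (FO F X)" "Cod C (t X) = X"
      using t(1)[OF X] by (auto simp: hom_iff)
    define w where "w p = Comp C (t X) (FA G p)" for p
    have w_hom: "w p \<in> Hom C (FO G A) X" if "p \<in> Hom M A (FO F X)" for p
      using that by (simp add: w_def hom_iff)
    have S_ty: "p \<in> Arr M \<and> Dom M p = A \<and> Cod M p = FO F X" if "p \<in> S" for p
      using S(2) that by (auto simp: hom_iff)
    have span: "w q \<in> hom_span C (FO G A) X (w ` S) \<and> q \<in> Hom M A (FO F X)"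
      if "q \<in> hom_span M A (FO F X) S" for q
      using that
    proof induction
      case zero
      have "w (Zero M A (FO F X)) = Zero C (FO G A) X"
        using AO FX X by (simp add: w_def G.map_zero)
      then show ?case using hom_span.zero[of C "FO G A" X "w ` S"] F.target.zero_hom[OF AO FX] by simp
    next
      case (add p h c)
      then have "w (Add M (Scale M c p) h) = Add C (Scale C c (w p)) (w h)"
        using S_ty[OF add(1)]
        by (simp add: w_def hom_iff G.map_add G.map_scale F.source.add_comp F.source.scale_comp)
      then show ?case
        using add S_ty[OF add(1)] hom_span.add[of "w p" "w ` S" "w h" C "FO G A" X c] by (auto simp: hom_iff)
    qed
    have "Hom C (FO G A) X \<subseteq> hom_span C (FO G A) X (w ` S)"
    proof
      fix f assume f: "f \<in> Hom C (FO G A) X"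
      obtain r where r: "r \<in> Arr C" "Dom C r = Cod C (t X)" "Cod C r = Dom C (t X)"
        "Comp C (t X) r = Id C (Cod C (t X))"
        using F.source.isoE[of "t X"] t(1)[OF X] by metis
      have "Comp C r f \<in> Hom C (FO G A) (FO G (FO F X))" using f r by (simp add: hom_iff)
      then obtain q where q: "q \<in> Hom M A (FO F X)" "FA G q = Comp C r f" using full FX by blast
      have "w q = f"
        unfolding w_def q(2) using f r F.source.assoc[of f r "t X"] by (simp add: hom_iff)
      then show "f \<in> hom_span C (FO G A) X (w ` S)" using span S(3) q(1) by blast
    qed
    moreover have "jointly_epi C X (w ` S)"
      unfolding jointly_epi_def
    proof (intro ballI impI)
      fix T u v assume T: "T \<in> Obj C" and u: "u \<in> Hom C X T" and v: "v \<in> Hom C X T"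
        and eq: "\<forall>p\<in>w ` S. Comp C u p = Comp C v p"
      have ty [simp]: "u \<in> Arr C" "Dom C u = X" "Cod C u = T" "v \<in> Arr C" "Dom C v = X" "Cod C v = T"
        "t T \<in> Arr C" "Dom C (t T) = FO G (FO F T)" "Cod C (t T) = T" "T \<in> Obj C"
        using u v T t(1)[OF T] by (auto simp: hom_iff)
      have "Comp M (FA F u) p = Comp M (FA F v) p" if p: "p \<in> S" for p
      proof -
        have pt [simp]: "p \<in> Arr M" "Dom M p = A" "Cod M p = FO F X" using S_ty[OF p] by auto
        have "Comp C (t T) (FA G (Comp M (FA F u) p)) = Comp C u (w p)"
          using t(2)[of u] by (simp add: G.map_comp w_def F.source.assoc[symmetric])
        also have "\<dots> = Comp C v (w p)" using eq p by blast
        also have "\<dots> = Comp C (t T) (FA G (Comp M (FA F v) p))"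
          using t(2)[of v] by (simp add: G.map_comp w_def F.source.assoc[symmetric])
        finally have "FA G (Comp M (FA F u) p) = FA G (Comp M (FA F v) p)"
          by (rule F.source.iso_cancel(1)[rotated]) (use t(1)[OF T] in auto)
        then show ?thesis by (rule faithG[where X = A and Y = "FO F T"]) (auto simp: hom_iff)
      qed
      then have "FA F u = FA F v"
        using S(4)[unfolded jointly_epi_def, rule_format, OF F.obj_map[OF T] F.hom_map[OF u] F.hom_map[OF v]]
        by blast
      then show "u = v" by (rule faithF[OF _ u v])
    qed
    ultimately show "\<exists>S. finite S \<and> S \<subseteq> Hom C (FO G A) X \<and> Hom C (FO G A) X \<subseteq> hom_span C (FO G A) X S
      \<and> jointly_epi C X S"
      using S(1,2) w_hom by (intro exI[of _ "w ` S"]) auto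
  qed
qed

lemma finite_category_generator:
  assumes "finite_category C"
  shows "\<exists>P. finite_generator C P"
proof -
  obtain n mul e F G where fd: "fd_algebra n mul e"
    and eq: "linear_functor C (fd_modules n mul e) F" "linear_functor (fd_modules n mul e) C G"
    "naturally_isomorphic C C (comp_functor G F) id_functor"
    "naturally_isomorphic (fd_modules n mul e) (fd_modules n mul e) (comp_functor F G) id_functor"
    using assms unfolding finite_category_def linearly_equivalent_def by blast
  show ?thesis
    by (rule exI, rule finite_generator_equivalent[OF eq regular_generator[OF fd]])
qed

section \<open>Extending families along a generator\<close>

text \<open>By normality p is the cokernel of some f. Since f factors through the kernel i of p, an
  arrow that kills i also kills f, so p is the cokernel of i as well.\<close>

lemma (in abelian_category) epi_short_exact:
  assumes "is_epi C p"
  shows "\<exists>i. short_exact C i p"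
proof -
  obtain f where f: "is_cokernel C p f" using epi_normal[OF assms] by blast
  then have p: "p \<in> Arr C" and f': "f \<in> Arr C" "Dom C p = Cod C f"
    and pf: "p \<cdot> f = Zero C (Dom C f) (Cod C p)"
    by (auto simp: is_cokernel_def)
  obtain i where i: "is_kernel C i p" using has_kernels[OF p] by blast
  then have i': "i \<in> Arr C" "Cod C i = Dom C p" "p \<cdot> i = Zero C (Dom C i) (Cod C p)"
    by (auto simp: is_kernel_def)
  obtain g where g: "g \<in> Hom C (Dom C f) (Dom C i)" "i \<cdot> g = f"
    using i pf f' p unfolding is_kernel_def by (metis (no_types, lifting) dom_obj hom_iff)
  have "is_cokernel C p i"
    unfolding is_cokernel_def
  proof (intro conjI ballI impI)
    fix T t assume T: "T \<in> Obj C" and t: "t \<in> Hom C (Cod C i) T" and ti: "t \<cdot> i = Zero C (Dom C i) T"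
    have "t \<cdot> f = (t \<cdot> i) \<cdot> g" using g i' t by (auto simp: hom_iff assoc)
    also have "\<dots> = Zero C (Dom C f) T" using g T i' by (simp add: ti hom_iff)
    finally show "\<exists>!u. u \<in> Hom C (Cod C p) T \<and> u \<cdot> p = t"
      using f T t i' f' unfolding is_cokernel_def by metis
  qed (use p i' in auto)
  with i show ?thesis by (auto simp: short_exact_def)
qed

lemma (in linear_category) cokernel_epi:
  assumes "is_cokernel C p f" "u \<in> Arr C" "v \<in> Arr C" "Dom C u = Cod C p" "Dom C v = Cod C p"
    "Cod C u = Cod C v" "u \<cdot> p = v \<cdot> p"
  shows "u = v"
proof -
  have p: "p \<in> Arr C" "f \<in> Arr C" "Dom C p = Cod C f" "p \<cdot> f = Zero C (Dom C f) (Cod C p)"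
    using assms(1) by (auto simp: is_cokernel_def)
  have "(u \<cdot> p) \<cdot> f = Zero C (Dom C f) (Cod C u)"
    using assms p by (simp add: assoc)
  then have "\<exists>!w. w \<in> Hom C (Cod C p) (Cod C u) \<and> w \<cdot> p = u \<cdot> p"
    using assms p unfolding is_cokernel_def by (metis cod_obj comp_typing hom_iff)
  then show ?thesis using assms by (auto simp: hom_iff)
qed

lemma (in linear_category) cokernel_factor:
  assumes "is_cokernel C p f" "t \<in> Hom C (Cod C f) T" "t \<cdot> f = Zero C (Dom C f) T"
  shows "\<exists>u\<in>Hom C (Cod C p) T. u \<cdot> p = t"
proof -
  have "T \<in> Obj C" using hom_obj[OF assms(2)] by simp
  then show ?thesis using assms unfolding is_cokernel_def by blast
qed

text \<open>Finite direct sums of copies of P. This is a relation because zero objects and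
  biproducts are only known to exist and no choice of them is part of the category.\<close>

inductive free_on :: "('o, 'm, 'k, 'x) lincat_scheme \<Rightarrow> 'o \<Rightarrow> 'o \<Rightarrow> bool"
  for C :: "('o, 'm, 'k, 'x) lincat_scheme" and P :: 'o where
  zero: "is_zero_object C N \<Longrightarrow> free_on C P N"
| biproduct: "\<lbrakk>free_on C P Q; is_biproduct C P Q B i j p q\<rbrakk> \<Longrightarrow> free_on C P B"

lemma free_on_obj: "free_on C P Q \<Longrightarrow> Q \<in> Obj C"
  by (induction rule: free_on.induct) (auto simp: is_zero_object_def is_biproduct_def)

text \<open>Q has one copy of P for each element of S, and that element is the component of r on its
  copy; the inclusions of the copies provide the arrows k.\<close>

lemma (in abelian_category) free_cover:
  assumes "finite S" "S \<subseteq> Hom C P X" "P \<in> Obj C" "X \<in> Obj C"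
  shows "\<exists>Q r. free_on C P Q \<and> r \<in> Hom C Q X \<and> (\<forall>s\<in>S. \<exists>k\<in>Hom C P Q. s = r \<cdot> k)"
  using assms(1,2)
proof (induction rule: finite_induct)
  case empty
  obtain N where N: "is_zero_object C N" using has_zero by blast
  then obtain r where "r \<in> Hom C N X" using assms(4) unfolding is_zero_object_def by blast
  with free_on.zero[OF N] show ?case by blast
next
  case (insert s S)
  then obtain Q r where Q: "free_on C P Q" and r: "r \<in> Hom C Q X"
    and cover: "\<And>s. s \<in> S \<Longrightarrow> \<exists>k\<in>Hom C P Q. s = r \<cdot> k" by blast
  obtain B i j p q where B: "is_biproduct C P Q B i j p q"
    using has_biproducts[OF assms(3) free_on_obj[OF Q]] by blast
  then have ty: "i \<in> Arr C" "Dom C i = P" "Cod C i = B" "j \<in> Arr C" "Dom C j = Q" "Cod C j = B"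
    "p \<in> Arr C" "Dom C p = B" "Cod C p = P" "q \<in> Arr C" "Dom C q = B" "Cod C q = Q"
    and eq: "p \<cdot> i = Id C P" "q \<cdot> j = Id C Q" "p \<cdot> j = Zero C Q P" "q \<cdot> i = Zero C P Q"
    by (auto simp: is_biproduct_def hom_iff)
  have s: "s \<in> Arr C" "Dom C s = P" "Cod C s = X" and r': "r \<in> Arr C" "Dom C r = Q" "Cod C r = X"
    using insert.prems r by (auto simp: hom_iff)
  have QO: "Q \<in> Obj C" by (rule free_on_obj[OF Q])
  let ?r = "Add C (s \<cdot> p) (r \<cdot> q)"
  have r1: "?r \<cdot> i = s" and r2: "?r \<cdot> j = r"
    using ty s r' QO assms(3,4) by (simp_all add: add_comp assoc eq)
  have "\<exists>k\<in>Hom C P B. s' = ?r \<cdot> k" if s': "s' \<in> insert s S" for s'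
  proof (cases "s' = s")
    case True
    then show ?thesis using ty r1 by (intro bexI[of _ i]) (auto simp: hom_iff)
  next
    case False
    then obtain k where k: "k \<in> Hom C P Q" "s' = r \<cdot> k" using cover s' by blast
    have "?r \<cdot> j \<cdot> k = (?r \<cdot> j) \<cdot> k" using ty s r' k by (intro assoc[symmetric]) (auto simp: hom_iff)
    then have "s' = ?r \<cdot> j \<cdot> k" using k r2 by simp
    then show ?thesis using ty k by (intro bexI[of _ "j \<cdot> k"]) (auto simp: hom_iff)
  qed
  moreover have "?r \<in> Hom C B X" using ty s r' by (simp add: hom_iff)
  ultimately show ?case using free_on.biproduct[OF Q B] by blast
qed

text \<open>Factoring through r is closed under linear combinations, so it is enough to factor a
  spanning set.\<close>

lemma (in linear_category) hom_span_factor: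
  assumes "h \<in> hom_span C P X S" "r \<in> Hom C Q X" "P \<in> Obj C"
    and "\<And>s. s \<in> S \<Longrightarrow> \<exists>k\<in>Hom C P Q. s = r \<cdot> k"
  shows "\<exists>k\<in>Hom C P Q. h = r \<cdot> k"
  using assms(1)
proof induction
  case zero
  then show ?case using assms(2,3) hom_obj[OF assms(2)]
    by (intro bexI[of _ "Zero C P Q"]) (auto simp: hom_iff)
next
  case (add s h c)
  obtain k l where "k \<in> Hom C P Q" "s = r \<cdot> k" "l \<in> Hom C P Q" "h = r \<cdot> l"
    using add assms(4) by blast
  then show ?case using assms(2)
    by (intro bexI[of _ "Add C (Scale C c k) l"]) (auto simp: hom_iff add_comp scale_comp)
qed

section \<open>Right exact functors and families indexed by arrows from the generator\<close>

text \<open>The functor E will be A \<otimes> F(-). The aim is to recover an arrow out of E(X) from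
  its composites with E(p), for p ranging over the arrows P \<rightarrow> X.\<close>

locale generated_right_exact = linear_functor C D E + abelian_category C
  for C :: "('o, 'm, 'k::field, 'x) lincat_scheme"
    and D :: "('p, 'q, 'k, 'y) lincat_scheme"
    and E :: "('o, 'm, 'p, 'q) functr" +
  fixes P :: 'o
  assumes right_exact: "short_exact C i p \<Longrightarrow> is_cokernel D (FA E p) (FA E i)"
    and generator: "finite_generator C P"
begin

lemma P_obj [simp]: "P \<in> Obj C"
  using generator by (simp add: finite_generator_def)

text \<open>The data that an arrow v : E(X) \<rightarrow> T induces by p \<mapsto> v E(p): an
  additive map, linear over the endomorphisms of P. Compatibility with scalars is contained in the
  last clause, taken at multiples of the identity of P.\<close>

definition family :: "'p \<Rightarrow> 'o \<Rightarrow> ('m \<Rightarrow> 'q) \<Rightarrow> bool" where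
  "family T X u \<longleftrightarrow> T \<in> Obj D \<and> (\<forall>p\<in>Hom C P X. u p \<in> Hom D (FO E P) T) \<and>
     (\<forall>p\<in>Hom C P X. \<forall>p'\<in>Hom C P X. u (Add C p p') = Add D (u p) (u p')) \<and>
     (\<forall>p\<in>Hom C P X. \<forall>a\<in>Hom C P P. u (p \<cdot>\<^bsub>C\<^esub> a) = u p \<cdot>\<^bsub>D\<^esub> FA E a)"

lemma family_zero:
  assumes "family T X u" "X \<in> Obj C"
  shows "u (Zero C P X) = Zero D (FO E P) T"
proof -
  have z: "Zero C P X \<in> Hom C P X" "Zero C P P \<in> Hom C P P" using assms by (simp_all add: hom_iff)
  have "u (Zero C P X \<cdot>\<^bsub>C\<^esub> Zero C P P) = u (Zero C P X) \<cdot>\<^bsub>D\<^esub> FA E (Zero C P P)"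
    using assms z unfolding family_def by blast
  moreover have "u (Zero C P X) \<in> Hom D (FO E P) T" using assms z unfolding family_def by blast
  ultimately show ?thesis using assms(2) by (simp add: map_zero hom_iff)
qed

lemma family_comp:
  assumes u: "family T X u" and r: "r \<in> Hom C Q X"
  shows "family T Q (\<lambda>k. u (r \<cdot>\<^bsub>C\<^esub> k))"
  unfolding family_def
proof (intro conjI ballI)
  show "T \<in> Obj D" using u by (simp add: family_def)
  fix p assume p: "p \<in> Hom C P Q"
  then have rp: "r \<cdot>\<^bsub>C\<^esub> p \<in> Hom C P X" using r by (auto simp: hom_iff)
  then show "u (r \<cdot>\<^bsub>C\<^esub> p) \<in> Hom D (FO E P) T" using u unfolding family_def by blast
  show "u (r \<cdot>\<^bsub>C\<^esub> p \<cdot>\<^bsub>C\<^esub> a) = u (r \<cdot>\<^bsub>C\<^esub> p) \<cdot>\<^bsub>D\<^esub> FA E a" if a: "a \<in> Hom C P P" for a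
  proof -
    have "r \<cdot>\<^bsub>C\<^esub> p \<cdot>\<^bsub>C\<^esub> a = (r \<cdot>\<^bsub>C\<^esub> p) \<cdot>\<^bsub>C\<^esub> a" using r p a by (auto simp: hom_iff source.assoc)
    then show ?thesis using u rp a unfolding family_def by metis
  qed
  fix p' assume p': "p' \<in> Hom C P Q"
  then have "r \<cdot>\<^bsub>C\<^esub> p' \<in> Hom C P X" using r by (auto simp: hom_iff)
  moreover have "r \<cdot>\<^bsub>C\<^esub> Add C p p' = Add C (r \<cdot>\<^bsub>C\<^esub> p) (r \<cdot>\<^bsub>C\<^esub> p')"
    using r p p' by (auto simp: hom_iff source.add_comp)
  ultimately show "u (r \<cdot>\<^bsub>C\<^esub> Add C p p') = Add D (u (r \<cdot>\<^bsub>C\<^esub> p)) (u (r \<cdot>\<^bsub>C\<^esub> p'))"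
    using u rp unfolding family_def by metis
qed

text \<open>On a biproduct of P and Q the extension is w(i) on the copy of P and, on Q, the
  extension of the family pulled back along j.\<close>

lemma free_extension:
  assumes "free_on C P Q" "family T Q w"
  shows "\<exists>v\<in>Hom D (FO E Q) T. \<forall>k\<in>Hom C P Q. v \<cdot>\<^bsub>D\<^esub> FA E k = w k"
  using assms
proof (induction arbitrary: w)
  case (zero N)
  have N: "N \<in> Obj C" and uniq: "\<exists>!f. f \<in> Hom C P N" using zero by (auto simp: is_zero_object_def)
  have T: "T \<in> Obj D" using zero by (simp add: family_def)
  have "k = Zero C P N" if "k \<in> Hom C P N" for k
    using uniq that source.zero_hom[OF P_obj N] by blast
  then show ?case
    using family_zero[OF zero(2) N] T N
    by (intro bexI[of _ "Zero D (FO E N) T"]) (auto simp: map_zero hom_iff)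
next
  case (biproduct Q B i j p q)
  then have ty [simp]: "i \<in> Arr C" "Dom C i = P" "Cod C i = B" "j \<in> Arr C" "Dom C j = Q" "Cod C j = B"
    "p \<in> Arr C" "Dom C p = B" "Cod C p = P" "q \<in> Arr C" "Dom C q = B" "Cod C q = Q"
    and eq: "Add C (i \<cdot>\<^bsub>C\<^esub> p) (j \<cdot>\<^bsub>C\<^esub> q) = Id C B"
    by (auto simp: is_biproduct_def hom_iff)
  have iB: "i \<in> Hom C P B" and jB: "j \<in> Hom C Q B" by (auto simp: hom_iff)
  obtain v where v: "v \<in> Hom D (FO E Q) T" "\<And>k. k \<in> Hom C P Q \<Longrightarrow> v \<cdot>\<^bsub>D\<^esub> FA E k = w (j \<cdot>\<^bsub>C\<^esub> k)"
    using biproduct.IH[OF family_comp[OF biproduct.prems jB]] by blast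
  have wi: "w i \<in> Hom D (FO E P) T" using biproduct.prems iB unfolding family_def by blast
  note ty' [simp] = v(1)[unfolded hom_iff] wi[unfolded hom_iff]
  let ?v = "Add D (w i \<cdot>\<^bsub>D\<^esub> FA E p) (v \<cdot>\<^bsub>D\<^esub> FA E q)"
  have "?v \<cdot>\<^bsub>D\<^esub> FA E k = w k" if k: "k \<in> Hom C P B" for k
  proof -
    note k' [simp] = k[unfolded hom_iff]
    have pk: "p \<cdot>\<^bsub>C\<^esub> k \<in> Hom C P P" and qk: "q \<cdot>\<^bsub>C\<^esub> k \<in> Hom C P Q" by (auto simp: hom_iff)
    have "?v \<cdot>\<^bsub>D\<^esub> FA E k = Add D (w i \<cdot>\<^bsub>D\<^esub> FA E (p \<cdot>\<^bsub>C\<^esub> k)) (v \<cdot>\<^bsub>D\<^esub> FA E (q \<cdot>\<^bsub>C\<^esub> k))"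
      by (simp add: target.add_comp target.assoc map_comp)
    also have "\<dots> = Add D (w (i \<cdot>\<^bsub>C\<^esub> p \<cdot>\<^bsub>C\<^esub> k)) (w (j \<cdot>\<^bsub>C\<^esub> q \<cdot>\<^bsub>C\<^esub> k))"
      using biproduct.prems pk iB v(2)[OF qk] unfolding family_def by metis
    also have "\<dots> = w (Add C (i \<cdot>\<^bsub>C\<^esub> p \<cdot>\<^bsub>C\<^esub> k) (j \<cdot>\<^bsub>C\<^esub> q \<cdot>\<^bsub>C\<^esub> k))"
    proof -
      have "i \<cdot>\<^bsub>C\<^esub> p \<cdot>\<^bsub>C\<^esub> k \<in> Hom C P B" "j \<cdot>\<^bsub>C\<^esub> q \<cdot>\<^bsub>C\<^esub> k \<in> Hom C P B" by (auto simp: hom_iff)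
      then show ?thesis using biproduct.prems unfolding family_def by metis
    qed
    also have "Add C (i \<cdot>\<^bsub>C\<^esub> p \<cdot>\<^bsub>C\<^esub> k) (j \<cdot>\<^bsub>C\<^esub> q \<cdot>\<^bsub>C\<^esub> k) = Add C (i \<cdot>\<^bsub>C\<^esub> p) (j \<cdot>\<^bsub>C\<^esub> q) \<cdot>\<^bsub>C\<^esub> k"
      by (simp add: source.add_comp source.assoc)
    finally show ?thesis by (simp add: eq)
  qed
  then show ?case by (intro bexI[of _ ?v]) (auto simp: hom_iff)
qed

text \<open>The functor E is additive and so preserves the decomposition of the identity of a
  biproduct; an arrow is the sum of its restrictions to the copies of P.\<close>

lemma free_unique:
  assumes "free_on C P Q" "v \<in> Hom D (FO E Q) T" "v' \<in> Hom D (FO E Q) T"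
    and "\<And>k. k \<in> Hom C P Q \<Longrightarrow> v \<cdot>\<^bsub>D\<^esub> FA E k = v' \<cdot>\<^bsub>D\<^esub> FA E k"
  shows "v = v'"
  using assms
proof (induction arbitrary: v v')
  case (zero N)
  have N: "N \<in> Obj C" and uniq: "\<exists>!f. f \<in> Hom C N N" using zero by (auto simp: is_zero_object_def)
  have "Id C N = Zero C N N" using uniq source.id_hom[OF N] source.zero_hom[OF N N] by blast
  then have "Id D (FO E N) = Zero D (FO E N) (FO E N)" using id_map[OF N] map_zero[OF N N] by metis
  moreover have "v \<cdot>\<^bsub>D\<^esub> Id D (FO E N) = v" "v' \<cdot>\<^bsub>D\<^esub> Id D (FO E N) = v'" using zero by (auto simp: hom_iff)
  ultimately show ?case using zero N by (simp add: hom_iff)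
next
  case (biproduct Q B i j p q)
  then have ty [simp]: "i \<in> Arr C" "Dom C i = P" "Cod C i = B" "j \<in> Arr C" "Dom C j = Q" "Cod C j = B"
    "p \<in> Arr C" "Dom C p = B" "Cod C p = P" "q \<in> Arr C" "Dom C q = B" "Cod C q = Q"
    and eq: "Add C (i \<cdot>\<^bsub>C\<^esub> p) (j \<cdot>\<^bsub>C\<^esub> q) = Id C B" and B: "B \<in> Obj C"
    by (auto simp: is_biproduct_def hom_iff)
  note ty' [simp] = biproduct.prems(1,2)[unfolded hom_iff]
  have vi: "v \<cdot>\<^bsub>D\<^esub> FA E i = v' \<cdot>\<^bsub>D\<^esub> FA E i" by (rule biproduct.prems(3)) (simp add: hom_iff)
  have vj: "v \<cdot>\<^bsub>D\<^esub> FA E j = v' \<cdot>\<^bsub>D\<^esub> FA E j"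
  proof (rule biproduct.IH)
    fix k assume "k \<in> Hom C P Q"
    then have k [simp]: "k \<in> Arr C" "Dom C k = P" "Cod C k = Q" by (auto simp: hom_iff)
    have "v \<cdot>\<^bsub>D\<^esub> FA E (j \<cdot>\<^bsub>C\<^esub> k) = v' \<cdot>\<^bsub>D\<^esub> FA E (j \<cdot>\<^bsub>C\<^esub> k)" by (rule biproduct.prems(3)) (simp add: hom_iff)
    then show "(v \<cdot>\<^bsub>D\<^esub> FA E j) \<cdot>\<^bsub>D\<^esub> FA E k = (v' \<cdot>\<^bsub>D\<^esub> FA E j) \<cdot>\<^bsub>D\<^esub> FA E k"
      by (simp add: map_comp target.assoc)
  qed (auto simp: hom_iff)
  have expand: "x = Add D ((x \<cdot>\<^bsub>D\<^esub> FA E i) \<cdot>\<^bsub>D\<^esub> FA E p) ((x \<cdot>\<^bsub>D\<^esub> FA E j) \<cdot>\<^bsub>D\<^esub> FA E q)"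
    if x: "x \<in> Hom D (FO E B) T" for x
  proof -
    note [simp] = x[unfolded hom_iff]
    have "x = x \<cdot>\<^bsub>D\<^esub> FA E (Add C (i \<cdot>\<^bsub>C\<^esub> p) (j \<cdot>\<^bsub>C\<^esub> q))" unfolding eq using B by (simp add: id_map)
    then show ?thesis by (simp add: map_add map_comp target.add_comp target.assoc)
  qed
  show ?case using expand[OF biproduct.prems(1)] expand[OF biproduct.prems(2)] vi vj by simp
qed

text \<open>The generator is not assumed to be projective. Instead, the cover \<open>r : Q \<rightarrow> X\<close> below is large
  enough that every arrow \<open>P \<rightarrow> X\<close> factors through it.\<close>

lemma family_extension:
  assumes X: "X \<in> Obj C" and u: "family T X u"
  shows "\<exists>!v. v \<in> Hom D (FO E X) T \<and> (\<forall>p\<in>Hom C P X. v \<cdot>\<^bsub>D\<^esub> FA E p = u p)"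
proof -
  have cover: "\<exists>Q r i. free_on C P Q \<and> r \<in> Hom C Q X \<and> (\<forall>p\<in>Hom C P X. \<exists>k\<in>Hom C P Q. p = r \<cdot>\<^bsub>C\<^esub> k)
      \<and> short_exact C i r" if X: "X \<in> Obj C" for X
  proof -
    obtain S where S: "finite S" "S \<subseteq> Hom C P X" "Hom C P X \<subseteq> hom_span C P X S" "jointly_epi C X S"
      using generator X unfolding finite_generator_def by blast
    obtain Q r where Q: "free_on C P Q" "r \<in> Hom C Q X" "\<And>s. s \<in> S \<Longrightarrow> \<exists>k\<in>Hom C P Q. s = r \<cdot>\<^bsub>C\<^esub> k"
      using free_cover[OF S(1,2) P_obj X] by blast
    note [simp] = Q(2)[unfolded hom_iff]
    have "is_epi C r"
      unfolding is_epi_def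
    proof (intro conjI ballI impI)
      fix T a b assume T: "T \<in> Obj C" and a: "a \<in> Hom C (Cod C r) T" and b: "b \<in> Hom C (Cod C r) T"
        and eq: "a \<cdot>\<^bsub>C\<^esub> r = b \<cdot>\<^bsub>C\<^esub> r"
      have "a \<cdot>\<^bsub>C\<^esub> s = b \<cdot>\<^bsub>C\<^esub> s" if s: "s \<in> S" for s
      proof -
        obtain k where k: "k \<in> Hom C P Q" "s = r \<cdot>\<^bsub>C\<^esub> k" using Q(3)[OF s] by blast
        then have "a \<cdot>\<^bsub>C\<^esub> s = (a \<cdot>\<^bsub>C\<^esub> r) \<cdot>\<^bsub>C\<^esub> k" "b \<cdot>\<^bsub>C\<^esub> s = (b \<cdot>\<^bsub>C\<^esub> r) \<cdot>\<^bsub>C\<^esub> k"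
          using a b by (auto simp: hom_iff source.assoc)
        then show ?thesis by (simp add: eq)
      qed
      then show "a = b" using S(4) T a b unfolding jointly_epi_def by (simp add: hom_iff)
    qed simp
    then obtain i where "short_exact C i r" using epi_short_exact by blast
    moreover have "\<exists>k\<in>Hom C P Q. p = r \<cdot>\<^bsub>C\<^esub> k" if "p \<in> Hom C P X" for p
      using source.hom_span_factor[OF _ Q(2) P_obj Q(3)] S(3) that by blast
    ultimately show ?thesis using Q by blast
  qed
  obtain Q r i where Q: "free_on C P Q" "r \<in> Hom C Q X" "\<And>p. p \<in> Hom C P X \<Longrightarrow> \<exists>k\<in>Hom C P Q. p = r \<cdot>\<^bsub>C\<^esub> k"
    "short_exact C i r" using cover[OF X] by blast
  have i: "i \<in> Arr C" "Cod C i = Q" "r \<cdot>\<^bsub>C\<^esub> i = Zero C (Dom C i) X"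
    using Q(2,4) by (auto simp: short_exact_def is_kernel_def hom_iff)
  \<comment> \<open>The kernel of r is covered too, which gives a presentation Q' \<rightarrow> Q
    \<rightarrow> X. Since E(r') is an epimorphism, v E(i) = 0 can be tested on arrows P
    \<rightarrow> Q', and there it follows from r i = 0.\<close>
  obtain Q' r' i' where Q': "free_on C P Q'" "r' \<in> Hom C Q' (Dom C i)" "short_exact C i' r'"
    using cover[of "Dom C i"] i by auto
  note [simp] = Q(2)[unfolded hom_iff] Q'(2)[unfolded hom_iff] i(1,2)
  have T [simp]: "T \<in> Obj D" using u by (simp add: family_def)
  have X_Q [simp]: "X \<in> Obj C" "Q \<in> Obj C" "Q' \<in> Obj C" using X free_on_obj Q(1) Q'(1) by auto
  obtain v where v: "v \<in> Hom D (FO E Q) T" "\<And>k. k \<in> Hom C P Q \<Longrightarrow> v \<cdot>\<^bsub>D\<^esub> FA E k = u (r \<cdot>\<^bsub>C\<^esub> k)"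
    using free_extension[OF Q(1) family_comp[OF u Q(2)]] by blast
  note [simp] = v(1)[unfolded hom_iff]
  have "(v \<cdot>\<^bsub>D\<^esub> FA E i) \<cdot>\<^bsub>D\<^esub> FA E r' = Zero D (FO E (Dom C i)) T \<cdot>\<^bsub>D\<^esub> FA E r'"
  proof (rule free_unique[OF Q'(1)])
    fix k assume "k \<in> Hom C P Q'"
    note k [simp] = this[unfolded hom_iff]
    have irk: "i \<cdot>\<^bsub>C\<^esub> r' \<cdot>\<^bsub>C\<^esub> k \<in> Hom C P Q" by (simp add: hom_iff)
    have "((v \<cdot>\<^bsub>D\<^esub> FA E i) \<cdot>\<^bsub>D\<^esub> FA E r') \<cdot>\<^bsub>D\<^esub> FA E k = v \<cdot>\<^bsub>D\<^esub> FA E (i \<cdot>\<^bsub>C\<^esub> r' \<cdot>\<^bsub>C\<^esub> k)"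
      by (simp add: map_comp target.assoc)
    also have "\<dots> = u ((r \<cdot>\<^bsub>C\<^esub> i) \<cdot>\<^bsub>C\<^esub> r' \<cdot>\<^bsub>C\<^esub> k)" by (simp add: v(2)[OF irk] source.assoc)
    also have "\<dots> = Zero D (FO E P) T" by (simp add: i(3) family_zero[OF u X])
    finally show "((v \<cdot>\<^bsub>D\<^esub> FA E i) \<cdot>\<^bsub>D\<^esub> FA E r') \<cdot>\<^bsub>D\<^esub> FA E k
        = (Zero D (FO E (Dom C i)) T \<cdot>\<^bsub>D\<^esub> FA E r') \<cdot>\<^bsub>D\<^esub> FA E k" by simp
  qed (auto simp: hom_iff)
  then have "v \<cdot>\<^bsub>D\<^esub> FA E i = Zero D (FO E (Dom C i)) T"
    by (rule target.cokernel_epi[OF right_exact[OF Q'(3)], rotated -1]) simp_all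
  moreover have "is_cokernel D (FA E r) (FA E i)" by (rule right_exact[OF Q(4)])
  ultimately obtain w where w: "w \<in> Hom D (FO E X) T" "w \<cdot>\<^bsub>D\<^esub> FA E r = v"
    using target.cokernel_factor[of "FA E r" "FA E i" v T] v(1) by auto
  note [simp] = w(1)[unfolded hom_iff]
  have wp: "w \<cdot>\<^bsub>D\<^esub> FA E p = u p" if "p \<in> Hom C P X" for p
  proof -
    obtain k where k: "k \<in> Hom C P Q" "p = r \<cdot>\<^bsub>C\<^esub> k" using Q(3) \<open>p \<in> Hom C P X\<close> by blast
    note [simp] = k(1)[unfolded hom_iff]
    have "w \<cdot>\<^bsub>D\<^esub> FA E p = (w \<cdot>\<^bsub>D\<^esub> FA E r) \<cdot>\<^bsub>D\<^esub> FA E k" unfolding k(2) by (simp add: map_comp target.assoc)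
    also have "\<dots> = u p" unfolding w(2) k(2) by (rule v(2)[OF k(1)])
    finally show ?thesis .
  qed
  moreover have "w' = w" if w': "w' \<in> Hom D (FO E X) T" "\<And>p. p \<in> Hom C P X \<Longrightarrow> w' \<cdot>\<^bsub>D\<^esub> FA E p = u p" for w'
  proof -
    note [simp] = w'(1)[unfolded hom_iff]
    have "w' \<cdot>\<^bsub>D\<^esub> FA E r = w \<cdot>\<^bsub>D\<^esub> FA E r"
    proof (rule free_unique[OF Q(1)])
      fix k assume "k \<in> Hom C P Q"
      note k [simp] = this[unfolded hom_iff]
      have rk: "r \<cdot>\<^bsub>C\<^esub> k \<in> Hom C P X" by (simp add: hom_iff)
      show "(w' \<cdot>\<^bsub>D\<^esub> FA E r) \<cdot>\<^bsub>D\<^esub> FA E k = (w \<cdot>\<^bsub>D\<^esub> FA E r) \<cdot>\<^bsub>D\<^esub> FA E k"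
        using w'(2)[OF rk] wp[OF rk] by (simp add: map_comp target.assoc)
    qed (auto simp: hom_iff)
    then show ?thesis
      by (rule target.cokernel_epi[OF right_exact[OF Q(4)], rotated -1]) simp_all
  qed
  ultimately show ?thesis using w(1) by (intro ex1I[of _ w]) blast+
qed

lemma family_unique:
  assumes "X \<in> Obj C" "v \<in> Hom D (FO E X) T" "v' \<in> Hom D (FO E X) T"
    and eq: "\<And>p. p \<in> Hom C P X \<Longrightarrow> v \<cdot>\<^bsub>D\<^esub> FA E p = v' \<cdot>\<^bsub>D\<^esub> FA E p"
  shows "v = v'"
proof -
  note [simp] = assms(2,3)[unfolded hom_iff]
  have "family T X (\<lambda>p. v \<cdot>\<^bsub>D\<^esub> FA E p)"
    unfolding family_def
  proof (intro conjI ballI)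
    show "T \<in> Obj D" using target.hom_obj[OF assms(2)] by simp
  qed (auto simp: hom_iff map_add map_comp target.add_comp target.assoc)
  from family_extension[OF assms(1) this] show ?thesis using assms(2,3) eq by metis
qed

end

text \<open>The arrows of R are killed one after another: each step passes to the cokernel of the
  next arrow followed by the quotient reached so far. Uniqueness of factorizations is expressed by
  \<open>is_epi\<close>.\<close>

lemma (in abelian_category) simultaneous_cokernel:
  assumes "finite R" "B \<in> Obj C" "\<And>r. r \<in> R \<Longrightarrow> r \<in> Arr C \<and> Cod C r = B"
  shows "\<exists>T q. q \<in> Hom C B T \<and> is_epi C q \<and> (\<forall>r\<in>R. q \<cdot> r = Zero C (Dom C r) T) \<and>
    (\<forall>T' t. t \<in> Hom C B T' \<longrightarrow> (\<forall>r\<in>R. t \<cdot> r = Zero C (Dom C r) T') \<longrightarrow> (\<exists>u\<in>Hom C T T'. u \<cdot> q = t))"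
  using assms(1,3)
proof (induction rule: finite_induct)
  case empty
  have "is_epi C (Id C B)" using assms(2) by (auto simp: is_epi_def hom_iff)
  then show ?case
    using assms(2) by (intro exI[of _ B] exI[of _ "Id C B"]) (auto simp: hom_iff)
next
  case (insert r R)
  then obtain T q where q: "q \<in> Hom C B T" "is_epi C q" "\<And>r. r \<in> R \<Longrightarrow> q \<cdot> r = Zero C (Dom C r) T"
    and univ: "\<And>T' t. t \<in> Hom C B T' \<Longrightarrow> \<forall>r\<in>R. t \<cdot> r = Zero C (Dom C r) T' \<Longrightarrow> \<exists>u\<in>Hom C T T'. u \<cdot> q = t"
    by blast
  note [simp] = q(1)[unfolded hom_iff]
  have R [simp]: "s \<in> Arr C" "Cod C s = B" if "s \<in> insert r R" for s using insert.prems that by auto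
  have qr [simp]: "q \<cdot> r \<in> Arr C" "Cod C (q \<cdot> r) = T" "Dom C (q \<cdot> r) = Dom C r" by simp_all
  obtain p where p: "is_cokernel C p (q \<cdot> r)" using has_cokernels[of "q \<cdot> r"] by auto
  then have p' [simp]: "p \<in> Arr C" "Dom C p = T" and pqr: "p \<cdot> q \<cdot> r = Zero C (Dom C r) (Cod C p)"
    by (auto simp: is_cokernel_def)
  have "\<forall>s\<in>insert r R. (p \<cdot> q) \<cdot> s = Zero C (Dom C s) (Cod C p)"
    using q(3) pqr by (auto simp: assoc)
  moreover have "is_epi C (p \<cdot> q)"
    unfolding is_epi_def
  proof (intro conjI ballI impI)
    fix T' u v assume T': "T' \<in> Obj C" and u: "u \<in> Hom C (Cod C (p \<cdot> q)) T'" and v: "v \<in> Hom C (Cod C (p \<cdot> q)) T'"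
      and eq: "u \<cdot> p \<cdot> q = v \<cdot> p \<cdot> q"
    note [simp] = u[unfolded hom_iff] v[unfolded hom_iff]
    have "(u \<cdot> p) \<cdot> q = (v \<cdot> p) \<cdot> q" using eq by (simp add: assoc)
    moreover have "u \<cdot> p \<in> Hom C (Cod C q) T'" "v \<cdot> p \<in> Hom C (Cod C q) T'" by (simp_all add: hom_iff)
    ultimately have "u \<cdot> p = v \<cdot> p" using q(2) T' unfolding is_epi_def by blast
    then show "u = v" by (rule cokernel_epi[OF p, rotated -1]) simp_all
  qed simp
  moreover have "\<exists>u\<in>Hom C (Cod C p) T'. u \<cdot> p \<cdot> q = t"
    if t: "t \<in> Hom C B T'" and tr: "\<forall>s\<in>insert r R. t \<cdot> s = Zero C (Dom C s) T'" for T' t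
  proof -
    note [simp] = t[unfolded hom_iff]
    have T': "T' \<in> Obj C" using hom_obj[OF t] by simp
    obtain u where u: "u \<in> Hom C T T'" "u \<cdot> q = t" using univ[OF t] tr by blast
    note [simp] = u(1)[unfolded hom_iff]
    have "u \<cdot> q \<cdot> r = Zero C (Dom C r) T'"
      using tr assoc[of r q u] by (simp add: u(2))
    then obtain w where w: "w \<in> Hom C (Cod C p) T'" "w \<cdot> p = u"
      using cokernel_factor[OF p, of u T'] u(1) by auto
    note [simp] = w(1)[unfolded hom_iff]
    have "w \<cdot> p \<cdot> q = t" using assoc[of q p w] by (simp add: w u)
    with w(1) show ?thesis by blast
  qed
  moreover have "p \<cdot> q \<in> Hom C B (Cod C p)" by (simp add: hom_iff)
  ultimately show ?case by blast
qed

section \<open>The central coend\<close>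

text \<open>Serves to pass between the dinatural and the natural form of a universal property, whose
  defining equations are equivalent component by component.\<close>

lemma ex1_ball_cong:
  assumes "\<And>t X. \<lbrakk>t \<in> H; X \<in> S\<rbrakk> \<Longrightarrow> Q t X \<longleftrightarrow> P t X" and "\<exists>!t. t \<in> H \<and> (\<forall>X\<in>S. P t X)"
  shows "\<exists>!t. t \<in> H \<and> (\<forall>X\<in>S. Q t X)"
proof -
  have "(t \<in> H \<and> (\<forall>X\<in>S. Q t X)) = (t \<in> H \<and> (\<forall>X\<in>S. P t X))" for t using assms(1) by blast
  then show ?thesis using assms(2) by simp
qed

locale monoidal_functor = davydov_yetter C D F + C: strict_tensor_category C +
    D: strict_tensor_category D + F: linear_functor C D F
  for C :: "('o, 'm, 'k::field) tcat"
    and D :: "('p, 'q, 'k) tcat" (structure)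
    and F :: "('o, 'm, 'p, 'q) functr" +
  assumes exact: "exact_functor C D F"
    and FO_unit [simp]: "FO F (Unit C) = Unit D"
    and FO_tens [simp]: "\<lbrakk>X \<in> Obj C; Y \<in> Obj C\<rbrakk> \<Longrightarrow> FO F (X \<otimes>\<^bsub>C\<^esub> Y) = FO F X \<otimes> FO F Y"
    and FA_tens: "\<lbrakk>f \<in> Arr C; g \<in> Arr C\<rbrakk> \<Longrightarrow> FA F (f \<boxtimes>\<^bsub>C\<^esub> g) = FA F f \<boxtimes> FA F g"
    and finite: "finite_category C"
begin

lemma FA_id: "X \<in> Obj C \<Longrightarrow> FA F (Id C X) = Id D (FO F X)"
  by (rule F.id_map)

lemmas FA_simps = FA_tens FA_id F.map_comp

section \<open>Dinatural families as natural families\<close>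

lemma dual_pair_FO:
  assumes [simp]: "X \<in> Obj C"
  shows "dual_pair D (FO F X) (FO F (Dual C X)) (FA F (Ev C X)) (FA F (Coev C X))"
proof unfold_locales
  have "FA F ((Id C X \<boxtimes>\<^bsub>C\<^esub> Ev C X) \<cdot>\<^bsub>C\<^esub> (Coev C X \<boxtimes>\<^bsub>C\<^esub> Id C X)) = Id D (FO F X)"
    by (simp add: C.zigzag FA_id)
  then show "(Id D (FO F X) \<boxtimes> FA F (Ev C X)) \<cdot> (FA F (Coev C X) \<boxtimes> Id D (FO F X)) = Id D (FO F X)"
    by (simp add: FA_simps)
  have "FA F ((Ev C X \<boxtimes>\<^bsub>C\<^esub> Id C (Dual C X)) \<cdot>\<^bsub>C\<^esub> (Id C (Dual C X) \<boxtimes>\<^bsub>C\<^esub> Coev C X)) = Id D (FO F (Dual C X))"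
    by (simp add: C.zigzag_dual FA_id)
  then show "(FA F (Ev C X) \<boxtimes> Id D (FO F (Dual C X))) \<cdot> (Id D (FO F (Dual C X)) \<boxtimes> FA F (Coev C X))
      = Id D (FO F (Dual C X))"
    by (simp add: FA_simps)
qed simp_all

text \<open>Transposing along the duality of \<open>F(X)\<close> turns dinatural families
  \<open>F(X)\<^sup>\<or> \<otimes> A \<otimes> F(X) \<rightarrow> B\<close> into natural families \<open>A \<otimes> F(X) \<rightarrow> F(X) \<otimes> B\<close>. The additional
  factor \<open>Q\<close> is a parameter.\<close>

definition natural :: "'p \<Rightarrow> 'p \<Rightarrow> 'p \<Rightarrow> ('o \<Rightarrow> 'q) \<Rightarrow> bool" where
  "natural A Q B \<tau> \<longleftrightarrow> A \<in> Obj D \<and> Q \<in> Obj D \<and> B \<in> Obj D \<and>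
     (\<forall>X\<in>Obj C. \<tau> X \<in> Arr D \<and> Dom D (\<tau> X) = A \<otimes> FO F X \<otimes> Q \<and> Cod D (\<tau> X) = FO F X \<otimes> B) \<and>
     (\<forall>\<phi>\<in>Arr C. \<tau> (Cod C \<phi>) \<cdot> (Id D A \<boxtimes> FA F \<phi> \<boxtimes> Id D Q) = (FA F \<phi> \<boxtimes> Id D B) \<cdot> \<tau> (Dom C \<phi>))"

lemma naturalD:
  assumes "natural A Q B \<tau>"
  shows "A \<in> Obj D" "Q \<in> Obj D" "B \<in> Obj D"
    "X \<in> Obj C \<Longrightarrow> \<tau> X \<in> Arr D" "X \<in> Obj C \<Longrightarrow> Dom D (\<tau> X) = A \<otimes> FO F X \<otimes> Q"
    "X \<in> Obj C \<Longrightarrow> Cod D (\<tau> X) = FO F X \<otimes> B"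
    "\<phi> \<in> Arr C \<Longrightarrow> \<tau> (Cod C \<phi>) \<cdot> (Id D A \<boxtimes> FA F \<phi> \<boxtimes> Id D Q) = (FA F \<phi> \<boxtimes> Id D B) \<cdot> \<tau> (Dom C \<phi>)"
  using assms unfolding natural_def by blast+

definition transpose :: "'p \<Rightarrow> 'o \<Rightarrow> 'q \<Rightarrow> 'q" where
  "transpose A X j = (Id D (FO F X) \<boxtimes> j) \<cdot> (FA F (Coev C X) \<boxtimes> Id D (A \<otimes> FO F X))"

definition untranspose :: "'p \<Rightarrow> 'o \<Rightarrow> 'q \<Rightarrow> 'q" where
  "untranspose B X \<tau> = (FA F (Ev C X) \<boxtimes> Id D B) \<cdot> (Id D (FO F (Dual C X)) \<boxtimes> \<tau>)"

lemma transpose_typing [simp]: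
  assumes "j \<in> Arr D" "Dom D j = coend_body A X" "A \<in> Obj D" "X \<in> Obj C"
  shows "transpose A X j \<in> Arr D" "Dom D (transpose A X j) = A \<otimes> FO F X"
    "Cod D (transpose A X j) = FO F X \<otimes> Cod D j"
  using assms by (simp_all add: transpose_def coend_body_def)

lemma untranspose_typing [simp]:
  assumes "\<tau> \<in> Arr D" "Cod D \<tau> = FO F X \<otimes> B" "B \<in> Obj D" "X \<in> Obj C"
  shows "untranspose B X \<tau> \<in> Arr D" "Dom D (untranspose B X \<tau>) = FO F (Dual C X) \<otimes> Dom D \<tau>"
    "Cod D (untranspose B X \<tau>) = B"
  using assms by (simp_all add: untranspose_def)

lemma untranspose_transpose:
  assumes "j \<in> Arr D" "Dom D j = coend_body A X" "Cod D j = B" "A \<in> Obj D" "B \<in> Obj D" "X \<in> Obj C"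
  shows "untranspose B X (transpose A X j) = j"
proof -
  interpret X: dual_pair D "FO F X" "FO F (Dual C X)" "FA F (Ev C X)" "FA F (Coev C X)"
    by (rule dual_pair_FO) fact
  show ?thesis
    unfolding untranspose_def transpose_def
    by (rule X.transpose_left_inv') (use assms in \<open>simp_all add: coend_body_def\<close>)
qed

lemma transpose_untranspose:
  assumes "\<tau> \<in> Arr D" "Dom D \<tau> = A \<otimes> FO F X" "Cod D \<tau> = FO F X \<otimes> B" "A \<in> Obj D" "B \<in> Obj D" "X \<in> Obj C"
  shows "transpose A X (untranspose B X \<tau>) = \<tau>"
proof -
  interpret X: dual_pair D "FO F X" "FO F (Dual C X)" "FA F (Ev C X)" "FA F (Coev C X)"
    by (rule dual_pair_FO) fact
  show ?thesis
    unfolding untranspose_def transpose_def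
    by (rule X.transpose_left_inv) (use assms in simp_all)
qed

lemma untranspose_cancel:
  assumes "untranspose B X \<tau> = untranspose B X \<tau>'" "\<tau> \<in> Arr D" "\<tau>' \<in> Arr D" "Cod D \<tau> = FO F X \<otimes> B"
    "Cod D \<tau>' = FO F X \<otimes> B" "Dom D \<tau>' = Dom D \<tau>" "B \<in> Obj D" "X \<in> Obj C"
  shows "\<tau> = \<tau>'"
proof -
  interpret X: dual_pair D "FO F X" "FO F (Dual C X)" "FA F (Ev C X)" "FA F (Coev C X)"
    by (rule dual_pair_FO) fact
  show ?thesis
    by (rule X.transpose_left_cancel) (use assms in \<open>simp_all add: untranspose_def\<close>)
qed

lemma untranspose_inject:
  assumes "\<tau> \<in> Arr D" "\<tau>' \<in> Arr D" "Cod D \<tau> = FO F X \<otimes> B"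
    "Cod D \<tau>' = FO F X \<otimes> B" "Dom D \<tau>' = Dom D \<tau>" "B \<in> Obj D" "X \<in> Obj C"
  shows "untranspose B X \<tau> = untranspose B X \<tau>' \<longleftrightarrow> \<tau> = \<tau>'"
  using untranspose_cancel[OF _ assms] by metis

lemma untranspose_post:
  assumes [simp]: "\<tau> \<in> Arr D" "Cod D \<tau> = FO F X \<otimes> B" "t \<in> Arr D" "Dom D t = B" "Cod D t = B'" "X \<in> Obj C"
  shows "untranspose B' X ((Id D (FO F X) \<boxtimes> t) \<cdot> \<tau>) = t \<cdot> untranspose B X \<tau>"
proof -
  have [simp]: "B \<in> Obj D" "B' \<in> Obj D" using D.arr_obj[of t] by simp_all
  have "untranspose B' X ((Id D (FO F X) \<boxtimes> t) \<cdot> \<tau>)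
      = ((FA F (Ev C X) \<boxtimes> Id D B') \<cdot> (Id D (FO F (Dual C X) \<otimes> FO F X) \<boxtimes> t)) \<cdot> (Id D (FO F (Dual C X)) \<boxtimes> \<tau>)"
    by (simp add: untranspose_def D.slices)
  also have "(FA F (Ev C X) \<boxtimes> Id D B') \<cdot> (Id D (FO F (Dual C X) \<otimes> FO F X) \<boxtimes> t) = t \<cdot> (FA F (Ev C X) \<boxtimes> Id D B)"
    using D.exchange[of "FA F (Ev C X)" t "FO F (Dual C X) \<otimes> FO F X" "Unit D" B B'] by simp
  finally show ?thesis by (simp add: untranspose_def D.assoc)
qed

lemma untranspose_pre:
  assumes "\<tau> \<in> Arr D" "Cod D \<tau> = FO F X \<otimes> B" "B \<in> Obj D" "s \<in> Arr D" "Cod D s = Dom D \<tau>" "X \<in> Obj C"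
  shows "untranspose B X (\<tau> \<cdot> s) = untranspose B X \<tau> \<cdot> (Id D (FO F (Dual C X)) \<boxtimes> s)"
  using assms by (simp add: untranspose_def D.slices)

text \<open>By \<open>ev_dual_map\<close> both sides of the dinaturality equation are untransposes
  along Y, namely of the two sides of the naturality square, and untransposition is
  injective.\<close>

lemma dinatural_iff_natural:
  assumes [simp]: "\<phi> \<in> Arr C" "Dom C \<phi> = X" "Cod C \<phi> = Y" "A \<in> Obj D" "B \<in> Obj D"
    and \<sigma> [simp]: "\<sigma> \<in> Arr D" "Dom D \<sigma> = A \<otimes> FO F X" "Cod D \<sigma> = FO F X \<otimes> B"
    and \<tau> [simp]: "\<tau> \<in> Arr D" "Dom D \<tau> = A \<otimes> FO F Y" "Cod D \<tau> = FO F Y \<otimes> B"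
  shows "untranspose B X \<sigma> \<cdot> (FA F (dual_map C \<phi>) \<boxtimes> Id D A \<boxtimes> Id D (FO F X))
      = untranspose B Y \<tau> \<cdot> (Id D (FO F (Dual C Y)) \<boxtimes> Id D A \<boxtimes> FA F \<phi>)
    \<longleftrightarrow> \<tau> \<cdot> (Id D A \<boxtimes> FA F \<phi>) = (FA F \<phi> \<boxtimes> Id D B) \<cdot> \<sigma>" (is "?l = ?r \<longleftrightarrow> _")
proof -
  have [simp]: "X \<in> Obj C" "Y \<in> Obj C" using C.arr_obj[of \<phi>] by simp_all
  have "?l = (FA F (Ev C X) \<boxtimes> Id D B) \<cdot> ((Id D (FO F (Dual C X)) \<boxtimes> \<sigma>) \<cdot> (FA F (dual_map C \<phi>) \<boxtimes> Id D (A \<otimes> FO F X)))"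
    by (simp add: untranspose_def D.slices)
  also have "(Id D (FO F (Dual C X)) \<boxtimes> \<sigma>) \<cdot> (FA F (dual_map C \<phi>) \<boxtimes> Id D (A \<otimes> FO F X))
      = (FA F (dual_map C \<phi>) \<boxtimes> Id D (FO F X \<otimes> B)) \<cdot> (Id D (FO F (Dual C Y)) \<boxtimes> \<sigma>)"
    by (rule D.exchange[symmetric]) simp_all
  also have "(FA F (Ev C X) \<boxtimes> Id D B) \<cdot> \<dots>
      = (FA F (Ev C X \<cdot>\<^bsub>C\<^esub> (dual_map C \<phi> \<boxtimes>\<^bsub>C\<^esub> Id C X)) \<boxtimes> Id D B) \<cdot> (Id D (FO F (Dual C Y)) \<boxtimes> \<sigma>)"
    by (simp add: FA_simps D.slices)
  also have "\<dots> = untranspose B Y ((FA F \<phi> \<boxtimes> Id D B) \<cdot> \<sigma>)"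
    by (simp add: C.ev_dual_map[of \<phi> X Y] FA_simps untranspose_def D.slices)
  finally have l: "?l = untranspose B Y ((FA F \<phi> \<boxtimes> Id D B) \<cdot> \<sigma>)" .
  have r: "?r = untranspose B Y (\<tau> \<cdot> (Id D A \<boxtimes> FA F \<phi>))"
    by (simp add: untranspose_def D.slices)
  have "untranspose B Y (\<tau> \<cdot> (Id D A \<boxtimes> FA F \<phi>)) = untranspose B Y ((FA F \<phi> \<boxtimes> Id D B) \<cdot> \<sigma>)
      \<longleftrightarrow> \<tau> \<cdot> (Id D A \<boxtimes> FA F \<phi>) = (FA F \<phi> \<boxtimes> Id D B) \<cdot> \<sigma>"
    by (rule untranspose_inject) simp_all
  then show ?thesis unfolding l r by metis
qed

lemma dinatural_untranspose:
  assumes "natural A (Unit D) B \<tau>"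
  shows "dinatural A B (\<lambda>X. untranspose B X (\<tau> X))"
proof -
  note [simp] = naturalD[OF assms]
  show ?thesis
    unfolding dinatural_def
  proof (intro conjI ballI)
    fix X Y \<phi> assume XY: "X \<in> Obj C" "Y \<in> Obj C" and "\<phi> \<in> Hom C X Y"
    then have \<phi>: "\<phi> \<in> Arr C" "Dom C \<phi> = X" "Cod C \<phi> = Y" by (auto simp: hom_iff)
    show "untranspose B X (\<tau> X) \<cdot> (FA F (dual_map C \<phi>) \<boxtimes> Id D A \<boxtimes> Id D (FO F X))
      = untranspose B Y (\<tau> Y) \<cdot> (Id D (FO F (Dual C Y)) \<boxtimes> Id D A \<boxtimes> FA F \<phi>)"
      using naturalD(7)[OF assms \<phi>(1)] \<phi> XY by (subst dinatural_iff_natural) simp_all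
  qed (simp_all add: hom_iff coend_body_def)
qed

lemma natural_transpose:
  assumes j: "dinatural A B j" and A [simp]: "A \<in> Obj D"
  shows "natural A (Unit D) B (\<lambda>X. transpose A X (j X))"
proof -
  have B [simp]: "B \<in> Obj D" using j by (simp add: dinatural_def)
  have jX [simp]: "j X \<in> Arr D" "Dom D (j X) = coend_body A X" "Cod D (j X) = B" if "X \<in> Obj C" for X
    using j that by (auto simp: dinatural_def hom_iff)
  have [simp]: "untranspose B X (transpose A X (j X)) = j X" if "X \<in> Obj C" for X
    by (rule untranspose_transpose) (use that in simp_all)
  show ?thesis
    unfolding natural_def
  proof (intro conjI ballI)
    fix \<phi> assume \<phi> [simp]: "\<phi> \<in> Arr C"
    let ?X = "Dom C \<phi>" and ?Y = "Cod C \<phi>"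
    have "j ?X \<cdot> (FA F (dual_map C \<phi>) \<boxtimes> Id D A \<boxtimes> Id D (FO F ?X)) =
        j ?Y \<cdot> (Id D (FO F (Dual C ?Y)) \<boxtimes> Id D A \<boxtimes> FA F \<phi>)"
      using j unfolding dinatural_def by (auto simp: hom_iff)
    then have "transpose A ?Y (j ?Y) \<cdot> (Id D A \<boxtimes> FA F \<phi>) = (FA F \<phi> \<boxtimes> Id D B) \<cdot> transpose A ?X (j ?X)"
      by (intro dinatural_iff_natural[where X = ?X and Y = ?Y, THEN iffD1]) simp_all
    then show "transpose A ?Y (j ?Y) \<cdot> (Id D A \<boxtimes> FA F \<phi> \<boxtimes> Id D (Unit D)) = (FA F \<phi> \<boxtimes> Id D B) \<cdot> transpose A ?X (j ?X)"
      by simp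
  qed simp_all
qed

text \<open>The coend property after transposition; \<open>is_coend_untranspose\<close> and
  \<open>universal_transpose\<close> pass between the two forms. Existence is proved in this
  form.\<close>

definition universal :: "'p \<Rightarrow> 'p \<Rightarrow> ('o \<Rightarrow> 'q) \<Rightarrow> bool" where
  "universal A T \<theta> \<longleftrightarrow> natural A (Unit D) T \<theta> \<and>
     (\<forall>B \<tau>. natural A (Unit D) B \<tau> \<longrightarrow>
       (\<exists>!t. t \<in> Hom D T B \<and> (\<forall>X\<in>Obj C. (Id D (FO F X) \<boxtimes> t) \<cdot> \<theta> X = \<tau> X)))"

lemma is_coend_untranspose:
  assumes "universal A T \<theta>"
  shows "is_coend A T (\<lambda>X. untranspose T X (\<theta> X))"
  unfolding is_coend_def
proof (intro conjI allI impI)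
  have nat: "natural A (Unit D) T \<theta>" using assms by (simp add: universal_def)
  note [simp] = naturalD[OF nat]
  show "dinatural A T (\<lambda>X. untranspose T X (\<theta> X))" by (rule dinatural_untranspose[OF nat])
  fix B j assume j: "dinatural A B j"
  have B [simp]: "B \<in> Obj D" using j by (simp add: dinatural_def)
  have jX [simp]: "j X \<in> Arr D" "Dom D (j X) = coend_body A X" "Cod D (j X) = B" if "X \<in> Obj C" for X
    using j that by (auto simp: dinatural_def hom_iff)
  have "(t \<cdot> untranspose T X (\<theta> X) = j X) \<longleftrightarrow> ((Id D (FO F X) \<boxtimes> t) \<cdot> \<theta> X = transpose A X (j X))"
    if t: "t \<in> Hom D T B" and X: "X \<in> Obj C" for t X
  proof -
    note [simp] = t[unfolded hom_iff] X
    have "t \<cdot> untranspose T X (\<theta> X) = untranspose B X ((Id D (FO F X) \<boxtimes> t) \<cdot> \<theta> X)"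
      by (rule untranspose_post[symmetric]) simp_all
    moreover have "untranspose B X (transpose A X (j X)) = j X"
      by (rule untranspose_transpose) simp_all
    moreover have "untranspose B X ((Id D (FO F X) \<boxtimes> t) \<cdot> \<theta> X) = untranspose B X (transpose A X (j X))
        \<longleftrightarrow> (Id D (FO F X) \<boxtimes> t) \<cdot> \<theta> X = transpose A X (j X)"
      by (rule untranspose_inject) simp_all
    ultimately show ?thesis by metis
  qed
  moreover have "\<exists>!t. t \<in> Hom D T B \<and> (\<forall>X\<in>Obj C. (Id D (FO F X) \<boxtimes> t) \<cdot> \<theta> X = transpose A X (j X))"
    using assms natural_transpose[OF j naturalD(1)[OF nat]] unfolding universal_def by blast
  ultimately show "\<exists>!t. t \<in> Hom D T B \<and> (\<forall>X\<in>Obj C. t \<cdot> untranspose T X (\<theta> X) = j X)"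
    by (rule ex1_ball_cong)
qed

lemma universal_transpose:
  assumes j: "is_coend A T j" and A [simp]: "A \<in> Obj D"
  shows "universal A T (\<lambda>X. transpose A X (j X))"
  unfolding universal_def
proof (intro conjI allI impI)
  have din: "dinatural A T j" using j by (simp add: is_coend_def)
  have T [simp]: "T \<in> Obj D" using din by (simp add: dinatural_def)
  have jX [simp]: "j X \<in> Arr D" "Dom D (j X) = coend_body A X" "Cod D (j X) = T" if "X \<in> Obj C" for X
    using din that by (auto simp: dinatural_def hom_iff)
  show "natural A (Unit D) T (\<lambda>X. transpose A X (j X))" by (rule natural_transpose[OF din A])
  fix B \<tau> assume nat: "natural A (Unit D) B \<tau>"
  note [simp] = naturalD[OF nat]
  have iff: "(t \<cdot> j X = untranspose B X (\<tau> X)) \<longleftrightarrow> ((Id D (FO F X) \<boxtimes> t) \<cdot> transpose A X (j X) = \<tau> X)"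
    if t: "t \<in> Hom D T B" and X: "X \<in> Obj C" for t X
  proof -
    note [simp] = t[unfolded hom_iff] X
    have "t \<cdot> j X = t \<cdot> untranspose T X (transpose A X (j X))"
      by (subst untranspose_transpose) simp_all
    also have "\<dots> = untranspose B X ((Id D (FO F X) \<boxtimes> t) \<cdot> transpose A X (j X))"
      by (rule untranspose_post[symmetric]) simp_all
    finally have "t \<cdot> j X = untranspose B X ((Id D (FO F X) \<boxtimes> t) \<cdot> transpose A X (j X))" .
    moreover have "untranspose B X ((Id D (FO F X) \<boxtimes> t) \<cdot> transpose A X (j X)) = untranspose B X (\<tau> X)
        \<longleftrightarrow> (Id D (FO F X) \<boxtimes> t) \<cdot> transpose A X (j X) = \<tau> X"
      by (rule untranspose_inject) simp_all
    ultimately show ?thesis by metis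
  qed
  have "\<exists>!t. t \<in> Hom D T B \<and> (\<forall>X\<in>Obj C. t \<cdot> j X = untranspose B X (\<tau> X))"
    using j dinatural_untranspose[OF nat] unfolding is_coend_def by blast
  then show "\<exists>!t. t \<in> Hom D T B \<and> (\<forall>X\<in>Obj C. (Id D (FO F X) \<boxtimes> t) \<cdot> transpose A X (j X) = \<tau> X)"
    by (rule ex1_ball_cong[OF iff[symmetric], rotated 2])
qed

section \<open>Existence of the coend\<close>

definition tens_functor :: "'p \<Rightarrow> ('o, 'm, 'p, 'q) functr" where
  "tens_functor A = \<lparr>FO = \<lambda>X. A \<otimes> FO F X, FA = \<lambda>f. Id D A \<boxtimes> FA F f\<rparr>"

lemma tens_functor_simps [simp]:
  "FO (tens_functor A) X = A \<otimes> FO F X" "FA (tens_functor A) f = Id D A \<boxtimes> FA F f"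
  by (simp_all add: tens_functor_def)

text \<open>F carries a short exact sequence to a short exact one, and tensoring with A keeps its
  cokernel by \<open>tens_cokernel_left\<close>.\<close>

lemma tens_functor_right_exact:
  assumes [simp]: "A \<in> Obj D" and P: "finite_generator C P"
  shows "generated_right_exact C D (tens_functor A) P"
proof unfold_locales
  show "is_cokernel D (FA (tens_functor A) p) (FA (tens_functor A) i)" if "short_exact C i p" for i p
    using that exact by (auto simp: exact_functor_def short_exact_def intro: D.tens_cokernel_left)
qed (auto simp: P hom_iff FA_id D.tens_id_simps D.slices F.map_comp F.map_add F.map_scale D.tens_add D.tens_scale_right)

text \<open>The coend over the single object \<open>P\<close> is a cokernel, because \<open>End(P)\<close> is spanned by a finite set.
  The component at \<open>X\<close> of its universal family is the unique extension of
  \<open>p \<mapsto> (F(p) \<otimes> 1) \<theta>\<^sub>P\<close> along the generator.\<close>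

lemma universal_exists:
  assumes A [simp]: "A \<in> Obj D"
  shows "\<exists>T \<theta>. universal A T \<theta>"
proof -
  obtain P where P: "finite_generator C P" using finite_category_generator[OF finite] by blast
  interpret E: generated_right_exact C D "tens_functor A" P
    by (rule tens_functor_right_exact[OF A P])
  have PO [simp]: "P \<in> Obj C" by (rule E.P_obj)
  obtain S where S: "finite S" "S \<subseteq> Hom C P P" "Hom C P P \<subseteq> hom_span C P P S"
    using P unfolding finite_generator_def by blast
  define H where "H = coend_body A P"
  have H [simp]: "H \<in> Obj D" by (simp add: H_def coend_body_def)
  \<comment> \<open>For an endomorphism a of P, \<open>l a\<close> and \<open>r a\<close> are the
    two arrows that a dinatural family has to equalize, and \<open>d a\<close> is their
    difference.\<close>
  define l where "l a = FA F (dual_map C a) \<boxtimes> Id D A \<boxtimes> Id D (FO F P)" for a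
  define r where "r a = Id D (FO F (Dual C P)) \<boxtimes> Id D A \<boxtimes> FA F a" for a
  define d where "d a = Add D (l a) (Scale D (- 1) (r a))" for a
  have lr [simp]: "l a \<in> Arr D" "Dom D (l a) = H" "Cod D (l a) = H" "r a \<in> Arr D" "Dom D (r a) = H" "Cod D (r a) = H"
    "d a \<in> Arr D" "Dom D (d a) = H" "Cod D (d a) = H"
    if "a \<in> Hom C P P" for a
    using that by (auto simp: l_def r_def d_def H_def coend_body_def hom_iff)
  have kill: "t \<cdot> d a = Zero D H T \<longleftrightarrow> t \<cdot> l a = t \<cdot> r a" if "t \<in> Hom D H T" "a \<in> Hom C P P" for t T a
    using that D.add_eq_zero_iff[of "t \<cdot> l a" "t \<cdot> r a"]
    by (auto simp: d_def hom_iff D.add_comp D.scale_comp)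
  \<comment> \<open>T is the quotient of F(P') \<otimes> A \<otimes> F(P), with P' the dual of P, by
    the differences \<open>d a\<close>. Letting a run through the finite spanning set S makes this a
    finite cokernel.\<close>
  obtain T q where q: "q \<in> Hom D H T" "is_epi D q" "\<And>a. a \<in> S \<Longrightarrow> q \<cdot> d a = Zero D H T"
    and q_univ: "\<And>T' t. t \<in> Hom D H T' \<Longrightarrow> (\<And>a. a \<in> S \<Longrightarrow> t \<cdot> d a = Zero D H T') \<Longrightarrow> \<exists>u\<in>Hom D T T'. u \<cdot> q = t"
  proof -
    have SP: "a \<in> Hom C P P" if "a \<in> S" for a using S(2) that by blast
    have "\<exists>T q. q \<in> Hom D H T \<and> is_epi D q \<and> (\<forall>r\<in>d ` S. q \<cdot> r = Zero D (Dom D r) T) \<and>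
      (\<forall>T' t. t \<in> Hom D H T' \<longrightarrow> (\<forall>r\<in>d ` S. t \<cdot> r = Zero D (Dom D r) T') \<longrightarrow> (\<exists>u\<in>Hom D T T'. u \<cdot> q = t))"
      by (rule D.simultaneous_cokernel) (use S(1) SP in auto)
    then show ?thesis using that SP by (simp add: ball_simps lr) blast
  qed
  note q_ty [simp] = q(1)[unfolded hom_iff]
  have T [simp]: "T \<in> Obj D" using D.hom_obj[OF q(1)] by simp
  define \<theta>P where "\<theta>P = transpose A P q"
  have \<theta>P [simp]: "\<theta>P \<in> Arr D" "Dom D \<theta>P = A \<otimes> FO F P" "Cod D \<theta>P = FO F P \<otimes> T"
    by (simp_all add: \<theta>P_def H_def[symmetric])
  have un\<theta>P: "untranspose T P \<theta>P = q"
    unfolding \<theta>P_def by (rule untranspose_transpose) (simp_all add: H_def[symmetric])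
  have nat_S: "\<theta>P \<cdot> (Id D A \<boxtimes> FA F a) = (FA F a \<boxtimes> Id D T) \<cdot> \<theta>P" if a: "a \<in> S" for a
  proof -
    have a': "a \<in> Hom C P P" using a S(2) by blast
    note [simp] = a'[unfolded hom_iff]
    have "q \<cdot> l a = q \<cdot> r a" using q(3)[OF a] kill[OF q(1) a'] by simp
    then have "untranspose T P \<theta>P \<cdot> (FA F (dual_map C a) \<boxtimes> Id D A \<boxtimes> Id D (FO F P))
        = untranspose T P \<theta>P \<cdot> (Id D (FO F (Dual C P)) \<boxtimes> Id D A \<boxtimes> FA F a)"
      unfolding un\<theta>P l_def r_def .
    then show ?thesis by (intro dinatural_iff_natural[THEN iffD1]) simp_all
  qed
  \<comment> \<open>Both sides are linear in a, so naturality extends from S to all endomorphisms of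
    P.\<close>
  have nat_P: "\<theta>P \<cdot> (Id D A \<boxtimes> FA F a) = (FA F a \<boxtimes> Id D T) \<cdot> \<theta>P" if "a \<in> Hom C P P" for a
  proof -
    have "a \<in> Hom C P P \<and> \<theta>P \<cdot> (Id D A \<boxtimes> FA F a) = (FA F a \<boxtimes> Id D T) \<cdot> \<theta>P" if "a \<in> hom_span C P P S" for a
      using that
    proof induction
      case zero
      then show ?case by (simp add: hom_iff F.map_zero)
    next
      case (add s h c)
      have s: "s \<in> Hom C P P" using add(1) S(2) by blast
      note [simp] = s[unfolded hom_iff] add.IH[THEN conjunct1, unfolded hom_iff]
      show ?case
        using nat_S[OF add(1)] add.IH
        by (simp add: hom_iff F.map_add F.map_scale D.tens_add D.tens_scale D.add_comp D.scale_comp)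
    qed
    then show ?thesis using that S(3) by blast
  qed
  \<comment> \<open>Naturality at p : P \<rightarrow> X forces this value for the composite of the
    component at X with 1 \<otimes> F(p). That the values form a family is naturality at the
    endomorphisms of P.\<close>
  define u where "u p = (FA F p \<boxtimes> Id D T) \<cdot> \<theta>P" for p
  have fam: "E.family (FO F X \<otimes> T) X u" if [simp]: "X \<in> Obj C" for X
    unfolding E.family_def u_def
  proof (intro conjI ballI)
    fix p a assume p: "p \<in> Hom C P X" and a: "a \<in> Hom C P P"
    note [simp] = p[unfolded hom_iff] a[unfolded hom_iff]
    have "(FA F (p \<cdot>\<^bsub>C\<^esub> a) \<boxtimes> Id D T) \<cdot> \<theta>P = (FA F p \<boxtimes> Id D T) \<cdot> ((FA F a \<boxtimes> Id D T) \<cdot> \<theta>P)"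
      by (simp add: F.map_comp D.slices)
    also have "\<dots> = ((FA F p \<boxtimes> Id D T) \<cdot> \<theta>P) \<cdot> (Id D A \<boxtimes> FA F a)"
      unfolding nat_P[OF a, symmetric] by (simp add: D.assoc)
    finally show "(FA F (p \<cdot>\<^bsub>C\<^esub> a) \<boxtimes> Id D T) \<cdot> \<theta>P = ((FA F p \<boxtimes> Id D T) \<cdot> \<theta>P) \<cdot> FA (tens_functor A) a" by simp
  qed (auto simp: hom_iff F.map_add D.tens_add D.add_comp)
  have "\<forall>X\<in>Obj C. \<exists>v. v \<in> Hom D (A \<otimes> FO F X) (FO F X \<otimes> T) \<and>
      (\<forall>p\<in>Hom C P X. v \<cdot> (Id D A \<boxtimes> FA F p) = (FA F p \<boxtimes> Id D T) \<cdot> \<theta>P)"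
    using E.family_extension[OF _ fam, THEN ex1_implies_ex] by (simp add: u_def)
  then obtain \<theta> where \<theta>: "\<And>X. X \<in> Obj C \<Longrightarrow> \<theta> X \<in> Hom D (A \<otimes> FO F X) (FO F X \<otimes> T)"
    "\<And>X p. \<lbrakk>X \<in> Obj C; p \<in> Hom C P X\<rbrakk> \<Longrightarrow> \<theta> X \<cdot> (Id D A \<boxtimes> FA F p) = (FA F p \<boxtimes> Id D T) \<cdot> \<theta>P"
    by (metis (no_types, lifting))
  have \<theta>_ty [simp]: "\<theta> X \<in> Arr D" "Dom D (\<theta> X) = A \<otimes> FO F X" "Cod D (\<theta> X) = FO F X \<otimes> T" if "X \<in> Obj C" for X
    using \<theta>(1)[OF that] by (simp_all add: hom_iff)
  have \<theta>_P: "\<theta> P = \<theta>P" using \<theta>(2)[OF PO C.id_hom[OF PO]] by (simp add: FA_id D.tens_id_simps)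
  have uniq: "v = v'" if "X \<in> Obj C" "v \<in> Hom D (A \<otimes> FO F X) T'" "v' \<in> Hom D (A \<otimes> FO F X) T'"
    "\<And>p. p \<in> Hom C P X \<Longrightarrow> v \<cdot> (Id D A \<boxtimes> FA F p) = v' \<cdot> (Id D A \<boxtimes> FA F p)" for X v v' T'
    by (rule E.family_unique[OF that(1), of v T' v']) (use that(2-) in simp_all)
  have nat: "natural A (Unit D) T \<theta>"
    unfolding natural_def
  proof (intro conjI ballI)
    fix \<phi> assume \<phi> [simp]: "\<phi> \<in> Arr C"
    have "\<theta> (Cod C \<phi>) \<cdot> (Id D A \<boxtimes> FA F \<phi>) = (FA F \<phi> \<boxtimes> Id D T) \<cdot> \<theta> (Dom C \<phi>)"
    proof (rule uniq[of "Dom C \<phi>" _ "FO F (Cod C \<phi>) \<otimes> T"])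
      fix p assume p: "p \<in> Hom C P (Dom C \<phi>)"
      note [simp] = p[unfolded hom_iff]
      have \<phi>p: "\<phi> \<cdot>\<^bsub>C\<^esub> p \<in> Hom C P (Cod C \<phi>)" by (simp add: hom_iff)
      have "(\<theta> (Cod C \<phi>) \<cdot> (Id D A \<boxtimes> FA F \<phi>)) \<cdot> (Id D A \<boxtimes> FA F p) = \<theta> (Cod C \<phi>) \<cdot> (Id D A \<boxtimes> FA F (\<phi> \<cdot>\<^bsub>C\<^esub> p))"
        by (simp add: F.map_comp D.slices)
      also have "\<dots> = (FA F (\<phi> \<cdot>\<^bsub>C\<^esub> p) \<boxtimes> Id D T) \<cdot> \<theta>P" by (rule \<theta>(2)[OF _ \<phi>p]) simp
      also have "\<dots> = (FA F \<phi> \<boxtimes> Id D T) \<cdot> ((FA F p \<boxtimes> Id D T) \<cdot> \<theta>P)" by (simp add: F.map_comp D.slices)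
      also have "(FA F p \<boxtimes> Id D T) \<cdot> \<theta>P = \<theta> (Dom C \<phi>) \<cdot> (Id D A \<boxtimes> FA F p)"
        by (rule \<theta>(2)[OF _ p, symmetric]) simp
      finally show "(\<theta> (Cod C \<phi>) \<cdot> (Id D A \<boxtimes> FA F \<phi>)) \<cdot> (Id D A \<boxtimes> FA F p)
          = ((FA F \<phi> \<boxtimes> Id D T) \<cdot> \<theta> (Dom C \<phi>)) \<cdot> (Id D A \<boxtimes> FA F p)"
        by (simp add: D.assoc)
    qed (simp_all add: hom_iff)
    then show "\<theta> (Cod C \<phi>) \<cdot> (Id D A \<boxtimes> FA F \<phi> \<boxtimes> Id D (Unit D)) = (FA F \<phi> \<boxtimes> Id D T) \<cdot> \<theta> (Dom C \<phi>)"
      by simp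
  qed simp_all
  have "\<exists>!t. t \<in> Hom D T B \<and> (\<forall>X\<in>Obj C. (Id D (FO F X) \<boxtimes> t) \<cdot> \<theta> X = \<tau> X)"
    if \<tau>: "natural A (Unit D) B \<tau>" for B \<tau>
  proof -
    note [simp] = naturalD(3-6)[OF \<tau>]
    let ?j = "untranspose B P (\<tau> P)"
    have j: "?j \<in> Hom D H B" by (simp add: hom_iff H_def coend_body_def)
    have "?j \<cdot> d a = Zero D H B" if "a \<in> S" for a
    proof -
      have a: "a \<in> Hom C P P" using that S(2) by blast
      note [simp] = a[unfolded hom_iff]
      have "\<tau> P \<cdot> (Id D A \<boxtimes> FA F a) = (FA F a \<boxtimes> Id D B) \<cdot> \<tau> P" using naturalD(7)[OF \<tau>, of a] by simp
      then have "?j \<cdot> l a = ?j \<cdot> r a"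
        unfolding l_def r_def by (intro dinatural_iff_natural[THEN iffD2]) simp_all
      then show ?thesis using kill[OF j a] by simp
    qed
    then obtain t where t: "t \<in> Hom D T B" "t \<cdot> q = ?j" using q_univ[OF j] by blast
    \<comment> \<open>At the generator the required equation says that t' factors the untransposed
      component through q. The other components then agree by uniqueness along P.\<close>
    have P_iff: "(Id D (FO F P) \<boxtimes> t') \<cdot> \<theta>P = \<tau> P \<longleftrightarrow> t' \<cdot> q = ?j" if t': "t' \<in> Hom D T B" for t'
    proof -
      note [simp] = t'[unfolded hom_iff]
      have "untranspose B P ((Id D (FO F P) \<boxtimes> t') \<cdot> \<theta>P) = t' \<cdot> untranspose T P \<theta>P"
        by (rule untranspose_post) simp_all
      moreover have "untranspose B P ((Id D (FO F P) \<boxtimes> t') \<cdot> \<theta>P) = ?j \<longleftrightarrow> (Id D (FO F P) \<boxtimes> t') \<cdot> \<theta>P = \<tau> P"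
        by (rule untranspose_inject) simp_all
      ultimately show ?thesis unfolding un\<theta>P by metis
    qed
    have "(Id D (FO F X) \<boxtimes> t) \<cdot> \<theta> X = \<tau> X" if X [simp]: "X \<in> Obj C" for X
    proof (rule uniq[OF X, of _ "FO F X \<otimes> B"])
      note [simp] = t(1)[unfolded hom_iff]
      show "(Id D (FO F X) \<boxtimes> t) \<cdot> \<theta> X \<in> Hom D (A \<otimes> FO F X) (FO F X \<otimes> B)" by (simp add: hom_iff)
      show "\<tau> X \<in> Hom D (A \<otimes> FO F X) (FO F X \<otimes> B)" by (simp add: hom_iff)
      fix p assume p: "p \<in> Hom C P X"
      note [simp] = p[unfolded hom_iff]
      have "((Id D (FO F X) \<boxtimes> t) \<cdot> \<theta> X) \<cdot> (Id D A \<boxtimes> FA F p) = (Id D (FO F X) \<boxtimes> t) \<cdot> (FA F p \<boxtimes> Id D T) \<cdot> \<theta>P"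
        using \<theta>(2)[OF X p] by (simp add: D.assoc)
      also have "\<dots> = ((Id D (FO F X) \<boxtimes> t) \<cdot> (FA F p \<boxtimes> Id D T)) \<cdot> \<theta>P" by (simp add: D.assoc)
      also have "(Id D (FO F X) \<boxtimes> t) \<cdot> (FA F p \<boxtimes> Id D T) = (FA F p \<boxtimes> Id D B) \<cdot> (Id D (FO F P) \<boxtimes> t)"
        by (rule D.exchange[symmetric]) simp_all
      also have "\<dots> \<cdot> \<theta>P = (FA F p \<boxtimes> Id D B) \<cdot> \<tau> P"
        using P_iff[OF t(1)] t(2) by (simp add: D.assoc)
      also have "\<dots> = \<tau> X \<cdot> (Id D A \<boxtimes> FA F p)" using naturalD(7)[OF \<tau>, of p] by simp
      finally show "((Id D (FO F X) \<boxtimes> t) \<cdot> \<theta> X) \<cdot> (Id D A \<boxtimes> FA F p) = \<tau> X \<cdot> (Id D A \<boxtimes> FA F p)" .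
    qed
    moreover have "t' = t" if t': "t' \<in> Hom D T B" and eq: "\<forall>X\<in>Obj C. (Id D (FO F X) \<boxtimes> t') \<cdot> \<theta> X = \<tau> X" for t'
    proof -
      have "t' \<cdot> q = t \<cdot> q" using P_iff[OF t'] eq t(2) \<theta>_P PO by metis
      then show ?thesis
        using q(2) t(1) t' q_ty D.hom_obj[OF t'] unfolding is_epi_def by metis
    qed
    ultimately show ?thesis using t(1) by (intro ex1I[of _ t]) blast+
  qed
  with nat have "universal A T \<theta>" by (simp add: universal_def)
  then show ?thesis by blast
qed

section \<open>The chosen coend and its universal natural family\<close>

lemma coend_choice:
  assumes "A \<in> Obj D"
  shows "is_coend A (ZO A) (\<lambda>X. din X A)"
proof -
  obtain T \<theta> where "universal A T \<theta>" using universal_exists[OF assms] by blast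
  then have "is_coend A T (\<lambda>X. untranspose T X (\<theta> X))" by (rule is_coend_untranspose)
  then have "case coend_choice A of (T, j) \<Rightarrow> is_coend A T j"
    unfolding coend_choice_def
    by (intro someI[of "\<lambda>(T, j). is_coend A T j" "(T, \<lambda>X. untranspose T X (\<theta> X))"]) simp
  then show ?thesis by (simp add: ZO_def din_def case_prod_beta)
qed

definition theta :: "'o \<Rightarrow> 'p \<Rightarrow> 'q" where
  "theta X A = transpose A X (din X A)"

lemma universal_theta: "A \<in> Obj D \<Longrightarrow> universal A (ZO A) (\<lambda>X. theta X A)"
  unfolding theta_def by (intro universal_transpose coend_choice)

lemma ZO_obj [simp]: "A \<in> Obj D \<Longrightarrow> ZO A \<in> Obj D"
  using universal_theta naturalD(3) unfolding universal_def by blast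

lemma theta_natural: "A \<in> Obj D \<Longrightarrow> natural A (Unit D) (ZO A) (\<lambda>X. theta X A)"
  using universal_theta unfolding universal_def by blast

lemma theta_typing [simp]:
  assumes "A \<in> Obj D" "X \<in> Obj C"
  shows "theta X A \<in> Arr D" "Dom D (theta X A) = A \<otimes> FO F X" "Cod D (theta X A) = FO F X \<otimes> ZO A"
  using naturalD(4-6)[OF theta_natural[OF assms(1)] assms(2)] assms by simp_all

lemma din_typing [simp]:
  assumes "A \<in> Obj D" "X \<in> Obj C"
  shows "din X A \<in> Arr D" "Dom D (din X A) = coend_body A X" "Cod D (din X A) = ZO A"
  using coend_choice[OF assms(1)] assms(2) by (auto simp: is_coend_def dinatural_def hom_iff)

lemma din_theta:
  assumes "A \<in> Obj D" "X \<in> Obj C"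
  shows "din X A = untranspose (ZO A) X (theta X A)"
  unfolding theta_def by (rule untranspose_transpose[symmetric]) (use assms in simp_all)

lemma theta_factor:
  assumes "natural A (Unit D) B \<tau>"
  shows "\<exists>!t. t \<in> Hom D (ZO A) B \<and> (\<forall>X\<in>Obj C. (Id D (FO F X) \<boxtimes> t) \<cdot> theta X A = \<tau> X)"
  using universal_theta[OF naturalD(1)[OF assms]] assms unfolding universal_def by blast

text \<open>With this, an arrow out of Z(A) \<otimes> F(Y) is itself a solution of a factorization
  problem, so uniqueness of factorizations becomes a cancellation rule.\<close>

lemma natural_theta:
  assumes t [simp]: "t \<in> Arr D" "Dom D t = ZO A \<otimes> Q" "Cod D t = B" and [simp]: "A \<in> Obj D" "Q \<in> Obj D"
  shows "natural A Q B (\<lambda>X. (Id D (FO F X) \<boxtimes> t) \<cdot> (theta X A \<boxtimes> Id D Q))"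
  unfolding natural_def
proof (intro conjI ballI)
  show [simp]: "B \<in> Obj D" using D.arr_obj(2)[OF t(1)] by simp
  fix \<phi> assume [simp]: "\<phi> \<in> Arr C"
  let ?X = "Dom C \<phi>" and ?Y = "Cod C \<phi>"
  have "((Id D (FO F ?Y) \<boxtimes> t) \<cdot> (theta ?Y A \<boxtimes> Id D Q)) \<cdot> (Id D A \<boxtimes> FA F \<phi> \<boxtimes> Id D Q)
      = (Id D (FO F ?Y) \<boxtimes> t) \<cdot> ((theta ?Y A \<cdot> (Id D A \<boxtimes> FA F \<phi>)) \<boxtimes> Id D Q)"
    by (simp add: D.slices)
  also have "theta ?Y A \<cdot> (Id D A \<boxtimes> FA F \<phi>) = (FA F \<phi> \<boxtimes> Id D (ZO A)) \<cdot> theta ?X A"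
    using naturalD(7)[OF theta_natural, of A \<phi>] by simp
  also have "(Id D (FO F ?Y) \<boxtimes> t) \<cdot> (((FA F \<phi> \<boxtimes> Id D (ZO A)) \<cdot> theta ?X A) \<boxtimes> Id D Q)
      = ((Id D (FO F ?Y) \<boxtimes> t) \<cdot> (FA F \<phi> \<boxtimes> Id D (ZO A \<otimes> Q))) \<cdot> (theta ?X A \<boxtimes> Id D Q)"
    by (simp add: D.slices)
  also have "(Id D (FO F ?Y) \<boxtimes> t) \<cdot> (FA F \<phi> \<boxtimes> Id D (ZO A \<otimes> Q)) = (FA F \<phi> \<boxtimes> Id D B) \<cdot> (Id D (FO F ?X) \<boxtimes> t)"
    by (rule D.exchange[symmetric]) simp_all
  finally show "((Id D (FO F ?Y) \<boxtimes> t) \<cdot> (theta ?Y A \<boxtimes> Id D Q)) \<cdot> (Id D A \<boxtimes> FA F \<phi> \<boxtimes> Id D Q)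
      = (FA F \<phi> \<boxtimes> Id D B) \<cdot> (Id D (FO F ?X) \<boxtimes> t) \<cdot> (theta ?X A \<boxtimes> Id D Q)"
    by (simp add: D.assoc)
qed simp_all

text \<open>The parameter F(Y) is moved to the target by duality: arrows M \<otimes> F(Y)
  \<rightarrow> B are the same as arrows from M to B tensored with the dual of F(Y). This reduces to
  \<open>theta_factor\<close>. The version with parameter is needed because half-braidings of Z(A)
  are arrows out of Z(A) \<otimes> F(Y).\<close>

lemma theta_factor_tens:
  assumes nat: "natural A (FO F Y) B \<tau>" and Y [simp]: "Y \<in> Obj C"
  shows "\<exists>!t. t \<in> Hom D (ZO A \<otimes> FO F Y) B \<and>
    (\<forall>X\<in>Obj C. (Id D (FO F X) \<boxtimes> t) \<cdot> (theta X A \<boxtimes> Id D (FO F Y)) = \<tau> X)"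
proof -
  let ?Y = "FO F Y" and ?Y' = "FO F (Dual C Y)" and ?c = "FA F (Coev C Y)" and ?e = "FA F (Ev C Y)"
  interpret Y: dual_pair D ?Y ?Y' ?e ?c by (rule dual_pair_FO) fact
  note [simp] = naturalD(1-6)[OF nat]
  \<comment> \<open>The right transpose with respect to the duality of F(Y), for an arbitrary first
    factor A'.\<close>
  define hat where "hat A' t = (t \<boxtimes> Id D ?Y') \<cdot> (Id D A' \<boxtimes> ?c)" for A' t
  have nat': "natural A (Unit D) (B \<otimes> ?Y') (\<lambda>X. hat (A \<otimes> FO F X) (\<tau> X))"
    unfolding natural_def hat_def
  proof (intro conjI ballI)
    fix \<phi> assume [simp]: "\<phi> \<in> Arr C"
    let ?X1 = "Dom C \<phi>" and ?X2 = "Cod C \<phi>"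
    have "((\<tau> ?X2 \<boxtimes> Id D ?Y') \<cdot> (Id D (A \<otimes> FO F ?X2) \<boxtimes> ?c)) \<cdot> (Id D A \<boxtimes> FA F \<phi> \<boxtimes> Id D (Unit D))
        = (\<tau> ?X2 \<boxtimes> Id D ?Y') \<cdot> (Id D A \<boxtimes> ((Id D (FO F ?X2) \<boxtimes> ?c) \<cdot> FA F \<phi>))"
      by (simp add: D.slices)
    also have "(Id D (FO F ?X2) \<boxtimes> ?c) \<cdot> FA F \<phi> = (FA F \<phi> \<boxtimes> Id D (?Y \<otimes> ?Y')) \<cdot> (Id D (FO F ?X1) \<boxtimes> ?c)"
      using D.exchange[of "FA F \<phi>" ?c "FO F ?X1" "FO F ?X2" "Unit D" "?Y \<otimes> ?Y'"] by simp
    also have "(\<tau> ?X2 \<boxtimes> Id D ?Y') \<cdot> (Id D A \<boxtimes> \<dots>)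
        = ((\<tau> ?X2 \<cdot> (Id D A \<boxtimes> FA F \<phi> \<boxtimes> Id D ?Y)) \<boxtimes> Id D ?Y') \<cdot> (Id D (A \<otimes> FO F ?X1) \<boxtimes> ?c)"
      by (simp add: D.slices)
    also have "\<tau> ?X2 \<cdot> (Id D A \<boxtimes> FA F \<phi> \<boxtimes> Id D ?Y) = (FA F \<phi> \<boxtimes> Id D B) \<cdot> \<tau> ?X1"
      by (rule naturalD(7)[OF nat]) simp
    finally show "((\<tau> ?X2 \<boxtimes> Id D ?Y') \<cdot> (Id D (A \<otimes> FO F ?X2) \<boxtimes> ?c)) \<cdot> (Id D A \<boxtimes> FA F \<phi> \<boxtimes> Id D (Unit D))
        = (FA F \<phi> \<boxtimes> Id D (B \<otimes> ?Y')) \<cdot> (\<tau> ?X1 \<boxtimes> Id D ?Y') \<cdot> (Id D (A \<otimes> FO F ?X1) \<boxtimes> ?c)"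
      by (simp add: D.slices)
  qed simp_all
  have iff: "(Id D (FO F X) \<boxtimes> t) \<cdot> (theta X A \<boxtimes> Id D ?Y) = \<tau> X
      \<longleftrightarrow> (Id D (FO F X) \<boxtimes> hat (ZO A) t) \<cdot> theta X A = hat (A \<otimes> FO F X) (\<tau> X)"
    if t: "t \<in> Hom D (ZO A \<otimes> ?Y) B" and X [simp]: "X \<in> Obj C" for t X
  proof -
    note [simp] = t[unfolded hom_iff]
    have "hat (A \<otimes> FO F X) ((Id D (FO F X) \<boxtimes> t) \<cdot> (theta X A \<boxtimes> Id D ?Y))
        = (Id D (FO F X) \<boxtimes> t \<boxtimes> Id D ?Y') \<cdot> ((theta X A \<boxtimes> Id D (?Y \<otimes> ?Y')) \<cdot> (Id D (A \<otimes> FO F X) \<boxtimes> ?c))"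
      by (simp add: hat_def D.slices)
    also have "(theta X A \<boxtimes> Id D (?Y \<otimes> ?Y')) \<cdot> (Id D (A \<otimes> FO F X) \<boxtimes> ?c) = (Id D (FO F X \<otimes> ZO A) \<boxtimes> ?c) \<cdot> theta X A"
      using D.exchange[of "theta X A" ?c "A \<otimes> FO F X" "FO F X \<otimes> ZO A" "Unit D" "?Y \<otimes> ?Y'"] by simp
    also have "(Id D (FO F X) \<boxtimes> t \<boxtimes> Id D ?Y') \<cdot> \<dots> = (Id D (FO F X) \<boxtimes> hat (ZO A) t) \<cdot> theta X A"
      by (simp add: hat_def D.slices)
    finally have 1: "hat (A \<otimes> FO F X) ((Id D (FO F X) \<boxtimes> t) \<cdot> (theta X A \<boxtimes> Id D ?Y))
        = (Id D (FO F X) \<boxtimes> hat (ZO A) t) \<cdot> theta X A" .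
    have "(Id D (FO F X) \<boxtimes> t) \<cdot> (theta X A \<boxtimes> Id D ?Y) = \<tau> X"
      if "hat (A \<otimes> FO F X) ((Id D (FO F X) \<boxtimes> t) \<cdot> (theta X A \<boxtimes> Id D ?Y)) = hat (A \<otimes> FO F X) (\<tau> X)"
      by (rule Y.transpose_right_cancel[OF that[unfolded hat_def]]) simp_all
    then show ?thesis using 1 by metis
  qed
  obtain t0 where t0: "t0 \<in> Hom D (ZO A) (B \<otimes> ?Y')"
    "\<And>X. X \<in> Obj C \<Longrightarrow> (Id D (FO F X) \<boxtimes> t0) \<cdot> theta X A = hat (A \<otimes> FO F X) (\<tau> X)"
    and uniq: "\<And>t1. \<lbrakk>t1 \<in> Hom D (ZO A) (B \<otimes> ?Y');
      \<forall>X\<in>Obj C. (Id D (FO F X) \<boxtimes> t1) \<cdot> theta X A = hat (A \<otimes> FO F X) (\<tau> X)\<rbrakk> \<Longrightarrow> t1 = t0"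
    using theta_factor[OF nat'] by blast
  note [simp] = t0(1)[unfolded hom_iff]
  define t where "t = (Id D B \<boxtimes> ?e) \<cdot> (t0 \<boxtimes> Id D ?Y)"
  have t: "t \<in> Hom D (ZO A \<otimes> ?Y) B" by (simp add: t_def hom_iff)
  have hat_t: "hat (ZO A) t = t0"
    unfolding hat_def t_def by (rule Y.transpose_right_inv') simp_all
  have "(Id D (FO F X) \<boxtimes> t) \<cdot> (theta X A \<boxtimes> Id D ?Y) = \<tau> X" if "X \<in> Obj C" for X
    using iff[OF t that] t0(2)[OF that] hat_t by simp
  moreover have "s = t" if s: "s \<in> Hom D (ZO A \<otimes> ?Y) B"
      "\<forall>X\<in>Obj C. (Id D (FO F X) \<boxtimes> s) \<cdot> (theta X A \<boxtimes> Id D ?Y) = \<tau> X" for s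
  proof -
    note [simp] = s(1)[unfolded hom_iff] t[unfolded hom_iff]
    have "hat (ZO A) s = t0"
      using iff[OF s(1)] s(2) by (intro uniq) (simp_all add: hat_def hom_iff)
    then show ?thesis
      using hat_t unfolding hat_def by (intro Y.transpose_right_cancel[where g = s and g' = t and A = "ZO A"]) simp_all
  qed
  ultimately show ?thesis using t by (intro ex1I[of _ t]) blast+
qed

text \<open>Cancellation form of the universal property. An identity between arrows out of Z(A)
  \<otimes> F(Y) is proved by composing both sides with the transposed dinatural maps.\<close>

lemma theta_cancel_tens:
  assumes "t \<in> Arr D" "t' \<in> Arr D" "Dom D t = ZO A \<otimes> FO F Y" "Dom D t' = ZO A \<otimes> FO F Y" "Cod D t' = Cod D t"
    and "A \<in> Obj D" "Y \<in> Obj C"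
    and "\<And>X. X \<in> Obj C \<Longrightarrow> (Id D (FO F X) \<boxtimes> t) \<cdot> (theta X A \<boxtimes> Id D (FO F Y))
      = (Id D (FO F X) \<boxtimes> t') \<cdot> (theta X A \<boxtimes> Id D (FO F Y))"
  shows "t = t'"
proof -
  have "\<exists>!s. s \<in> Hom D (ZO A \<otimes> FO F Y) (Cod D t) \<and> (\<forall>X\<in>Obj C. (Id D (FO F X) \<boxtimes> s) \<cdot> (theta X A \<boxtimes> Id D (FO F Y))
      = (Id D (FO F X) \<boxtimes> t) \<cdot> (theta X A \<boxtimes> Id D (FO F Y)))"
    by (rule theta_factor_tens[OF natural_theta]) (use assms in simp_all)
  moreover have "t \<in> Hom D (ZO A \<otimes> FO F Y) (Cod D t)" "t' \<in> Hom D (ZO A \<otimes> FO F Y) (Cod D t)"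
    using assms by (simp_all add: hom_iff)
  ultimately show ?thesis using assms(8) by metis
qed

lemma theta_cancel:
  assumes "t \<in> Arr D" "t' \<in> Arr D" "Dom D t = ZO A" "Dom D t' = ZO A" "Cod D t' = Cod D t" "A \<in> Obj D"
    and "\<And>X. X \<in> Obj C \<Longrightarrow> (Id D (FO F X) \<boxtimes> t) \<cdot> theta X A = (Id D (FO F X) \<boxtimes> t') \<cdot> theta X A"
  shows "t = t'"
  by (rule theta_cancel_tens[of t t' A "Unit C"]) (use assms in simp_all)

subsection \<open>The free functor\<close>

text \<open>The description that follows \<open>THE\<close> in \<open>ZA\<close> is equivalent,
  component by component, to an equation between natural families, which has exactly one solution by
  \<open>theta_factor\<close>.\<close>

lemma ZA_theta_hom:
  assumes f [simp]: "f \<in> Arr D"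
  shows "ZA f \<in> Hom D (ZO (Dom D f)) (ZO (Cod D f)) \<and>
    (\<forall>X\<in>Obj C. (Id D (FO F X) \<boxtimes> ZA f) \<cdot> theta X (Dom D f) = theta X (Cod D f) \<cdot> (f \<boxtimes> Id D (FO F X)))"
proof -
  let ?A = "Dom D f" and ?B = "Cod D f"
  have nat: "natural ?A (Unit D) (ZO ?B) (\<lambda>X. theta X ?B \<cdot> (f \<boxtimes> Id D (FO F X)))"
    unfolding natural_def
  proof (intro conjI ballI)
    fix \<phi> assume [simp]: "\<phi> \<in> Arr C"
    let ?X = "Dom C \<phi>" and ?Y = "Cod C \<phi>"
    have "(theta ?Y ?B \<cdot> (f \<boxtimes> Id D (FO F ?Y))) \<cdot> (Id D ?A \<boxtimes> FA F \<phi> \<boxtimes> Id D (Unit D))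
        = theta ?Y ?B \<cdot> ((f \<boxtimes> Id D (FO F ?Y)) \<cdot> (Id D ?A \<boxtimes> FA F \<phi>))" by (simp add: D.assoc)
    also have "(f \<boxtimes> Id D (FO F ?Y)) \<cdot> (Id D ?A \<boxtimes> FA F \<phi>) = (Id D ?B \<boxtimes> FA F \<phi>) \<cdot> (f \<boxtimes> Id D (FO F ?X))"
      by (rule D.exchange) simp_all
    also have "theta ?Y ?B \<cdot> \<dots> = (theta ?Y ?B \<cdot> (Id D ?B \<boxtimes> FA F \<phi>)) \<cdot> (f \<boxtimes> Id D (FO F ?X))"
      by (simp add: D.assoc)
    also have "theta ?Y ?B \<cdot> (Id D ?B \<boxtimes> FA F \<phi>) = (FA F \<phi> \<boxtimes> Id D (ZO ?B)) \<cdot> theta ?X ?B"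
      using naturalD(7)[OF theta_natural, of ?B \<phi>] by simp
    finally show "(theta ?Y ?B \<cdot> (f \<boxtimes> Id D (FO F ?Y))) \<cdot> (Id D ?A \<boxtimes> FA F \<phi> \<boxtimes> Id D (Unit D))
        = (FA F \<phi> \<boxtimes> Id D (ZO ?B)) \<cdot> theta ?X ?B \<cdot> (f \<boxtimes> Id D (FO F ?X))" by (simp add: D.assoc)
  qed simp_all
  have iff: "t \<cdot> din X ?A = din X ?B \<cdot> (Id D (FO F (Dual C X)) \<boxtimes> f \<boxtimes> Id D (FO F X))
      \<longleftrightarrow> (Id D (FO F X) \<boxtimes> t) \<cdot> theta X ?A = theta X ?B \<cdot> (f \<boxtimes> Id D (FO F X))"
    if t: "t \<in> Hom D (ZO ?A) (ZO ?B)" and X [simp]: "X \<in> Obj C" for t X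
  proof -
    note [simp] = t[unfolded hom_iff]
    have "t \<cdot> din X ?A = untranspose (ZO ?B) X ((Id D (FO F X) \<boxtimes> t) \<cdot> theta X ?A)"
      by (simp add: din_theta untranspose_post[of _ _ "ZO ?A"])
    moreover have "din X ?B \<cdot> (Id D (FO F (Dual C X)) \<boxtimes> f \<boxtimes> Id D (FO F X))
        = untranspose (ZO ?B) X (theta X ?B \<cdot> (f \<boxtimes> Id D (FO F X)))"
      by (simp add: din_theta untranspose_pre)
    moreover have "untranspose (ZO ?B) X ((Id D (FO F X) \<boxtimes> t) \<cdot> theta X ?A)
        = untranspose (ZO ?B) X (theta X ?B \<cdot> (f \<boxtimes> Id D (FO F X)))
      \<longleftrightarrow> (Id D (FO F X) \<boxtimes> t) \<cdot> theta X ?A = theta X ?B \<cdot> (f \<boxtimes> Id D (FO F X))"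
      by (rule untranspose_inject) simp_all
    ultimately show ?thesis by metis
  qed
  have "\<exists>!t. t \<in> Hom D (ZO ?A) (ZO ?B) \<and>
      (\<forall>X\<in>Obj C. t \<cdot> din X ?A = din X ?B \<cdot> (Id D (FO F (Dual C X)) \<boxtimes> f \<boxtimes> Id D (FO F X)))"
    by (rule ex1_ball_cong[OF iff theta_factor[OF nat]])
  from theI'[OF this] iff show ?thesis unfolding ZA_def by blast
qed

lemma ZA_typing [simp]:
  assumes "f \<in> Arr D"
  shows "ZA f \<in> Arr D" "Dom D (ZA f) = ZO (Dom D f)" "Cod D (ZA f) = ZO (Cod D f)"
  using ZA_theta_hom[OF assms] by (simp_all add: hom_iff)

lemma ZA_theta:
  assumes "f \<in> Arr D" "X \<in> Obj C" "Dom D f = A" "Cod D f = B"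
  shows "(Id D (FO F X) \<boxtimes> ZA f) \<cdot> theta X A = theta X B \<cdot> (f \<boxtimes> Id D (FO F X))"
  using ZA_theta_hom[OF assms(1)] assms(2-) by auto

lemma ZA_eqI:
  assumes "f \<in> Arr D" "t \<in> Arr D" "Dom D t = ZO (Dom D f)" "Cod D t = ZO (Cod D f)"
    and "\<And>X. X \<in> Obj C \<Longrightarrow> (Id D (FO F X) \<boxtimes> t) \<cdot> theta X (Dom D f) = theta X (Cod D f) \<cdot> (f \<boxtimes> Id D (FO F X))"
  shows "ZA f = t"
  by (rule theta_cancel[where A = "Dom D f"]) (use assms ZA_theta[of f] in simp_all)

lemma ZA_id [simp]: "A \<in> Obj D \<Longrightarrow> ZA (Id D A) = Id D (ZO A)"
  by (rule ZA_eqI) (simp_all add: D.tens_id_simps)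

lemma ZA_comp:
  assumes [simp]: "f \<in> Arr D" "g \<in> Arr D" "Dom D g = Cod D f"
  shows "ZA (g \<cdot> f) = ZA g \<cdot> ZA f"
proof (rule ZA_eqI)
  fix X assume [simp]: "X \<in> Obj C"
  have "(Id D (FO F X) \<boxtimes> (ZA g \<cdot> ZA f)) \<cdot> theta X (Dom D f) = (Id D (FO F X) \<boxtimes> ZA g) \<cdot> ((Id D (FO F X) \<boxtimes> ZA f) \<cdot> theta X (Dom D f))"
    by (simp add: D.slices)
  also have "\<dots> = ((Id D (FO F X) \<boxtimes> ZA g) \<cdot> theta X (Cod D f)) \<cdot> (f \<boxtimes> Id D (FO F X))"
    by (simp add: ZA_theta[of f X "Dom D f" "Cod D f"] D.assoc)
  also have "(Id D (FO F X) \<boxtimes> ZA g) \<cdot> theta X (Cod D f) = theta X (Cod D g) \<cdot> (g \<boxtimes> Id D (FO F X))"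
    by (rule ZA_theta) simp_all
  also have "\<dots> \<cdot> (f \<boxtimes> Id D (FO F X)) = theta X (Cod D g) \<cdot> ((g \<cdot> f) \<boxtimes> Id D (FO F X))"
    by (simp add: D.slices)
  finally show "(Id D (FO F X) \<boxtimes> (ZA g \<cdot> ZA f)) \<cdot> theta X (Dom D (g \<cdot> f)) = theta X (Cod D (g \<cdot> f)) \<cdot> ((g \<cdot> f) \<boxtimes> Id D (FO F X))"
    by simp
qed simp_all

lemma ZA_add:
  assumes [simp]: "f \<in> Arr D" "g \<in> Arr D" "Dom D g = Dom D f" "Cod D g = Cod D f"
  shows "ZA (Add D f g) = Add D (ZA f) (ZA g)"
proof (rule ZA_eqI)
  fix X assume [simp]: "X \<in> Obj C"
  have "(Id D (FO F X) \<boxtimes> ZA g) \<cdot> theta X (Dom D f) = theta X (Cod D f) \<cdot> (g \<boxtimes> Id D (FO F X))"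
    by (rule ZA_theta) simp_all
  then show "(Id D (FO F X) \<boxtimes> Add D (ZA f) (ZA g)) \<cdot> theta X (Dom D (Add D f g))
      = theta X (Cod D (Add D f g)) \<cdot> (Add D f g \<boxtimes> Id D (FO F X))"
    by (simp add: D.tens_add D.add_comp ZA_theta)
qed simp_all

lemma ZA_scale:
  assumes [simp]: "f \<in> Arr D"
  shows "ZA (Scale D c f) = Scale D c (ZA f)"
  by (rule ZA_eqI) (simp_all add: D.tens_scale D.scale_comp ZA_theta)

lemma ZA_zero [simp]:
  assumes "A \<in> Obj D" "B \<in> Obj D"
  shows "ZA (Zero D A B) = Zero D (ZO A) (ZO B)"
  by (rule ZA_eqI) (use assms in simp_all)

subsection \<open>The half-braiding of the free object\<close>

lemma natural_theta_tens:
  assumes [simp]: "A \<in> Obj D" "Y \<in> Obj C"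
  shows "natural A (FO F Y) (FO F Y \<otimes> ZO A) (\<lambda>X. theta (X \<otimes>\<^bsub>C\<^esub> Y) A)"
  unfolding natural_def
proof (intro conjI ballI)
  fix \<phi> assume [simp]: "\<phi> \<in> Arr C"
  show "theta (Cod C \<phi> \<otimes>\<^bsub>C\<^esub> Y) A \<cdot> (Id D A \<boxtimes> FA F \<phi> \<boxtimes> Id D (FO F Y))
      = (FA F \<phi> \<boxtimes> Id D (FO F Y \<otimes> ZO A)) \<cdot> theta (Dom C \<phi> \<otimes>\<^bsub>C\<^esub> Y) A"
    using naturalD(7)[OF theta_natural, of A "\<phi> \<boxtimes>\<^bsub>C\<^esub> Id C Y"] by (simp add: FA_simps D.tens_id_simps)
qed simp_all

text \<open>By \<open>ev_dual_tensor\<close> the evaluation of X \<otimes> Y becomes a nested one,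
  in which the coevaluation of Y cancels the evaluation of Y. The right-hand side prescribed in
  \<open>Z_braiding\<close> is thus \<open>theta\<close> at X \<otimes> Y, untransposed along X
  alone, and \<open>theta_factor_tens\<close> solves the equation uniquely.\<close>

lemma Z_braiding_theta_hom:
  assumes [simp]: "A \<in> Obj D" "Y \<in> Obj C"
  shows "Z_braiding A Y \<in> Hom D (ZO A \<otimes> FO F Y) (FO F Y \<otimes> ZO A) \<and>
    (\<forall>X\<in>Obj C. (Id D (FO F X) \<boxtimes> Z_braiding A Y) \<cdot> (theta X A \<boxtimes> Id D (FO F Y)) = theta (X \<otimes>\<^bsub>C\<^esub> Y) A)"
proof -
  let ?rhs = "\<lambda>X. (Id D (FO F Y) \<boxtimes> din (X \<otimes>\<^bsub>C\<^esub> Y) A) \<cdot>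
        (Id D (FO F Y) \<boxtimes> FA F (dual_tensor C X Y) \<boxtimes> Id D (A \<otimes> FO F X \<otimes> FO F Y)) \<cdot>
        (FA F (Coev C Y) \<boxtimes> Id D (coend_body A X \<otimes> FO F Y))"
  have iff: "r \<cdot> (din X A \<boxtimes> Id D (FO F Y)) = ?rhs X
      \<longleftrightarrow> (Id D (FO F X) \<boxtimes> r) \<cdot> (theta X A \<boxtimes> Id D (FO F Y)) = theta (X \<otimes>\<^bsub>C\<^esub> Y) A"
    if r: "r \<in> Hom D (ZO A \<otimes> FO F Y) (FO F Y \<otimes> ZO A)" and X [simp]: "X \<in> Obj C" for r X
  proof -
    note [simp] = r[unfolded hom_iff]
    let ?th = "theta (X \<otimes>\<^bsub>C\<^esub> Y) A" and ?X' = "FO F (Dual C X)" and ?Y' = "FO F (Dual C Y)"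
    let ?g = "untranspose (FO F Y \<otimes> ZO A) X ?th"
    have "r \<cdot> (din X A \<boxtimes> Id D (FO F Y)) = r \<cdot> untranspose (ZO A \<otimes> FO F Y) X (theta X A \<boxtimes> Id D (FO F Y))"
      by (simp add: din_theta untranspose_def D.slices)
    also have "\<dots> = untranspose (FO F Y \<otimes> ZO A) X ((Id D (FO F X) \<boxtimes> r) \<cdot> (theta X A \<boxtimes> Id D (FO F Y)))"
      by (rule untranspose_post[symmetric]) simp_all
    finally have l: "r \<cdot> (din X A \<boxtimes> Id D (FO F Y))
        = untranspose (FO F Y \<otimes> ZO A) X ((Id D (FO F X) \<boxtimes> r) \<cdot> (theta X A \<boxtimes> Id D (FO F Y)))" .
    have "din (X \<otimes>\<^bsub>C\<^esub> Y) A \<cdot> (FA F (dual_tensor C X Y) \<boxtimes> Id D (A \<otimes> FO F X \<otimes> FO F Y))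
      = (FA F (Ev C (X \<otimes>\<^bsub>C\<^esub> Y)) \<boxtimes> Id D (ZO A)) \<cdot> ((Id D (FO F (Dual C (X \<otimes>\<^bsub>C\<^esub> Y))) \<boxtimes> ?th)
          \<cdot> (FA F (dual_tensor C X Y) \<boxtimes> Id D (A \<otimes> FO F X \<otimes> FO F Y)))"
      by (simp add: din_theta untranspose_def D.slices)
    also have "(Id D (FO F (Dual C (X \<otimes>\<^bsub>C\<^esub> Y))) \<boxtimes> ?th) \<cdot> (FA F (dual_tensor C X Y) \<boxtimes> Id D (A \<otimes> FO F X \<otimes> FO F Y))
        = (FA F (dual_tensor C X Y) \<boxtimes> Id D (FO F X \<otimes> FO F Y \<otimes> ZO A)) \<cdot> (Id D (?Y' \<otimes> ?X') \<boxtimes> ?th)"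
      by (rule D.exchange[symmetric]) simp_all
    also have "(FA F (Ev C (X \<otimes>\<^bsub>C\<^esub> Y)) \<boxtimes> Id D (ZO A)) \<cdot> \<dots>
        = (FA F (Ev C (X \<otimes>\<^bsub>C\<^esub> Y) \<cdot>\<^bsub>C\<^esub> (dual_tensor C X Y \<boxtimes>\<^bsub>C\<^esub> Id C (X \<otimes>\<^bsub>C\<^esub> Y))) \<boxtimes> Id D (ZO A)) \<cdot> (Id D (?Y' \<otimes> ?X') \<boxtimes> ?th)"
      by (simp add: FA_simps D.slices)
    also have "\<dots> = untranspose (ZO A) Y ?g"
      by (simp add: C.ev_dual_tensor FA_simps untranspose_def D.slices)
    finally have *: "din (X \<otimes>\<^bsub>C\<^esub> Y) A \<cdot> (FA F (dual_tensor C X Y) \<boxtimes> Id D (A \<otimes> FO F X \<otimes> FO F Y)) = untranspose (ZO A) Y ?g" .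
    have "?rhs X = transpose (coend_body A X) Y (din (X \<otimes>\<^bsub>C\<^esub> Y) A \<cdot> (FA F (dual_tensor C X Y) \<boxtimes> Id D (A \<otimes> FO F X \<otimes> FO F Y)))"
      by (simp add: transpose_def coend_body_def D.slices)
    also have "\<dots> = ?g"
      unfolding * by (rule transpose_untranspose) (simp_all add: coend_body_def)
    finally have r: "?rhs X = ?g" .
    have "untranspose (FO F Y \<otimes> ZO A) X ((Id D (FO F X) \<boxtimes> r) \<cdot> (theta X A \<boxtimes> Id D (FO F Y))) = ?g
      \<longleftrightarrow> (Id D (FO F X) \<boxtimes> r) \<cdot> (theta X A \<boxtimes> Id D (FO F Y)) = ?th"
      by (rule untranspose_inject) simp_all
    then show ?thesis unfolding l r .
  qed
  have "\<exists>!r. r \<in> Hom D (ZO A \<otimes> FO F Y) (FO F Y \<otimes> ZO A) \<and> (\<forall>X\<in>Obj C. r \<cdot> (din X A \<boxtimes> Id D (FO F Y)) = ?rhs X)"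
    by (rule ex1_ball_cong[OF iff theta_factor_tens[OF natural_theta_tens]]) simp_all
  from theI'[OF this] iff show ?thesis unfolding Z_braiding_def restrict_apply'[OF assms(2)] by blast
qed

lemma Z_braiding_typing [simp]:
  assumes "A \<in> Obj D" "Y \<in> Obj C"
  shows "Z_braiding A Y \<in> Arr D" "Dom D (Z_braiding A Y) = ZO A \<otimes> FO F Y" "Cod D (Z_braiding A Y) = FO F Y \<otimes> ZO A"
  using Z_braiding_theta_hom[OF assms] by (simp_all add: hom_iff)

lemma theta_tens:
  assumes "A \<in> Obj D" "X \<in> Obj C" "Y \<in> Obj C"
  shows "(Id D (FO F X) \<boxtimes> Z_braiding A Y) \<cdot> (theta X A \<boxtimes> Id D (FO F Y)) = theta (X \<otimes>\<^bsub>C\<^esub> Y) A"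
  using Z_braiding_theta_hom[OF assms(1,3)] assms(2) by blast

text \<open>Invertibility is a consequence of rigidity: the inverse at X is the mate of the
  component at a right dual Y of X. Multiplicativity combines the two components into one at Y
  \<otimes> X or X \<otimes> Y, and naturality at c or e reduces that to the component at the unit
  object.\<close>

lemma half_braiding_iso:
  assumes V [simp]: "V \<in> Obj D"
    and ty [simp]: "\<And>X. X \<in> Obj C \<Longrightarrow> \<rho> X \<in> Arr D" "\<And>X. X \<in> Obj C \<Longrightarrow> Dom D (\<rho> X) = V \<otimes> FO F X"
      "\<And>X. X \<in> Obj C \<Longrightarrow> Cod D (\<rho> X) = FO F X \<otimes> V"
    and nat: "\<And>\<phi>. \<phi> \<in> Arr C \<Longrightarrow> \<rho> (Cod C \<phi>) \<cdot> (Id D V \<boxtimes> FA F \<phi>) = (FA F \<phi> \<boxtimes> Id D V) \<cdot> \<rho> (Dom C \<phi>)"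
    and mult: "\<And>X Y. \<lbrakk>X \<in> Obj C; Y \<in> Obj C\<rbrakk> \<Longrightarrow>
      \<rho> (X \<otimes>\<^bsub>C\<^esub> Y) = (Id D (FO F X) \<boxtimes> \<rho> Y) \<cdot> (\<rho> X \<boxtimes> Id D (FO F Y))"
    and unit: "\<rho> (Unit C) = Id D V"
    and X [simp]: "X \<in> Obj C"
  shows "is_iso D (\<rho> X)"
proof -
  obtain Y e c where Y [simp]: "Y \<in> Obj C" and e: "e \<in> Hom C (X \<otimes>\<^bsub>C\<^esub> Y) (Unit C)"
    and c: "c \<in> Hom C (Unit C) (Y \<otimes>\<^bsub>C\<^esub> X)"
    and zz: "(e \<boxtimes>\<^bsub>C\<^esub> Id C X) \<cdot>\<^bsub>C\<^esub> (Id C X \<boxtimes>\<^bsub>C\<^esub> c) = Id C X"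
    using C.right_dual[OF X] by blast
  note ec [simp] = e[unfolded hom_iff] c[unfolded hom_iff]
  let ?X = "FO F X" and ?Y = "FO F Y" and ?e = "FA F e" and ?c = "FA F c"
  \<comment> \<open>The mate of \<rho> at Y: the strand F(X) is bent around it with the coevaluation
    c and the evaluation e.\<close>
  define s where "s = (?e \<boxtimes> Id D (V \<otimes> ?X)) \<cdot> (Id D ?X \<boxtimes> \<rho> Y \<boxtimes> Id D ?X) \<cdot> (Id D (?X \<otimes> V) \<boxtimes> ?c)"
  have s: "s \<in> Hom D (?X \<otimes> V) (V \<otimes> ?X)" by (simp add: s_def hom_iff)
  have zzF: "(?e \<boxtimes> Id D ?X) \<cdot> (Id D ?X \<boxtimes> ?c) = Id D ?X"
    using arg_cong[OF zz, of "FA F"] by (simp add: FA_simps)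
  have "\<rho> X \<cdot> s = (\<rho> X \<cdot> (?e \<boxtimes> Id D (V \<otimes> ?X))) \<cdot> (Id D ?X \<boxtimes> \<rho> Y \<boxtimes> Id D ?X) \<cdot> (Id D (?X \<otimes> V) \<boxtimes> ?c)"
    by (simp add: s_def D.assoc)
  also have "\<rho> X \<cdot> (?e \<boxtimes> Id D (V \<otimes> ?X)) = (?e \<boxtimes> Id D (?X \<otimes> V)) \<cdot> (Id D (?X \<otimes> ?Y) \<boxtimes> \<rho> X)"
    using D.exchange[of ?e "\<rho> X" "?X \<otimes> ?Y" "Unit D" "V \<otimes> ?X" "?X \<otimes> V"] by simp
  also have "((?e \<boxtimes> Id D (?X \<otimes> V)) \<cdot> (Id D (?X \<otimes> ?Y) \<boxtimes> \<rho> X)) \<cdot> (Id D ?X \<boxtimes> \<rho> Y \<boxtimes> Id D ?X) \<cdot> (Id D (?X \<otimes> V) \<boxtimes> ?c)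
      = (?e \<boxtimes> Id D (?X \<otimes> V)) \<cdot> (Id D ?X \<boxtimes> (((Id D ?Y \<boxtimes> \<rho> X) \<cdot> (\<rho> Y \<boxtimes> Id D ?X)) \<cdot> (Id D V \<boxtimes> ?c)))"
    by (simp add: D.slices)
  also have "((Id D ?Y \<boxtimes> \<rho> X) \<cdot> (\<rho> Y \<boxtimes> Id D ?X)) \<cdot> (Id D V \<boxtimes> ?c) = ?c \<boxtimes> Id D V"
    using nat[of c] by (simp add: mult[OF Y X, symmetric] unit)
  also have "(?e \<boxtimes> Id D (?X \<otimes> V)) \<cdot> (Id D ?X \<boxtimes> ?c \<boxtimes> Id D V) = ((?e \<boxtimes> Id D ?X) \<cdot> (Id D ?X \<boxtimes> ?c)) \<boxtimes> Id D V"
    by (simp add: D.slices)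
  finally have rs: "\<rho> X \<cdot> s = Id D (?X \<otimes> V)" by (simp add: zzF D.tens_id_simps)
  have "s \<cdot> \<rho> X = (?e \<boxtimes> Id D (V \<otimes> ?X)) \<cdot> (Id D ?X \<boxtimes> \<rho> Y \<boxtimes> Id D ?X) \<cdot> ((Id D (?X \<otimes> V) \<boxtimes> ?c) \<cdot> \<rho> X)"
    by (simp add: s_def D.assoc)
  also have "(Id D (?X \<otimes> V) \<boxtimes> ?c) \<cdot> \<rho> X = (\<rho> X \<boxtimes> Id D (?Y \<otimes> ?X)) \<cdot> (Id D (V \<otimes> ?X) \<boxtimes> ?c)"
    using D.exchange[of "\<rho> X" ?c "V \<otimes> ?X" "?X \<otimes> V" "Unit D" "?Y \<otimes> ?X"] by simp
  also have "(?e \<boxtimes> Id D (V \<otimes> ?X)) \<cdot> (Id D ?X \<boxtimes> \<rho> Y \<boxtimes> Id D ?X) \<cdot> \<dots>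
      = (((?e \<boxtimes> Id D V) \<cdot> ((Id D ?X \<boxtimes> \<rho> Y) \<cdot> (\<rho> X \<boxtimes> Id D ?Y))) \<boxtimes> Id D ?X) \<cdot> (Id D (V \<otimes> ?X) \<boxtimes> ?c)"
    by (simp add: D.slices)
  also have "(?e \<boxtimes> Id D V) \<cdot> ((Id D ?X \<boxtimes> \<rho> Y) \<cdot> (\<rho> X \<boxtimes> Id D ?Y)) = Id D V \<boxtimes> ?e"
    using nat[of e] by (simp add: mult[OF X Y, symmetric] unit)
  also have "((Id D V \<boxtimes> ?e) \<boxtimes> Id D ?X) \<cdot> (Id D (V \<otimes> ?X) \<boxtimes> ?c) = Id D V \<boxtimes> ((?e \<boxtimes> Id D ?X) \<cdot> (Id D ?X \<boxtimes> ?c))"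
    by (simp add: D.slices)
  finally have sr: "s \<cdot> \<rho> X = Id D (V \<otimes> ?X)" by (simp add: zzF D.tens_id_simps)
  show ?thesis
    unfolding is_iso_def using s rs sr by (auto intro!: bexI[of _ s])
qed

lemma Z_braiding_natural:
  assumes [simp]: "A \<in> Obj D" "\<phi> \<in> Arr C"
  shows "Z_braiding A (Cod C \<phi>) \<cdot> (Id D (ZO A) \<boxtimes> FA F \<phi>) = (FA F \<phi> \<boxtimes> Id D (ZO A)) \<cdot> Z_braiding A (Dom C \<phi>)"
proof (rule theta_cancel_tens[where A = A and Y = "Dom C \<phi>"])
  fix X assume [simp]: "X \<in> Obj C"
  let ?X = "FO F X" and ?Y = "Dom C \<phi>" and ?Y' = "Cod C \<phi>"
  have "(Id D ?X \<boxtimes> (Z_braiding A ?Y' \<cdot> (Id D (ZO A) \<boxtimes> FA F \<phi>))) \<cdot> (theta X A \<boxtimes> Id D (FO F ?Y))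
      = (Id D ?X \<boxtimes> Z_braiding A ?Y') \<cdot> ((Id D (?X \<otimes> ZO A) \<boxtimes> FA F \<phi>) \<cdot> (theta X A \<boxtimes> Id D (FO F ?Y)))"
    by (simp add: D.slices)
  also have "(Id D (?X \<otimes> ZO A) \<boxtimes> FA F \<phi>) \<cdot> (theta X A \<boxtimes> Id D (FO F ?Y)) = (theta X A \<boxtimes> Id D (FO F ?Y')) \<cdot> (Id D (A \<otimes> ?X) \<boxtimes> FA F \<phi>)"
    by (rule D.exchange[symmetric]) simp_all
  also have "(Id D ?X \<boxtimes> Z_braiding A ?Y') \<cdot> \<dots> = theta (X \<otimes>\<^bsub>C\<^esub> ?Y') A \<cdot> (Id D (A \<otimes> ?X) \<boxtimes> FA F \<phi>)"
    by (simp add: D.assoc[symmetric] theta_tens)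
  also have "\<dots> = (Id D ?X \<boxtimes> FA F \<phi> \<boxtimes> Id D (ZO A)) \<cdot> theta (X \<otimes>\<^bsub>C\<^esub> ?Y) A"
    using naturalD(7)[OF theta_natural, of A "Id C X \<boxtimes>\<^bsub>C\<^esub> \<phi>"] by (simp add: FA_simps D.tens_id_simps)
  also have "\<dots> = (Id D ?X \<boxtimes> ((FA F \<phi> \<boxtimes> Id D (ZO A)) \<cdot> Z_braiding A ?Y)) \<cdot> (theta X A \<boxtimes> Id D (FO F ?Y))"
    by (simp add: theta_tens[symmetric] D.slices)
  finally show "(Id D ?X \<boxtimes> (Z_braiding A ?Y' \<cdot> (Id D (ZO A) \<boxtimes> FA F \<phi>))) \<cdot> (theta X A \<boxtimes> Id D (FO F ?Y))
      = (Id D ?X \<boxtimes> ((FA F \<phi> \<boxtimes> Id D (ZO A)) \<cdot> Z_braiding A ?Y)) \<cdot> (theta X A \<boxtimes> Id D (FO F ?Y))" .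
qed simp_all

text \<open>Composed with \<open>theta\<close> at W, both sides become \<open>theta\<close> at W
  \<otimes> X \<otimes> Y.\<close>

lemma Z_braiding_mult:
  assumes [simp]: "A \<in> Obj D" "X \<in> Obj C" "Y \<in> Obj C"
  shows "Z_braiding A (X \<otimes>\<^bsub>C\<^esub> Y) = (Id D (FO F X) \<boxtimes> Z_braiding A Y) \<cdot> (Z_braiding A X \<boxtimes> Id D (FO F Y))"
proof (rule theta_cancel_tens[where A = A and Y = "X \<otimes>\<^bsub>C\<^esub> Y"])
  fix W assume [simp]: "W \<in> Obj C"
  have "(Id D (FO F W) \<boxtimes> ((Id D (FO F X) \<boxtimes> Z_braiding A Y) \<cdot> (Z_braiding A X \<boxtimes> Id D (FO F Y)))) \<cdot> (theta W A \<boxtimes> Id D (FO F (X \<otimes>\<^bsub>C\<^esub> Y)))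
      = (Id D (FO F W \<otimes> FO F X) \<boxtimes> Z_braiding A Y) \<cdot> (((Id D (FO F W) \<boxtimes> Z_braiding A X) \<cdot> (theta W A \<boxtimes> Id D (FO F X))) \<boxtimes> Id D (FO F Y))"
    by (simp add: D.slices)
  also have "\<dots> = (Id D (FO F (W \<otimes>\<^bsub>C\<^esub> X)) \<boxtimes> Z_braiding A Y) \<cdot> (theta (W \<otimes>\<^bsub>C\<^esub> X) A \<boxtimes> Id D (FO F Y))"
    by (simp add: theta_tens)
  also have "\<dots> = theta (W \<otimes>\<^bsub>C\<^esub> X \<otimes>\<^bsub>C\<^esub> Y) A"
    by (subst theta_tens) simp_all
  finally show "(Id D (FO F W) \<boxtimes> Z_braiding A (X \<otimes>\<^bsub>C\<^esub> Y)) \<cdot> (theta W A \<boxtimes> Id D (FO F (X \<otimes>\<^bsub>C\<^esub> Y)))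
      = (Id D (FO F W) \<boxtimes> ((Id D (FO F X) \<boxtimes> Z_braiding A Y) \<cdot> (Z_braiding A X \<boxtimes> Id D (FO F Y)))) \<cdot> (theta W A \<boxtimes> Id D (FO F (X \<otimes>\<^bsub>C\<^esub> Y)))"
    by (subst theta_tens) simp_all
qed simp_all

lemma Z_braiding_unit:
  assumes [simp]: "A \<in> Obj D"
  shows "Z_braiding A (Unit C) = Id D (ZO A)"
proof (rule theta_cancel_tens[where A = A and Y = "Unit C"])
  fix X assume [simp]: "X \<in> Obj C"
  show "(Id D (FO F X) \<boxtimes> Z_braiding A (Unit C)) \<cdot> (theta X A \<boxtimes> Id D (FO F (Unit C)))
      = (Id D (FO F X) \<boxtimes> Id D (ZO A)) \<cdot> (theta X A \<boxtimes> Id D (FO F (Unit C)))"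
    using theta_tens[of A X "Unit C"] by (simp add: D.tens_id_simps)
qed simp_all

lemma Z_half_braiding:
  assumes [simp]: "A \<in> Obj D"
  shows "half_braiding (ZO A) (Z_braiding A)"
  unfolding half_braiding_def
proof (intro conjI ballI)
  show "Z_braiding A \<in> extensional (Obj C)" by (simp add: Z_braiding_def)
  show "is_iso D (Z_braiding A X)" if "X \<in> Obj C" for X
    by (rule half_braiding_iso[where V = "ZO A"]) (use that in \<open>simp_all add: Z_braiding_natural Z_braiding_mult Z_braiding_unit\<close>)
  fix X Y \<phi> assume "X \<in> Obj C" "Y \<in> Obj C" "\<phi> \<in> Hom C X Y"
  then show "Z_braiding A Y \<cdot> (Id D (ZO A) \<boxtimes> FA F \<phi>) = (FA F \<phi> \<boxtimes> Id D (ZO A)) \<cdot> Z_braiding A X"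
    using Z_braiding_natural[of A \<phi>] by (auto simp: hom_iff)
qed (simp_all add: Z_braiding_mult hom_iff)

subsection \<open>The comonad\<close>

lemma centralizerD:
  assumes "V \<in> centralizer"
  shows "fst V \<in> Obj D"
    "X \<in> Obj C \<Longrightarrow> snd V X \<in> Arr D" "X \<in> Obj C \<Longrightarrow> Dom D (snd V X) = fst V \<otimes> FO F X"
    "X \<in> Obj C \<Longrightarrow> Cod D (snd V X) = FO F X \<otimes> fst V"
    "X \<in> Obj C \<Longrightarrow> is_iso D (snd V X)"
    "\<phi> \<in> Arr C \<Longrightarrow> snd V (Cod C \<phi>) \<cdot> (Id D (fst V) \<boxtimes> FA F \<phi>) = (FA F \<phi> \<boxtimes> Id D (fst V)) \<cdot> snd V (Dom C \<phi>)"
    "\<lbrakk>X \<in> Obj C; Y \<in> Obj C\<rbrakk> \<Longrightarrow> snd V (X \<otimes>\<^bsub>C\<^esub> Y) = (Id D (FO F X) \<boxtimes> snd V Y) \<cdot> (snd V X \<boxtimes> Id D (FO F Y))"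
proof -
  have h: "fst V \<in> Obj D" "half_braiding (fst V) (snd V)"
    using assms by (auto simp: centralizer_def)
  then show "fst V \<in> Obj D" by simp
  note hb = h(2)[unfolded half_braiding_def]
  show "snd V X \<in> Arr D" "Dom D (snd V X) = fst V \<otimes> FO F X" "Cod D (snd V X) = FO F X \<otimes> fst V" "is_iso D (snd V X)"
    if "X \<in> Obj C" using hb that by (auto simp: hom_iff)
  show "snd V (X \<otimes>\<^bsub>C\<^esub> Y) = (Id D (FO F X) \<boxtimes> snd V Y) \<cdot> (snd V X \<boxtimes> Id D (FO F Y))"
    if "X \<in> Obj C" "Y \<in> Obj C" using hb that by blast
  have "\<forall>X\<in>Obj C. \<forall>Y\<in>Obj C. \<forall>\<phi>\<in>Hom C X Y. snd V Y \<cdot> (Id D (fst V) \<boxtimes> FA F \<phi>) = (FA F \<phi> \<boxtimes> Id D (fst V)) \<cdot> snd V X"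
    using hb by blast
  then show "snd V (Cod C \<phi>) \<cdot> (Id D (fst V) \<boxtimes> FA F \<phi>) = (FA F \<phi> \<boxtimes> Id D (fst V)) \<cdot> snd V (Dom C \<phi>)"
    if "\<phi> \<in> Arr C" using that C.arr_obj by (simp add: hom_iff)
qed

text \<open>Multiplicativity at the pair of unit objects makes this component idempotent, and it is
  invertible.\<close>

lemma centralizer_unit:
  assumes V: "V \<in> centralizer"
  shows "snd V (Unit C) = Id D (fst V)"
proof (rule D.iso_cancel(1))
  note [simp] = centralizerD(1-4)[OF V]
  show "is_iso D (snd V (Unit C))" by (rule centralizerD(5)[OF V]) simp
  show "snd V (Unit C) \<cdot> snd V (Unit C) = snd V (Unit C) \<cdot> Id D (fst V)"
    using centralizerD(7)[OF V, of "Unit C" "Unit C"] by simp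
qed (use centralizerD(1-4)[OF V] in simp_all)

lemma centralizer_natural: "V \<in> centralizer \<Longrightarrow> natural (fst V) (Unit D) (fst V) (snd V)"
  unfolding natural_def using centralizerD by simp

lemma centralizer_homD:
  assumes "f \<in> centralizer_hom V W"
  shows "f \<in> Arr D" "Dom D f = fst V" "Cod D f = fst W"
    "X \<in> Obj C \<Longrightarrow> (Id D (FO F X) \<boxtimes> f) \<cdot> snd V X = snd W X \<cdot> (f \<boxtimes> Id D (FO F X))"
  using assms unfolding centralizer_hom_def by (auto simp: hom_iff)

lemma GO_simps [simp]: "fst (GO V) = ZO (fst V)" "snd (GO V) = Z_braiding (fst V)"
  by (simp_all add: GO_def)

lemma GO_centralizer: "fst V \<in> Obj D \<Longrightarrow> GO V \<in> centralizer"
  using Z_half_braiding by (simp add: centralizer_def GO_def)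

text \<open>Here f is any arrow of D. Z is the free functor into the centralizer, so the unit and
  the retraction onto the kernel of the counit, which live in D, become arrows of the centralizer
  after one application of Z.\<close>

lemma ZA_centralizer_hom:
  assumes f: "f \<in> Hom D (fst V) (fst W)"
  shows "ZA f \<in> centralizer_hom (GO V) (GO W)"
  unfolding centralizer_hom_def
proof (intro CollectI conjI ballI)
  note [simp] = f[unfolded hom_iff]
  have [simp]: "fst V \<in> Obj D" "fst W \<in> Obj D" using D.hom_obj[OF f] by simp_all
  show "ZA f \<in> Hom D (fst (GO V)) (fst (GO W))" by (simp add: hom_iff)
  fix Y assume [simp]: "Y \<in> Obj C"
  have "(Id D (FO F Y) \<boxtimes> ZA f) \<cdot> Z_braiding (fst V) Y = Z_braiding (fst W) Y \<cdot> (ZA f \<boxtimes> Id D (FO F Y))"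
  proof (rule theta_cancel_tens[where A = "fst V" and Y = Y])
    fix X assume [simp]: "X \<in> Obj C"
    have "(Id D (FO F X) \<boxtimes> ((Id D (FO F Y) \<boxtimes> ZA f) \<cdot> Z_braiding (fst V) Y)) \<cdot> (theta X (fst V) \<boxtimes> Id D (FO F Y))
        = (Id D (FO F (X \<otimes>\<^bsub>C\<^esub> Y)) \<boxtimes> ZA f) \<cdot> ((Id D (FO F X) \<boxtimes> Z_braiding (fst V) Y) \<cdot> (theta X (fst V) \<boxtimes> Id D (FO F Y)))"
      by (simp add: D.slices)
    also have "\<dots> = (Id D (FO F (X \<otimes>\<^bsub>C\<^esub> Y)) \<boxtimes> ZA f) \<cdot> theta (X \<otimes>\<^bsub>C\<^esub> Y) (fst V)"
      by (simp add: theta_tens)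
    also have "\<dots> = theta (X \<otimes>\<^bsub>C\<^esub> Y) (fst W) \<cdot> (f \<boxtimes> Id D (FO F (X \<otimes>\<^bsub>C\<^esub> Y)))"
      by (rule ZA_theta) simp_all
    also have "\<dots> = (Id D (FO F X) \<boxtimes> Z_braiding (fst W) Y) \<cdot> ((theta X (fst W) \<cdot> (f \<boxtimes> Id D (FO F X))) \<boxtimes> Id D (FO F Y))"
      by (simp add: theta_tens[symmetric] D.slices)
    also have "theta X (fst W) \<cdot> (f \<boxtimes> Id D (FO F X)) = (Id D (FO F X) \<boxtimes> ZA f) \<cdot> theta X (fst V)"
      by (rule ZA_theta[symmetric]) simp_all
    also have "(Id D (FO F X) \<boxtimes> Z_braiding (fst W) Y) \<cdot> (((Id D (FO F X) \<boxtimes> ZA f) \<cdot> theta X (fst V)) \<boxtimes> Id D (FO F Y))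
        = (Id D (FO F X) \<boxtimes> (Z_braiding (fst W) Y \<cdot> (ZA f \<boxtimes> Id D (FO F Y)))) \<cdot> (theta X (fst V) \<boxtimes> Id D (FO F Y))"
      by (simp add: D.slices)
    finally show "(Id D (FO F X) \<boxtimes> ((Id D (FO F Y) \<boxtimes> ZA f) \<cdot> Z_braiding (fst V) Y)) \<cdot> (theta X (fst V) \<boxtimes> Id D (FO F Y))
        = (Id D (FO F X) \<boxtimes> (Z_braiding (fst W) Y \<cdot> (ZA f \<boxtimes> Id D (FO F Y)))) \<cdot> (theta X (fst V) \<boxtimes> Id D (FO F Y))" .
  qed simp_all
  then show "(Id D (FO F Y) \<boxtimes> ZA f) \<cdot> snd (GO V) Y = snd (GO W) Y \<cdot> (ZA f \<boxtimes> Id D (FO F Y))" by simp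
qed

lemma counit_theta_hom:
  assumes V: "V \<in> centralizer"
  shows "counit V \<in> Hom D (ZO (fst V)) (fst V) \<and>
    (\<forall>X\<in>Obj C. (Id D (FO F X) \<boxtimes> counit V) \<cdot> theta X (fst V) = snd V X)"
proof -
  note [simp] = centralizerD(1-4)[OF V]
  let ?A = "fst V"
  have iff: "t \<cdot> din X ?A = (FA F (Ev C X) \<boxtimes> Id D ?A) \<cdot> (Id D (FO F (Dual C X)) \<boxtimes> snd V X)
      \<longleftrightarrow> (Id D (FO F X) \<boxtimes> t) \<cdot> theta X ?A = snd V X"
    if t: "t \<in> Hom D (ZO ?A) ?A" and X [simp]: "X \<in> Obj C" for t X
  proof -
    note [simp] = t[unfolded hom_iff]
    have "t \<cdot> din X ?A = untranspose ?A X ((Id D (FO F X) \<boxtimes> t) \<cdot> theta X ?A)"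
      by (simp add: din_theta untranspose_post[of _ _ "ZO ?A"])
    moreover have "untranspose ?A X ((Id D (FO F X) \<boxtimes> t) \<cdot> theta X ?A) = untranspose ?A X (snd V X)
        \<longleftrightarrow> (Id D (FO F X) \<boxtimes> t) \<cdot> theta X ?A = snd V X"
      by (rule untranspose_inject) simp_all
    ultimately show ?thesis by (simp add: untranspose_def)
  qed
  have "\<exists>!t. t \<in> Hom D (ZO ?A) ?A \<and>
      (\<forall>X\<in>Obj C. t \<cdot> din X ?A = (FA F (Ev C X) \<boxtimes> Id D ?A) \<cdot> (Id D (FO F (Dual C X)) \<boxtimes> snd V X))"
    by (rule ex1_ball_cong[OF iff theta_factor[OF centralizer_natural[OF V]]])
  from theI'[OF this] iff show ?thesis unfolding counit_def by blast
qed

lemma counit_typing [simp]: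
  assumes "V \<in> centralizer"
  shows "counit V \<in> Arr D" "Dom D (counit V) = ZO (fst V)" "Cod D (counit V) = fst V"
  using counit_theta_hom[OF assms] by (simp_all add: hom_iff)

lemma counit_theta:
  assumes "V \<in> centralizer" "X \<in> Obj C"
  shows "(Id D (FO F X) \<boxtimes> counit V) \<cdot> theta X (fst V) = snd V X"
  using counit_theta_hom[OF assms(1)] assms(2) by blast

text \<open>Composed with \<open>theta\<close> at X, both sides become the half-braiding of V at X
  \<otimes> Y; its multiplicativity is what makes the counit compatible.\<close>

lemma counit_centralizer_hom:
  assumes V: "V \<in> centralizer"
  shows "counit V \<in> centralizer_hom (GO V) V"
  unfolding centralizer_hom_def
proof (intro CollectI conjI ballI)
  note [simp] = V centralizerD(1-4)[OF V]
  show "counit V \<in> Hom D (fst (GO V)) (fst V)" by (simp add: hom_iff)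
  fix Y assume [simp]: "Y \<in> Obj C"
  have "(Id D (FO F Y) \<boxtimes> counit V) \<cdot> Z_braiding (fst V) Y = snd V Y \<cdot> (counit V \<boxtimes> Id D (FO F Y))"
  proof (rule theta_cancel_tens[where A = "fst V" and Y = Y])
    fix X assume [simp]: "X \<in> Obj C"
    have "(Id D (FO F X) \<boxtimes> ((Id D (FO F Y) \<boxtimes> counit V) \<cdot> Z_braiding (fst V) Y)) \<cdot> (theta X (fst V) \<boxtimes> Id D (FO F Y))
        = (Id D (FO F (X \<otimes>\<^bsub>C\<^esub> Y)) \<boxtimes> counit V) \<cdot> ((Id D (FO F X) \<boxtimes> Z_braiding (fst V) Y) \<cdot> (theta X (fst V) \<boxtimes> Id D (FO F Y)))"
      by (simp add: D.slices)
    also have "\<dots> = (Id D (FO F (X \<otimes>\<^bsub>C\<^esub> Y)) \<boxtimes> counit V) \<cdot> theta (X \<otimes>\<^bsub>C\<^esub> Y) (fst V)"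
      by (simp add: theta_tens)
    also have "\<dots> = snd V (X \<otimes>\<^bsub>C\<^esub> Y)" by (rule counit_theta) simp_all
    also have "\<dots> = (Id D (FO F X) \<boxtimes> snd V Y) \<cdot> (((Id D (FO F X) \<boxtimes> counit V) \<cdot> theta X (fst V)) \<boxtimes> Id D (FO F Y))"
      by (simp add: centralizerD(7)[OF V] counit_theta)
    also have "\<dots> = (Id D (FO F X) \<boxtimes> (snd V Y \<cdot> (counit V \<boxtimes> Id D (FO F Y)))) \<cdot> (theta X (fst V) \<boxtimes> Id D (FO F Y))"
      by (simp add: D.slices)
    finally show "(Id D (FO F X) \<boxtimes> ((Id D (FO F Y) \<boxtimes> counit V) \<cdot> Z_braiding (fst V) Y)) \<cdot> (theta X (fst V) \<boxtimes> Id D (FO F Y))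
        = (Id D (FO F X) \<boxtimes> (snd V Y \<cdot> (counit V \<boxtimes> Id D (FO F Y)))) \<cdot> (theta X (fst V) \<boxtimes> Id D (FO F Y))" .
  qed simp_all
  then show "(Id D (FO F Y) \<boxtimes> counit V) \<cdot> snd (GO V) Y = snd V Y \<cdot> (counit V \<boxtimes> Id D (FO F Y))" by simp
qed

lemma counit_natural:
  assumes V: "V \<in> centralizer" and W: "W \<in> centralizer" and f: "f \<in> centralizer_hom V W"
  shows "counit W \<cdot> ZA f = f \<cdot> counit V"
proof (rule theta_cancel[where A = "fst V"])
  note [simp] = V W centralizerD(1-4)[OF V] centralizerD(1-4)[OF W] centralizer_homD(1-3)[OF f]
  fix X assume [simp]: "X \<in> Obj C"
  have "(Id D (FO F X) \<boxtimes> (counit W \<cdot> ZA f)) \<cdot> theta X (fst V)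
      = (Id D (FO F X) \<boxtimes> counit W) \<cdot> ((Id D (FO F X) \<boxtimes> ZA f) \<cdot> theta X (fst V))"
    by (simp add: D.slices)
  also have "(Id D (FO F X) \<boxtimes> ZA f) \<cdot> theta X (fst V) = theta X (fst W) \<cdot> (f \<boxtimes> Id D (FO F X))"
    by (rule ZA_theta) simp_all
  also have "(Id D (FO F X) \<boxtimes> counit W) \<cdot> \<dots> = snd W X \<cdot> (f \<boxtimes> Id D (FO F X))"
    by (simp add: D.assoc[symmetric] counit_theta)
  also have "\<dots> = (Id D (FO F X) \<boxtimes> f) \<cdot> snd V X" by (rule centralizer_homD(4)[OF f, symmetric]) simp
  also have "\<dots> = (Id D (FO F X) \<boxtimes> (f \<cdot> counit V)) \<cdot> theta X (fst V)"
    by (simp add: counit_theta[OF V, symmetric] D.slices)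
  finally show "(Id D (FO F X) \<boxtimes> (counit W \<cdot> ZA f)) \<cdot> theta X (fst V)
      = (Id D (FO F X) \<boxtimes> (f \<cdot> counit V)) \<cdot> theta X (fst V)" .
qed (use V W centralizerD(1)[OF V] centralizer_homD(1-3)[OF f] in simp_all)

definition unit :: "'p \<Rightarrow> 'q" where
  "unit A = theta (Unit C) A"

lemma unit_typing [simp]:
  assumes "A \<in> Obj D"
  shows "unit A \<in> Arr D" "Dom D (unit A) = A" "Cod D (unit A) = ZO A"
  using assms by (simp_all add: unit_def)

lemma theta_unit:
  assumes "A \<in> Obj D" "X \<in> Obj C"
  shows "theta X A = Z_braiding A X \<cdot> (unit A \<boxtimes> Id D (FO F X))"
  using theta_tens[of A "Unit C" X] assms by (simp add: unit_def)

lemma unit_natural: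
  assumes "f \<in> Arr D" "Dom D f = A" "Cod D f = B"
  shows "ZA f \<cdot> unit A = unit B \<cdot> f"
  using ZA_theta[of f "Unit C" A B] assms by (simp add: unit_def)

text \<open>Together with \<open>counit_ZA_unit\<close>, the triangle identities of the
  free-forgetful adjunction. This one is the defining property of the counit at the unit
  object.\<close>

lemma counit_unit:
  assumes "V \<in> centralizer"
  shows "counit V \<cdot> unit (fst V) = Id D (fst V)"
  using counit_theta[OF assms, of "Unit C"] assms centralizerD(1)[OF assms]
  by (simp add: unit_def centralizer_unit)

lemma counit_ZA_unit:
  assumes V: "fst V \<in> Obj D"
  shows "counit (GO V) \<cdot> ZA (unit (fst V)) = Id D (ZO (fst V))"
proof (rule theta_cancel[where A = "fst V"])
  note [simp] = V GO_centralizer[OF V]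
  fix X assume [simp]: "X \<in> Obj C"
  have "(Id D (FO F X) \<boxtimes> (counit (GO V) \<cdot> ZA (unit (fst V)))) \<cdot> theta X (fst V)
      = (Id D (FO F X) \<boxtimes> counit (GO V)) \<cdot> ((Id D (FO F X) \<boxtimes> ZA (unit (fst V))) \<cdot> theta X (fst V))"
    by (simp add: D.slices)
  also have "(Id D (FO F X) \<boxtimes> ZA (unit (fst V))) \<cdot> theta X (fst V) = theta X (ZO (fst V)) \<cdot> (unit (fst V) \<boxtimes> Id D (FO F X))"
    by (rule ZA_theta) simp_all
  also have "(Id D (FO F X) \<boxtimes> counit (GO V)) \<cdot> \<dots> = Z_braiding (fst V) X \<cdot> (unit (fst V) \<boxtimes> Id D (FO F X))"
    using counit_theta[of "GO V" X] by (simp add: D.assoc[symmetric])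
  also have "\<dots> = theta X (fst V)" by (simp add: theta_unit)
  finally show "(Id D (FO F X) \<boxtimes> (counit (GO V) \<cdot> ZA (unit (fst V)))) \<cdot> theta X (fst V)
      = (Id D (FO F X) \<boxtimes> Id D (ZO (fst V))) \<cdot> theta X (fst V)" by (simp add: D.tens_id_simps)
qed (use V GO_centralizer[OF V] in simp_all)

end

section \<open>Cochains as arrows out of iterated coends\<close>

context monoidal_functor
begin

lemma FOs_simps [simp]: "FOs [] = Unit D" "FOs (X # Xs) = FO F X \<otimes> FOs Xs"
  by (simp_all add: FOs_def)

lemma FAs_simps [simp]: "FAs [] = Id D (Unit D)" "FAs (\<phi> # \<phi>s) = FA F \<phi> \<boxtimes> FAs \<phi>s"
  by (simp_all add: FAs_def)

lemma image_obj [simp]: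
  "S \<subseteq> Arr C \<Longrightarrow> Dom C ` S \<subseteq> Obj C" "S \<subseteq> Arr C \<Longrightarrow> Cod C ` S \<subseteq> Obj C"
  "S' \<subseteq> Obj C \<Longrightarrow> Id C ` S' \<subseteq> Arr C"
  by (auto simp: subset_iff)

lemma map_Id:
  "set Xs \<subseteq> Obj C \<Longrightarrow> map (Dom C) (map (Id C) Xs) = Xs"
  "set Xs \<subseteq> Obj C \<Longrightarrow> map (Cod C) (map (Id C) Xs) = Xs"
  by (induction Xs) simp_all

lemma FOs_obj [simp]: "set Xs \<subseteq> Obj C \<Longrightarrow> FOs Xs \<in> Obj D"
  by (induction Xs) simp_all

lemma FOs_append [simp]:
  "\<lbrakk>set Xs \<subseteq> Obj C; set Ys \<subseteq> Obj C\<rbrakk> \<Longrightarrow> FOs (Xs @ Ys) = FOs Xs \<otimes> FOs Ys"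
  by (induction Xs) simp_all

lemma FAs_typing [simp]:
  assumes "set \<phi>s \<subseteq> Arr C"
  shows "FAs \<phi>s \<in> Arr D" "Dom D (FAs \<phi>s) = FOs (map (Dom C) \<phi>s)" "Cod D (FAs \<phi>s) = FOs (map (Cod C) \<phi>s)"
  using assms by (induction \<phi>s) simp_all

lemma FAs_ids: "set Xs \<subseteq> Obj C \<Longrightarrow> FAs (map (Id C) Xs) = Id D (FOs Xs)"
  by (induction Xs) (simp_all add: FA_id D.tens_id_simps)

text \<open>By strictness the tensor product of the F(X) is F of the tensor product. Statements with
  one parameter F(Y) therefore apply to lists.\<close>

lemma FOs_image: "set Xs \<subseteq> Obj C \<Longrightarrow> \<exists>Y\<in>Obj C. FO F Y = FOs Xs"
proof (induction Xs)
  case (Cons X Xs)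
  then obtain Y where "Y \<in> Obj C" "FO F Y = FOs Xs" by auto
  then show ?case using Cons.prems by (intro bexI[of _ "X \<otimes>\<^bsub>C\<^esub> Y"]) simp_all
qed (auto intro!: bexI[of _ "Unit C"])

lemma funpow_simps [simp]:
  "(ZO ^^ n) (ZO A) = ZO ((ZO ^^ n) A)" "(GO ^^ n) (GO V) = GO ((GO ^^ n) V)"
  "(ZA ^^ n) (ZA f) = ZA ((ZA ^^ n) f)"
  by (simp_all add: funpow_swap1)

lemma funpow_ZO_obj [simp]: "A \<in> Obj D \<Longrightarrow> (ZO ^^ n) A \<in> Obj D"
  by (induction n) simp_all

lemma funpow_GO_fst [simp]: "fst ((GO ^^ n) V) = (ZO ^^ n) (fst V)"
  by (induction n) simp_all

lemma funpow_GO_centralizer [simp]: "V \<in> centralizer \<Longrightarrow> (GO ^^ n) V \<in> centralizer"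
  by (induction n) (simp_all add: GO_centralizer centralizerD(1))

lemma funpow_ZA_typing [simp]:
  assumes "f \<in> Arr D"
  shows "(ZA ^^ n) f \<in> Arr D" "Dom D ((ZA ^^ n) f) = (ZO ^^ n) (Dom D f)" "Cod D ((ZA ^^ n) f) = (ZO ^^ n) (Cod D f)"
  using assms by (induction n) simp_all

text \<open>The transposed form of \<open>din_iter\<close>, as \<open>din_iter_theta\<close> shows.
  The first object of the list is absorbed first and so belongs to the innermost Z.\<close>

primrec iter_theta :: "'o list \<Rightarrow> 'p \<Rightarrow> 'q" where
  "iter_theta [] A = Id D A"
| "iter_theta (X # Xs) A = (Id D (FO F X) \<boxtimes> iter_theta Xs (ZO A)) \<cdot> (theta X A \<boxtimes> Id D (FOs Xs))"

lemma iter_theta_typing [simp]: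
  assumes "set Xs \<subseteq> Obj C" "A \<in> Obj D"
  shows "iter_theta Xs A \<in> Arr D" "Dom D (iter_theta Xs A) = A \<otimes> FOs Xs"
    "Cod D (iter_theta Xs A) = FOs Xs \<otimes> (ZO ^^ length Xs) A"
  using assms by (induction Xs arbitrary: A) simp_all

lemma iter_theta_snoc:
  assumes "set Xs \<subseteq> Obj C" "X \<in> Obj C" "A \<in> Obj D"
  shows "iter_theta (Xs @ [X]) A
    = (Id D (FOs Xs) \<boxtimes> theta X ((ZO ^^ length Xs) A)) \<cdot> (iter_theta Xs A \<boxtimes> Id D (FO F X))"
  using assms
proof (induction Xs arbitrary: A)
  case (Cons Y Xs)
  then have [simp]: "Y \<in> Obj C" "set Xs \<subseteq> Obj C" "X \<in> Obj C" "A \<in> Obj D" by simp_all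
  show ?case using Cons.IH[of "ZO A"] by (simp add: D.slices)
qed (simp add: D.tens_id_simps)

lemma iter_theta_natural:
  assumes "set \<phi>s \<subseteq> Arr C" "A \<in> Obj D"
  shows "iter_theta (map (Cod C) \<phi>s) A \<cdot> (Id D A \<boxtimes> FAs \<phi>s)
    = (FAs \<phi>s \<boxtimes> Id D ((ZO ^^ length \<phi>s) A)) \<cdot> iter_theta (map (Dom C) \<phi>s) A"
  using assms
proof (induction \<phi>s arbitrary: A)
  case (Cons \<phi> \<phi>s)
  then have [simp]: "\<phi> \<in> Arr C" "set \<phi>s \<subseteq> Arr C" "A \<in> Obj D"
    by simp_all
  let ?X = "Dom C \<phi>" and ?Y = "Cod C \<phi>" and ?Xs = "map (Dom C) \<phi>s" and ?Ys = "map (Cod C) \<phi>s"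
  let ?Z = "(ZO ^^ length \<phi>s) (ZO A)"
  have split: "FA F \<phi> \<boxtimes> FAs \<phi>s = (Id D (FO F ?Y) \<boxtimes> FAs \<phi>s) \<cdot> (FA F \<phi> \<boxtimes> Id D (FOs ?Xs))"
    by (simp add: D.interchange)
  have "((Id D (FO F ?Y) \<boxtimes> iter_theta ?Ys (ZO A)) \<cdot> (theta ?Y A \<boxtimes> Id D (FOs ?Ys))) \<cdot> (Id D A \<boxtimes> (FA F \<phi> \<boxtimes> FAs \<phi>s))
      = (Id D (FO F ?Y) \<boxtimes> iter_theta ?Ys (ZO A)) \<cdot> ((theta ?Y A \<boxtimes> Id D (FOs ?Ys)) \<cdot> (Id D (A \<otimes> FO F ?Y) \<boxtimes> FAs \<phi>s))
          \<cdot> (Id D A \<boxtimes> FA F \<phi> \<boxtimes> Id D (FOs ?Xs))"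
    unfolding split by (simp add: D.slices)
  also have "(theta ?Y A \<boxtimes> Id D (FOs ?Ys)) \<cdot> (Id D (A \<otimes> FO F ?Y) \<boxtimes> FAs \<phi>s)
      = (Id D (FO F ?Y \<otimes> ZO A) \<boxtimes> FAs \<phi>s) \<cdot> (theta ?Y A \<boxtimes> Id D (FOs ?Xs))"
    by (rule D.exchange) simp_all
  also have "(Id D (FO F ?Y) \<boxtimes> iter_theta ?Ys (ZO A)) \<cdot> \<dots> \<cdot> (Id D A \<boxtimes> FA F \<phi> \<boxtimes> Id D (FOs ?Xs))
      = (Id D (FO F ?Y) \<boxtimes> (iter_theta ?Ys (ZO A) \<cdot> (Id D (ZO A) \<boxtimes> FAs \<phi>s))) \<cdot> ((theta ?Y A \<cdot> (Id D A \<boxtimes> FA F \<phi>)) \<boxtimes> Id D (FOs ?Xs))"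
    by (simp add: D.slices)
  also have "theta ?Y A \<cdot> (Id D A \<boxtimes> FA F \<phi>) = (FA F \<phi> \<boxtimes> Id D (ZO A)) \<cdot> theta ?X A"
    using naturalD(7)[OF theta_natural, of A \<phi>] by simp
  also have "iter_theta ?Ys (ZO A) \<cdot> (Id D (ZO A) \<boxtimes> FAs \<phi>s) = (FAs \<phi>s \<boxtimes> Id D ?Z) \<cdot> iter_theta ?Xs (ZO A)"
    using Cons.IH[of "ZO A"] by simp
  also have "(Id D (FO F ?Y) \<boxtimes> ((FAs \<phi>s \<boxtimes> Id D ?Z) \<cdot> iter_theta ?Xs (ZO A)))
        \<cdot> (((FA F \<phi> \<boxtimes> Id D (ZO A)) \<cdot> theta ?X A) \<boxtimes> Id D (FOs ?Xs))
      = (Id D (FO F ?Y) \<boxtimes> FAs \<phi>s \<boxtimes> Id D ?Z) \<cdot> ((Id D (FO F ?Y) \<boxtimes> iter_theta ?Xs (ZO A)) \<cdot> (FA F \<phi> \<boxtimes> Id D (ZO A \<otimes> FOs ?Xs)))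
        \<cdot> (theta ?X A \<boxtimes> Id D (FOs ?Xs))"
    by (simp add: D.slices)
  also have "(Id D (FO F ?Y) \<boxtimes> iter_theta ?Xs (ZO A)) \<cdot> (FA F \<phi> \<boxtimes> Id D (ZO A \<otimes> FOs ?Xs))
      = (FA F \<phi> \<boxtimes> Id D (FOs ?Xs \<otimes> ?Z)) \<cdot> (Id D (FO F ?X) \<boxtimes> iter_theta ?Xs (ZO A))"
    by (rule D.exchange[symmetric]) simp_all
  also have "(Id D (FO F ?Y) \<boxtimes> FAs \<phi>s \<boxtimes> Id D ?Z) \<cdot> \<dots> \<cdot> (theta ?X A \<boxtimes> Id D (FOs ?Xs))
      = (((Id D (FO F ?Y) \<boxtimes> FAs \<phi>s) \<cdot> (FA F \<phi> \<boxtimes> Id D (FOs ?Xs))) \<boxtimes> Id D ?Z) \<cdot> (Id D (FO F ?X) \<boxtimes> iter_theta ?Xs (ZO A)) \<cdot> (theta ?X A \<boxtimes> Id D (FOs ?Xs))"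
    by (simp add: D.slices)
  finally show ?case unfolding split[symmetric] by (simp del: D.tens_arr_simps)
qed (simp add: D.tens_id_simps)

lemma tuples_simps:
  "Xs \<in> tuples n \<longleftrightarrow> set Xs \<subseteq> Obj C \<and> length Xs = n"
  "Xs \<in> tuples (Suc n) \<longleftrightarrow> (\<exists>Y Ys. Xs = Y # Ys \<and> Y \<in> Obj C \<and> Ys \<in> tuples n)"
  by (auto simp: tuples_def length_Suc_conv)

text \<open>The cochain condition for objects of D and without extensionality, so that an induction
  on n may replace A by Z(A).\<close>

definition natural_tuples :: "nat \<Rightarrow> 'p \<Rightarrow> 'p \<Rightarrow> ('o list \<Rightarrow> 'q) \<Rightarrow> bool" where
  "natural_tuples n A B f \<longleftrightarrow> A \<in> Obj D \<and> B \<in> Obj D \<and>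
     (\<forall>Xs\<in>tuples n. f Xs \<in> Hom D (A \<otimes> FOs Xs) (FOs Xs \<otimes> B)) \<and>
     (\<forall>\<phi>s. set \<phi>s \<subseteq> Arr C \<and> length \<phi>s = n \<longrightarrow>
        f (map (Cod C) \<phi>s) \<cdot> (Id D A \<boxtimes> FAs \<phi>s) = (FAs \<phi>s \<boxtimes> Id D B) \<cdot> f (map (Dom C) \<phi>s))"

text \<open>Cochains of degree n are the arrows Z^n(A) \<rightarrow> B. With the tail of the list
  fixed, a family of degree n + 1 is natural in its first variable and so comes from one arrow out
  of Z(A) tensored with the tail. These arrows form a family of degree n over Z(A), to which the
  induction hypothesis applies.\<close>

lemma iter_theta_factor:
  assumes "natural_tuples n A B f"
  shows "\<exists>!t. t \<in> Hom D ((ZO ^^ n) A) B \<and> (\<forall>Xs\<in>tuples n. (Id D (FOs Xs) \<boxtimes> t) \<cdot> iter_theta Xs A = f Xs)"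
  using assms
proof (induction n arbitrary: A f)
  case 0
  then have AB: "A \<in> Obj D" "B \<in> Obj D" and f: "f [] \<in> Hom D A B"
    by (auto simp: natural_tuples_def tuples_simps)
  have "(t \<in> Hom D A B \<and> (\<forall>Xs\<in>tuples 0. (Id D (FOs Xs) \<boxtimes> t) \<cdot> iter_theta Xs A = f Xs)) \<longleftrightarrow> t = f []" for t
    using f AB by (auto simp: tuples_def hom_iff)
  then show ?case by simp
next
  case (Suc n)
  have A [simp]: "A \<in> Obj D" and B [simp]: "B \<in> Obj D"
    and fty: "\<And>Xs. Xs \<in> tuples (Suc n) \<Longrightarrow> f Xs \<in> Hom D (A \<otimes> FOs Xs) (FOs Xs \<otimes> B)"
    and fnat: "\<And>\<phi>s. \<lbrakk>set \<phi>s \<subseteq> Arr C; length \<phi>s = Suc n\<rbrakk> \<Longrightarrow>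
        f (map (Cod C) \<phi>s) \<cdot> (Id D A \<boxtimes> FAs \<phi>s) = (FAs \<phi>s \<boxtimes> Id D B) \<cdot> f (map (Dom C) \<phi>s)"
    using Suc.prems by (auto simp: natural_tuples_def)
  have f [simp]: "f (X # Xs) \<in> Arr D" "Dom D (f (X # Xs)) = A \<otimes> FO F X \<otimes> FOs Xs"
    "Cod D (f (X # Xs)) = FO F X \<otimes> FOs Xs \<otimes> B" if "X \<in> Obj C" "Xs \<in> tuples n" for X Xs
    using fty[of "X # Xs"] that by (simp_all add: tuples_simps hom_iff)
  have ex1: "\<exists>!r. r \<in> Hom D (ZO A \<otimes> FOs Xs) (FOs Xs \<otimes> B) \<and>
      (\<forall>X\<in>Obj C. (Id D (FO F X) \<boxtimes> r) \<cdot> (theta X A \<boxtimes> Id D (FOs Xs)) = f (X # Xs))"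
    if Xs: "Xs \<in> tuples n" for Xs
  proof -
    have [simp]: "set Xs \<subseteq> Obj C" "length Xs = n" using Xs by (simp_all add: tuples_simps)
    \<comment> \<open>The tail is presented as a single F(Y), the shape that
      \<open>theta_factor_tens\<close> requires.\<close>
    obtain Y where Y: "Y \<in> Obj C" "FO F Y = FOs Xs" using FOs_image[of Xs] by auto
    have "natural A (FO F Y) (FOs Xs \<otimes> B) (\<lambda>X. f (X # Xs))"
      unfolding natural_def Y(2)
    proof (intro conjI ballI)
      fix \<phi> assume [simp]: "\<phi> \<in> Arr C"
      have ids: "map (Dom C) (map (Id C) Xs) = Xs" "map (Cod C) (map (Id C) Xs) = Xs"
        by (rule map_Id; simp)+
      show "f (Cod C \<phi> # Xs) \<cdot> (Id D A \<boxtimes> FA F \<phi> \<boxtimes> Id D (FOs Xs)) = (FA F \<phi> \<boxtimes> Id D (FOs Xs \<otimes> B)) \<cdot> f (Dom C \<phi> # Xs)"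
        using fnat[of "\<phi> # map (Id C) Xs"] by (simp add: ids[simplified] FAs_ids D.tens_id_simps)
    qed (use Xs in simp_all)
    from theta_factor_tens[OF this Y(1)] show ?thesis by (simp only: Y(2))
  qed
  define g where "g Xs = (THE r. r \<in> Hom D (ZO A \<otimes> FOs Xs) (FOs Xs \<otimes> B) \<and>
      (\<forall>X\<in>Obj C. (Id D (FO F X) \<boxtimes> r) \<cdot> (theta X A \<boxtimes> Id D (FOs Xs)) = f (X # Xs)))" for Xs
  have g: "g Xs \<in> Hom D (ZO A \<otimes> FOs Xs) (FOs Xs \<otimes> B)"
    "X \<in> Obj C \<Longrightarrow> (Id D (FO F X) \<boxtimes> g Xs) \<cdot> (theta X A \<boxtimes> Id D (FOs Xs)) = f (X # Xs)"
    if Xs: "Xs \<in> tuples n" for X Xs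
    using theI'[OF ex1[OF Xs]] unfolding g_def by blast+
  have g_unique: "r = g Xs" if Xs: "Xs \<in> tuples n" and "r \<in> Hom D (ZO A \<otimes> FOs Xs) (FOs Xs \<otimes> B)"
    "\<And>X. X \<in> Obj C \<Longrightarrow> (Id D (FO F X) \<boxtimes> r) \<cdot> (theta X A \<boxtimes> Id D (FOs Xs)) = f (X # Xs)" for r Xs
    using ex1[OF Xs] g[OF Xs] that by blast
  have nat: "natural_tuples n (ZO A) B g"
    unfolding natural_tuples_def
  proof (intro conjI ballI allI impI)
    fix \<phi>s assume "set \<phi>s \<subseteq> Arr C \<and> length \<phi>s = n"
    then have [simp]: "set \<phi>s \<subseteq> Arr C" "length \<phi>s = n" by auto
    let ?Xs = "map (Dom C) \<phi>s" and ?Ys = "map (Cod C) \<phi>s"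
    have tup: "?Xs \<in> tuples n" "?Ys \<in> tuples n" by (simp_all add: tuples_simps(1))
    then have [simp]: "set ?Xs \<subseteq> Obj C" "set ?Ys \<subseteq> Obj C" by (simp_all only: tuples_simps(1))
    note [simp] = g(1)[OF tup(1), unfolded hom_iff] g(1)[OF tup(2), unfolded hom_iff]
    obtain Y where Y: "Y \<in> Obj C" "FO F Y = FOs ?Xs" using FOs_image[of ?Xs] by auto
    show "g ?Ys \<cdot> (Id D (ZO A) \<boxtimes> FAs \<phi>s) = (FAs \<phi>s \<boxtimes> Id D B) \<cdot> g ?Xs"
    proof (rule theta_cancel_tens[where A = A and Y = Y], unfold Y(2))
      fix X assume X [simp]: "X \<in> Obj C"
      have "(Id D (FO F X) \<boxtimes> (g ?Ys \<cdot> (Id D (ZO A) \<boxtimes> FAs \<phi>s))) \<cdot> (theta X A \<boxtimes> Id D (FOs ?Xs))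
          = (Id D (FO F X) \<boxtimes> g ?Ys) \<cdot> ((Id D (FO F X \<otimes> ZO A) \<boxtimes> FAs \<phi>s) \<cdot> (theta X A \<boxtimes> Id D (FOs ?Xs)))"
        by (simp add: D.slices)
      also have "(Id D (FO F X \<otimes> ZO A) \<boxtimes> FAs \<phi>s) \<cdot> (theta X A \<boxtimes> Id D (FOs ?Xs))
          = (theta X A \<boxtimes> Id D (FOs ?Ys)) \<cdot> (Id D (A \<otimes> FO F X) \<boxtimes> FAs \<phi>s)"
        by (rule D.exchange[symmetric]) simp_all
      also have "(Id D (FO F X) \<boxtimes> g ?Ys) \<cdot> \<dots> = ((Id D (FO F X) \<boxtimes> g ?Ys) \<cdot> (theta X A \<boxtimes> Id D (FOs ?Ys))) \<cdot> (Id D (A \<otimes> FO F X) \<boxtimes> FAs \<phi>s)"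
        by (simp add: D.assoc)
      also have "(Id D (FO F X) \<boxtimes> g ?Ys) \<cdot> (theta X A \<boxtimes> Id D (FOs ?Ys)) = f (X # ?Ys)" by (rule g(2)[OF tup(2) X])
      also have "f (X # ?Ys) \<cdot> (Id D (A \<otimes> FO F X) \<boxtimes> FAs \<phi>s) = (Id D (FO F X) \<boxtimes> FAs \<phi>s \<boxtimes> Id D B) \<cdot> f (X # ?Xs)"
        using fnat[of "Id C X # \<phi>s"] by (simp add: FA_id D.tens_id_simps)
      also have "f (X # ?Xs) = (Id D (FO F X) \<boxtimes> g ?Xs) \<cdot> (theta X A \<boxtimes> Id D (FOs ?Xs))" by (rule g(2)[OF tup(1) X, symmetric])
      also have "(Id D (FO F X) \<boxtimes> FAs \<phi>s \<boxtimes> Id D B) \<cdot> \<dots> = (Id D (FO F X) \<boxtimes> ((FAs \<phi>s \<boxtimes> Id D B) \<cdot> g ?Xs)) \<cdot> (theta X A \<boxtimes> Id D (FOs ?Xs))"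
        by (simp add: D.slices)
      finally show "(Id D (FO F X) \<boxtimes> (g ?Ys \<cdot> (Id D (ZO A) \<boxtimes> FAs \<phi>s))) \<cdot> (theta X A \<boxtimes> Id D (FOs ?Xs))
          = (Id D (FO F X) \<boxtimes> ((FAs \<phi>s \<boxtimes> Id D B) \<cdot> g ?Xs)) \<cdot> (theta X A \<boxtimes> Id D (FOs ?Xs))" .
    qed (use Y in simp_all)
  qed (use g(1) in simp_all)
  have iff: "(\<forall>Xs\<in>tuples (Suc n). (Id D (FOs Xs) \<boxtimes> t) \<cdot> iter_theta Xs A = f Xs)
      \<longleftrightarrow> (\<forall>Xs\<in>tuples n. (Id D (FOs Xs) \<boxtimes> t) \<cdot> iter_theta Xs (ZO A) = g Xs)"
    if t: "t \<in> Hom D ((ZO ^^ n) (ZO A)) B" for t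
  proof -
    note [simp] = t[unfolded hom_iff]
    have split: "(Id D (FOs (X # Xs)) \<boxtimes> t) \<cdot> iter_theta (X # Xs) A
        = (Id D (FO F X) \<boxtimes> ((Id D (FOs Xs) \<boxtimes> t) \<cdot> iter_theta Xs (ZO A))) \<cdot> (theta X A \<boxtimes> Id D (FOs Xs))"
      if "X \<in> Obj C" "Xs \<in> tuples n" for X Xs
      using that by (simp add: tuples_simps(1) D.slices)
    have typed: "(Id D (FOs Xs) \<boxtimes> t) \<cdot> iter_theta Xs (ZO A) \<in> Hom D (ZO A \<otimes> FOs Xs) (FOs Xs \<otimes> B)"
      if "Xs \<in> tuples n" for Xs
      using that by (simp add: tuples_simps(1) hom_iff)
    show ?thesis
    proof (intro iffI ballI)
      fix Xs assume *: "\<forall>Xs\<in>tuples (Suc n). (Id D (FOs Xs) \<boxtimes> t) \<cdot> iter_theta Xs A = f Xs" and Xs: "Xs \<in> tuples n"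
      show "(Id D (FOs Xs) \<boxtimes> t) \<cdot> iter_theta Xs (ZO A) = g Xs"
      proof (rule g_unique[OF Xs typed[OF Xs]])
        fix X assume X: "X \<in> Obj C"
        then have "X # Xs \<in> tuples (Suc n)" using Xs by (simp add: tuples_simps(1))
        then show "(Id D (FO F X) \<boxtimes> ((Id D (FOs Xs) \<boxtimes> t) \<cdot> iter_theta Xs (ZO A))) \<cdot> (theta X A \<boxtimes> Id D (FOs Xs)) = f (X # Xs)"
          using * split[OF X Xs] by metis
      qed
    next
      fix Xs assume *: "\<forall>Xs\<in>tuples n. (Id D (FOs Xs) \<boxtimes> t) \<cdot> iter_theta Xs (ZO A) = g Xs" and "Xs \<in> tuples (Suc n)"
      then obtain Y Ys where Y: "Xs = Y # Ys" "Y \<in> Obj C" "Ys \<in> tuples n" by (auto simp: tuples_simps(2))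
      then show "(Id D (FOs Xs) \<boxtimes> t) \<cdot> iter_theta Xs A = f Xs"
        using * split[OF Y(2,3)] g(2)[OF Y(3,2)] by metis
    qed
  qed
  have "(t \<in> Hom D ((ZO ^^ n) (ZO A)) B \<and> (\<forall>Xs\<in>tuples (Suc n). (Id D (FOs Xs) \<boxtimes> t) \<cdot> iter_theta Xs A = f Xs))
      \<longleftrightarrow> (t \<in> Hom D ((ZO ^^ n) (ZO A)) B \<and> (\<forall>Xs\<in>tuples n. (Id D (FOs Xs) \<boxtimes> t) \<cdot> iter_theta Xs (ZO A) = g Xs))" for t
    using iff by blast
  with Suc.IH[OF nat] have "\<exists>!t. t \<in> Hom D ((ZO ^^ n) (ZO A)) B \<and>
      (\<forall>Xs\<in>tuples (Suc n). (Id D (FOs Xs) \<boxtimes> t) \<cdot> iter_theta Xs A = f Xs)" by presburger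
  then show ?case by simp
qed

definition cochain :: "nat \<Rightarrow> 'p \<Rightarrow> 'q \<Rightarrow> 'o list \<Rightarrow> 'q" where
  "cochain n A t = (\<lambda>Xs\<in>tuples n. (Id D (FOs Xs) \<boxtimes> t) \<cdot> iter_theta Xs A)"

lemma natural_tuples_cochain:
  assumes t: "t \<in> Hom D ((ZO ^^ n) A) B" and A [simp]: "A \<in> Obj D"
  shows "natural_tuples n A B (cochain n A t)"
  unfolding natural_tuples_def
proof (intro conjI ballI allI impI)
  note [simp] = t[unfolded hom_iff]
  show B [simp]: "B \<in> Obj D" using D.hom_obj[OF t] by simp
  show "cochain n A t Xs \<in> Hom D (A \<otimes> FOs Xs) (FOs Xs \<otimes> B)" if "Xs \<in> tuples n" for Xs
    using that by (simp add: cochain_def tuples_simps(1) hom_iff)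
  fix \<phi>s assume "set \<phi>s \<subseteq> Arr C \<and> length \<phi>s = n"
  then have [simp]: "set \<phi>s \<subseteq> Arr C" "length \<phi>s = n" by auto
  let ?Xs = "map (Dom C) \<phi>s" and ?Ys = "map (Cod C) \<phi>s"
  have tup: "?Xs \<in> tuples n" "?Ys \<in> tuples n" by (simp_all add: tuples_simps(1))
  then have [simp]: "set ?Xs \<subseteq> Obj C" "set ?Ys \<subseteq> Obj C" by (simp_all only: tuples_simps(1))
  have "cochain n A t ?Ys \<cdot> (Id D A \<boxtimes> FAs \<phi>s) = (Id D (FOs ?Ys) \<boxtimes> t) \<cdot> (iter_theta ?Ys A \<cdot> (Id D A \<boxtimes> FAs \<phi>s))"
    using tup by (simp add: cochain_def D.assoc)
  also have "iter_theta ?Ys A \<cdot> (Id D A \<boxtimes> FAs \<phi>s) = (FAs \<phi>s \<boxtimes> Id D ((ZO ^^ n) A)) \<cdot> iter_theta ?Xs A"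
    using iter_theta_natural[of \<phi>s A] by simp
  also have "(Id D (FOs ?Ys) \<boxtimes> t) \<cdot> \<dots> = ((Id D (FOs ?Ys) \<boxtimes> t) \<cdot> (FAs \<phi>s \<boxtimes> Id D ((ZO ^^ n) A))) \<cdot> iter_theta ?Xs A"
    by (simp add: D.assoc)
  also have "(Id D (FOs ?Ys) \<boxtimes> t) \<cdot> (FAs \<phi>s \<boxtimes> Id D ((ZO ^^ n) A)) = (FAs \<phi>s \<boxtimes> Id D B) \<cdot> (Id D (FOs ?Xs) \<boxtimes> t)"
    by (rule D.exchange[symmetric]) simp_all
  finally show "cochain n A t ?Ys \<cdot> (Id D A \<boxtimes> FAs \<phi>s) = (FAs \<phi>s \<boxtimes> Id D B) \<cdot> cochain n A t ?Xs"
    using tup by (simp add: cochain_def D.assoc)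
qed simp

lemma dy_cochains_iff:
  assumes "fst U \<in> Obj D" "fst V \<in> Obj D"
  shows "f \<in> dy_cochains n U V \<longleftrightarrow> f \<in> extensional (tuples n) \<and> natural_tuples n (fst U) (fst V) f"
  using assms by (auto simp: dy_cochains_def natural_tuples_def)

lemma cochain_cancel:
  assumes "t \<in> Hom D ((ZO ^^ n) A) B" "t' \<in> Hom D ((ZO ^^ n) A) B" "A \<in> Obj D"
    and "\<And>Xs. Xs \<in> tuples n \<Longrightarrow> (Id D (FOs Xs) \<boxtimes> t) \<cdot> iter_theta Xs A = (Id D (FOs Xs) \<boxtimes> t') \<cdot> iter_theta Xs A"
  shows "t = t'"
proof -
  have "\<forall>Xs\<in>tuples n. (Id D (FOs Xs) \<boxtimes> t) \<cdot> iter_theta Xs A = cochain n A t Xs" 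
    "\<forall>Xs\<in>tuples n. (Id D (FOs Xs) \<boxtimes> t') \<cdot> iter_theta Xs A = cochain n A t Xs"
    using assms(4) by (simp_all add: cochain_def)
  then show ?thesis
    using iter_theta_factor[OF natural_tuples_cochain[OF assms(1,3)]] assms(1,2) by metis
qed

lemma cochain_mem:
  assumes "t \<in> Hom D ((ZO ^^ n) (fst U)) (fst V)" "fst U \<in> Obj D"
  shows "cochain n (fst U) t \<in> dy_cochains n U V"
  using natural_tuples_cochain[OF assms] D.hom_obj[OF assms(1)] assms(2)
  by (simp add: dy_cochains_iff cochain_def)

lemma cochain_surj:
  assumes f: "f \<in> dy_cochains n U V" and "fst U \<in> Obj D" "fst V \<in> Obj D"
  shows "\<exists>t\<in>Hom D ((ZO ^^ n) (fst U)) (fst V). f = cochain n (fst U) t"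
proof -
  have f': "f \<in> extensional (tuples n)" "natural_tuples n (fst U) (fst V) f"
    using assms by (auto simp: dy_cochains_iff)
  obtain t where t: "t \<in> Hom D ((ZO ^^ n) (fst U)) (fst V)"
    "\<forall>Xs\<in>tuples n. (Id D (FOs Xs) \<boxtimes> t) \<cdot> iter_theta Xs (fst U) = f Xs"
    using iter_theta_factor[OF f'(2)] by blast
  have "f = cochain n (fst U) t"
    by (rule extensionalityI[OF f'(1)]) (use t(2) in \<open>simp_all add: cochain_def\<close>)
  with t(1) show ?thesis by blast
qed

end

lemma (in linear_category) hom_sum_map:
  assumes h: "\<And>i. i < n \<Longrightarrow> h i \<in> Hom C X Y" and "X \<in> Obj C" "Y \<in> Obj C"
    and add: "\<And>f g. \<lbrakk>f \<in> Hom C X Y; g \<in> Hom C X Y\<rbrakk> \<Longrightarrow> L (Add C f g) = Add C' (L f) (L g)"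
    and zero: "L (Zero C X Y) = Zero C' X' Y'"
  shows "L (hom_sum C X Y h n) = hom_sum C' X' Y' (\<lambda>i. L (h i)) n"
  using h
proof (induction n)
  case (Suc n)
  have "hom_sum C X Y h n \<in> Hom C X Y" by (rule hom_sum_typing) (use assms Suc.prems in auto)
  then show ?case using Suc by (simp add: add)
qed (simp add: zero)

text \<open>\<open>hom_sum\<close> grows at its last summand, whereas the Davydov--Yetter
  differential singles out the first face.\<close>

lemma (in linear_category) hom_sum_shift:
  assumes h: "\<And>i. i < Suc n \<Longrightarrow> h i \<in> Hom C X Y" and "X \<in> Obj C" "Y \<in> Obj C"
  shows "hom_sum C X Y h (Suc n) = Add C (h 0) (hom_sum C X Y (\<lambda>i. h (Suc i)) n)"
  using h
proof (induction n)
  case 0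
  then show ?case using assms by (simp add: hom_iff)
next
  case (Suc n)
  have s: "hom_sum C X Y (\<lambda>i. h (Suc i)) n \<in> Hom C X Y"
    by (rule hom_sum_typing) (use assms Suc.prems in auto)
  have h0: "h 0 \<in> Hom C X Y" and h1: "h (Suc n) \<in> Hom C X Y" using Suc.prems by auto
  have "hom_sum C X Y h (Suc (Suc n)) = Add C (hom_sum C X Y h (Suc n)) (h (Suc n))" by simp
  also have "hom_sum C X Y h (Suc n) = Add C (h 0) (hom_sum C X Y (\<lambda>i. h (Suc i)) n)"
    using Suc by simp
  also have "Add C \<dots> (h (Suc n)) = Add C (h 0) (Add C (hom_sum C X Y (\<lambda>i. h (Suc i)) n) (h (Suc n)))"
    by (rule add_assoc[OF h0 s h1])
  finally show ?case by simp
qed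

context monoidal_functor
begin

section \<open>Faces of the bar resolution on the iterated universal family\<close>

lemma funpow_ZA_theta:
  assumes "set Xs \<subseteq> Obj C" "s \<in> Arr D" "Dom D s = A" "Cod D s = B"
  shows "(Id D (FOs Xs) \<boxtimes> (ZA ^^ length Xs) s) \<cdot> iter_theta Xs A = iter_theta Xs B \<cdot> (s \<boxtimes> Id D (FOs Xs))"
  using assms
proof (induction Xs arbitrary: s A B)
  case Nil
  then have "A \<in> Obj D" "B \<in> Obj D" using D.arr_obj by auto
  with Nil show ?case by simp
next
  case (Cons X Xs)
  then have [simp]: "X \<in> Obj C" "set Xs \<subseteq> Obj C" "s \<in> Arr D" "Dom D s = A" "Cod D s = B" by simp_all
  have [simp]: "A \<in> Obj D" "B \<in> Obj D" using D.arr_obj[of s] by simp_all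
  let ?R = "FOs Xs"
  have "(Id D (FOs (X # Xs)) \<boxtimes> (ZA ^^ length (X # Xs)) s) \<cdot> iter_theta (X # Xs) A
      = (Id D (FO F X) \<boxtimes> ((Id D ?R \<boxtimes> (ZA ^^ length Xs) (ZA s)) \<cdot> iter_theta Xs (ZO A))) \<cdot> (theta X A \<boxtimes> Id D ?R)"
    by (simp add: D.slices)
  also have "(Id D ?R \<boxtimes> (ZA ^^ length Xs) (ZA s)) \<cdot> iter_theta Xs (ZO A) = iter_theta Xs (ZO B) \<cdot> (ZA s \<boxtimes> Id D ?R)"
    by (rule Cons.IH) simp_all
  also have "(Id D (FO F X) \<boxtimes> \<dots>) \<cdot> (theta X A \<boxtimes> Id D ?R)
      = (Id D (FO F X) \<boxtimes> iter_theta Xs (ZO B)) \<cdot> (((Id D (FO F X) \<boxtimes> ZA s) \<cdot> theta X A) \<boxtimes> Id D ?R)"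
    by (simp add: D.slices)
  also have "(Id D (FO F X) \<boxtimes> ZA s) \<cdot> theta X A = theta X B \<cdot> (s \<boxtimes> Id D (FO F X))"
    by (rule ZA_theta) simp_all
  finally show ?case by (simp add: D.slices)
qed

text \<open>The innermost counit turns the first \<open>theta\<close> into the half-braiding of V.
  This face yields the first term of the Davydov--Yetter differential.\<close>

lemma iter_theta_counit_Cons:
  assumes V: "V \<in> centralizer" and [simp]: "X \<in> Obj C" "set Xs \<subseteq> Obj C"
  shows "(Id D (FO F X \<otimes> FOs Xs) \<boxtimes> (ZA ^^ length Xs) (counit V)) \<cdot> iter_theta (X # Xs) (fst V)
    = (Id D (FO F X) \<boxtimes> iter_theta Xs (fst V)) \<cdot> (snd V X \<boxtimes> Id D (FOs Xs))"
proof -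
  note [simp] = V centralizerD(1-4)[OF V]
  have "(Id D (FO F X \<otimes> FOs Xs) \<boxtimes> (ZA ^^ length Xs) (counit V)) \<cdot> iter_theta (X # Xs) (fst V)
      = (Id D (FO F X) \<boxtimes> ((Id D (FOs Xs) \<boxtimes> (ZA ^^ length Xs) (counit V)) \<cdot> iter_theta Xs (ZO (fst V))))
        \<cdot> (theta X (fst V) \<boxtimes> Id D (FOs Xs))"
    by (simp add: D.slices)
  also have "(Id D (FOs Xs) \<boxtimes> (ZA ^^ length Xs) (counit V)) \<cdot> iter_theta Xs (ZO (fst V))
      = iter_theta Xs (fst V) \<cdot> (counit V \<boxtimes> Id D (FOs Xs))"
    by (rule funpow_ZA_theta) simp_all
  also have "(Id D (FO F X) \<boxtimes> \<dots>) \<cdot> (theta X (fst V) \<boxtimes> Id D (FOs Xs))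
      = (Id D (FO F X) \<boxtimes> iter_theta Xs (fst V)) \<cdot> (((Id D (FO F X) \<boxtimes> counit V) \<cdot> theta X (fst V)) \<boxtimes> Id D (FOs Xs))"
    by (simp add: D.slices)
  finally show ?thesis by (simp add: counit_theta)
qed

text \<open>The counit of a free object acts through the half-braiding of that object, and
  \<open>theta_tens\<close> then merges two neighbouring objects of the list. These faces yield the
  inner terms of the Davydov--Yetter differential.\<close>

lemma iter_theta_counit_mult:
  assumes "set Ps \<subseteq> Obj C" "X \<in> Obj C" "Y \<in> Obj C" "set Ss \<subseteq> Obj C" "fst V \<in> Obj D"
  shows "(Id D (FOs (Ps @ X # Y # Ss)) \<boxtimes> (ZA ^^ length Ss) (counit ((GO ^^ Suc (length Ps)) V))) \<cdot> iter_theta (Ps @ X # Y # Ss) (fst V)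
    = iter_theta (Ps @ (X \<otimes>\<^bsub>C\<^esub> Y) # Ss) (fst V)"
  using assms
proof (induction Ps arbitrary: V)
  case Nil
  then have [simp]: "X \<in> Obj C" "Y \<in> Obj C" "set Ss \<subseteq> Obj C" "fst V \<in> Obj D" by simp_all
  have G [simp]: "GO V \<in> centralizer" by (rule GO_centralizer) simp
  let ?A = "fst V"
  have "(Id D (FO F X \<otimes> FO F Y \<otimes> FOs Ss) \<boxtimes> (ZA ^^ length Ss) (counit (GO V))) \<cdot> iter_theta (X # Y # Ss) ?A
      = (Id D (FO F X) \<boxtimes> ((Id D (FO F Y \<otimes> FOs Ss) \<boxtimes> (ZA ^^ length Ss) (counit (GO V))) \<cdot> iter_theta (Y # Ss) (ZO ?A)))
        \<cdot> (theta X ?A \<boxtimes> Id D (FO F Y \<otimes> FOs Ss))"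
    by (simp add: D.slices)
  also have "(Id D (FO F Y \<otimes> FOs Ss) \<boxtimes> (ZA ^^ length Ss) (counit (GO V))) \<cdot> iter_theta (Y # Ss) (ZO ?A)
      = (Id D (FO F Y) \<boxtimes> iter_theta Ss (ZO ?A)) \<cdot> (Z_braiding ?A Y \<boxtimes> Id D (FOs Ss))"
    using iter_theta_counit_Cons[OF G, of Y Ss] by simp
  also have "(Id D (FO F X) \<boxtimes> \<dots>) \<cdot> (theta X ?A \<boxtimes> Id D (FO F Y \<otimes> FOs Ss))
      = (Id D (FO F X \<otimes> FO F Y) \<boxtimes> iter_theta Ss (ZO ?A)) \<cdot> (((Id D (FO F X) \<boxtimes> Z_braiding ?A Y) \<cdot> (theta X ?A \<boxtimes> Id D (FO F Y))) \<boxtimes> Id D (FOs Ss))"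
    by (simp add: D.slices)
  finally show ?case by (simp add: theta_tens)
next
  case (Cons P Ps)
  then have [simp]: "P \<in> Obj C" "set Ps \<subseteq> Obj C" "X \<in> Obj C" "Y \<in> Obj C" "set Ss \<subseteq> Obj C" "fst V \<in> Obj D" by simp_all
  have G [simp]: "GO V \<in> centralizer" by (rule GO_centralizer) simp
  let ?A = "fst V" and ?R = "FOs (Ps @ X # Y # Ss)" and ?c = "(ZA ^^ length Ss) (counit ((GO ^^ Suc (length Ps)) (GO V)))"
  have G': "(GO ^^ Suc (length Ps)) (GO V) \<in> centralizer" by (rule funpow_GO_centralizer) simp
  have c [simp]: "?c \<in> Arr D" "Dom D ?c = ZO (ZO (ZO ((ZO ^^ length Ss) ((ZO ^^ length Ps) ?A))))"
     "Cod D ?c = ZO (ZO ((ZO ^^ length Ss) ((ZO ^^ length Ps) ?A)))"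
    using G' by simp_all
  have len: "length (Ps @ X # Y # Ss) = Suc (Suc (length Ss + length Ps))" by simp
  have sub: "set (Ps @ X # Y # Ss) \<subseteq> Obj C" by simp
  define R i where "R = ?R" and "i = iter_theta (Ps @ X # Y # Ss) (ZO ?A)"
  have [simp]: "R \<in> Obj D" "i \<in> Arr D" "Dom D i = ZO ?A \<otimes> R" "Cod D i = R \<otimes> Dom D ?c"
    using FOs_obj[OF sub] iter_theta_typing[OF sub, of "ZO ?A"]
    unfolding R_def i_def len c by (simp_all add: funpow_add)
  have "(Id D (FOs ((P # Ps) @ X # Y # Ss)) \<boxtimes> ?c) \<cdot> iter_theta ((P # Ps) @ X # Y # Ss) ?A
      = (Id D (FO F P \<otimes> R) \<boxtimes> ?c) \<cdot> (Id D (FO F P) \<boxtimes> i) \<cdot> (theta P ?A \<boxtimes> Id D R)"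
    by (simp add: R_def i_def del: FOs_append)
  also have "\<dots> = (Id D (FO F P) \<boxtimes> ((Id D R \<boxtimes> ?c) \<cdot> i)) \<cdot> (theta P ?A \<boxtimes> Id D R)"
    using G' by (simp add: D.slices)
  finally have "(Id D (FOs ((P # Ps) @ X # Y # Ss)) \<boxtimes> ?c) \<cdot> iter_theta ((P # Ps) @ X # Y # Ss) ?A
      = (Id D (FO F P) \<boxtimes> ((Id D ?R \<boxtimes> ?c) \<cdot> iter_theta (Ps @ X # Y # Ss) (ZO ?A))) \<cdot> (theta P ?A \<boxtimes> Id D ?R)"
    by (simp only: R_def i_def)
  also have "(Id D ?R \<boxtimes> ?c) \<cdot> iter_theta (Ps @ X # Y # Ss) (ZO ?A) = iter_theta (Ps @ (X \<otimes>\<^bsub>C\<^esub> Y) # Ss) (ZO ?A)"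
    using Cons.IH[of "GO V"] by simp
  finally show ?case by simp
qed

text \<open>Z(t) moves past the last \<open>theta\<close>, and the counit then turns that
  \<open>theta\<close> into the half-braiding of V. The right-hand side is the shape shared by
  \<Gamma> and by the last term of the Davydov--Yetter differential.\<close>

lemma counit_ZA_iter_theta:
  assumes V: "V \<in> centralizer" and t: "t \<in> Hom D ((ZO ^^ length Xs) A) (fst V)"
    and [simp]: "set Xs \<subseteq> Obj C" "X \<in> Obj C" "A \<in> Obj D"
  shows "(Id D (FOs (Xs @ [X])) \<boxtimes> (counit V \<cdot> ZA t)) \<cdot> iter_theta (Xs @ [X]) A
    = (Id D (FOs Xs) \<boxtimes> snd V X) \<cdot> (((Id D (FOs Xs) \<boxtimes> t) \<cdot> iter_theta Xs A) \<boxtimes> Id D (FO F X))"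
proof -
  note [simp] = V centralizerD(1-4)[OF V] t[unfolded hom_iff]
  let ?Z = "(ZO ^^ length Xs) A"
  have "(Id D (FOs (Xs @ [X])) \<boxtimes> (counit V \<cdot> ZA t)) \<cdot> iter_theta (Xs @ [X]) A
      = (Id D (FOs Xs) \<boxtimes> ((Id D (FO F X) \<boxtimes> counit V) \<cdot> ((Id D (FO F X) \<boxtimes> ZA t) \<cdot> theta X ?Z))) \<cdot> (iter_theta Xs A \<boxtimes> Id D (FO F X))"
    by (simp add: iter_theta_snoc D.slices)
  also have "(Id D (FO F X) \<boxtimes> ZA t) \<cdot> theta X ?Z = theta X (fst V) \<cdot> (t \<boxtimes> Id D (FO F X))"
    by (rule ZA_theta) simp_all
  also have "(Id D (FO F X) \<boxtimes> counit V) \<cdot> \<dots> = snd V X \<cdot> (t \<boxtimes> Id D (FO F X))"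
    by (simp add: D.assoc[symmetric] counit_theta)
  finally show ?thesis by (simp add: D.slices)
qed

subsection \<open>The isomorphism \<open>\<Gamma>\<close>\<close>

definition untranspose_list :: "'p \<Rightarrow> 'o list \<Rightarrow> 'q \<Rightarrow> 'q" where
  "untranspose_list B Xs g = (evs Xs \<boxtimes> Id D B) \<cdot> (Id D (FO_duals Xs) \<boxtimes> g)"

lemma evs_simps:
  "evs [] = Id D (Unit D)"
  "evs (Xs @ [X]) = FA F (Ev C X) \<cdot> (Id D (FO F (Dual C X)) \<boxtimes> evs Xs \<boxtimes> Id D (FO F X))"
  by (simp_all add: evs_def)

lemma FO_duals_simps [simp]:
  "FO_duals [] = Unit D" "FO_duals (Xs @ [X]) = FO F (Dual C X) \<otimes> FO_duals Xs"
  by (simp_all add: FO_duals_def)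

lemma FO_duals_obj [simp]: "set Xs \<subseteq> Obj C \<Longrightarrow> FO_duals Xs \<in> Obj D"
  by (induction Xs rule: rev_induct) simp_all

lemma evs_typing [simp]:
  assumes "set Xs \<subseteq> Obj C"
  shows "evs Xs \<in> Arr D" "Dom D (evs Xs) = FO_duals Xs \<otimes> FOs Xs" "Cod D (evs Xs) = Unit D"
  using assms by (induction Xs rule: rev_induct) (simp_all add: evs_simps)

lemma untranspose_list_typing [simp]:
  assumes "set Xs \<subseteq> Obj C" "g \<in> Arr D" "Cod D g = FOs Xs \<otimes> B" "B \<in> Obj D"
  shows "untranspose_list B Xs g \<in> Arr D" "Dom D (untranspose_list B Xs g) = FO_duals Xs \<otimes> Dom D g"
    "Cod D (untranspose_list B Xs g) = B"
  using assms by (simp_all add: untranspose_list_def)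

lemma untranspose_list_snoc:
  assumes [simp]: "set Xs \<subseteq> Obj C" "X \<in> Obj C" "g \<in> Arr D" "Cod D g = FOs Xs \<otimes> FO F X \<otimes> B" "B \<in> Obj D"
  shows "untranspose_list B (Xs @ [X]) g = untranspose B X (untranspose_list (FO F X \<otimes> B) Xs g)"
  by (simp add: untranspose_list_def untranspose_def evs_simps D.slices)

lemma untranspose_list_cancel:
  assumes "untranspose_list B Xs g = untranspose_list B Xs g'" "set Xs \<subseteq> Obj C" "g \<in> Arr D" "g' \<in> Arr D"
    "Cod D g = FOs Xs \<otimes> B" "Cod D g' = FOs Xs \<otimes> B" "Dom D g' = Dom D g" "B \<in> Obj D"
  shows "g = g'"
  using assms
proof (induction Xs arbitrary: B rule: rev_induct)
  case Nil
  then show ?case by (simp add: untranspose_list_def evs_simps)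
next
  case (snoc X Xs)
  have [simp]: "set Xs \<subseteq> Obj C" "X \<in> Obj C" using snoc.prems(2) by simp_all
  note [simp] = snoc.prems(3-8)
  have "untranspose_list (FO F X \<otimes> B) Xs g = untranspose_list (FO F X \<otimes> B) Xs g'"
    by (rule untranspose_cancel[of B X]) (use snoc.prems(1) in \<open>simp_all add: untranspose_list_snoc\<close>)
  then show ?case by (rule snoc.IH) simp_all
qed

lemma untranspose_list_post:
  assumes [simp]: "set Xs \<subseteq> Obj C" "g \<in> Arr D" "Cod D g = FOs Xs \<otimes> B" "t \<in> Arr D" "Dom D t = B" "Cod D t = B'"
  shows "untranspose_list B' Xs ((Id D (FOs Xs) \<boxtimes> t) \<cdot> g) = t \<cdot> untranspose_list B Xs g"
proof -
  have [simp]: "B \<in> Obj D" "B' \<in> Obj D" using D.arr_obj[of t] by simp_all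
  have "untranspose_list B' Xs ((Id D (FOs Xs) \<boxtimes> t) \<cdot> g)
      = ((evs Xs \<boxtimes> Id D B') \<cdot> (Id D (FO_duals Xs \<otimes> FOs Xs) \<boxtimes> t)) \<cdot> (Id D (FO_duals Xs) \<boxtimes> g)"
    by (simp add: untranspose_list_def D.slices)
  also have "(evs Xs \<boxtimes> Id D B') \<cdot> (Id D (FO_duals Xs \<otimes> FOs Xs) \<boxtimes> t) = t \<cdot> (evs Xs \<boxtimes> Id D B)"
    using D.exchange[of "evs Xs" t "FO_duals Xs \<otimes> FOs Xs" "Unit D" B B'] by simp
  finally show ?thesis by (simp add: untranspose_list_def D.assoc)
qed

text \<open>\<open>din_iter\<close> evaluates after each dinatural map, the right-hand side
  evaluates at the end. An evaluation can be postponed because the later maps act on other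
  strands.\<close>

lemma din_iter_theta:
  assumes "set Xs \<subseteq> Obj C" "A \<in> Obj D"
  shows "din_iter Xs A = untranspose_list ((ZO ^^ length Xs) A) Xs (iter_theta Xs A)"
  using assms
proof (induction Xs rule: rev_induct)
  case Nil
  then show ?case by (simp add: din_iter_def untranspose_list_def evs_simps D.tens_id_simps)
next
  case (snoc X Xs)
  then have [simp]: "set Xs \<subseteq> Obj C" "X \<in> Obj C" "A \<in> Obj D" by simp_all
  let ?Z = "(ZO ^^ length Xs) A" and ?X = "FO F X" and ?X' = "FO F (Dual C X)" and ?th = "iter_theta Xs A"
  have "din_iter (Xs @ [X]) A = din X ?Z \<cdot> (Id D ?X' \<boxtimes> din_iter Xs A \<boxtimes> Id D ?X)"
    by (simp add: din_iter_def)
  also have "\<dots> = (FA F (Ev C X) \<boxtimes> Id D (ZO ?Z)) \<cdot> (Id D ?X' \<boxtimes> (theta X ?Z \<cdot> (untranspose_list ?Z Xs ?th \<boxtimes> Id D ?X)))"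
    using snoc.IH by (simp add: din_theta untranspose_def D.slices)
  also have "untranspose_list ?Z Xs ?th \<boxtimes> Id D ?X = untranspose_list (?Z \<otimes> ?X) Xs (?th \<boxtimes> Id D ?X)"
    by (simp add: untranspose_list_def D.slices)
  also have "theta X ?Z \<cdot> \<dots> = untranspose_list (?X \<otimes> ZO ?Z) Xs ((Id D (FOs Xs) \<boxtimes> theta X ?Z) \<cdot> (?th \<boxtimes> Id D ?X))"
    by (rule untranspose_list_post[symmetric]) simp_all
  also have "(Id D (FOs Xs) \<boxtimes> theta X ?Z) \<cdot> (?th \<boxtimes> Id D ?X) = iter_theta (Xs @ [X]) A"
    by (rule iter_theta_snoc[symmetric]) simp_all
  also have "(FA F (Ev C X) \<boxtimes> Id D (ZO ?Z)) \<cdot> (Id D ?X' \<boxtimes> untranspose_list (?X \<otimes> ZO ?Z) Xs (iter_theta (Xs @ [X]) A))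
      = untranspose_list (ZO ?Z) (Xs @ [X]) (iter_theta (Xs @ [X]) A)"
    by (subst untranspose_list_snoc) (simp_all add: untranspose_def)
  finally show ?case by simp
qed

text \<open>Once a cochain is written as an arrow t : Z^n(U) \<rightarrow> V of D, \<Gamma> is the
  adjunction bijection that extends t to an arrow of the centralizer out of the free object
  G^(n+1)(U).\<close>

lemma Gam_cochain:
  assumes V: "V \<in> centralizer" and A [simp]: "fst U \<in> Obj D" and t: "t \<in> Hom D ((ZO ^^ n) (fst U)) (fst V)"
  shows "Gam n U V (cochain n (fst U) t) = counit V \<cdot> ZA t"
proof -
  note [simp] = V centralizerD(1-4)[OF V] t[unfolded hom_iff]
  let ?A = "fst U" and ?B = "fst V" and ?c = "cochain n (fst U) t"
  let ?rhs = "\<lambda>Xs. (evs Xs \<boxtimes> Id D ?B) \<cdot>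
        (Id D (FO_duals Xs) \<boxtimes> Id D (FOs (butlast Xs)) \<boxtimes> snd V (last Xs)) \<cdot>
        (Id D (FO_duals Xs) \<boxtimes> ?c (butlast Xs) \<boxtimes> Id D (FO F (last Xs)))"
  have iff: "s \<cdot> din_iter Xs ?A = ?rhs Xs \<longleftrightarrow>
      (Id D (FOs Xs) \<boxtimes> s) \<cdot> iter_theta Xs ?A = (Id D (FOs Xs) \<boxtimes> (counit V \<cdot> ZA t)) \<cdot> iter_theta Xs ?A"
    if s: "s \<in> Hom D ((ZO ^^ Suc n) ?A) ?B" and Xs: "Xs \<in> tuples (Suc n)" for s Xs
  proof -
    note [simp] = s[unfolded hom_iff]
    have "Xs \<noteq> []" using Xs by (auto simp: tuples_simps(1))
    then obtain Ys X where Xs_eq: "Xs = Ys @ [X]" by (metis append_butlast_last_id)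
    have Ys [simp]: "set Ys \<subseteq> Obj C" "X \<in> Obj C" "length Ys = n" using Xs by (auto simp: Xs_eq tuples_simps(1))
    have [simp]: "set (Ys @ [X]) \<subseteq> Obj C" by simp
    have "?rhs Xs = untranspose_list ?B Xs ((Id D (FOs Ys) \<boxtimes> snd V X) \<cdot> (((Id D (FOs Ys) \<boxtimes> t) \<cdot> iter_theta Ys ?A) \<boxtimes> Id D (FO F X)))"
      by (simp add: Xs_eq cochain_def tuples_simps(1) untranspose_list_def D.slices)
    also have "\<dots> = untranspose_list ?B Xs ((Id D (FOs Xs) \<boxtimes> (counit V \<cdot> ZA t)) \<cdot> iter_theta Xs ?A)"
      using counit_ZA_iter_theta[OF V, of t Ys ?A X] t by (simp add: Xs_eq)
    finally have r: "?rhs Xs = untranspose_list ?B Xs ((Id D (FOs Xs) \<boxtimes> (counit V \<cdot> ZA t)) \<cdot> iter_theta Xs ?A)" .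
    have l: "s \<cdot> din_iter Xs ?A = untranspose_list ?B Xs ((Id D (FOs Xs) \<boxtimes> s) \<cdot> iter_theta Xs ?A)"
      by (subst untranspose_list_post[of _ _ "(ZO ^^ length Xs) ?A"]) (simp_all add: Xs_eq din_iter_theta)
    show ?thesis
      unfolding l r
      by (intro iffI, erule untranspose_list_cancel) (simp_all add: Xs_eq)
  qed
  show ?thesis
    unfolding Gam_def
  proof (rule the_equality)
    have c: "counit V \<cdot> ZA t \<in> Hom D ((ZO ^^ Suc n) ?A) ?B" by (simp add: hom_iff)
    then show "counit V \<cdot> ZA t \<in> Hom D ((ZO ^^ Suc n) ?A) ?B \<and> (\<forall>Xs\<in>tuples (Suc n). (counit V \<cdot> ZA t) \<cdot> din_iter Xs ?A = ?rhs Xs)"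
      using iff[OF c] by blast
    fix s assume "s \<in> Hom D ((ZO ^^ Suc n) ?A) ?B \<and> (\<forall>Xs\<in>tuples (Suc n). s \<cdot> din_iter Xs ?A = ?rhs Xs)"
    then have s: "s \<in> Hom D ((ZO ^^ Suc n) ?A) ?B" "\<And>Xs. Xs \<in> tuples (Suc n) \<Longrightarrow> s \<cdot> din_iter Xs ?A = ?rhs Xs" by auto
    show "s = counit V \<cdot> ZA t"
      by (rule cochain_cancel[OF s(1) c A]) (use iff[OF s(1)] s(2) in blast)
  qed
qed

end

section \<open>The bar complex\<close>

context monoidal_functor
begin

lemma centralizer_hom_iff:
  "f \<in> centralizer_hom V W \<longleftrightarrow> f \<in> Arr D \<and> Dom D f = fst V \<and> Cod D f = fst W \<and>
     (\<forall>X\<in>Obj C. (Id D (FO F X) \<boxtimes> f) \<cdot> snd V X = snd W X \<cdot> (f \<boxtimes> Id D (FO F X)))"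
  by (auto simp: centralizer_hom_def hom_iff)

lemma centralizer_hom_comp:
  assumes "f \<in> centralizer_hom U V" "g \<in> centralizer_hom V W" "U \<in> centralizer" "V \<in> centralizer" "W \<in> centralizer"
  shows "g \<cdot> f \<in> centralizer_hom U W"
  unfolding centralizer_hom_iff
proof (intro conjI ballI)
  note [simp] = centralizer_homD(1-3)[OF assms(1)] centralizer_homD(1-3)[OF assms(2)]
    centralizerD(1-4)[OF assms(3)] centralizerD(1-4)[OF assms(4)] centralizerD(1-4)[OF assms(5)]
  fix X assume X [simp]: "X \<in> Obj C"
  have "(Id D (FO F X) \<boxtimes> (g \<cdot> f)) \<cdot> snd U X = (Id D (FO F X) \<boxtimes> g) \<cdot> ((Id D (FO F X) \<boxtimes> f) \<cdot> snd U X)"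
    by (simp add: D.slices)
  also have "\<dots> = ((Id D (FO F X) \<boxtimes> g) \<cdot> snd V X) \<cdot> (f \<boxtimes> Id D (FO F X))"
    by (simp add: centralizer_homD(4)[OF assms(1)] D.assoc)
  also have "\<dots> = snd W X \<cdot> ((g \<cdot> f) \<boxtimes> Id D (FO F X))"
    by (simp add: centralizer_homD(4)[OF assms(2)] D.slices)
  finally show "(Id D (FO F X) \<boxtimes> (g \<cdot> f)) \<cdot> snd U X = snd W X \<cdot> ((g \<cdot> f) \<boxtimes> Id D (FO F X))" .
qed (use centralizer_homD(1-3)[OF assms(1)] centralizer_homD(1-3)[OF assms(2)] in simp_all)

lemma centralizer_hom_add:
  assumes f: "f \<in> centralizer_hom U V" and g: "g \<in> centralizer_hom U V" and "U \<in> centralizer" "V \<in> centralizer"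
  shows "Add D f g \<in> centralizer_hom U V"
  using f g centralizerD(1-4)[OF assms(3)] centralizerD(1-4)[OF assms(4)]
  by (auto simp: centralizer_hom_iff D.tens_add D.add_comp)

lemma centralizer_hom_scale:
  assumes f: "f \<in> centralizer_hom U V" and "U \<in> centralizer" "V \<in> centralizer"
  shows "Scale D c f \<in> centralizer_hom U V"
  using f centralizerD(1-4)[OF assms(2)] centralizerD(1-4)[OF assms(3)]
  by (auto simp: centralizer_hom_iff D.tens_scale D.scale_comp)

lemma centralizer_hom_zero:
  assumes "U \<in> centralizer" "V \<in> centralizer"
  shows "Zero D (fst U) (fst V) \<in> centralizer_hom U V"
  using centralizerD(1-4)[OF assms(1)] centralizerD(1-4)[OF assms(2)] by (auto simp: centralizer_hom_iff)

text \<open>The first application of Z makes an arrow of D compatible with the half-braidings. The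
  primed version also covers zero applications and so starts with an arrow of the
  centralizer.\<close>

lemma funpow_ZA_centralizer_hom:
  "s \<in> Hom D (fst V) (fst W) \<Longrightarrow> (ZA ^^ Suc n) s \<in> centralizer_hom ((GO ^^ Suc n) V) ((GO ^^ Suc n) W)"
proof (induction n)
  case (Suc n)
  then have "(ZA ^^ Suc n) s \<in> Hom D (fst ((GO ^^ Suc n) V)) (fst ((GO ^^ Suc n) W))"
    by (auto simp: hom_iff)
  from ZA_centralizer_hom[OF this] show ?case by simp
qed (simp add: ZA_centralizer_hom)

lemma funpow_ZA_centralizer_hom':
  assumes "s \<in> centralizer_hom V W"
  shows "(ZA ^^ n) s \<in> centralizer_hom ((GO ^^ n) V) ((GO ^^ n) W)"
proof (cases n)
  case (Suc m)
  then show ?thesis using funpow_ZA_centralizer_hom[of s V W m] assms by (simp add: centralizer_hom_iff hom_iff)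
qed (simp add: assms)

lemma funpow_ZA_comp:
  "\<lbrakk>f \<in> Arr D; g \<in> Arr D; Dom D g = Cod D f\<rbrakk> \<Longrightarrow> (ZA ^^ n) (g \<cdot> f) = (ZA ^^ n) g \<cdot> (ZA ^^ n) f"
  by (induction n) (simp_all add: ZA_comp)

lemma funpow_ZA_add:
  "\<lbrakk>f \<in> Arr D; g \<in> Arr D; Dom D g = Dom D f; Cod D g = Cod D f\<rbrakk>
    \<Longrightarrow> (ZA ^^ n) (Add D f g) = Add D ((ZA ^^ n) f) ((ZA ^^ n) g)"
  by (induction n) (simp_all add: ZA_add)

lemma funpow_ZA_scale: "f \<in> Arr D \<Longrightarrow> (ZA ^^ n) (Scale D c f) = Scale D c ((ZA ^^ n) f)"
  by (induction n) (simp_all add: ZA_scale)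

lemma funpow_ZA_id: "A \<in> Obj D \<Longrightarrow> (ZA ^^ n) (Id D A) = Id D ((ZO ^^ n) A)"
  by (induction n) simp_all

lemma funpow_ZA_zero: "\<lbrakk>A \<in> Obj D; B \<in> Obj D\<rbrakk> \<Longrightarrow> (ZA ^^ n) (Zero D A B) = Zero D ((ZO ^^ n) A) ((ZO ^^ n) B)"
  by (induction n) simp_all

lemma bar_d_term:
  assumes "V \<in> centralizer" "i \<le> n"
  shows "(ZA ^^ (n - i)) (counit ((GO ^^ i) V)) \<in> Hom D (ZO ((ZO ^^ n) (fst V))) ((ZO ^^ n) (fst V))"
proof -
  have eq: "(ZO ^^ (n - i)) ((ZO ^^ i) A) = (ZO ^^ n) A" for A
    using assms(2) funpow_add[of "n - i" i ZO] by simp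
  have "counit ((GO ^^ i) V) \<in> Arr D" "Dom D (counit ((GO ^^ i) V)) = ZO ((ZO ^^ i) (fst V))"
    "Cod D (counit ((GO ^^ i) V)) = (ZO ^^ i) (fst V)" using assms(1) by simp_all
  then show ?thesis by (simp add: hom_iff eq)
qed

lemma bar_d_0: "V \<in> centralizer \<Longrightarrow> bar_d V 0 = counit V"
  using centralizerD(1)[of V] by (simp add: bar_d_def)

text \<open>All faces but the last arise from those of one degree lower by applying Z. This
  recursion replaces the alternating sums by inductions.\<close>

lemma bar_d_Suc:
  assumes V: "V \<in> centralizer"
  shows "bar_d V (Suc n) = Add D (ZA (bar_d V n)) (Scale D ((- 1) ^ Suc n) (counit ((GO ^^ Suc n) V)))"
proof -
  have [simp]: "fst V \<in> Obj D" by (rule centralizerD(1)[OF V])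
  let ?h = "\<lambda>n i. Scale D ((- 1) ^ i) ((ZA ^^ (n - i)) (counit ((GO ^^ i) V)))"
  let ?Z = "\<lambda>n. (ZO ^^ n) (fst V)"
  have t: "?h n i \<in> Hom D (ZO (?Z n)) (?Z n)" if "i < Suc n" for i
    using bar_d_term[OF V, of i n] that by (simp add: hom_iff)
  have "ZA (bar_d V n) = hom_sum D (ZO (ZO (?Z n))) (ZO (?Z n)) (\<lambda>i. ZA (?h n i)) (Suc n)"
    unfolding bar_d_def
    by (subst D.hom_sum_map[where L = ZA and X' = "ZO (ZO (?Z n))" and Y' = "ZO (?Z n)" and C' = D])
      (use t in \<open>auto simp: hom_iff intro!: ZA_add\<close>)
  also have "\<dots> = hom_sum D (ZO (ZO (?Z n))) (ZO (?Z n)) (?h (Suc n)) (Suc n)"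
  proof (rule D.hom_sum_cong)
    fix i assume "i < Suc n"
    moreover from this have "(ZA ^^ (n - i)) (counit ((GO ^^ i) V)) \<in> Arr D"
      using bar_d_term[OF V, of i n] by (simp add: hom_iff)
    ultimately show "ZA (?h n i) = ?h (Suc n) i" by (simp add: ZA_scale Suc_diff_le)
  qed
  finally show ?thesis by (simp add: bar_d_def)
qed

lemma bar_d_hom:
  assumes V: "V \<in> centralizer"
  shows "bar_d V n \<in> centralizer_hom ((GO ^^ Suc n) V) ((GO ^^ n) V)"
proof (induction n)
  case 0
  then show ?case using counit_centralizer_hom[OF V] by (simp add: bar_d_0[OF V])
next
  case (Suc n)
  then have "bar_d V n \<in> Hom D (fst ((GO ^^ Suc n) V)) (fst ((GO ^^ n) V))" by (simp add: centralizer_hom_iff hom_iff)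
  from ZA_centralizer_hom[OF this]
  have 1: "ZA (bar_d V n) \<in> centralizer_hom ((GO ^^ Suc (Suc n)) V) ((GO ^^ Suc n) V)" by simp
  have c: "(GO ^^ Suc n) V \<in> centralizer" "(GO ^^ Suc (Suc n)) V \<in> centralizer"
    using V by (auto simp del: funpow.simps)
  have 2: "counit ((GO ^^ Suc n) V) \<in> centralizer_hom ((GO ^^ Suc (Suc n)) V) ((GO ^^ Suc n) V)"
    using counit_centralizer_hom[OF c(1)] by simp
  show ?case
    unfolding bar_d_Suc[OF V] by (intro centralizer_hom_add centralizer_hom_scale 1 2 c)
qed

lemma bar_d_typing [simp]:
  assumes "V \<in> centralizer"
  shows "bar_d V n \<in> Arr D" "Dom D (bar_d V n) = ZO ((ZO ^^ n) (fst V))" "Cod D (bar_d V n) = (ZO ^^ n) (fst V)"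
  using bar_d_hom[OF assms, of n] by (simp_all add: centralizer_hom_iff)

lemma GO_centralizer' [simp]: "V \<in> centralizer \<Longrightarrow> GO V \<in> centralizer"
  using funpow_GO_centralizer[of V "Suc 0"] by simp

text \<open>The first term and the inner terms of the differential are the faces of
  \<open>bar_d U n\<close> followed by t. The last term is not of this form: it is the adjoint
  extension of t, and its half-braiding is that of V.\<close>

lemma dy_delta_cochain:
  assumes U: "U \<in> centralizer" and V: "V \<in> centralizer" and t: "t \<in> Hom D ((ZO ^^ n) (fst U)) (fst V)"
  shows "dy_delta n U V (cochain n (fst U) t) = cochain (Suc n) (fst U)
    (Add D (t \<cdot> bar_d U n) (Scale D ((- 1) ^ Suc n) (counit V \<cdot> ZA t)))"
proof -
  note [simp] = U V centralizerD(1-4)[OF U] centralizerD(1-4)[OF V] t[unfolded hom_iff]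
  let ?A = "fst U" and ?B = "fst V" and ?f = "cochain n (fst U) t"
  let ?Z = "(ZO ^^ n) ?A"
  define h where "h i = Scale D ((- 1) ^ i) ((ZA ^^ (n - i)) (counit ((GO ^^ i) U)))" for i
  have h: "h i \<in> Hom D (ZO ?Z) ?Z" if "i < Suc n" for i
    using bar_d_term[OF U, of i n] that by (simp add: h_def hom_iff)
  have "(Id D (FO F (hd Xs)) \<boxtimes> ?f (tl Xs)) \<cdot> (snd U (hd Xs) \<boxtimes> Id D (FOs (tl Xs))) =
      (Id D (FOs Xs) \<boxtimes> (t \<cdot> h 0)) \<cdot> iter_theta Xs ?A"
    (is ?first)
    and "hom_sum D (?A \<otimes> FOs Xs) (FOs Xs \<otimes> ?B)
           (\<lambda>j. Scale D ((- 1) ^ Suc j)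
                  (?f (take j Xs @ [(Xs ! j) \<otimes>\<^bsub>C\<^esub> (Xs ! Suc j)] @ drop (Suc (Suc j)) Xs))) n
      = hom_sum D (?A \<otimes> FOs Xs) (FOs Xs \<otimes> ?B) (\<lambda>j. (Id D (FOs Xs) \<boxtimes> (t \<cdot> h (Suc j))) \<cdot> iter_theta Xs ?A) n"
    (is ?middle)
    and "(Id D (FOs (butlast Xs)) \<boxtimes> snd V (last Xs)) \<cdot> (?f (butlast Xs) \<boxtimes> Id D (FO F (last Xs)))
      = (Id D (FOs Xs) \<boxtimes> (counit V \<cdot> ZA t)) \<cdot> iter_theta Xs ?A"
    (is ?last)
    if Xs: "Xs \<in> tuples (Suc n)" for Xs
  proof -
    have XsO: "set Xs \<subseteq> Obj C" "length Xs = Suc n" using Xs by (simp_all add: tuples_simps(1))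
    show ?first
    proof -
      obtain Y Ys where Y: "Xs = Y # Ys" using XsO(2) by (cases Xs) auto
      have [simp]: "Y \<in> Obj C" "set Ys \<subseteq> Obj C" "length Ys = n" using XsO by (simp_all add: Y)
      have [simp]: "(ZA ^^ n) (counit U) \<in> Arr D" "Dom D ((ZA ^^ n) (counit U)) = ZO ?Z" "Cod D ((ZA ^^ n) (counit U)) = ?Z"
        by simp_all
      have "(Id D (FOs Xs) \<boxtimes> (t \<cdot> h 0)) \<cdot> iter_theta Xs ?A
          = (Id D (FOs Xs) \<boxtimes> t) \<cdot> ((Id D (FO F Y \<otimes> FOs Ys) \<boxtimes> (ZA ^^ length Ys) (counit U)) \<cdot> iter_theta (Y # Ys) ?A)"
        by (simp add: Y h_def D.slices)
      also have "\<dots> = (Id D (FOs Xs) \<boxtimes> t) \<cdot> (Id D (FO F Y) \<boxtimes> iter_theta Ys ?A) \<cdot> (snd U Y \<boxtimes> Id D (FOs Ys))"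
        by (subst iter_theta_counit_Cons) simp_all
      also have "\<dots> = (Id D (FO F Y) \<boxtimes> ?f Ys) \<cdot> (snd U Y \<boxtimes> Id D (FOs Ys))"
        by (simp add: Y cochain_def tuples_simps(1) D.slices)
      finally show ?thesis by (simp add: Y)
    qed
    show ?middle
    proof (rule D.hom_sum_cong)
      fix j assume j: "j < n"
      \<comment> \<open>The list is cut around the two objects that are multiplied. The j objects
        before X account for the counit being taken at G^(j+1)(U), and those after Y for the outer
        applications of Z.\<close>
      define Ps X Y Ss where "Ps = take j Xs" and "X = Xs ! j" and "Y = Xs ! Suc j" and "Ss = drop (Suc (Suc j)) Xs"
      have Xs_eq: "Xs = Ps @ X # Y # Ss"
        using j XsO(2) by (simp add: Ps_def X_def Y_def Ss_def Cons_nth_drop_Suc)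
      have len [simp]: "length Ps = j" "length Ss = n - Suc j" using j XsO(2) by (simp_all add: Ps_def Ss_def)
      have O [simp]: "set Ps \<subseteq> Obj C" "X \<in> Obj C" "Y \<in> Obj C" "set Ss \<subseteq> Obj C" using XsO(1) by (simp_all add: Xs_eq)
      define c where "c = (ZA ^^ (n - Suc j)) (counit ((GO ^^ Suc j) U))"
      have "c \<in> Hom D (ZO ?Z) ?Z" using bar_d_term[OF U, of "Suc j" n] j by (simp add: c_def)
      note [simp] = this[unfolded hom_iff]
      have "iter_theta (Ps @ (X \<otimes>\<^bsub>C\<^esub> Y) # Ss) ?A = (Id D (FOs Xs) \<boxtimes> c) \<cdot> iter_theta Xs ?A"
        using iter_theta_counit_mult[of Ps X Y Ss U] by (simp add: Xs_eq c_def del: funpow.simps FOs_append)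
      moreover have "Ps @ (X \<otimes>\<^bsub>C\<^esub> Y) # Ss \<in> tuples n" using j by (simp add: tuples_simps(1))
      moreover have "FOs (Ps @ (X \<otimes>\<^bsub>C\<^esub> Y) # Ss) = FOs Xs" by (simp add: Xs_eq)
      ultimately have "?f (Ps @ (X \<otimes>\<^bsub>C\<^esub> Y) # Ss) = (Id D (FOs Xs) \<boxtimes> t) \<cdot> (Id D (FOs Xs) \<boxtimes> c) \<cdot> iter_theta Xs ?A"
        by (simp add: cochain_def)
      moreover have "(Id D (FOs Xs) \<boxtimes> (t \<cdot> h (Suc j))) \<cdot> iter_theta Xs ?A
          = Scale D ((- 1) ^ Suc j) ((Id D (FOs Xs) \<boxtimes> t) \<cdot> (Id D (FOs Xs) \<boxtimes> c) \<cdot> iter_theta Xs ?A)"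
        unfolding h_def c_def[symmetric] using XsO by (simp add: D.slices D.scale_comp D.tens_scale)
      ultimately show "Scale D ((- 1) ^ Suc j) (?f (take j Xs @ [(Xs ! j) \<otimes>\<^bsub>C\<^esub> (Xs ! Suc j)] @ drop (Suc (Suc j)) Xs))
          = (Id D (FOs Xs) \<boxtimes> (t \<cdot> h (Suc j))) \<cdot> iter_theta Xs ?A"
        by (simp add: Ps_def X_def Y_def Ss_def)
    qed
    show ?last
    proof -
      obtain Ys X where Y: "Xs = Ys @ [X]" using XsO(2) by (metis append_butlast_last_id length_0_conv nat.distinct(1))
      have [simp]: "set Ys \<subseteq> Obj C" "X \<in> Obj C" "length Ys = n" using XsO by (simp_all add: Y)
      show ?thesis
        using counit_ZA_iter_theta[OF V, of t Ys ?A X] t by (simp add: Y cochain_def tuples_simps(1))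
    qed
  qed
  note parts = this
  have total: "(Id D (FOs Xs) \<boxtimes> (t \<cdot> bar_d U n)) \<cdot> iter_theta Xs ?A
      = Add D ((Id D (FOs Xs) \<boxtimes> (t \<cdot> h 0)) \<cdot> iter_theta Xs ?A)
         (hom_sum D (?A \<otimes> FOs Xs) (FOs Xs \<otimes> ?B) (\<lambda>j. (Id D (FOs Xs) \<boxtimes> (t \<cdot> h (Suc j))) \<cdot> iter_theta Xs ?A) n)"
    if Xs: "Xs \<in> tuples (Suc n)" for Xs
  proof -
    have XsO [simp]: "set Xs \<subseteq> Obj C" "length Xs = Suc n" using Xs by (simp_all add: tuples_simps(1))
    let ?L = "\<lambda>x. (Id D (FOs Xs) \<boxtimes> (t \<cdot> x)) \<cdot> iter_theta Xs ?A"
    have "?L (bar_d U n) = ?L (hom_sum D (ZO ?Z) ?Z h (Suc n))"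
      by (simp only: bar_d_def h_def[abs_def] funpow.simps o_apply)
    also have "\<dots> = hom_sum D (?A \<otimes> FOs Xs) (FOs Xs \<otimes> ?B) (\<lambda>i. ?L (h i)) (Suc n)"
      by (rule D.hom_sum_map[OF h]) (simp_all add: hom_iff D.add_comp D.tens_add)
    also have "\<dots> = Add D (?L (h 0)) (hom_sum D (?A \<otimes> FOs Xs) (FOs Xs \<otimes> ?B) (\<lambda>j. ?L (h (Suc j))) n)"
      by (rule D.hom_sum_shift) (use h in \<open>simp_all add: hom_iff\<close>)
    finally show ?thesis .
  qed
  show ?thesis
  proof (rule extensionalityI[where A = "tuples (Suc n)"])
    fix Xs assume Xs: "Xs \<in> tuples (Suc n)"
    have XsO [simp]: "set Xs \<subseteq> Obj C" "length Xs = Suc n" using Xs by (simp_all add: tuples_simps(1))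
    have "dy_delta n U V ?f Xs = Add D ((Id D (FOs Xs) \<boxtimes> (t \<cdot> bar_d U n)) \<cdot> iter_theta Xs ?A)
      (Scale D ((- 1) ^ Suc n) ((Id D (FOs Xs) \<boxtimes> (counit V \<cdot> ZA t)) \<cdot> iter_theta Xs ?A))"
      using Xs by (simp only: dy_delta_def restrict_apply' parts[OF Xs] total[OF Xs])
    also have "\<dots> = cochain (Suc n) ?A (Add D (t \<cdot> bar_d U n) (Scale D ((- 1) ^ Suc n) (counit V \<cdot> ZA t))) Xs"
      using Xs by (simp add: cochain_def D.tens_add D.add_comp D.tens_scale D.scale_comp)
    finally show "dy_delta n U V ?f Xs = cochain (Suc n) ?A (Add D (t \<cdot> bar_d U n) (Scale D ((- 1) ^ Suc n) (counit V \<cdot> ZA t))) Xs" .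
  qed (simp_all add: dy_delta_def cochain_def)
qed

section \<open>Translation into the bar complex by the adjunction\<close>

text \<open>The extension of t to the free object on \<open>fst X\<close>. Restriction along the
  unit recovers t by naturality of the unit and the triangle identity
  \<open>counit_unit\<close>.\<close>

lemma counit_ZA_hom:
  assumes V: "V \<in> centralizer" and t: "t \<in> Hom D (fst X) (fst V)"
  shows "counit V \<cdot> ZA t \<in> centralizer_hom (GO X) V" "(counit V \<cdot> ZA t) \<cdot> unit (fst X) = t"
proof -
  note [simp] = V centralizerD(1)[OF V] t[unfolded hom_iff]
  have [simp]: "fst X \<in> Obj D" using D.hom_obj[OF t] by simp
  show "counit V \<cdot> ZA t \<in> centralizer_hom (GO X) V"
    by (rule centralizer_hom_comp[OF ZA_centralizer_hom[OF t] counit_centralizer_hom])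
      (simp_all add: GO_centralizer)
  have "(counit V \<cdot> ZA t) \<cdot> unit (fst X) = counit V \<cdot> (ZA t \<cdot> unit (fst X))" by (simp add: D.assoc)
  also have "ZA t \<cdot> unit (fst X) = unit (fst V) \<cdot> t" by (rule unit_natural) simp_all
  also have "counit V \<cdot> \<dots> = (counit V \<cdot> unit (fst V)) \<cdot> t" by (simp add: D.assoc)
  finally show "(counit V \<cdot> ZA t) \<cdot> unit (fst X) = t" by (simp add: counit_unit)
qed

text \<open>The converse: insert the identity in the form given by \<open>counit_ZA_unit\<close> and
  move f past the counit by naturality.\<close>

lemma centralizer_hom_GO:
  assumes f: "f \<in> centralizer_hom (GO X) V" and V: "V \<in> centralizer" and X: "fst X \<in> Obj D"
  shows "f = counit V \<cdot> ZA (f \<cdot> unit (fst X))"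
proof -
  note [simp] = V X centralizer_homD(1-3)[OF f] centralizerD(1)[OF V] GO_centralizer[OF X]
  have "f = f \<cdot> (counit (GO X) \<cdot> ZA (unit (fst X)))" by (simp add: counit_ZA_unit)
  also have "\<dots> = (f \<cdot> counit (GO X)) \<cdot> ZA (unit (fst X))" by (simp add: D.assoc)
  also have "f \<cdot> counit (GO X) = counit V \<cdot> ZA f"
    by (rule counit_natural[symmetric]) (use f in simp_all)
  finally show ?thesis by (simp add: ZA_comp D.assoc)
qed

lemma centralizer_hom_GO_cancel:
  assumes "f \<in> centralizer_hom (GO X) V" "g \<in> centralizer_hom (GO X) V" "V \<in> centralizer" "fst X \<in> Obj D"
    and "f \<cdot> unit (fst X) = g \<cdot> unit (fst X)"
  shows "f = g"
  using centralizer_hom_GO[OF assms(1,3,4)] centralizer_hom_GO[OF assms(2,3,4)] assms(5) by simp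

lemma Gam_cases:
  assumes f: "f \<in> dy_cochains n U V" and U: "U \<in> centralizer" and V: "V \<in> centralizer"
  obtains t where "t \<in> Hom D ((ZO ^^ n) (fst U)) (fst V)" "f = cochain n (fst U) t"
    "Gam n U V f = counit V \<cdot> ZA t"
  using cochain_surj[OF f centralizerD(1)[OF U] centralizerD(1)[OF V]] Gam_cochain[OF V centralizerD(1)[OF U]]
  by blast

lemma Gam_hom:
  assumes "f \<in> dy_cochains n U V" "U \<in> centralizer" "V \<in> centralizer"
  shows "Gam n U V f \<in> centralizer_hom ((GO ^^ Suc n) U) V"
proof -
  obtain t where t: "t \<in> Hom D ((ZO ^^ n) (fst U)) (fst V)" "Gam n U V f = counit V \<cdot> ZA t"
    using Gam_cases[OF assms] by metis
  then show ?thesis using counit_ZA_hom(1)[OF assms(3), of t "(GO ^^ n) U"] by simp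
qed

lemma Gam_inject:
  assumes "Gam n U V f = Gam n U V g" "f \<in> dy_cochains n U V" "g \<in> dy_cochains n U V" "U \<in> centralizer" "V \<in> centralizer"
  shows "f = g"
proof -
  obtain s where s: "s \<in> Hom D ((ZO ^^ n) (fst U)) (fst V)" "f = cochain n (fst U) s" "Gam n U V f = counit V \<cdot> ZA s"
    using Gam_cases[OF assms(2,4,5)] by metis
  obtain t where t: "t \<in> Hom D ((ZO ^^ n) (fst U)) (fst V)" "g = cochain n (fst U) t" "Gam n U V g = counit V \<cdot> ZA t"
    using Gam_cases[OF assms(3,4,5)] by metis
  have "s = (counit V \<cdot> ZA s) \<cdot> unit (fst ((GO ^^ n) U))"
    by (rule counit_ZA_hom(2)[OF assms(5), symmetric]) (simp add: s(1))
  also have "counit V \<cdot> ZA s = counit V \<cdot> ZA t" using s(3) t(3) assms(1) by metis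
  also have "(counit V \<cdot> ZA t) \<cdot> unit (fst ((GO ^^ n) U)) = t"
    by (rule counit_ZA_hom(2)[OF assms(5)]) (simp add: t(1))
  finally show ?thesis using s(2) t(2) by metis
qed

lemma Gam_surj:
  assumes a: "a \<in> centralizer_hom ((GO ^^ Suc n) U) V" and U: "U \<in> centralizer" and V: "V \<in> centralizer"
  obtains f where "f \<in> dy_cochains n U V" "Gam n U V f = a"
proof -
  note [simp] = U V centralizerD(1)[OF U] centralizer_homD(1-3)[OF a]
  let ?t = "a \<cdot> unit ((ZO ^^ n) (fst U))"
  have t: "?t \<in> Hom D ((ZO ^^ n) (fst U)) (fst V)" by (simp add: hom_iff)
  have "Gam n U V (cochain n (fst U) ?t) = a"
    using Gam_cochain[OF V _ t] centralizer_hom_GO[of a "(GO ^^ n) U" V] a by simp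
  then show ?thesis using that cochain_mem[OF t] by simp
qed

text \<open>\<Gamma> is a map of complexes. Extending the arrow found in
  \<open>dy_delta_cochain\<close> turns its first part into all faces but the last, since these are
  Z of \<open>bar_d U n\<close>; the remaining part becomes the last face by naturality of the
  counit.\<close>

lemma Gam_delta:
  assumes f: "f \<in> dy_cochains n U V" and U: "U \<in> centralizer" and V: "V \<in> centralizer"
  shows "dy_delta n U V f \<in> dy_cochains (Suc n) U V"
    "Gam (Suc n) U V (dy_delta n U V f) = Gam n U V f \<cdot> bar_d U (Suc n)"
proof -
  note [simp] = U V centralizerD(1)[OF U] centralizerD(1)[OF V]
  obtain t where t: "t \<in> Hom D ((ZO ^^ n) (fst U)) (fst V)" "f = cochain n (fst U) t" "Gam n U V f = counit V \<cdot> ZA t"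
    using Gam_cases[OF assms] by metis
  note [simp] = t(1)[unfolded hom_iff]
  let ?s = "Add D (t \<cdot> bar_d U n) (Scale D ((- 1) ^ Suc n) (counit V \<cdot> ZA t))"
  have s: "?s \<in> Hom D ((ZO ^^ Suc n) (fst U)) (fst V)" by (simp add: hom_iff)
  have eq: "dy_delta n U V f = cochain (Suc n) (fst U) ?s"
    unfolding t(2) by (rule dy_delta_cochain[OF U V t(1)])
  show "dy_delta n U V f \<in> dy_cochains (Suc n) U V"
    unfolding eq by (rule cochain_mem[OF s]) simp
  have "counit V \<cdot> ZA t \<in> centralizer_hom ((GO ^^ Suc n) U) V"
    using Gam_hom[OF assms] t(3) by simp
  then have nat: "counit V \<cdot> ZA (counit V \<cdot> ZA t) = (counit V \<cdot> ZA t) \<cdot> counit ((GO ^^ Suc n) U)"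
    by (intro counit_natural) simp_all
  have "Gam (Suc n) U V (dy_delta n U V f) = counit V \<cdot> ZA ?s"
    unfolding eq by (rule Gam_cochain[OF V _ s]) simp
  also have "\<dots> = Add D (counit V \<cdot> ZA t \<cdot> ZA (bar_d U n)) (Scale D ((- 1) ^ Suc n) (counit V \<cdot> ZA (counit V \<cdot> ZA t)))"
    by (simp add: ZA_add ZA_scale ZA_comp D.add_comp D.scale_comp)
  also have "\<dots> = (counit V \<cdot> ZA t) \<cdot> bar_d U (Suc n)"
    unfolding nat bar_d_Suc[OF U] by (simp add: D.add_comp D.scale_comp D.assoc)
  finally show "Gam (Suc n) U V (dy_delta n U V f) = Gam n U V f \<cdot> bar_d U (Suc n)" by (simp add: t(3))
qed

lemma dy_cocycles_iff:
  assumes U: "U \<in> centralizer" and V: "V \<in> centralizer"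
  shows "f \<in> dy_cocycles n U V \<longleftrightarrow> f \<in> dy_cochains n U V \<and>
    Gam n U V f \<cdot> bar_d U (Suc n) = Zero D ((ZO ^^ Suc (Suc n)) (fst U)) (fst V)"
proof (cases "f \<in> dy_cochains n U V")
  case True
  note [simp] = U V centralizerD(1)[OF U] centralizerD(1)[OF V]
  let ?z = "Zero D ((ZO ^^ Suc n) (fst U)) (fst V)"
  have z: "?z \<in> Hom D ((ZO ^^ Suc n) (fst U)) (fst V)" by (simp add: hom_iff)
  have zero: "cochain (Suc n) (fst U) ?z Xs = Zero D (fst U \<otimes> FOs Xs) (FOs Xs \<otimes> fst V)" if "Xs \<in> tuples (Suc n)" for Xs
    using that by (simp add: cochain_def tuples_simps(1))
  have Gz: "Gam (Suc n) U V (cochain (Suc n) (fst U) ?z) = Zero D ((ZO ^^ Suc (Suc n)) (fst U)) (fst V)"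
    by (subst Gam_cochain[OF V _ z]) simp_all
  have "(\<forall>Xs\<in>tuples (Suc n). dy_delta n U V f Xs = Zero D (fst U \<otimes> FOs Xs) (FOs Xs \<otimes> fst V))
      \<longleftrightarrow> dy_delta n U V f = cochain (Suc n) (fst U) ?z"
  proof
    assume "\<forall>Xs\<in>tuples (Suc n). dy_delta n U V f Xs = Zero D (fst U \<otimes> FOs Xs) (FOs Xs \<otimes> fst V)"
    then show "dy_delta n U V f = cochain (Suc n) (fst U) ?z"
      using zero by (intro extensionalityI[where A = "tuples (Suc n)"]) (simp_all add: dy_delta_def cochain_def)
  qed (use zero in metis)
  also have "\<dots> \<longleftrightarrow> Gam (Suc n) U V (dy_delta n U V f) = Gam (Suc n) U V (cochain (Suc n) (fst U) ?z)"
    using Gam_inject[OF _ Gam_delta(1)[OF True U V] cochain_mem[OF z]] by auto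
  finally show ?thesis
    unfolding dy_cocycles_def Gz Gam_delta(2)[OF True U V] using True by blast
qed (simp add: dy_cocycles_def)

text \<open>Here e is a bar cochain of degree n. Its preimage under \<Gamma> is the cochain whose
  coboundary is the difference of f and h; this lemma and its converse let cohomologous cocycles be
  handled in the bar complex.\<close>

lemma dy_cohomologousI:
  assumes U: "U \<in> centralizer" and V: "V \<in> centralizer"
    and f: "f \<in> dy_cochains (Suc n) U V" and h: "h \<in> dy_cochains (Suc n) U V"
    and e: "e \<in> centralizer_hom ((GO ^^ Suc n) U) V"
    and eq: "Gam (Suc n) U V f = Add D (Gam (Suc n) U V h) (e \<cdot> bar_d U (Suc n))"
  shows "dy_cohomologous (Suc n) U V f h"
proof -
  note [simp] = U V centralizerD(1)[OF U] centralizerD(1)[OF V]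
  obtain k where k: "k \<in> dy_cochains n U V" "Gam n U V k = e" using Gam_surj[OF e U V] by metis
  obtain r where r: "r \<in> Hom D ((ZO ^^ Suc n) (fst U)) (fst V)" "h = cochain (Suc n) (fst U) r"
    "Gam (Suc n) U V h = counit V \<cdot> ZA r" using Gam_cases[OF h U V] by metis
  obtain s where s: "s \<in> Hom D ((ZO ^^ Suc n) (fst U)) (fst V)" "dy_delta n U V k = cochain (Suc n) (fst U) s"
    "Gam (Suc n) U V (dy_delta n U V k) = counit V \<cdot> ZA s" using Gam_cases[OF Gam_delta(1)[OF k(1) U V] U V] by metis
  note [simp] = r(1)[unfolded hom_iff] s(1)[unfolded hom_iff]
  have a: "Add D r s \<in> Hom D ((ZO ^^ Suc n) (fst U)) (fst V)" by (simp add: hom_iff)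
  have "Gam (Suc n) U V (cochain (Suc n) (fst U) (Add D r s)) = Add D (counit V \<cdot> ZA r) (counit V \<cdot> ZA s)"
    by (subst Gam_cochain[OF V _ a]) (simp_all add: ZA_add D.add_comp)
  also have "\<dots> = Gam (Suc n) U V f"
    using eq Gam_delta(2)[OF k(1) U V] r(3) s(3) k(2) by simp
  finally have "f = cochain (Suc n) (fst U) (Add D r s)"
    by (intro Gam_inject[OF _ f cochain_mem[OF a] U V]) simp_all
  then have "\<forall>Xs\<in>tuples (Suc n). f Xs = Add D (h Xs) (dy_delta n U V k Xs)"
    unfolding r(2) s(2) by (simp add: cochain_def tuples_simps(1) D.tens_add D.add_comp)
  then show ?thesis using k(1) by (auto simp: dy_cohomologous_def)
qed

lemma dy_cohomologousE:
  assumes U: "U \<in> centralizer" and V: "V \<in> centralizer"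
    and f: "f \<in> dy_cochains (Suc n) U V" and h: "h \<in> dy_cochains (Suc n) U V"
    and coh: "dy_cohomologous (Suc n) U V f h"
  obtains e where "e \<in> centralizer_hom ((GO ^^ Suc n) U) V"
    "Gam (Suc n) U V f = Add D (Gam (Suc n) U V h) (e \<cdot> bar_d U (Suc n))"
proof -
  note [simp] = U V centralizerD(1)[OF U] centralizerD(1)[OF V]
  obtain k where k: "k \<in> dy_cochains n U V" "\<forall>Xs\<in>tuples (Suc n). f Xs = Add D (h Xs) (dy_delta n U V k Xs)"
    using coh by (auto simp: dy_cohomologous_def)
  obtain r where r: "r \<in> Hom D ((ZO ^^ Suc n) (fst U)) (fst V)" "h = cochain (Suc n) (fst U) r"
    "Gam (Suc n) U V h = counit V \<cdot> ZA r" using Gam_cases[OF h U V] by metis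
  obtain s where s: "s \<in> Hom D ((ZO ^^ Suc n) (fst U)) (fst V)" "dy_delta n U V k = cochain (Suc n) (fst U) s"
    "Gam (Suc n) U V (dy_delta n U V k) = counit V \<cdot> ZA s" using Gam_cases[OF Gam_delta(1)[OF k(1) U V] U V] by metis
  note [simp] = r(1)[unfolded hom_iff] s(1)[unfolded hom_iff]
  have a: "Add D r s \<in> Hom D ((ZO ^^ Suc n) (fst U)) (fst V)" by (simp add: hom_iff)
  have "f = cochain (Suc n) (fst U) (Add D r s)"
  proof (rule extensionalityI[where A = "tuples (Suc n)"])
    show "f \<in> extensional (tuples (Suc n))" using f by (simp add: dy_cochains_def)
    show "f Xs = cochain (Suc n) (fst U) (Add D r s) Xs" if "Xs \<in> tuples (Suc n)" for Xs
      using k(2) that unfolding r(2) s(2) by (simp add: cochain_def tuples_simps(1) D.tens_add D.add_comp)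
  qed (simp add: cochain_def)
  then have "Gam (Suc n) U V f = Add D (counit V \<cdot> ZA r) (counit V \<cdot> ZA s)"
    by (simp add: Gam_cochain[OF V _ a] ZA_add D.add_comp)
  also have "\<dots> = Add D (Gam (Suc n) U V h) (Gam n U V k \<cdot> bar_d U (Suc n))"
    using Gam_delta(2)[OF k(1) U V] r(3) s(3) by simp
  finally show ?thesis using that Gam_hom[OF k(1) U V] by blast
qed

end

section \<open>Lifts along the bar resolution\<close>

lemma (in linear_category) add_add_minus:
  assumes "x \<in> Arr C" "y \<in> Arr C" "z \<in> Arr C" "Dom C y = Dom C x" "Cod C y = Cod C x"
    "Dom C z = Dom C x" "Cod C z = Cod C x"
  shows "Add C (Add C x z) (Add C y (Scale C (- 1) z)) = Add C x y"
proof -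
  have "Add C y (Scale C (- 1) z) = Add C (Scale C (- 1) z) y" using assms by (intro add_ac(2)) simp_all
  then show ?thesis using assms by (simp add: add_ac(1))
qed

context monoidal_functor
begin

text \<open>The units form a contracting homotopy of the bar resolution in D, up to sign. Naturality
  of the unit treats all faces but the last, and the triangle identity treats the last.\<close>

lemma bar_d_unit:
  assumes V: "V \<in> centralizer"
  shows "bar_d V (Suc n) \<cdot> unit (ZO ((ZO ^^ n) (fst V)))
    = Add D (unit ((ZO ^^ n) (fst V)) \<cdot> bar_d V n) (Scale D ((- 1) ^ Suc n) (Id D (ZO ((ZO ^^ n) (fst V)))))"
proof -
  note [simp] = V centralizerD(1)[OF V]
  have c: "counit (GO ((GO ^^ n) V)) \<cdot> unit (ZO ((ZO ^^ n) (fst V))) = Id D (ZO ((ZO ^^ n) (fst V)))"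
    using counit_unit[of "GO ((GO ^^ n) V)"] by simp
  have "ZA (bar_d V n) \<cdot> unit (ZO ((ZO ^^ n) (fst V))) = unit ((ZO ^^ n) (fst V)) \<cdot> bar_d V n"
    by (rule unit_natural) simp_all
  then show ?thesis
    unfolding bar_d_Suc[OF V] by (simp add: D.add_comp D.scale_comp c)
qed

lemma counit_funpow_ZA:
  assumes "s \<in> Hom D (fst V) (fst W)" "V \<in> centralizer" "W \<in> centralizer"
  shows "counit ((GO ^^ Suc n) W) \<cdot> ZA ((ZA ^^ Suc n) s) = (ZA ^^ Suc n) s \<cdot> counit ((GO ^^ Suc n) V)"
  by (rule counit_natural[OF _ _ funpow_ZA_centralizer_hom]) (use assms in simp_all)

text \<open>Expanding by \<open>bar_d_Suc\<close> leaves Z of the previous instance and two further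
  terms. By naturality of the counit at the differential these agree up to opposite signs.\<close>

lemma bar_d_bar_d:
  assumes V: "V \<in> centralizer"
  shows "bar_d V n \<cdot> bar_d V (Suc n) = Zero D (ZO (ZO ((ZO ^^ n) (fst V)))) ((ZO ^^ n) (fst V))"
proof (induction n)
  note [simp] = V centralizerD(1)[OF V]
  have nat: "bar_d V n \<cdot> counit ((GO ^^ Suc n) V) = counit ((GO ^^ n) V) \<cdot> ZA (bar_d V n)" for n
    by (rule counit_natural[OF _ _ bar_d_hom, symmetric]) simp_all
  {
    case 0
    show ?case using nat[of 0] by (simp add: bar_d_Suc bar_d_0 D.add_comp D.scale_comp)
  next
    case (Suc n)
    let ?d = "bar_d V n" and ?d' = "bar_d V (Suc n)"
    have "?d' \<cdot> bar_d V (Suc (Suc n)) = Add D (?d' \<cdot> ZA ?d') (Scale D ((- 1) ^ Suc (Suc n)) (?d' \<cdot> counit ((GO ^^ Suc (Suc n)) V)))"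
      by (subst (2) bar_d_Suc) (simp_all add: D.add_comp D.scale_comp)
    also have "?d' \<cdot> counit ((GO ^^ Suc (Suc n)) V) = counit ((GO ^^ Suc n) V) \<cdot> ZA ?d'"
      by (rule nat)
    also have "?d' \<cdot> ZA ?d' = Add D (ZA (?d \<cdot> ?d')) (Scale D ((- 1) ^ Suc n) (counit ((GO ^^ Suc n) V) \<cdot> ZA ?d'))"
      by (subst bar_d_Suc) (simp_all add: D.add_comp D.scale_comp ZA_comp)
    finally show ?case using Suc by (simp add: D.add_ac(1) D.scale_add_left[symmetric])
  }
qed

text \<open>Free objects are projective relative to the bar resolution. An arrow out of G(X) is
  determined by its restriction along the unit, so the lift may be constructed in D, where the
  resolution is contractible.\<close>

lemma lift_along_bar_d:
  assumes V: "V \<in> centralizer" and X: "fst X \<in> Obj D"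
    and f: "f \<in> centralizer_hom (GO X) ((GO ^^ Suc l) V)"
    and df: "bar_d V l \<cdot> f = Zero D (ZO (fst X)) ((ZO ^^ l) (fst V))"
  shows "\<exists>g\<in>centralizer_hom (GO X) ((GO ^^ Suc (Suc l)) V). bar_d V (Suc l) \<cdot> g = f"
proof -
  note [simp] = V X centralizerD(1)[OF V] GO_centralizer[OF X] centralizer_homD(1-3)[OF f, simplified]
  let ?A = "fst X" and ?Z = "ZO ((ZO ^^ l) (fst V))"
  \<comment> \<open>The contraction applied to the restriction of f. The sign compensates for the
    one in \<open>bar_d_unit\<close>; the other term there vanishes by the assumption on f.\<close>
  let ?s = "Scale D ((- 1) ^ Suc l) (unit ?Z \<cdot> f \<cdot> unit ?A)"
  have s: "?s \<in> Hom D (fst X) (fst ((GO ^^ Suc (Suc l)) V))" by (simp add: hom_iff)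
  have V2: "(GO ^^ Suc (Suc l)) V \<in> centralizer" "(GO ^^ Suc l) V \<in> centralizer" by (simp_all)
  let ?g = "counit ((GO ^^ Suc (Suc l)) V) \<cdot> ZA ?s"
  have g: "?g \<in> centralizer_hom (GO X) ((GO ^^ Suc (Suc l)) V)" "?g \<cdot> unit ?A = ?s"
    by (rule counit_ZA_hom[OF V2(1) s])+
  note g' [simp] = centralizer_homD(1-3)[OF g(1), simplified]
  have "bar_d V (Suc l) \<cdot> ?g = f"
  proof (rule centralizer_hom_GO_cancel[OF _ f V2(2) X])
    show "bar_d V (Suc l) \<cdot> ?g \<in> centralizer_hom (GO X) ((GO ^^ Suc l) V)"
      by (rule centralizer_hom_comp[OF g(1) bar_d_hom[OF V] _ V2]) simp
    have "(bar_d V (Suc l) \<cdot> ?g) \<cdot> unit ?A = bar_d V (Suc l) \<cdot> ?s"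
      using g(2) g' by (simp add: D.assoc)
    also have "\<dots> = Scale D ((- 1) ^ Suc l) ((bar_d V (Suc l) \<cdot> unit ?Z) \<cdot> f \<cdot> unit ?A)"
      by (simp add: D.scale_comp D.assoc)
    also have "(bar_d V (Suc l) \<cdot> unit ?Z) \<cdot> f \<cdot> unit ?A
        = Add D (unit ((ZO ^^ l) (fst V)) \<cdot> (bar_d V l \<cdot> f) \<cdot> unit ?A) (Scale D ((- 1) ^ Suc l) (f \<cdot> unit ?A))"
      unfolding bar_d_unit[OF V] by (simp add: D.add_comp D.scale_comp D.assoc)
    also have "\<dots> = Scale D ((- 1) ^ Suc l) (f \<cdot> unit ?A)"
      unfolding df by simp
    also have "Scale D ((- 1) ^ Suc l) \<dots> = f \<cdot> unit ?A"
      by (simp add: power_add[symmetric] mult_2[symmetric] power_mult del: power_Suc)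
    finally show "(bar_d V (Suc l) \<cdot> ?g) \<cdot> unit ?A = f \<cdot> unit ?A" .
  qed
  with g(1) show ?thesis by blast
qed

text \<open>To be applied to the difference \<open>c\<close> of two lifts of the same cocycle.\<close>

lemma lift_homotopy:
  assumes U: "U \<in> centralizer" and V: "V \<in> centralizer"
    and c: "\<And>l. l \<le> n \<Longrightarrow> c l \<in> centralizer_hom ((GO ^^ Suc (Suc m + l)) U) ((GO ^^ Suc l) V)"
    and c0: "counit V \<cdot> c 0 = Zero D ((ZO ^^ Suc (Suc m)) (fst U)) (fst V)"
    and cS: "\<And>l. l < n \<Longrightarrow> bar_d V (Suc l) \<cdot> c (Suc l) = c l \<cdot> bar_d U (Suc (Suc m + l))"
    and l: "l \<le> n"
  shows "\<exists>s\<in>centralizer_hom ((GO ^^ (Suc m + l)) U) ((GO ^^ Suc l) V).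
    \<exists>s'\<in>centralizer_hom ((GO ^^ Suc (Suc m + l)) U) ((GO ^^ Suc (Suc l)) V).
      c l = Add D (s \<cdot> bar_d U (Suc m + l)) (bar_d V (Suc l) \<cdot> s')"
  using l
proof (induction l)
  note [simp] = U V centralizerD(1)[OF U] centralizerD(1)[OF V]
  note UV = funpow_GO_centralizer[OF U] funpow_GO_centralizer[OF V]
  {
    case 0
    obtain s' where s': "s' \<in> centralizer_hom ((GO ^^ Suc (Suc m)) U) ((GO ^^ Suc (Suc 0)) V)" "bar_d V (Suc 0) \<cdot> s' = c 0"
      using lift_along_bar_d[OF V, of "(GO ^^ Suc m) U" "c 0" 0] c[of 0] c0 by (auto simp: bar_d_0)
    \<comment> \<open>There is no homotopy in lower degree, so the first component starts at
      zero.\<close>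
    let ?z = "Zero D (fst ((GO ^^ Suc m) U)) (fst ((GO ^^ Suc 0) V))"
    have "?z \<in> centralizer_hom ((GO ^^ Suc m) U) ((GO ^^ Suc 0) V)" by (intro centralizer_hom_zero UV)
    moreover have "c 0 = Add D (?z \<cdot> bar_d U (Suc m)) (bar_d V (Suc 0) \<cdot> s')"
      using centralizer_homD(1-3)[OF c[of 0]] by (simp add: s'(2))
    ultimately show ?case using s'(1) by (intro bexI[of _ ?z] bexI[of _ s']) simp_all
  next
    case (Suc l)
    then have ln: "l < n" "l \<le> n" "Suc l \<le> n" by simp_all
    obtain s s' where s: "s \<in> centralizer_hom ((GO ^^ (Suc m + l)) U) ((GO ^^ Suc l) V)"
      and s': "s' \<in> centralizer_hom ((GO ^^ Suc (Suc m + l)) U) ((GO ^^ Suc (Suc l)) V)"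
      and cl: "c l = Add D (s \<cdot> bar_d U (Suc m + l)) (bar_d V (Suc l) \<cdot> s')"
      using Suc.IH[OF ln(2)] by blast
    let ?k = "Suc m + l"
    note [simp] = centralizer_homD(1-3)[OF s, simplified] centralizer_homD(1-3)[OF s', simplified]
      centralizer_homD(1-3)[OF c[OF ln(3)], simplified]
    \<comment> \<open>The part of the next difference not yet explained by the homotopy. The
      differential kills it, so it lifts. The old s' takes over the role of s.\<close>
    let ?e = "Add D (c (Suc l)) (Scale D (- 1) (s' \<cdot> bar_d U (Suc ?k)))"
    have sd: "s' \<cdot> bar_d U (Suc ?k) \<in> centralizer_hom ((GO ^^ Suc (Suc ?k)) U) ((GO ^^ Suc (Suc l)) V)"
      by (rule centralizer_hom_comp[OF bar_d_hom[OF U] s' UV(1) UV(1) UV(2)])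
    have e: "?e \<in> centralizer_hom ((GO ^^ Suc (Suc ?k)) U) ((GO ^^ Suc (Suc l)) V)"
      using c[OF ln(3)] sd by (intro centralizer_hom_add centralizer_hom_scale UV) simp_all
    have "bar_d V (Suc l) \<cdot> ?e = Add D (c l \<cdot> bar_d U (Suc ?k)) (Scale D (- 1) (bar_d V (Suc l) \<cdot> s' \<cdot> bar_d U (Suc ?k)))"
      using cS[OF ln(1)] by (simp add: D.add_comp D.scale_comp)
    also have "c l \<cdot> bar_d U (Suc ?k) = Add D (s \<cdot> (bar_d U ?k \<cdot> bar_d U (Suc ?k))) (bar_d V (Suc l) \<cdot> s' \<cdot> bar_d U (Suc ?k))"
      unfolding cl by (simp add: D.add_comp D.assoc)
    also have "\<dots> = bar_d V (Suc l) \<cdot> s' \<cdot> bar_d U (Suc ?k)"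
      unfolding bar_d_bar_d[OF U] by simp
    finally have "bar_d V (Suc l) \<cdot> ?e = Zero D (ZO (fst ((GO ^^ Suc ?k) U))) ((ZO ^^ Suc l) (fst V))"
      by simp
    then obtain s'' where s'': "s'' \<in> centralizer_hom ((GO ^^ Suc (Suc ?k)) U) ((GO ^^ Suc (Suc (Suc l))) V)"
      "bar_d V (Suc (Suc l)) \<cdot> s'' = ?e"
      using lift_along_bar_d[OF V, of "(GO ^^ Suc ?k) U" ?e "Suc l"] e by auto
    have "c (Suc l) = Add D (s' \<cdot> bar_d U (Suc ?k)) (bar_d V (Suc (Suc l)) \<cdot> s'')"
      unfolding s''(2) by (subst D.add_ac(3)) simp_all
    then show ?case using s' s''(1) by auto
  }
qed

lemma bar_d_natural:
  assumes f: "f \<in> centralizer_hom V W" and V: "V \<in> centralizer" and W: "W \<in> centralizer"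
  shows "bar_d W n \<cdot> (ZA ^^ Suc n) f = (ZA ^^ n) f \<cdot> bar_d V n"
proof (induction n)
  note [simp] = V W centralizerD(1)[OF V] centralizerD(1)[OF W] centralizer_homD(1-3)[OF f]
  {
    case 0
    show ?case using counit_natural[OF V W f] by (simp add: bar_d_0)
  next
    case (Suc n)
    have c: "counit ((GO ^^ Suc n) W) \<cdot> ZA ((ZA ^^ Suc n) f) = (ZA ^^ Suc n) f \<cdot> counit ((GO ^^ Suc n) V)"
      by (rule counit_funpow_ZA) (simp_all add: hom_iff)
    have "bar_d W (Suc n) \<cdot> (ZA ^^ Suc (Suc n)) f
        = Add D (ZA (bar_d W n \<cdot> (ZA ^^ Suc n) f)) (Scale D ((- 1) ^ Suc n) (counit ((GO ^^ Suc n) W) \<cdot> ZA ((ZA ^^ Suc n) f)))"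
      unfolding bar_d_Suc[OF W] by (simp add: D.add_comp D.scale_comp ZA_comp)
    also have "\<dots> = (ZA ^^ Suc n) f \<cdot> bar_d V (Suc n)"
      unfolding Suc c bar_d_Suc[OF V] by (simp add: D.add_comp D.scale_comp ZA_comp)
    finally show ?case .
  }
qed

text \<open>The bar resolution of \<open>G(U)\<close> is that of \<open>U\<close> with the first face removed.\<close>

lemma bar_d_GO:
  assumes U: "U \<in> centralizer"
  shows "bar_d U (Suc n) = Add D ((ZA ^^ Suc n) (counit U)) (Scale D (- 1) (bar_d (GO U) n))"
proof (induction n)
  note [simp] = U centralizerD(1)[OF U]
  {
    case 0
    show ?case by (simp add: bar_d_Suc bar_d_0)
  next
    case (Suc n)
    have "bar_d U (Suc (Suc n)) = Add D (ZA (bar_d U (Suc n))) (Scale D ((- 1) ^ Suc (Suc n)) (counit ((GO ^^ Suc (Suc n)) U)))"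
      by (rule bar_d_Suc[OF U])
    also have "ZA (bar_d U (Suc n)) = Add D ((ZA ^^ Suc (Suc n)) (counit U)) (Scale D (- 1) (ZA (bar_d (GO U) n)))"
      unfolding Suc by (simp add: ZA_add ZA_scale)
    also have "Add D \<dots> (Scale D ((- 1) ^ Suc (Suc n)) (counit ((GO ^^ Suc (Suc n)) U)))
        = Add D ((ZA ^^ Suc (Suc n)) (counit U)) (Scale D (- 1) (bar_d (GO U) (Suc n)))"
      by (simp add: bar_d_Suc[of "GO U"] D.scale_add_right D.add_ac(1))
    finally show ?case .
  }
qed

text \<open>The endomorphism \<eta> \<epsilon> becomes null-homotopic on the bar resolution, with
  the arrows Z^n(\<eta>) as homotopy. In the induction Z is applied to the previous instance and
  each of the two summands gains a last face; these cancel by naturality of the counit. For n = 0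
  the cancelling terms are two identities, one from each triangle identity.\<close>

lemma unit_homotopy:
  assumes U: "U \<in> centralizer"
  shows "Add D ((ZA ^^ n) (unit (fst U)) \<cdot> bar_d U n) (bar_d U (Suc n) \<cdot> (ZA ^^ Suc n) (unit (fst U)))
    = (ZA ^^ n) (unit (fst U) \<cdot> counit U)"
proof (induction n)
  note [simp] = U centralizerD(1)[OF U]
  let ?u = "unit (fst U)"
  {
    case 0
    have 1: "ZA (counit U) \<cdot> ZA ?u = Id D (ZO (fst U))"
      using counit_unit[OF U] by (simp add: ZA_comp[symmetric])
    have 2: "counit (GO U) \<cdot> ZA ?u = Id D (ZO (fst U))" by (rule counit_ZA_unit) simp
    show ?case using 1 2 by (simp add: bar_d_0 bar_d_Suc D.add_comp D.scale_comp)
  next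
    case (Suc n)
    have u: "?u \<in> Hom D (fst U) (fst (GO U))" by (simp add: hom_iff)
    have c: "counit ((GO ^^ Suc (Suc n)) U) \<cdot> ZA ((ZA ^^ Suc n) ?u) = (ZA ^^ Suc n) ?u \<cdot> counit ((GO ^^ Suc n) U)"
      using counit_funpow_ZA[OF u, of n] by simp
    let ?x = "ZA ((ZA ^^ n) ?u \<cdot> bar_d U n)" and ?y = "ZA (bar_d U (Suc n) \<cdot> (ZA ^^ Suc n) ?u)"
      and ?z = "(ZA ^^ Suc n) ?u \<cdot> counit ((GO ^^ Suc n) U)"
    have x: "(ZA ^^ Suc n) ?u \<cdot> bar_d U (Suc n) = Add D ?x (Scale D ((- 1) ^ Suc n) ?z)"
      unfolding bar_d_Suc[OF U, of n] by (simp add: D.add_comp D.scale_comp ZA_comp)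
    have y: "bar_d U (Suc (Suc n)) \<cdot> (ZA ^^ Suc (Suc n)) ?u = Add D ?y (Scale D (- 1) (Scale D ((- 1) ^ Suc n) ?z))"
      unfolding c[symmetric] bar_d_Suc[OF U, of "Suc n"] by (simp add: D.add_comp D.scale_comp ZA_comp)
    have ty: "?x \<in> Arr D" "?y \<in> Arr D" "?z \<in> Arr D" "Dom D ?y = Dom D ?x" "Cod D ?y = Cod D ?x"
      "Dom D ?z = Dom D ?x" "Cod D ?z = Cod D ?x" by simp_all
    have "Add D ((ZA ^^ Suc n) ?u \<cdot> bar_d U (Suc n)) (bar_d U (Suc (Suc n)) \<cdot> (ZA ^^ Suc (Suc n)) ?u) = Add D ?x ?y"
      unfolding x y by (rule D.add_add_minus) (use ty in simp_all)
    also have "\<dots> = ZA ((ZA ^^ n) (?u \<cdot> counit U))"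
      unfolding Suc[symmetric] by (subst ZA_add) simp_all
    finally show ?case by (simp del: funpow_simps)
  }
qed

end

section \<open>Dimension shifting\<close>

context monoidal_functor
begin

text \<open>The kernel of \<open>\<epsilon> : G(U) \<rightarrow> U\<close> in the centralizer: in \<open>D\<close> the counit is split by the unit, so
  the half-braiding of \<open>G(U)\<close> restricts along a section \<open>i\<close> and a retraction \<open>r\<close>.\<close>

lemma counit_kernel:
  assumes U: "U \<in> centralizer"
  obtains K i r where "K \<in> centralizer" "i \<in> centralizer_hom K (GO U)" "r \<in> Hom D (ZO (fst U)) (fst K)"
    "r \<cdot> i = Id D (fst K)" "i \<cdot> r = Add D (Id D (ZO (fst U))) (Scale D (- 1) (unit (fst U) \<cdot> counit U))"
    "counit U \<cdot> i = Zero D (fst K) (fst U)"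
proof -
  note [simp] = U centralizerD(1-4)[OF U]
  let ?A = "fst U" and ?eps = "counit U" and ?u = "unit (fst U)" and ?b = "Z_braiding (fst U)"
  let ?p = "Add D (Id D (ZO ?A)) (Scale D (- 1) (?u \<cdot> ?eps))"
  obtain i where i: "is_kernel D i ?eps" using D.has_kernels[of ?eps] by auto
  define K where "K = Dom D i"
  have i_ty [simp]: "i \<in> Arr D" "Dom D i = K" "Cod D i = ZO ?A" and eps_i: "?eps \<cdot> i = Zero D K ?A"
    using i by (auto simp: is_kernel_def K_def)
  have KO [simp]: "K \<in> Obj D" using D.arr_obj(1)[of i] by simp
  have ker: "\<exists>!w. w \<in> Hom D T K \<and> i \<cdot> w = t" if "t \<in> Hom D T (ZO ?A)" "?eps \<cdot> t = Zero D T ?A" for t T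
    using i that D.hom_obj[OF that(1)] unfolding is_kernel_def by (simp add: K_def[symmetric])
  \<comment> \<open>The complementary idempotent 1 - \<eta> \<epsilon> is killed by \<epsilon>
    because \<epsilon> \<eta> = 1. Its factorization through the kernel i is the retraction
    r.\<close>
  have eps_p: "?eps \<cdot> ?p = Zero D (ZO ?A) ?A"
    using D.assoc[of ?eps ?u ?eps] by (simp add: D.add_comp D.scale_comp counit_unit)
  have "?p \<in> Hom D (ZO ?A) (ZO ?A)" by (simp add: hom_iff)
  then obtain r where r: "r \<in> Hom D (ZO ?A) K" and ir: "i \<cdot> r = ?p" using ker[OF _ eps_p] by blast
  note r_ty [simp] = r[unfolded hom_iff]
  have "i \<cdot> r \<cdot> i = i"
  proof -
    have "i \<cdot> r \<cdot> i = ?p \<cdot> i" by (simp add: ir[symmetric] D.assoc)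
    also have "\<dots> = i" by (simp add: D.add_comp D.scale_comp D.assoc eps_i)
    finally show ?thesis .
  qed
  moreover have "r \<cdot> i \<in> Hom D K K" "Id D K \<in> Hom D K K" "i \<in> Hom D K (ZO ?A)" by (simp_all add: hom_iff)
  ultimately have ri: "r \<cdot> i = Id D K" using ker[of i K] eps_i i_ty by (metis D.id_comp(2))
  define \<rho> where "\<rho> = (\<lambda>X\<in>Obj C. (Id D (FO F X) \<boxtimes> r) \<cdot> ?b X \<cdot> (i \<boxtimes> Id D (FO F X)))"
  have \<rho>: "\<rho> X = (Id D (FO F X) \<boxtimes> r) \<cdot> ?b X \<cdot> (i \<boxtimes> Id D (FO F X))" if "X \<in> Obj C" for X
    using that by (simp add: \<rho>_def)
  have \<rho>_ty [simp]: "\<rho> X \<in> Arr D" "Dom D (\<rho> X) = K \<otimes> FO F X" "Cod D (\<rho> X) = FO F X \<otimes> K" if "X \<in> Obj C" for X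
    using that by (simp_all add: \<rho>)
  \<comment> \<open>Replacing i r by 1 - \<eta> \<epsilon> leaves a correction that passes through
    \<epsilon>. It vanishes since \<epsilon> is compatible with the half-braidings and \<epsilon> i
    = 0. The inclusion thus intertwines the half-braidings, although r is only an arrow of
    D.\<close>
  have i_br: "(Id D (FO F X) \<boxtimes> i) \<cdot> \<rho> X = ?b X \<cdot> (i \<boxtimes> Id D (FO F X))" if X [simp]: "X \<in> Obj C" for X
  proof -
    let ?x = "?b X \<cdot> (i \<boxtimes> Id D (FO F X))"
    have "(Id D (FO F X) \<boxtimes> ?eps) \<cdot> ?x = ((Id D (FO F X) \<boxtimes> ?eps) \<cdot> ?b X) \<cdot> (i \<boxtimes> Id D (FO F X))"
      by (simp add: D.assoc)
    also have "(Id D (FO F X) \<boxtimes> ?eps) \<cdot> ?b X = snd U X \<cdot> (?eps \<boxtimes> Id D (FO F X))"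
      using centralizer_homD(4)[OF counit_centralizer_hom[OF U] X] by simp
    also have "\<dots> \<cdot> (i \<boxtimes> Id D (FO F X)) = snd U X \<cdot> ((?eps \<cdot> i) \<boxtimes> Id D (FO F X))" by (simp add: D.slices)
    finally have z: "(Id D (FO F X) \<boxtimes> ?eps) \<cdot> ?x = Zero D (K \<otimes> FO F X) (FO F X \<otimes> ?A)" by (simp add: eps_i)
    have "(Id D (FO F X) \<boxtimes> i) \<cdot> \<rho> X = (Id D (FO F X) \<boxtimes> (i \<cdot> r)) \<cdot> ?x"
      by (simp add: \<rho> D.slices)
    also have "\<dots> = Add D ?x (Scale D (- 1) ((Id D (FO F X) \<boxtimes> ?u) \<cdot> ((Id D (FO F X) \<boxtimes> ?eps) \<cdot> ?x)))"
      unfolding ir by (simp add: D.tens_add D.tens_scale D.add_comp D.scale_comp D.slices)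
    also have "\<dots> = ?x" unfolding z by simp
    finally show ?thesis .
  qed
  have nat: "\<rho> (Cod C \<phi>) \<cdot> (Id D K \<boxtimes> FA F \<phi>) = (FA F \<phi> \<boxtimes> Id D K) \<cdot> \<rho> (Dom C \<phi>)" if [simp]: "\<phi> \<in> Arr C" for \<phi>
  proof -
    let ?X = "Dom C \<phi>" and ?Y = "Cod C \<phi>"
    have "\<rho> ?Y \<cdot> (Id D K \<boxtimes> FA F \<phi>) = (Id D (FO F ?Y) \<boxtimes> r) \<cdot> ?b ?Y \<cdot> ((i \<boxtimes> Id D (FO F ?Y)) \<cdot> (Id D K \<boxtimes> FA F \<phi>))"
      by (simp add: \<rho> D.assoc)
    also have "(i \<boxtimes> Id D (FO F ?Y)) \<cdot> (Id D K \<boxtimes> FA F \<phi>) = (Id D (ZO ?A) \<boxtimes> FA F \<phi>) \<cdot> (i \<boxtimes> Id D (FO F ?X))"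
      by (rule D.exchange) simp_all
    also have "(Id D (FO F ?Y) \<boxtimes> r) \<cdot> ?b ?Y \<cdot> \<dots> = (Id D (FO F ?Y) \<boxtimes> r) \<cdot> (?b ?Y \<cdot> (Id D (ZO ?A) \<boxtimes> FA F \<phi>)) \<cdot> (i \<boxtimes> Id D (FO F ?X))"
      by (simp add: D.assoc)
    also have "?b ?Y \<cdot> (Id D (ZO ?A) \<boxtimes> FA F \<phi>) = (FA F \<phi> \<boxtimes> Id D (ZO ?A)) \<cdot> ?b ?X"
      by (rule Z_braiding_natural) simp_all
    also have "(Id D (FO F ?Y) \<boxtimes> r) \<cdot> \<dots> \<cdot> (i \<boxtimes> Id D (FO F ?X))
        = ((Id D (FO F ?Y) \<boxtimes> r) \<cdot> (FA F \<phi> \<boxtimes> Id D (ZO ?A))) \<cdot> ?b ?X \<cdot> (i \<boxtimes> Id D (FO F ?X))"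
      by (simp add: D.assoc)
    also have "(Id D (FO F ?Y) \<boxtimes> r) \<cdot> (FA F \<phi> \<boxtimes> Id D (ZO ?A)) = (FA F \<phi> \<boxtimes> Id D K) \<cdot> (Id D (FO F ?X) \<boxtimes> r)"
      by (rule D.exchange[symmetric]) simp_all
    finally show ?thesis by (simp add: \<rho> D.assoc)
  qed
  have mult: "\<rho> (X \<otimes>\<^bsub>C\<^esub> Y) = (Id D (FO F X) \<boxtimes> \<rho> Y) \<cdot> (\<rho> X \<boxtimes> Id D (FO F Y))"
    if [simp]: "X \<in> Obj C" "Y \<in> Obj C" for X Y
  proof -
    have "\<rho> (X \<otimes>\<^bsub>C\<^esub> Y) = (Id D (FO F X \<otimes> FO F Y) \<boxtimes> r) \<cdot> (Id D (FO F X) \<boxtimes> ?b Y) \<cdot> ((?b X \<cdot> (i \<boxtimes> Id D (FO F X))) \<boxtimes> Id D (FO F Y))"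
      by (simp add: \<rho> Z_braiding_mult D.slices)
    also have "?b X \<cdot> (i \<boxtimes> Id D (FO F X)) = (Id D (FO F X) \<boxtimes> i) \<cdot> \<rho> X" by (rule i_br[symmetric]) simp
    also have "(Id D (FO F X \<otimes> FO F Y) \<boxtimes> r) \<cdot> (Id D (FO F X) \<boxtimes> ?b Y) \<cdot> (((Id D (FO F X) \<boxtimes> i) \<cdot> \<rho> X) \<boxtimes> Id D (FO F Y))
        = (Id D (FO F X) \<boxtimes> ((Id D (FO F Y) \<boxtimes> r) \<cdot> ?b Y \<cdot> (i \<boxtimes> Id D (FO F Y)))) \<cdot> (\<rho> X \<boxtimes> Id D (FO F Y))"
      by (simp add: D.slices)
    finally show ?thesis by (simp add: \<rho>[symmetric])
  qed
  have unit1: "\<rho> (Unit C) = Id D K"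
    by (simp add: \<rho> Z_braiding_unit ri)
  have "half_braiding K \<rho>"
    unfolding half_braiding_def
  proof (intro conjI ballI)
    show "\<rho> \<in> extensional (Obj C)" by (simp add: \<rho>_def)
    show "is_iso D (\<rho> X)" if "X \<in> Obj C" for X
      by (rule half_braiding_iso[where V = K]) (use that nat mult unit1 in simp_all)
    show "\<rho> Y \<cdot> (Id D K \<boxtimes> FA F \<phi>) = (FA F \<phi> \<boxtimes> Id D K) \<cdot> \<rho> X" if "\<phi> \<in> Hom C X Y" for X Y \<phi>
      using nat[of \<phi>] that by (auto simp: hom_iff)
  qed (simp_all add: mult hom_iff)
  then have "(K, \<rho>) \<in> centralizer" by (simp add: centralizer_def)
  moreover have "i \<in> centralizer_hom (K, \<rho>) (GO U)" using i_br by (simp add: centralizer_hom_iff)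
  ultimately show ?thesis using that[of "(K, \<rho>)" i r] r ri ir eps_i by simp
qed

lemma dimension_shift:
  assumes U: "U \<in> centralizer" and W: "W \<in> centralizer" and f: "f \<in> dy_cocycles (Suc n) U W"
  obtains K f' g b e where "K \<in> centralizer" "f' \<in> dy_cocycles n K W" "g \<in> dy_cocycles 1 U K"
    "\<And>l. b l \<in> centralizer_hom ((GO ^^ Suc (Suc l)) U) ((GO ^^ Suc l) K)"
    "counit K \<cdot> b 0 = Gam 1 U K g"
    "\<And>l. bar_d K (Suc l) \<cdot> b (Suc l) = b l \<cdot> bar_d U (Suc (Suc l))"
    "e \<in> centralizer_hom ((GO ^^ Suc n) U) W"
    "Gam (Suc n) U W f = Add D (Gam n K W f' \<cdot> b n) (e \<cdot> bar_d U (Suc n))"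
proof -
  obtain K i r where K: "K \<in> centralizer" and i: "i \<in> centralizer_hom K (GO U)"
    and r: "r \<in> Hom D (ZO (fst U)) (fst K)" and ri: "r \<cdot> i = Id D (fst K)"
    and ir: "i \<cdot> r = Add D (Id D (ZO (fst U))) (Scale D (- 1) (unit (fst U) \<cdot> counit U))"
    and eps_i: "counit U \<cdot> i = Zero D (fst K) (fst U)"
    using counit_kernel[OF U] by metis
  let ?A = "fst U" and ?u = "unit (fst U)"
  note [simp] = U W K centralizerD(1)[OF U] centralizerD(1)[OF W] centralizerD(1)[OF K]
    centralizer_homD(1-3)[OF i, simplified] r[unfolded hom_iff]
  define \<alpha> where "\<alpha> = Gam (Suc n) U W f"
  have f': "f \<in> dy_cochains (Suc n) U W" and \<alpha>_cocycle: "\<alpha> \<cdot> bar_d U (Suc (Suc n)) = Zero D ((ZO ^^ Suc (Suc (Suc n))) ?A) (fst W)"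
    using f by (auto simp: dy_cocycles_iff[OF U W] \<alpha>_def)
  have \<alpha>: "\<alpha> \<in> centralizer_hom ((GO ^^ Suc (Suc n)) U) W" unfolding \<alpha>_def by (rule Gam_hom[OF f' U W])
  note [simp] = centralizer_homD(1-3)[OF \<alpha>, simplified]

  \<comment> \<open>Substituting i r = 1 - \<eta> \<epsilon> and a triangle identity shows that the
    counit of G(U) composed with Z(i r) is the negative of \<open>bar_d U 1\<close>. Naturality at i
    turns it into i composed with the counit of K and Z(r), and r removes i.\<close>
  have base: "r \<cdot> bar_d U 1 = Scale D (- 1) (counit K \<cdot> ZA r)"
  proof -
    have c: "counit (GO U) \<cdot> ZA ?u = Id D (ZO ?A)" by (rule counit_ZA_unit) simp
    have "counit (GO U) \<cdot> ZA (i \<cdot> r) = Add D (counit (GO U)) (Scale D (- 1) ((counit (GO U) \<cdot> ZA ?u) \<cdot> ZA (counit U)))"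
      unfolding ir by (simp add: ZA_add ZA_scale ZA_comp D.add_comp D.scale_comp D.assoc)
    also have "\<dots> = Scale D (- 1) (bar_d U 1)"
      unfolding c by (simp add: bar_d_Suc bar_d_0 D.scale_add_right D.add_ac(2))
    finally have 1: "counit (GO U) \<cdot> ZA (i \<cdot> r) = Scale D (- 1) (bar_d U 1)" .
    have "counit (GO U) \<cdot> ZA (i \<cdot> r) = (counit (GO U) \<cdot> ZA i) \<cdot> ZA r" by (simp add: ZA_comp D.assoc)
    also have "counit (GO U) \<cdot> ZA i = i \<cdot> counit K" by (rule counit_natural[OF K _ i]) simp
    finally have "r \<cdot> (counit (GO U) \<cdot> ZA (i \<cdot> r)) = (r \<cdot> i) \<cdot> counit K \<cdot> ZA r" by (simp add: D.assoc)
    then have "Scale D (- 1) (r \<cdot> bar_d U 1) = counit K \<cdot> ZA r" unfolding 1 ri by (simp add: D.scale_comp)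
    then have "Scale D (- 1) (Scale D (- 1) (r \<cdot> bar_d U 1)) = Scale D (- 1) (counit K \<cdot> ZA r)" by simp
    then show ?thesis by simp
  qed
  \<comment> \<open>Applying Z gives all faces but the last. The last faces are matched by
    naturality of the counit, and the indices on U and K differ by one, so their signs also differ
    by -1.\<close>
  have lift: "(ZA ^^ l) r \<cdot> bar_d U (Suc l) = Scale D (- 1) (bar_d K l \<cdot> (ZA ^^ Suc l) r)" for l
  proof (induction l)
    case 0
    then show ?case using base by (simp add: bar_d_0)
  next
    case (Suc l)
    have r': "r \<in> Hom D (fst (GO U)) (fst K)" by (simp add: hom_iff)
    have c: "counit ((GO ^^ Suc l) K) \<cdot> ZA ((ZA ^^ Suc l) r) = (ZA ^^ Suc l) r \<cdot> counit ((GO ^^ Suc (Suc l)) U)"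
      using counit_funpow_ZA[OF r', of l] by simp
    have "(ZA ^^ Suc l) r \<cdot> bar_d U (Suc (Suc l))
        = Add D (ZA ((ZA ^^ l) r \<cdot> bar_d U (Suc l))) (Scale D ((- 1) ^ Suc (Suc l)) ((ZA ^^ Suc l) r \<cdot> counit ((GO ^^ Suc (Suc l)) U)))"
      unfolding bar_d_Suc[OF U, of "Suc l"] by (simp add: D.add_comp D.scale_comp ZA_comp)
    also have "\<dots> = Scale D (- 1) (bar_d K (Suc l) \<cdot> (ZA ^^ Suc (Suc l)) r)"
      unfolding Suc c[symmetric] bar_d_Suc[OF K]
      by (simp add: ZA_scale ZA_comp D.add_comp D.scale_comp D.scale_add_right)
    finally show ?case .
  qed

  \<comment> \<open>The factor (-1)^l absorbs the sign that \<open>lift\<close> produces in each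
    degree, so that b commutes with the differentials.\<close>
  define b where "b l = Scale D ((- 1) ^ l) ((ZA ^^ Suc l) r)" for l
  have b: "b l \<in> centralizer_hom ((GO ^^ Suc (Suc l)) U) ((GO ^^ Suc l) K)" for l
  proof -
    have "(ZA ^^ Suc l) r \<in> centralizer_hom ((GO ^^ Suc l) (GO U)) ((GO ^^ Suc l) K)"
      by (rule funpow_ZA_centralizer_hom) (simp add: hom_iff)
    then have "b l \<in> centralizer_hom ((GO ^^ Suc l) (GO U)) ((GO ^^ Suc l) K)"
      unfolding b_def by (rule centralizer_hom_scale) simp_all
    then show ?thesis by simp
  qed
  have b_chain: "bar_d K (Suc l) \<cdot> b (Suc l) = b l \<cdot> bar_d U (Suc (Suc l))" for l
  proof -
    have "bar_d K (Suc l) \<cdot> b (Suc l) = Scale D ((- 1) ^ l) (Scale D (- 1) (bar_d K (Suc l) \<cdot> (ZA ^^ Suc (Suc l)) r))"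
      by (simp add: b_def D.scale_comp)
    also have "\<dots> = b l \<cdot> bar_d U (Suc (Suc l))"
      unfolding lift[symmetric] b_def by (simp add: D.scale_comp)
    finally show ?thesis .
  qed

  have "b 0 \<in> centralizer_hom ((GO ^^ Suc 1) U) (GO K)" using b[of 0] by simp
  then have "counit K \<cdot> b 0 \<in> centralizer_hom ((GO ^^ Suc 1) U) K"
    by (rule centralizer_hom_comp[OF _ counit_centralizer_hom]) simp_all
  then obtain g where g: "g \<in> dy_cochains 1 U K" "Gam 1 U K g = counit K \<cdot> b 0"
    using Gam_surj[OF _ U K] by metis
  have "Gam 1 U K g \<cdot> bar_d U (Suc 1) = Zero D ((ZO ^^ Suc (Suc 1)) ?A) (fst K)"
  proof -
    note [simp] = centralizer_homD(1-3)[OF b[of 0], simplified] centralizer_homD(1-3)[OF b[of 1], simplified]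
    have "Gam 1 U K g \<cdot> bar_d U (Suc 1) = counit K \<cdot> (b 0 \<cdot> bar_d U (Suc (Suc 0)))"
      unfolding g(2) by (simp add: D.assoc)
    also have "\<dots> = (bar_d K 0 \<cdot> bar_d K 1) \<cdot> b 1"
      using b_chain[of 0] by (simp add: D.assoc bar_d_0)
    also have "\<dots> = Zero D ((ZO ^^ Suc (Suc 1)) ?A) (fst K)"
      using bar_d_bar_d[OF K, of 0] by simp
    finally show ?thesis .
  qed
  then have g_cocycle: "g \<in> dy_cocycles 1 U K" using g(1) by (simp add: dy_cocycles_iff)

  \<comment> \<open>The restriction of \<alpha> to the resolution of K. Its sign cancels against
    that of \<open>b n\<close>.\<close>
  let ?a = "Scale D ((- 1) ^ n) (\<alpha> \<cdot> (ZA ^^ Suc n) i)"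
  have Zi: "(ZA ^^ Suc n) i \<in> centralizer_hom ((GO ^^ Suc n) K) ((GO ^^ Suc (Suc n)) U)"
    using funpow_ZA_centralizer_hom'[OF i, of "Suc n"] by simp
  have "\<alpha> \<cdot> (ZA ^^ Suc n) i \<in> centralizer_hom ((GO ^^ Suc n) K) W"
    by (rule centralizer_hom_comp[OF Zi \<alpha>]) simp_all
  then have "?a \<in> centralizer_hom ((GO ^^ Suc n) K) W"
    by (rule centralizer_hom_scale) simp_all
  then obtain k where k: "k \<in> dy_cochains n K W" "Gam n K W k = ?a" using Gam_surj[OF _ K W] by metis
  have "?a \<cdot> bar_d K (Suc n) = Zero D ((ZO ^^ Suc (Suc n)) (fst K)) (fst W)"
  proof -
    \<comment> \<open>By \<open>bar_d_GO\<close> the cocycle condition on \<alpha> exchanges the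
      differential of G(U) for the first face alone. That face vanishes after i because \<epsilon> i
      = 0, so the restriction to K is a cocycle.\<close>
    have "\<alpha> \<cdot> bar_d (GO U) (Suc n) = \<alpha> \<cdot> (ZA ^^ Suc (Suc n)) (counit U)"
    proof -
      have "Zero D ((ZO ^^ Suc (Suc (Suc n))) ?A) (fst W)
          = Add D (\<alpha> \<cdot> (ZA ^^ Suc (Suc n)) (counit U)) (Scale D (- 1) (\<alpha> \<cdot> bar_d (GO U) (Suc n)))"
        unfolding \<alpha>_cocycle[symmetric] bar_d_GO[OF U] by (simp add: D.add_comp D.scale_comp)
      then show ?thesis
        using D.add_eq_zero_iff[of "\<alpha> \<cdot> (ZA ^^ Suc (Suc n)) (counit U)" "\<alpha> \<cdot> bar_d (GO U) (Suc n)"] by simp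
    qed
    then have *: "(\<alpha> \<cdot> bar_d (GO U) (Suc n)) \<cdot> (ZA ^^ Suc (Suc n)) i
        = (\<alpha> \<cdot> (ZA ^^ Suc (Suc n)) (counit U)) \<cdot> (ZA ^^ Suc (Suc n)) i" by simp
    have "(\<alpha> \<cdot> (ZA ^^ Suc n) i) \<cdot> bar_d K (Suc n) = \<alpha> \<cdot> ((ZA ^^ Suc n) i \<cdot> bar_d K (Suc n))"
      by (simp add: D.assoc)
    also have "(ZA ^^ Suc n) i \<cdot> bar_d K (Suc n) = bar_d (GO U) (Suc n) \<cdot> (ZA ^^ Suc (Suc n)) i"
      by (rule bar_d_natural[OF i K, symmetric]) simp
    also have "\<alpha> \<cdot> \<dots> = \<alpha> \<cdot> (ZA ^^ Suc (Suc n)) (counit U \<cdot> i)"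
      using * by (subst funpow_ZA_comp) (simp_all add: D.assoc)
    also have "\<dots> = Zero D ((ZO ^^ Suc (Suc n)) (fst K)) (fst W)"
      unfolding eps_i by (subst funpow_ZA_zero) simp_all
    finally show ?thesis by (simp add: D.scale_comp)
  qed
  then have k_cocycle: "k \<in> dy_cocycles n K W" using k by (simp add: dy_cocycles_iff)

  \<comment> \<open>In \<open>unit_homotopy\<close> in degree n + 1, the cocycle condition on
    \<alpha> kills one summand, and the other is this cochain followed by the differential.\<close>
  let ?e = "\<alpha> \<cdot> (ZA ^^ Suc n) ?u"
  have Zu: "(ZA ^^ Suc n) ?u \<in> centralizer_hom ((GO ^^ Suc n) U) ((GO ^^ Suc (Suc n)) U)"
    using funpow_ZA_centralizer_hom[of ?u U "GO U" n] by (simp add: hom_iff)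
  have e: "?e \<in> centralizer_hom ((GO ^^ Suc n) U) W"
    by (rule centralizer_hom_comp[OF Zu \<alpha>]) simp_all
  have "\<alpha> = Add D (?a \<cdot> b n) (?e \<cdot> bar_d U (Suc n))"
  proof -
    have "?a \<cdot> b n = \<alpha> \<cdot> (ZA ^^ Suc n) (i \<cdot> r)"
      by (simp add: b_def D.scale_comp D.assoc ZA_comp funpow_ZA_comp power_add[symmetric] mult_2[symmetric] power_mult)
    also have "\<dots> = Add D \<alpha> (Scale D (- 1) (\<alpha> \<cdot> (ZA ^^ Suc n) (?u \<cdot> counit U)))"
      unfolding ir by (subst funpow_ZA_add) (simp_all add: funpow_ZA_scale funpow_ZA_id ZA_scale D.add_comp D.scale_comp)
    also have "\<alpha> \<cdot> (ZA ^^ Suc n) (?u \<cdot> counit U)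
        = Add D (\<alpha> \<cdot> ((ZA ^^ Suc n) ?u \<cdot> bar_d U (Suc n))) ((\<alpha> \<cdot> bar_d U (Suc (Suc n))) \<cdot> (ZA ^^ Suc (Suc n)) ?u)"
      unfolding unit_homotopy[OF U, symmetric] by (simp add: D.add_comp D.assoc)
    also have "\<dots> = ?e \<cdot> bar_d U (Suc n)"
      unfolding \<alpha>_cocycle by (simp add: D.assoc)
    finally have 1: "?a \<cdot> b n = Add D \<alpha> (Scale D (- 1) (?e \<cdot> bar_d U (Suc n)))" .
    show ?thesis unfolding 1 by (simp add: D.add_ac(1))
  qed
  then have "Gam (Suc n) U W f = Add D (Gam n K W k \<cdot> b n) (?e \<cdot> bar_d U (Suc n))"
    by (simp only: \<alpha>_def[symmetric] k(2))
  then show ?thesis using that[OF K k_cocycle g_cocycle b _ b_chain e] g(2) by simp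
qed

text \<open>The product in \<open>prod\<close> may use other lifts than b and a cocycle h that is
  merely cohomologous to f'. The lifts differ by a homotopy and the cocycles by a coboundary; each
  contributes a coboundary to the product, in addition to the one already present in
  \<open>f_eq\<close>.\<close>

lemma yoneda_product_cohomologous:
  assumes U: "U \<in> centralizer" and K: "K \<in> centralizer" and W: "W \<in> centralizer"
    and f: "f \<in> dy_cochains (Suc (Suc n)) U W"
    and f': "f' \<in> dy_cocycles (Suc n) K W"
    and b: "\<And>l. b l \<in> centralizer_hom ((GO ^^ Suc (Suc l)) U) ((GO ^^ Suc l) K)"
      "counit K \<cdot> b 0 = Gam 1 U K g"
      "\<And>l. bar_d K (Suc l) \<cdot> b (Suc l) = b l \<cdot> bar_d U (Suc (Suc l))"
    and e: "e \<in> centralizer_hom ((GO ^^ Suc (Suc n)) U) W"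
    and f_eq: "Gam (Suc (Suc n)) U W f = Add D (Gam (Suc n) K W f' \<cdot> b (Suc n)) (e \<cdot> bar_d U (Suc (Suc n)))"
    and h: "h \<in> dy_cochains (Suc n) K W" "dy_cohomologous (Suc n) K W f' h"
    and prod: "yoneda_product (Suc n) 1 U K W h g h'"
  shows "dy_cohomologous (Suc (Suc n)) U W f h'"
proof -
  note [simp] = U K W centralizerD(1)[OF U] centralizerD(1)[OF K] centralizerD(1)[OF W]
  note UK = funpow_GO_centralizer[OF U] funpow_GO_centralizer[OF K]
  let ?N = "Suc n"
  have h': "h' \<in> dy_cochains (Suc ?N) U W" using prod by (simp add: yoneda_product_def)
  obtain b' where b': "\<And>l. l \<le> ?N \<Longrightarrow> b' l \<in> centralizer_hom ((GO ^^ Suc (Suc l)) U) ((GO ^^ Suc l) K)"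
    "counit K \<cdot> b' 0 = Gam 1 U K g"
    "\<And>l. l < ?N \<Longrightarrow> bar_d K (Suc l) \<cdot> b' (Suc l) = b' l \<cdot> bar_d U (Suc (Suc l))"
    "Gam (Suc ?N) U W h' = Gam ?N K W h \<cdot> b' ?N"
    using prod unfolding yoneda_product_def by (auto simp del: funpow.simps)
  have f'_cochain: "f' \<in> dy_cochains ?N K W"
    and \<beta>d: "Gam ?N K W f' \<cdot> bar_d K (Suc ?N) = Zero D ((ZO ^^ Suc (Suc ?N)) (fst K)) (fst W)"
    using f' by (auto simp: dy_cocycles_iff)
  define \<beta> where "\<beta> = Gam ?N K W f'"
  have \<beta>: "\<beta> \<in> centralizer_hom ((GO ^^ Suc ?N) K) W" unfolding \<beta>_def by (rule Gam_hom[OF f'_cochain K W])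
  note [simp] = centralizer_homD(1-3)[OF \<beta>, simplified] centralizer_homD(1-3)[OF e, simplified]
    centralizer_homD(1-3)[OF b(1), simplified]
  have b'_ty [simp]: "b' l \<in> Arr D" "Dom D (b' l) = ZO (ZO ((ZO ^^ l) (fst U)))" "Cod D (b' l) = ZO ((ZO ^^ l) (fst K))"
    if "l \<le> ?N" for l
    using centralizer_homD(1-3)[OF b'(1)[OF that]] by simp_all
  obtain e' where e': "e' \<in> centralizer_hom ((GO ^^ ?N) K) W" "\<beta> = Add D (Gam ?N K W h) (e' \<cdot> bar_d K ?N)"
    using dy_cohomologousE[OF K W f'_cochain h] unfolding \<beta>_def by metis
  have \<gamma>: "Gam ?N K W h \<in> centralizer_hom ((GO ^^ Suc ?N) K) W" by (rule Gam_hom[OF h(1) K W])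
  note [simp] = centralizer_homD(1-3)[OF e'(1), simplified] centralizer_homD(1-3)[OF \<gamma>, simplified]

  define c where "c l = Add D (b l) (Scale D (- 1) (b' l))" for l
  have c: "c l \<in> centralizer_hom ((GO ^^ Suc (Suc 0 + l)) U) ((GO ^^ Suc l) K)" if "l \<le> ?N" for l
    unfolding c_def using b(1)[of l] b'(1)[OF that] by (intro centralizer_hom_add centralizer_hom_scale UK) simp_all
  have "counit K \<cdot> c 0 = Zero D (fst ((GO ^^ Suc (Suc 0)) U)) (fst K)"
  proof -
    have g: "Dom D (Gam 1 U K g) = ZO (ZO (fst U))" "Gam 1 U K g \<in> Arr D" "Cod D (Gam 1 U K g) = fst K"
      unfolding b(2)[symmetric] by simp_all
    show ?thesis unfolding c_def using g by (simp add: D.add_comp D.scale_comp b(2) b'(2))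
  qed
  moreover have "bar_d K (Suc l) \<cdot> c (Suc l) = c l \<cdot> bar_d U (Suc (Suc 0 + l))" if "l < ?N" for l
    using that b(3)[of l] b'(3)[OF that] unfolding c_def by (simp add: D.add_comp D.scale_comp)
  ultimately obtain s s' where s: "s \<in> centralizer_hom ((GO ^^ (Suc 0 + ?N)) U) ((GO ^^ Suc ?N) K)"
    and s': "s' \<in> centralizer_hom ((GO ^^ Suc (Suc 0 + ?N)) U) ((GO ^^ Suc (Suc ?N)) K)"
    and cN: "c ?N = Add D (s \<cdot> bar_d U (Suc 0 + ?N)) (bar_d K (Suc ?N) \<cdot> s')"
    using lift_homotopy[OF U K, of ?N c 0 ?N] c by auto
  note [simp] = centralizer_homD(1-3)[OF s, simplified] centralizer_homD(1-3)[OF s', simplified]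

  \<comment> \<open>The summands account for the change of lifts, for the replacement of f' by h,
    and for the error of the dimension shift. Of the homotopy between the lifts only s remains,
    because \<beta> is a cocycle and kills the part that contains s'.\<close>
  let ?E = "Add D (Add D (\<beta> \<cdot> s) (e' \<cdot> b' n)) e"
  have E: "?E \<in> centralizer_hom ((GO ^^ Suc ?N) U) W"
  proof -
    have "\<beta> \<cdot> s \<in> centralizer_hom ((GO ^^ Suc ?N) U) W"
      by (rule centralizer_hom_comp[OF _ \<beta>]) (use s in simp_all)
    moreover have "e' \<cdot> b' n \<in> centralizer_hom ((GO ^^ Suc ?N) U) W"
      by (rule centralizer_hom_comp[OF _ e'(1)]) (use b'(1)[of n] in simp_all)
    ultimately show ?thesis using e by (intro centralizer_hom_add) simp_all
  qed
  have "\<beta> \<cdot> c ?N = Add D ((\<beta> \<cdot> s) \<cdot> bar_d U (Suc ?N)) ((\<beta> \<cdot> bar_d K (Suc ?N)) \<cdot> s')"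
    unfolding cN by (simp add: D.add_comp D.assoc)
  also have "\<dots> = (\<beta> \<cdot> s) \<cdot> bar_d U (Suc ?N)"
    unfolding \<beta>d[folded \<beta>_def] by simp
  finally have \<beta>c: "\<beta> \<cdot> c ?N = (\<beta> \<cdot> s) \<cdot> bar_d U (Suc ?N)" .
  have "b ?N = Add D (b' ?N) (c ?N)"
    unfolding c_def by (subst D.add_ac(3)) simp_all
  then have "\<beta> \<cdot> b ?N = Add D (\<beta> \<cdot> b' ?N) (\<beta> \<cdot> c ?N)"
    using centralizer_homD(1-3)[OF c[of ?N]] by (simp add: D.add_comp)
  also have "\<beta> \<cdot> b' ?N = Add D (Gam ?N K W h \<cdot> b' ?N) (e' \<cdot> (bar_d K ?N \<cdot> b' ?N))"
    by (subst e'(2)) (simp add: D.add_comp D.assoc)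
  also have "bar_d K ?N \<cdot> b' ?N = b' n \<cdot> bar_d U (Suc ?N)" by (rule b'(3)) simp
  finally have \<beta>b: "\<beta> \<cdot> b ?N = Add D (Add D (Gam (Suc ?N) U W h') (e' \<cdot> b' n \<cdot> bar_d U (Suc ?N))) ((\<beta> \<cdot> s) \<cdot> bar_d U (Suc ?N))"
    unfolding \<beta>c b'(4) .
  have h'_ty [simp]: "Gam (Suc ?N) U W h' \<in> Arr D" "Dom D (Gam (Suc ?N) U W h') = ZO (ZO (ZO ((ZO ^^ n) (fst U))))"
      "Cod D (Gam (Suc ?N) U W h') = fst W"
    unfolding b'(4) by simp_all
  have "Gam (Suc ?N) U W f = Add D (Gam (Suc ?N) U W h') (?E \<cdot> bar_d U (Suc ?N))"
    unfolding f_eq \<beta>_def[symmetric] \<beta>b by (simp add: D.add_comp D.assoc D.add_ac)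
  then show ?thesis by (rule dy_cohomologousI[OF U W f h' E])
qed

section \<open>Chains of 1-cocycles\<close>

text \<open>A chain of length n reads V and g up to index n, so both can be extended at the next
  index without affecting it.\<close>

lemma yoneda_chain_cong:
  assumes "yoneda_chain V g n h" "\<And>i. i \<le> n \<Longrightarrow> V i = V' i" "\<And>i. 1 \<le> i \<Longrightarrow> i \<le> n \<Longrightarrow> g i = g' i"
  shows "yoneda_chain V' g' n h"
  using assms
proof induction
  case single
  then show ?case using yoneda_chain.single[of V' g'] by simp
next
  case (extend n h h')
  then have "yoneda_chain V' g' n h" by simp
  then show ?case
    using extend.hyps extend.prems yoneda_chain.extend[of n V' g' h h'] by simp
qed

lemma yoneda_chain_cochain:
  assumes "yoneda_chain V g n h" "g 1 \<in> dy_cochains 1 (V 1) (V 0)"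
  shows "h \<in> dy_cochains n (V n) (V 0)"
  using assms by (cases rule: yoneda_chain.cases) (auto simp: yoneda_product_def)

lemma yoneda_chain_1: "yoneda_chain V g 1 h \<Longrightarrow> h = g 1"
  by (cases rule: yoneda_chain.cases) auto

lemma yoneda_chain_Suc:
  assumes "yoneda_chain V g (Suc n) h'" "n \<ge> 1"
  obtains h where "yoneda_chain V g n h" "yoneda_product n 1 (V (Suc n)) (V n) (V 0) h (g (Suc n)) h'"
  using assms(1) by (cases rule: yoneda_chain.cases) (use assms(2) that in auto)

text \<open>The claim concerns all values h so that the inductive step can handle whichever value of
  the shorter chain a given longer chain extends; the existence clause keeps it from being vacuous.
  Dimension shifting supplies the last 1-cocycle and the object K, and the induction hypothesis
  decomposes the shifted cocycle from K to W. A 1-cocycle is its own decomposition.\<close>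

lemma cocycle_decomposition:
  assumes "U \<in> centralizer" and W: "W \<in> centralizer" and "f \<in> dy_cocycles (Suc n) U W"
  shows "\<exists>V g. V 0 = W \<and> V (Suc n) = U \<and> (\<forall>i\<le>Suc n. V i \<in> centralizer) \<and>
    (\<forall>i\<in>{1..Suc n}. g i \<in> dy_cocycles 1 (V i) (V (i - 1))) \<and>
    (\<exists>h. yoneda_chain V g (Suc n) h) \<and>
    (\<forall>h. yoneda_chain V g (Suc n) h \<longrightarrow> dy_cohomologous (Suc n) U W f h)"
  using assms(1,3)
proof (induction n arbitrary: U f)
  case 0
  note U = \<open>U \<in> centralizer\<close>
  let ?V = "\<lambda>i. if i = 0 then W else U" and ?g = "\<lambda>_. f"
  have f: "f \<in> dy_cochains (Suc 0) U W" using 0 by (simp add: dy_cocycles_def)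
  have "Gam (Suc 0) U W f = Add D (Gam (Suc 0) U W f) (Zero D (fst ((GO ^^ Suc 0) U)) (fst W) \<cdot> bar_d U (Suc 0))"
    using centralizer_homD(1-3)[OF Gam_hom[OF f U W]] U centralizerD(1)[OF U] centralizerD(1)[OF W] by simp
  then have "dy_cohomologous (Suc 0) U W f f"
    by (rule dy_cohomologousI[OF U W f f centralizer_hom_zero, rotated 2]) (use U W in simp_all)
  moreover have "h = f" if "yoneda_chain ?V ?g (Suc 0) h" for h
    using yoneda_chain_1[of ?V ?g h] that by simp
  moreover have "\<exists>h. yoneda_chain ?V ?g (Suc 0) h"
    using yoneda_chain.single[of ?V ?g] by auto
  ultimately show ?case using U W 0(2) by (intro exI[of _ ?V] exI[of _ ?g]) auto
next
  case (Suc n)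
  note U = \<open>U \<in> centralizer\<close>
  obtain K f' k b e where K: "K \<in> centralizer" and f': "f' \<in> dy_cocycles (Suc n) K W" and k: "k \<in> dy_cocycles 1 U K"
    and b: "\<And>l. b l \<in> centralizer_hom ((GO ^^ Suc (Suc l)) U) ((GO ^^ Suc l) K)"
      "counit K \<cdot> b 0 = Gam 1 U K k"
      "\<And>l. bar_d K (Suc l) \<cdot> b (Suc l) = b l \<cdot> bar_d U (Suc (Suc l))"
    and e: "e \<in> centralizer_hom ((GO ^^ Suc (Suc n)) U) W"
    and f_eq: "Gam (Suc (Suc n)) U W f = Add D (Gam (Suc n) K W f' \<cdot> b (Suc n)) (e \<cdot> bar_d U (Suc (Suc n)))"
    using dimension_shift[OF U W Suc.prems(2)] by metis
  obtain V g where V: "V 0 = W" "V (Suc n) = K" "\<And>i. i \<le> Suc n \<Longrightarrow> V i \<in> centralizer"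
    and g: "\<And>i. i \<in> {1..Suc n} \<Longrightarrow> g i \<in> dy_cocycles 1 (V i) (V (i - 1))"
    and ex: "\<exists>h. yoneda_chain V g (Suc n) h"
    and coh: "\<And>h. yoneda_chain V g (Suc n) h \<Longrightarrow> dy_cohomologous (Suc n) K W f' h"
    using Suc.IH[OF K f'] by blast
  let ?V = "V(Suc (Suc n) := U)" and ?g = "g(Suc (Suc n) := k)"
  have chain: "yoneda_chain ?V ?g (Suc n) h \<longleftrightarrow> yoneda_chain V g (Suc n) h" for h
    by (auto elim!: yoneda_chain_cong)
  have cochain: "h \<in> dy_cochains (Suc n) K W" if "yoneda_chain V g (Suc n) h" for h
    using yoneda_chain_cochain[OF that] g[of 1] V by (simp add: dy_cocycles_def)
  have f: "f \<in> dy_cochains (Suc (Suc n)) U W" using Suc.prems by (simp add: dy_cocycles_def)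
  have "dy_cohomologous (Suc (Suc n)) U W f h'" if h': "yoneda_chain ?V ?g (Suc (Suc n)) h'" for h'
  proof -
    obtain h where "yoneda_chain ?V ?g (Suc n) h"
      "yoneda_product (Suc n) 1 (?V (Suc (Suc n))) (?V (Suc n)) (?V 0) h (?g (Suc (Suc n))) h'"
      by (rule yoneda_chain_Suc[OF h']) simp_all
    then have h: "yoneda_chain V g (Suc n) h" "yoneda_product (Suc n) 1 U K W h k h'"
      using V by (simp_all add: chain)
    show ?thesis
      by (rule yoneda_product_cohomologous[OF U K W f f' b e f_eq cochain[OF h(1)] coh[OF h(1)] h(2)])
  qed
  \<comment> \<open>The lifts b of the dimension shift serve for every h, because they depend on the
    new 1-cocycle alone.\<close>
  moreover have "\<exists>h'. yoneda_chain ?V ?g (Suc (Suc n)) h'"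
  proof -
    obtain h where h: "yoneda_chain V g (Suc n) h" using ex by blast
    have "Gam (Suc n) K W h \<cdot> b (Suc n) \<in> centralizer_hom ((GO ^^ Suc (Suc (Suc n))) U) W"
      by (rule centralizer_hom_comp[OF b(1) Gam_hom[OF cochain[OF h] K W]])
        (use U K W funpow_GO_centralizer in blast)+
    then obtain h' where h': "h' \<in> dy_cochains (Suc (Suc n)) U W" "Gam (Suc (Suc n)) U W h' = Gam (Suc n) K W h \<cdot> b (Suc n)"
      using Gam_surj[OF _ U W] by metis
    have "yoneda_product (Suc n) 1 U K W h k h'"
      unfolding yoneda_product_def using h' b by (auto simp del: funpow.simps)
    then have "yoneda_chain ?V ?g (Suc (Suc n)) h'"
      using h V by - (rule yoneda_chain.extend[where h = h], simp_all add: chain)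
    then show ?thesis by blast
  qed
  moreover have "?g i \<in> dy_cocycles 1 (?V i) (?V (i - 1))" if "i \<in> {1..Suc (Suc n)}" for i
    using that g[of i] k V(2) by (cases "i = Suc (Suc n)") auto
  moreover have "?V i \<in> centralizer" if "i \<le> Suc (Suc n)" for i using V(3)[of i] U that by auto
  moreover have "?V 0 = W" "?V (Suc (Suc n)) = U" using V(1) by simp_all
  ultimately show ?case by (intro exI[of _ ?V] exI[of _ ?g]) blast
qed

end

text \<open>The equation between f and the product is an equality of cohomology classes, since the
  product of cochains depends on the lifts: some value of the product exists, and every value is
  cohomologous to f. The objects run from V 0 = W to V n = U.\<close>

theorem lemma4p11:
  fixes C :: "('o, 'm, 'k::field) tcat"
    and D :: "('p, 'q, 'k) tcat"
    and F :: "('o, 'm, 'p, 'q) functr"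
    and U W :: "'p \<times> ('o \<Rightarrow> 'q)"
    and n :: nat
    and f :: "'o list \<Rightarrow> 'q"
  assumes "finite_strict_tensor_category C"
    and "finite_strict_tensor_category D"
    and "exact_strict_monoidal_functor C D F"
    and "U \<in> davydov_yetter.centralizer C D F"
    and "W \<in> davydov_yetter.centralizer C D F"
    and "n \<ge> 1"
    and "f \<in> davydov_yetter.dy_cocycles C D F n U W"
  shows "\<exists>V g.
    V 0 = W \<and> V n = U \<and>
    (\<forall>i\<in>{1..<n}. V i \<in> davydov_yetter.centralizer C D F) \<and>
    (\<forall>i\<in>{1..n}. g i \<in> davydov_yetter.dy_cocycles C D F 1 (V i) (V (i - 1))) \<and>
    (\<exists>h. davydov_yetter.yoneda_chain C D F V g n h) \<and>
    (\<forall>h. davydov_yetter.yoneda_chain C D F V g n h \<longrightarrow>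
         davydov_yetter.dy_cohomologous C D F n U W f h)"
proof -
  interpret C: strict_tensor_category C
    using assms(1) by (simp add: finite_strict_tensor_category_def)
  interpret D: strict_tensor_category D
    using assms(2) by (simp add: finite_strict_tensor_category_def)
  interpret F: linear_functor C D F
    using assms(3) by (simp add: exact_strict_monoidal_functor_def)
  interpret monoidal_functor C D F
    by unfold_locales
      (use assms(1,3) in \<open>auto simp: exact_strict_monoidal_functor_def finite_strict_tensor_category_def\<close>)
  obtain m where n: "n = Suc m" using assms(6) by (cases n) auto
  obtain V g where "V 0 = W" "V n = U" "\<forall>i\<le>n. V i \<in> centralizer"
    "\<forall>i\<in>{1..n}. g i \<in> dy_cocycles 1 (V i) (V (i - 1))"
    "\<exists>h. yoneda_chain V g n h" "\<forall>h. yoneda_chain V g n h \<longrightarrow> dy_cohomologous n U W f h"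
    using cocycle_decomposition[OF assms(4,5), of f m] assms(7) unfolding n by metis
  then show ?thesis by (intro exI[of _ V] exI[of _ g]) auto
qed

end
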